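(* Let $X_1,\dots,X_q$ be $C^1$ vector fields on a $C^2$ manifold $\mathfrak M$, let $x_0\in\mathfrak M$, let $Z=\{y\in\mathfrak M:\rho(x_0,y)<\infty\}$ with the topology induced by the metric $\rho$ (the sub-Riemannian distance of $X_1,\dots,X_q$), and let $M\subseteq Z$ be a connected open subset of $Z$ containing $x_0$. Assume that $[X_i,X_j]=\sum_{k=1}^q a_{i,j}^kX_k$ on $M$ for some locally bounded functions $a_{i,j}^k:M\to\mathbb R$, so that $M$ carries its canonical $C^2$ manifold structure, for which $X_1,\dots,X_q$ are $C^1$ vector fields on $M$ spanning the tangent space at every point. Let $n=\dim\operatorname{span}\{X_1(x_0),\dots,X_q(x_0)\}=\dim M$. Then the following three conditions are equivalent: (i) There exist an open neighborhood $V\subseteq M$ of $x_0$ and a $C^2$ diffeomorphism $\Phi:U\to V$, where $U\subseteq\mathbb R^n$ is open, such that $\Phi^*X_1,\dots,\Phi^*X_q\in C^{\omega}(U;\mathbb R^n)$. (ii) Reorder the vector fields so that $X_1(x_0),\dots,X_n(x_0)$ are linearly independent. There exists an open neighborhood $V\subseteq M$ of $x_0$ such that - $[X_i,X_j]=\sum_{k=1}^n\hat c_{i,j}^kX_k$ on $V$ for $1\le i,j\le n$, where $\hat c_{i,j}^k\in C^\omega_X(V)$; and - for $n+1\le j\le q$, $X_j=\sum_{k=1}^n b_j^kX_k$ on $V$, where $b_j^k\in C^\omega_X(V)$. (iii) There exists an open neighborhood $V\subseteq M$ of $x_0$ such that $[X_i,X_j]=\sum_{k=1}^q c_{i,j}^kX_k$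 on $V$ for $1\le i,j\le q$, where $c_{i,j}^k\in C_X^\omega(V)$.
   Context: **Sub-Riemannian distance.** For $C^1$ vector fields $X_1,\dots,X_q$ on a $C^2$ manifold $\mathfrak M$, $x\in \mathfrak M$, $\delta>0$, let $B_X(x,\delta)$ be the set of $y\in \mathfrak M$ for which there is $\gamma:[0,1]\to \mathfrak M$ with $\gamma(0)=x$, $\gamma(1)=y$, $\gamma'(t)=\sum_{j=1}^q a_j(t)\,\delta X_j(\gamma(t))$, $a_j\in L^\infty([0,1])$, $\big\|\sum_j|a_j|^2\big\|_{L^\infty}<1$ (here $\gamma$ is absolutely continuous in local $C^2$ charts and the equation holds for almost every $t$). Put $\rho(x,y)=\inf\{\delta>0:y\in B_X(x,\delta)\}$ ($=\infty$ if there is no such $\delta$). **The $C^2$ structure on $M$.** It is a known fact that, under the stated assumption (commutators are combinations of $X_1,\dots,X_q$ with locally bounded coefficients on $M$), there is a $C^2$ manifold structure on $M$, compatible with its topology, such that the inclusion $M\hookrightarrow\mathfrak M$ is a $C^2$ injective immersion and $X_1,\dots,X_q$ are $C^1$ vector fields tangent to $M$ which span the tangent space at every point of $M$; this structure is unique (any two $C^2$ structures compatible with the topology for which the inclusion is a $C^2$ injective immersion agree, via the identity map). $M$ is given this structure. **Function spaces on $\mathbb R^n$.** For $U\subseteq\mathbb R^n$ open, $r>0$ and a Banach space $E$, $C^{\omega,r}(U;E)$ is the space of $f\in C^\infty(U;E)$ with $\sum_{\alpha\in\mathbb N^n}\frac{r^{|\alpha|}}{\alpha!}\sup_{x\in U}\|\partial_x^\alpha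 f(x)\|_E<\infty$, and $C^\omega(U;E)=\bigcup_{r>0}C^{\omega,r}(U;E)$. A vector field $\sum_ja_j\partial_{x_j}$ on $U$ is identified with the function $(a_1,\dots,a_n):U\to\mathbb R^n$. **Function spaces with respect to $X$.** For a $C^1$ vector field $W$, $Wf(x):=\frac{d}{dt}\big|_{t=0}f(e^{tW}x)$ (classical derivative, required to exist at each point), and compositions are defined iteratively. For an ordered multi-index $\alpha$ (a finite list of elements of $\{1,\dots,q\}$ of length $|\alpha|$), $X^\alpha$ denotes the corresponding composition, e.g. $X^{(2,1,3)}=X_2X_1X_3$. For $V\subseteq M$ open and $r>0$, $C^{\omega,r}_X(V)$ is the space of bounded continuous $f$ on $V$ such that $X^\alpha f$ exists and is continuous on $V$ for every ordered multi-index $\alpha$ and $\sum_{m=0}^\infty\frac{r^m}{m!}\sum_{|\alpha|=m}\sup_V|X^\alpha f|<\infty$. $C^\omega_X(V)=\bigcup_{r>0}C_X^{\omega,r}(V)$. *)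

theory Defs
  imports
    "HOL-Analysis.Analysis"
    "HOL-Probability.Essential_Supremum"
    "HOL-Library.Function_Algebras"
    "HOL-Combinatorics.Permutations"
begin

text \<open>Pointwise real vector space structure on functions; the additive part comes from
  \<^theory>\<open>HOL-Library.Function_Algebras\<close>.\<close>

instantiation "fun" :: (type, real_vector) real_vector
begin

definition scaleR_fun :: "real \<Rightarrow> ('a \<Rightarrow> 'b) \<Rightarrow> 'a \<Rightarrow> 'b"
  where "scaleR_fun r f = (\<lambda>x. r *\<^sub>R f x)"

instance
  by standard (auto simp: scaleR_fun_def fun_eq_iff plus_fun_def scaleR_add_left scaleR_add_right)

end


section \<open>Calculus on open subsets of Euclidean space\<close>

text \<open>The dimension of a leaf is determined by the vector fields and may be 0, so Euclidean space
  of dimension \<open>n\<close> is the library's \<^const>\<open>Euclidean_space\<close> \<open>n\<close>, whose points are the functions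
  \<open>x :: nat \<Rightarrow> real\<close> vanishing at all \<open>i \<ge> n\<close>; coordinates are numbered from 0. Functions are
  differentiated only at points of open sets on which they are meaningful, so their values
  elsewhere play no role.\<close>

definition partial :: "nat \<Rightarrow> ((nat \<Rightarrow> real) \<Rightarrow> real) \<Rightarrow> (nat \<Rightarrow> real) \<Rightarrow> real"
  where "partial i f x = deriv (\<lambda>t. f (x(i := t))) (x i)"

definition has_partial :: "nat \<Rightarrow> ((nat \<Rightarrow> real) \<Rightarrow> real) \<Rightarrow> (nat \<Rightarrow> real) \<Rightarrow> bool"
  where "has_partial i f x \<longleftrightarrow> (\<lambda>t. f (x(i := t))) differentiable (at (x i))"

text \<open>\<open>Ck_on n k U f\<close>: all iterated partial derivatives of \<open>f\<close> of order at most \<open>k\<close> exist and are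
  continuous on the open set \<open>U\<close> of \<open>n\<close>-dimensional space.\<close>

primrec Ck_on :: "nat \<Rightarrow> nat \<Rightarrow> (nat \<Rightarrow> real) set \<Rightarrow> ((nat \<Rightarrow> real) \<Rightarrow> real) \<Rightarrow> bool" where
  "Ck_on n 0 U f \<longleftrightarrow> continuous_map (subtopology (Euclidean_space n) U) euclideanreal f"
| "Ck_on n (Suc k) U f \<longleftrightarrow>
     continuous_map (subtopology (Euclidean_space n) U) euclideanreal f \<and>
     (\<forall>i<n. (\<forall>x\<in>U. has_partial i f x) \<and> Ck_on n k U (partial i f))"

text \<open>The Jacobian matrix of \<open>F\<close> at \<open>x\<close> applied to the vector \<open>w\<close>; \<open>n\<close> is the dimension of the
  source.\<close>

definition jacobian_app ::
    "nat \<Rightarrow> ((nat \<Rightarrow> real) \<Rightarrow> nat \<Rightarrow> real) \<Rightarrow> (nat \<Rightarrow> real) \<Rightarrow> (nat \<Rightarrow> real) \<Rightarrow> nat \<Rightarrow> real"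
  where "jacobian_app n F x w i = (\<Sum>k<n. partial k (\<lambda>y. F y i) x * w k)"

text \<open>\<open>mpartial \<alpha> n f\<close> is \<open>\<partial>\<^sup>\<alpha>f\<close> for the multi-index \<open>(\<alpha> 0, \<dots>, \<alpha> (n - 1))\<close>.\<close>

primrec mpartial :: "(nat \<Rightarrow> nat) \<Rightarrow> nat \<Rightarrow> ((nat \<Rightarrow> real) \<Rightarrow> real) \<Rightarrow> (nat \<Rightarrow> real) \<Rightarrow> real" where
  "mpartial \<alpha> 0 f = f"
| "mpartial \<alpha> (Suc m) f = mpartial \<alpha> m ((partial m ^^ \<alpha> m) f)"

text \<open>The space \<open>C\<^sup>\<omega>\<^sup>,\<^sup>r(U; E)\<close> for \<open>E\<close> the Euclidean space of dimension \<open>m\<close>. The sum is taken in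
  \<^typ>\<open>ennreal\<close>, so that finiteness includes finiteness of every supremum.\<close>

definition C_omega_r ::
    "nat \<Rightarrow> nat \<Rightarrow> real \<Rightarrow> (nat \<Rightarrow> real) set \<Rightarrow> ((nat \<Rightarrow> real) \<Rightarrow> nat \<Rightarrow> real) \<Rightarrow> bool"
  where "C_omega_r n m r U F \<longleftrightarrow>
    (\<forall>i<m. \<forall>k. Ck_on n k U (\<lambda>x. F x i)) \<and>
    (\<Sum>\<^sub>\<infinity>\<alpha>\<in>{\<alpha>. \<forall>i\<ge>n. \<alpha> i = 0}.
       ennreal (r ^ (\<Sum>i<n. \<alpha> i) / (\<Prod>i<n. fact (\<alpha> i))) *
       (SUP x\<in>U. ennreal (L2_set (\<lambda>i. mpartial \<alpha> n (\<lambda>y. F y i) x) {..<m}))) < \<infinity>"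

definition C_omega ::
    "nat \<Rightarrow> nat \<Rightarrow> (nat \<Rightarrow> real) set \<Rightarrow> ((nat \<Rightarrow> real) \<Rightarrow> nat \<Rightarrow> real) \<Rightarrow> bool"
  where "C_omega n m U F \<longleftrightarrow> (\<exists>r>0. C_omega_r n m r U F)"


section \<open>Manifolds of class \<open>C\<^sup>2\<close>\<close>

text \<open>A chart is a domain together with a coordinate map, which is only relevant on the domain.
  The atlas need not be maximal.\<close>

type_synonym 'm chart = "'m set \<times> ('m \<Rightarrow> nat \<Rightarrow> real)"

record 'm manifold =
  mtop :: "'m topology"
  mdim :: nat
  atlas :: "'m chart set"

abbreviation points :: "'m manifold \<Rightarrow> 'm set"
  where "points S \<equiv> topspace (mtop S)"

abbreviation chart_inv :: "'m chart \<Rightarrow> (nat \<Rightarrow> real) \<Rightarrow> 'm"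
  where "chart_inv c \<equiv> inv_into (fst c) (snd c)"

definition C2_manifold :: "'m manifold \<Rightarrow> bool"
  where "C2_manifold S \<longleftrightarrow>
    Hausdorff_space (mtop S) \<and> second_countable (mtop S) \<and>
    (\<Union>c\<in>atlas S. fst c) = points S \<and>
    (\<forall>c\<in>atlas S.
       openin (mtop S) (fst c) \<and>
       openin (Euclidean_space (mdim S)) (snd c ` fst c) \<and>
       homeomorphic_map (subtopology (mtop S) (fst c))
         (subtopology (Euclidean_space (mdim S)) (snd c ` fst c)) (snd c)) \<and>
    (\<forall>c\<in>atlas S. \<forall>c'\<in>atlas S. \<forall>i<mdim S.
       Ck_on (mdim S) 2 (snd c ` (fst c \<inter> fst c')) (\<lambda>x. snd c' (chart_inv c x) i))"

text \<open>An open set \<open>U\<close> of \<open>n\<close>-dimensional space, and an open subset \<open>V\<close> of a manifold, as manifolds.\<close>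

definition eucl_manifold :: "nat \<Rightarrow> (nat \<Rightarrow> real) set \<Rightarrow> (nat \<Rightarrow> real) manifold"
  where "eucl_manifold n U =
    \<lparr>mtop = subtopology (Euclidean_space n) U, mdim = n, atlas = {(U, \<lambda>x. x)}\<rparr>"

definition open_submanifold :: "'m manifold \<Rightarrow> 'm set \<Rightarrow> 'm manifold"
  where "open_submanifold S V =
    \<lparr>mtop = subtopology (mtop S) V, mdim = mdim S, atlas = (\<lambda>c. (fst c \<inter> V, snd c)) ` atlas S\<rparr>"

definition C2_map :: "'m manifold \<Rightarrow> 'p manifold \<Rightarrow> ('m \<Rightarrow> 'p) \<Rightarrow> bool"
  where "C2_map S S' f \<longleftrightarrow>
    continuous_map (mtop S) (mtop S') f \<and>
    (\<forall>c\<in>atlas S. \<forall>c'\<in>atlas S'. \<forall>i<mdim S'.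
       Ck_on (mdim S) 2 (snd c ` {p \<in> fst c. f p \<in> fst c'}) (\<lambda>x. snd c' (f (chart_inv c x)) i))"

definition C2_diffeo :: "'m manifold \<Rightarrow> 'p manifold \<Rightarrow> ('m \<Rightarrow> 'p) \<Rightarrow> bool"
  where "C2_diffeo S S' f \<longleftrightarrow>
    bij_betw f (points S) (points S') \<and> C2_map S S' f \<and> C2_map S' S (inv_into (points S) f)"

text \<open>A tangent vector at \<open>p\<close> is the family of its coordinate vectors in the charts around \<open>p\<close>, which
  are related by the Jacobian matrices of the coordinate changes. All remaining entries are set
  to 0, so that the tangent space is a linear subspace of dimension \<^term>\<open>mdim S\<close> of the
  function space.\<close>

type_synonym 'm tvec = "'m chart \<Rightarrow> nat \<Rightarrow> real"

definition tangent_space :: "'m manifold \<Rightarrow> 'm \<Rightarrow> 'm tvec set"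
  where "tangent_space S p = {v.
    (\<forall>c\<in>atlas S. \<forall>c'\<in>atlas S. p \<in> fst c \<inter> fst c' \<longrightarrow>
       (\<forall>i<mdim S. v c' i = jacobian_app (mdim S) (\<lambda>x. snd c' (chart_inv c x)) (snd c p) (v c) i)) \<and>
    (\<forall>c i. \<not> (c \<in> atlas S \<and> p \<in> fst c \<and> i < mdim S) \<longrightarrow> v c i = 0)}"

text \<open>The differential of \<open>f\<close> at \<open>p\<close>. For tangent vectors \<open>v\<close> the chosen chart around \<open>p\<close> does not
  matter.\<close>

definition differential ::
    "'m manifold \<Rightarrow> 'p manifold \<Rightarrow> ('m \<Rightarrow> 'p) \<Rightarrow> 'm \<Rightarrow> 'm tvec \<Rightarrow> 'p tvec"
  where "differential S S' f p v = (\<lambda>c' i.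
    if c' \<in> atlas S' \<and> f p \<in> fst c' \<and> i < mdim S' then
      (let c = (SOME c. c \<in> atlas S \<and> p \<in> fst c)
       in jacobian_app (mdim S) (\<lambda>x. snd c' (f (chart_inv c x))) (snd c p) (v c) i)
    else 0)"

definition immersion :: "'m manifold \<Rightarrow> 'p manifold \<Rightarrow> ('m \<Rightarrow> 'p) \<Rightarrow> bool"
  where "immersion S S' f \<longleftrightarrow>
    C2_map S S' f \<and> (\<forall>p\<in>points S. inj_on (differential S S' f p) (tangent_space S p))"

definition C1_vector_field :: "'m manifold \<Rightarrow> ('m \<Rightarrow> 'm tvec) \<Rightarrow> bool"
  where "C1_vector_field S W \<longleftrightarrow>
    (\<forall>p\<in>points S. W p \<in> tangent_space S p) \<and>
    (\<forall>c\<in>atlas S. \<forall>i<mdim S. Ck_on (mdim S) 1 (snd c ` fst c) (\<lambda>x. W (chart_inv c x) c i))"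

text \<open>The pullback of \<open>W\<close> along \<open>f\<close>, for injective differentials of \<open>f\<close> whose ranges contain the
  values of \<open>W\<close>.\<close>

definition pullback ::
    "'m manifold \<Rightarrow> 'p manifold \<Rightarrow> ('m \<Rightarrow> 'p) \<Rightarrow> ('p \<Rightarrow> 'p tvec) \<Rightarrow> 'm \<Rightarrow> 'm tvec"
  where "pullback S S' f W p =
    (THE v. v \<in> tangent_space S p \<and> differential S S' f p v = W (f p))"

definition lie_bracket ::
    "'m manifold \<Rightarrow> ('m \<Rightarrow> 'm tvec) \<Rightarrow> ('m \<Rightarrow> 'm tvec) \<Rightarrow> 'm \<Rightarrow> 'm tvec"
  where "lie_bracket S W W' p = (\<lambda>c i.
    if c \<in> atlas S \<and> p \<in> fst c \<and> i < mdim S then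
      (\<Sum>k<mdim S.
         W p c k * partial k (\<lambda>x. W' (chart_inv c x) c i) (snd c p) -
         W' p c k * partial k (\<lambda>x. W (chart_inv c x) c i) (snd c p))
    else 0)"


section \<open>The sub-Riemannian distance\<close>

definition abs_cont_on :: "real \<Rightarrow> real \<Rightarrow> (real \<Rightarrow> real) \<Rightarrow> bool"
  where "abs_cont_on a b g \<longleftrightarrow>
    (\<forall>\<epsilon>>0. \<exists>\<delta>>0. \<forall>I :: (real \<times> real) set.
       finite I \<and> (\<forall>(s, t)\<in>I. a \<le> s \<and> s \<le> t \<and> t \<le> b) \<and>
       pairwise (\<lambda>(s, t) (s', t'). {s<..<t} \<inter> {s'<..<t'} = {}) I \<and>
       (\<Sum>(s, t)\<in>I. t - s) < \<delta> \<longrightarrow>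
       (\<Sum>(s, t)\<in>I. \<bar>g t - g s\<bar>) < \<epsilon>)"

definition abs_cont_curve :: "'m manifold \<Rightarrow> (real \<Rightarrow> 'm) \<Rightarrow> bool"
  where "abs_cont_curve S \<gamma> \<longleftrightarrow>
    continuous_map (top_of_set {0..1}) (mtop S) \<gamma> \<and>
    (\<forall>c\<in>atlas S. \<forall>s t. 0 \<le> s \<and> s \<le> t \<and> t \<le> 1 \<and> \<gamma> ` {s..t} \<subseteq> fst c \<longrightarrow>
       (\<forall>i<mdim S. abs_cont_on s t (\<lambda>u. snd c (\<gamma> u) i)))"

text \<open>The vector fields are \<open>X j\<close> for \<open>j < q\<close>. The bound on the essential supremum implies that every
  \<open>a j\<close> is essentially bounded.\<close>

definition sr_ball ::
    "'m manifold \<Rightarrow> nat \<Rightarrow> (nat \<Rightarrow> 'm \<Rightarrow> 'm tvec) \<Rightarrow> 'm \<Rightarrow> real \<Rightarrow> 'm set"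
  where "sr_ball S q X x \<delta> = {y \<in> points S. \<exists>\<gamma> (a :: nat \<Rightarrow> real \<Rightarrow> real).
    abs_cont_curve S \<gamma> \<and> \<gamma> 0 = x \<and> \<gamma> 1 = y \<and>
    (\<forall>j<q. a j \<in> borel_measurable (lebesgue_on {0..1})) \<and>
    esssup (lebesgue_on {0..1}) (\<lambda>t. ereal (\<Sum>j<q. \<bar>a j t\<bar>\<^sup>2)) < 1 \<and>
    (AE t in lebesgue_on {0..1}. \<forall>c\<in>atlas S. \<gamma> t \<in> fst c \<longrightarrow>
       (\<forall>i<mdim S. ((\<lambda>s. snd c (\<gamma> s) i) has_real_derivative
          (\<Sum>j<q. a j t * \<delta> * X j (\<gamma> t) c i)) (at t within {0..1})))}"

definition sr_dist ::
    "'m manifold \<Rightarrow> nat \<Rightarrow> (nat \<Rightarrow> 'm \<Rightarrow> 'm tvec) \<Rightarrow> 'm \<Rightarrow> 'm \<Rightarrow> ereal"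
  where "sr_dist S q X x y = (INF \<delta>\<in>{\<delta>. 0 < \<delta> \<and> y \<in> sr_ball S q X x \<delta>}. ereal \<delta>)"

definition orbit :: "'m manifold \<Rightarrow> nat \<Rightarrow> (nat \<Rightarrow> 'm \<Rightarrow> 'm tvec) \<Rightarrow> 'm \<Rightarrow> 'm set"
  where "orbit S q X x = {y \<in> points S. sr_dist S q X x y < \<infinity>}"

definition orbit_topology ::
    "'m manifold \<Rightarrow> nat \<Rightarrow> (nat \<Rightarrow> 'm \<Rightarrow> 'm tvec) \<Rightarrow> 'm \<Rightarrow> 'm topology"
  where "orbit_topology S q X x =
    Metric_space.mtopology (orbit S q X x) (\<lambda>y z. real_of_ereal (sr_dist S q X y z))"


section \<open>The canonical structure on an open subset of the orbit\<close>

definition locally_bounded :: "'m topology \<Rightarrow> ('m \<Rightarrow> real) \<Rightarrow> bool"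
  where "locally_bounded T f \<longleftrightarrow>
    (\<forall>p\<in>topspace T. \<exists>W. openin T W \<and> p \<in> W \<and> bounded (f ` W))"

text \<open>\<open>L\<close> is the canonical manifold structure on the open subset \<open>M\<close> of the orbit of \<open>x\<^sub>0\<close>. It is
  determined up to equivalence of atlases. The fields \<open>X j\<close>, regarded as vector fields on \<open>M\<close>, are
  their pullbacks along the inclusion.\<close>

definition canonical_structure ::
    "'m manifold \<Rightarrow> nat \<Rightarrow> (nat \<Rightarrow> 'm \<Rightarrow> 'm tvec) \<Rightarrow> 'm \<Rightarrow> 'm set \<Rightarrow> 'm manifold \<Rightarrow> bool"
  where "canonical_structure S q X x\<^sub>0 M L \<longleftrightarrow>
    C2_manifold L \<and>
    mtop L = subtopology (orbit_topology S q X x\<^sub>0) M \<and>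
    immersion L S (\<lambda>p. p) \<and>
    (\<forall>j<q. \<forall>p\<in>M. X j p \<in> differential L S (\<lambda>p. p) p ` tangent_space L p) \<and>
    (\<forall>j<q. C1_vector_field L (pullback L S (\<lambda>p. p) (X j))) \<and>
    (\<forall>p\<in>M. span ((\<lambda>j. pullback L S (\<lambda>p. p) (X j) p) ` {..<q}) = tangent_space L p)"


section \<open>Analyticity with respect to vector fields\<close>

definition integral_curve ::
    "'m manifold \<Rightarrow> ('m \<Rightarrow> 'm tvec) \<Rightarrow> real set \<Rightarrow> (real \<Rightarrow> 'm) \<Rightarrow> bool"
  where "integral_curve S W I \<gamma> \<longleftrightarrow>
    continuous_map (top_of_set I) (mtop S) \<gamma> \<and>
    (\<forall>t\<in>I. \<forall>c\<in>atlas S. \<gamma> t \<in> fst c \<longrightarrow>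
       (\<forall>i<mdim S. ((\<lambda>s. snd c (\<gamma> s) i) has_real_derivative W (\<gamma> t) c i) (at t)))"

text \<open>\<open>flow S W t x\<close> is \<open>e\<^sup>t\<^sup>Wx\<close>; it is only meaningful for \<open>t\<close> in the maximal interval of
  existence, which contains a neighbourhood of 0.\<close>

definition flow :: "'m manifold \<Rightarrow> ('m \<Rightarrow> 'm tvec) \<Rightarrow> real \<Rightarrow> 'm \<Rightarrow> 'm"
  where "flow S W t x = (THE y. \<exists>\<gamma> a b. a < 0 \<and> 0 < b \<and> t \<in> {a<..<b} \<and>
    integral_curve S W {a<..<b} \<gamma> \<and> \<gamma> 0 = x \<and> \<gamma> t = y)"

definition lie_deriv :: "'m manifold \<Rightarrow> ('m \<Rightarrow> 'm tvec) \<Rightarrow> ('m \<Rightarrow> real) \<Rightarrow> 'm \<Rightarrow> real"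
  where "lie_deriv S W f x = deriv (\<lambda>t. f (flow S W t x)) 0"

definition has_lie_deriv :: "'m manifold \<Rightarrow> ('m \<Rightarrow> 'm tvec) \<Rightarrow> ('m \<Rightarrow> real) \<Rightarrow> 'm \<Rightarrow> bool"
  where "has_lie_deriv S W f x \<longleftrightarrow> (\<lambda>t. f (flow S W t x)) differentiable (at 0)"

text \<open>The leftmost field of an ordered multi-index is applied last.\<close>

primrec lie_derivs ::
    "'m manifold \<Rightarrow> (nat \<Rightarrow> 'm \<Rightarrow> 'm tvec) \<Rightarrow> nat list \<Rightarrow> ('m \<Rightarrow> real) \<Rightarrow> 'm \<Rightarrow> real" where
  "lie_derivs S X [] f = f"
| "lie_derivs S X (j # \<alpha>) f = lie_deriv S (X j) (lie_derivs S X \<alpha> f)"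

definition C_X_omega_r ::
    "'m manifold \<Rightarrow> nat \<Rightarrow> (nat \<Rightarrow> 'm \<Rightarrow> 'm tvec) \<Rightarrow> real \<Rightarrow> 'm set \<Rightarrow> ('m \<Rightarrow> real) \<Rightarrow> bool"
  where "C_X_omega_r S q X r V f \<longleftrightarrow>
    bounded (f ` V) \<and>
    (\<forall>\<alpha>\<in>lists {..<q}.
       continuous_map (subtopology (mtop S) V) euclideanreal (lie_derivs S X \<alpha> f) \<and>
       (\<forall>j<q. \<forall>x\<in>V. has_lie_deriv S (X j) (lie_derivs S X \<alpha> f) x)) \<and>
    (\<Sum>m. ennreal (r ^ m / fact m) *
       (\<Sum>\<alpha> | \<alpha> \<in> lists {..<q} \<and> length \<alpha> = m.
          SUP x\<in>V. ennreal \<bar>lie_derivs S X \<alpha> f x\<bar>)) < \<infinity>"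

definition C_X_omega ::
    "'m manifold \<Rightarrow> nat \<Rightarrow> (nat \<Rightarrow> 'm \<Rightarrow> 'm tvec) \<Rightarrow> 'm set \<Rightarrow> ('m \<Rightarrow> real) \<Rightarrow> bool"
  where "C_X_omega S q X V f \<longleftrightarrow> (\<exists>r>0. C_X_omega_r S q X r V f)"


section \<open>The three conditions\<close>

text \<open>Here \<open>L\<close> is a manifold, \<open>n\<close> its dimension, and \<open>Y j\<close> for \<open>j < q\<close> are vector fields on it.\<close>

definition cond_coordinates ::
    "'m manifold \<Rightarrow> nat \<Rightarrow> nat \<Rightarrow> (nat \<Rightarrow> 'm \<Rightarrow> 'm tvec) \<Rightarrow> 'm \<Rightarrow> bool"
  where "cond_coordinates L n q Y x\<^sub>0 \<longleftrightarrow>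
    (\<exists>V U \<Phi>. openin (mtop L) V \<and> x\<^sub>0 \<in> V \<and> openin (Euclidean_space n) U \<and>
       C2_diffeo (eucl_manifold n U) (open_submanifold L V) \<Phi> \<and>
       (\<forall>j<q. C_omega n n U (\<lambda>x. pullback (eucl_manifold n U) L \<Phi> (Y j) x (U, \<lambda>x. x))))"

definition cond_basis ::
    "'m manifold \<Rightarrow> nat \<Rightarrow> nat \<Rightarrow> (nat \<Rightarrow> 'm \<Rightarrow> 'm tvec) \<Rightarrow> 'm \<Rightarrow> bool"
  where "cond_basis L n q Y x\<^sub>0 \<longleftrightarrow>
    (\<exists>V. openin (mtop L) V \<and> x\<^sub>0 \<in> V \<and>
       (\<exists>c :: nat \<Rightarrow> nat \<Rightarrow> nat \<Rightarrow> 'm \<Rightarrow> real. \<forall>i<n. \<forall>j<n.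
          (\<forall>k<n. C_X_omega L q Y V (c i j k)) \<and>
          (\<forall>p\<in>V. lie_bracket L (Y i) (Y j) p = (\<Sum>k<n. c i j k p *\<^sub>R Y k p))) \<and>
       (\<exists>b :: nat \<Rightarrow> nat \<Rightarrow> 'm \<Rightarrow> real. \<forall>j\<in>{n..<q}.
          (\<forall>k<n. C_X_omega L q Y V (b j k)) \<and>
          (\<forall>p\<in>V. Y j p = (\<Sum>k<n. b j k p *\<^sub>R Y k p))))"

definition cond_commutators ::
    "'m manifold \<Rightarrow> nat \<Rightarrow> (nat \<Rightarrow> 'm \<Rightarrow> 'm tvec) \<Rightarrow> 'm \<Rightarrow> bool"
  where "cond_commutators L q Y x\<^sub>0 \<longleftrightarrow>
    (\<exists>V. openin (mtop L) V \<and> x\<^sub>0 \<in> V \<and>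
       (\<exists>c :: nat \<Rightarrow> nat \<Rightarrow> nat \<Rightarrow> 'm \<Rightarrow> real. \<forall>i<q. \<forall>j<q.
          (\<forall>k<q. C_X_omega L q Y V (c i j k)) \<and>
          (\<forall>p\<in>V. lie_bracket L (Y i) (Y j) p = (\<Sum>k<q. c i j k p *\<^sub>R Y k p))))"

text \<open>After reordering by \<open>\<sigma>\<close> the first \<open>n\<close> fields are linearly independent at \<open>x\<^sub>0\<close>.\<close>

definition admissible_reordering ::
    "nat \<Rightarrow> nat \<Rightarrow> (nat \<Rightarrow> 'm \<Rightarrow> 'm tvec) \<Rightarrow> 'm \<Rightarrow> (nat \<Rightarrow> nat) \<Rightarrow> bool"
  where "admissible_reordering n q X x\<^sub>0 \<sigma> \<longleftrightarrow>
    \<sigma> permutes {..<q} \<and>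
    inj_on (\<lambda>j. X (\<sigma> j) x\<^sub>0) {..<n} \<and> independent ((\<lambda>j. X (\<sigma> j) x\<^sub>0) ` {..<n})"

end

theory Submission
 imports Defs "Jordan_Normal_Form.Determinant"
begin

text \<open>Only the direction towards coordinates is hard. Choose fields \<open>X\<^sub>1, \<dots>, X\<^sub>n\<close> independent at \<open>x\<^sub>0\<close>
  and canonical coordinates \<open>\<phi>(t) = exp (t\<^sub>1X\<^sub>1 + \<dots> + t\<^sub>nX\<^sub>n) x\<^sub>0\<close>. Functions in \<open>C\<^sup>\<omega>\<^sub>X\<close> are analytic
  in \<open>t\<close>, by Taylor expansion along the rays \<open>r t\<close>. The derivatives \<open>\<partial>\<^sub>i\<phi>(r t)\<close> solve the variational equation; writing
  \<open>\<partial>\<^sub>i\<phi> = \<Sum>\<^sub>k \<mu>\<^sub>i\<^sub>k X\<^sub>k(\<phi>)\<close> turns it into a linear equation \<open>\<mu>' = e\<^sub>i - C \<mu>\<close> in \<open>r\<close> whose matrix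
  \<open>C = \<Sum>\<^sub>j t\<^sub>j c\<^sub>j\<close> is made of the structure functions along the ray, hence is analytic. So \<open>\<mu>\<close> is analytic, and
  inverting it expresses every \<open>X\<^sub>k\<close> analytically in the coordinate fields; in particular \<open>\<phi>\<close> is of class
  \<open>C\<^sup>2\<close>, although the \<open>X\<^sub>k\<close> are only \<open>C\<^sup>1\<close>. Conversely, analytic fields in coordinates have analytic structure
  functions by Cramer's rule, and \<open>X\<^sup>\<alpha>f\<close> is bounded by \<open>C A\<^sup>m m!\<close> for \<open>m = |\<alpha>|\<close>.\<close>

text \<open>Conditions (ii) and (iii) are treated by one argument about \<open>p\<close> fields
  whose first \<open>n\<close> form a frame near x0: \<open>p = n\<close> for (ii),
  \<open>p = q\<close> for (iii). In (iii) the fields are redundant and the structure functions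
  refer to all of them; rewriting them in terms of a frame beforehand would need coefficients not
  yet known to be analytic. So the linear system has \<open>p\<close> unknowns, and linear relations
  to the frame are carried along from x0. A second obstacle: X^\<alpha>f is a derivative along the
  flow of a single field at each step, whereas Taylor expansion along a ray needs derivatives along
  constant combinations of the fields. As f has no chain rule at this stage, curves are approximated
  by short pieces of flows, and f is controlled by a Lipschitz bound that comes from the same
  approximation. Analyticity means bounds on all derivatives, uniform on the open set as in C^omega.
  Products, reciprocals and series are estimated by majorant series, and the linear equation is
  solved by a series in the resulting normed algebra.\<close>

type_synonym pt = "nat => real"

section \<open>Finite-dimensional calculus in a fixed Banach space\<close>

text \<open>The dimension is a term, so points are moved into the Banach space \<open>\<ell>\<^sup>\<infinity>\<close>, where derivatives
  and completeness are available: \<open>hb n\<close> embeds and \<open>cf n\<close> projects onto the first \<open>n\<close> coordinates.\<close>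

type_synonym linf = "nat \<Rightarrow>\<^sub>C real"

definition ev :: "nat => linf" where
 "ev i = Bcontfun (\<lambda>j. if j = i then 1 else 0)"

definition hb :: "nat => pt => linf" where
 "hb n x = (\<Sum>i<n. x i *\<^sub>R ev i)"

definition cf :: "nat => linf => nat => real" where
 "cf n h = (\<lambda>i. if i < n then apply_bcontfun h i else 0)"

text \<open>Cubes are tested coordinate by coordinate, which suits partial derivatives. The
  condition on the tail places them in the space of dimension \<open>n\<close>, a single point for
  \<open>n = 0\<close>.\<close>

definition cub :: "nat => pt => real => pt set" where
 "cub n x e = {y. (\<forall>i\<ge>n. y i = 0) \<and> (\<forall>i<n. \<bar>y i - x i\<bar> < e)}"

abbreviation eopen :: "nat => pt set => bool" where
 "eopen n U \<equiv> openin (Euclidean_space n) U"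

lemma ev_apply [simp]: "apply_bcontfun (ev i) j = (if j = i then 1 else 0)"
proof -
 have "(\<lambda>j. if j = i then 1 else 0 :: real) \<in> bcontfun"
  by (auto simp: bcontfun_def bounded_iff intro!: exI[of _ 1])
 then show ?thesis
  unfolding ev_def by (subst Bcontfun_inverse) auto
qed

lemma norm_ev [simp]: "norm (ev i) = 1"
proof (rule antisym)
 show "norm (ev i) \<le> 1"
  by (rule norm_bound) auto
 show "1 \<le> norm (ev i)"
  using norm_bounded[of "ev i" i] by auto
qed

lemma sum_apply_bcontfun: "apply_bcontfun (\<Sum>i\<in>A. f i) j = (\<Sum>i\<in>A. apply_bcontfun (f i) j)"
 by (induction A rule: infinite_finite_induct) auto

lemma hb_apply [simp]: "apply_bcontfun (hb n x) j = (if j < n then x j else 0)"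
proof -
 have "apply_bcontfun (hb n x) j = (\<Sum>i<n. if i = j then x i else 0)"
  unfolding hb_def sum_apply_bcontfun by (rule sum.cong) auto
 then show ?thesis by (simp add: sum.delta)
qed

lemma cf_hb [simp]: "cf n (hb n x) = (\<lambda>i. if i < n then x i else 0)"
 by (auto simp: cf_def)

lemma cf_hb_id: "(\<And>i. i \<ge> n ==> x i = 0) ==> cf n (hb n x) = x"
 by (auto simp: fun_eq_iff)

lemma cf_zero [simp]: "i \<ge> n ==> cf n h i = 0"
 by (simp add: cf_def)

lemma cf_less [simp]: "i < n ==> cf n h i = apply_bcontfun h i"
 by (simp add: cf_def)

lemma norm_hb_bound: "(\<And>i. i < n ==> \<bar>x i\<bar> \<le> e) ==> e \<ge> 0 ==> norm (hb n x) \<le> e"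
 by (rule norm_bound) auto

lemma coord_le_norm: "\<bar>apply_bcontfun h i\<bar> \<le> norm h"
 using norm_bounded[of h i] by simp

lemma hb_diff: "hb n x - hb n y = hb n (\<lambda>i. x i - y i)"
 by (auto intro!: bcontfun_eqI)

lemma continuous_on_cf [continuous_intros]:
 "continuous_on S f ==> continuous_on S (\<lambda>x. cf n (f x))"
proof (rule continuous_on_coordinatewise_then_product)
 fix i assume f: "continuous_on S f"
 have "bounded_linear (\<lambda>h::linf. apply_bcontfun h i)"
  by (rule bounded_linear_intro[where K=1]) (auto simp: coord_le_norm)
 from bounded_linear.continuous_on[OF this f]
 have "continuous_on S (\<lambda>x. apply_bcontfun (f x) i)" .
 then show "continuous_on S (\<lambda>x. cf n (f x) i)"
  by (cases "i < n") auto
qed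

lemma continuous_on_hb [continuous_intros]:
 "(\<And>i. i < n ==> continuous_on S (\<lambda>x. f x i)) ==> continuous_on S (\<lambda>x. hb n (f x))"
 unfolding hb_def by (intro continuous_intros) auto

lemma continuous_on_coord [continuous_intros]:
 "continuous_on S f ==> continuous_on S (\<lambda>x. f x (i::nat) :: real)"
 by (rule continuous_on_product_then_coordinatewise)

lemma bounded_linear_coord: "bounded_linear (\<lambda>h::linf. apply_bcontfun h i)"
 by (rule bounded_linear_intro[where K=1]) (auto simp: coord_le_norm)

lemma Euclidean_space_top_of_set: "Euclidean_space n = top_of_set {x. \<forall>i\<ge>n. x i = 0}"
 by (simp add: Euclidean_space_def euclidean_product_topology)

lemma eopen_zero: "eopen n U ==> x \<in> U ==> i \<ge> n ==> x i = 0"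
 using openin_subset[of "Euclidean_space n" U] by (auto simp: topspace_Euclidean_space)

lemma cf_hb_eopen: "eopen n U ==> x \<in> U ==> cf n (hb n x) = x"
 by (rule cf_hb_id) (rule eopen_zero)

text \<open>Both \<open>cf n\<close> and \<open>hb n\<close> are continuous and
  \<open>cf n (hb n x) = x\<close> for points with zero tail, so open sets of dimension
  \<open>n\<close> correspond to open cylinders in the Banach space. Derivatives can then be taken
  at interior points there.\<close>

lemma eopen_lift_iff:
 "eopen n U \<longleftrightarrow> U \<subseteq> {x. \<forall>i\<ge>n. x i = 0} \<and> open {h. cf n h \<in> U}" (is "_ \<longleftrightarrow> ?Z \<and> ?O")
proof
 assume "eopen n U"
 then obtain T where T: "open T" "U = {x. \<forall>i\<ge>n. x i = 0} \<inter> T"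
  by (auto simp: Euclidean_space_top_of_set openin_open)
 have "open (cf n -` T)"
  using T(1) continuous_on_cf[of UNIV "\<lambda>x. x" n] by (intro open_vimage) (auto intro: continuous_on_id)
 moreover have "{h. cf n h \<in> U} = cf n -` T"
  using T(2) by auto
 ultimately show "?Z \<and> ?O" using T(2) by auto
next
 assume R: "?Z \<and> ?O"
 have c: "continuous_on UNIV (hb n)"
  using continuous_on_hb[of n UNIV "\<lambda>x. x"] continuous_on_coord[OF continuous_on_id] by auto
 have "open (hb n -` {h. cf n h \<in> U})"
  using R c by (intro open_vimage) auto
 moreover have "U = {x. \<forall>i\<ge>n. x i = 0} \<inter> (hb n -` {h. cf n h \<in> U})"
  using R cf_hb_id[of n] by auto
 ultimately show "eopen n U"
  by (auto simp: Euclidean_space_top_of_set openin_open)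
qed

lemma open_lift: "eopen n U ==> open {h. cf n h \<in> U}"
 using eopen_lift_iff by blast

lemma eopen_iff_cub:
 "eopen n U \<longleftrightarrow> U \<subseteq> {x. \<forall>i\<ge>n. x i = 0} \<and> (\<forall>x\<in>U. \<exists>e>0. cub n x e \<subseteq> U)"
proof safe
 fix x i assume "eopen n U" "x \<in> U" "n \<le> i" then show "x i = 0" by (rule eopen_zero)
next
 fix x assume U: "eopen n U" "x \<in> U"
 have "hb n x \<in> {h. cf n h \<in> U}" using U cf_hb_eopen[OF U] by simp
 then obtain e where e: "e > 0" "ball (hb n x) e \<subseteq> {h. cf n h \<in> U}"
  using open_lift[OF U(1)] open_contains_ball by blast
 have "cub n x (e/2) \<subseteq> U"
 proof
  fix y assume y: "y \<in> cub n x (e/2)"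
  have "norm (hb n y - hb n x) \<le> e/2"
   unfolding hb_diff using y e(1) by (intro norm_hb_bound) (auto simp: cub_def less_imp_le)
  then have "hb n y \<in> ball (hb n x) e" using e(1) by (simp add: dist_norm norm_minus_commute)
  then have "cf n (hb n y) \<in> U" using e(2) by blast
  then show "y \<in> U" using y cf_hb_id[of n y] by (auto simp: cub_def)
 qed
 then show "\<exists>e>0. cub n x e \<subseteq> U" using e(1) half_gt_zero by blast
next
 assume Z: "U \<subseteq> {x. \<forall>i\<ge>n. x i = 0}" and R: "\<forall>x\<in>U. \<exists>e>0. cub n x e \<subseteq> U"
 have "open {h. cf n h \<in> U}"
 proof (subst open_contains_ball, safe)
  fix h assume "cf n h \<in> U"
  with R obtain e where e: "e > 0" "cub n (cf n h) e \<subseteq> U" by blast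
  have "cf n k \<in> cub n (cf n h) e" if "k \<in> ball h e" for k
  proof -
   have "\<bar>apply_bcontfun k i - apply_bcontfun h i\<bar> < e" for i
    using coord_le_norm[of "k - h" i] that by (simp add: dist_norm norm_minus_commute)
   then show ?thesis by (auto simp: cub_def)
  qed
  then show "\<exists>e>0. ball h e \<subseteq> {h. cf n h \<in> U}"
   using e by blast
 qed
 then show "eopen n U" using Z eopen_lift_iff by blast
qed

lemma eopen_cubE:
 assumes "eopen n U" "x \<in> U"
 obtains e where "e > 0" "cub n x e \<subseteq> U"
 using assms eopen_iff_cub by blast

lemma eopen_cub: "eopen n (cub n x e)"
 unfolding eopen_iff_cub
proof safe
 fix y i assume "y \<in> cub n x e" "n \<le> i" then show "y i = 0" by (auto simp: cub_def)
next
 fix y assume y: "y \<in> cub n x e"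
 define d where "d = Min (insert 1 ((\<lambda>i. e - \<bar>y i - x i\<bar>) ` {..<n}))"
 have d: "d > 0" unfolding d_def using y by (subst Min_gr_iff) (auto simp: cub_def)
 have "cub n y d \<subseteq> cub n x e"
 proof
  fix z assume z: "z \<in> cub n y d"
  have "\<bar>z i - x i\<bar> < e" if "i < n" for i
  proof -
   have "d \<le> e - \<bar>y i - x i\<bar>" unfolding d_def using that by (intro Min_le) auto
   moreover have "\<bar>z i - y i\<bar> < d" using z that by (auto simp: cub_def)
   ultimately show ?thesis by linarith
  qed
  then show "z \<in> cub n x e" using z by (auto simp: cub_def)
 qed
 then show "\<exists>d>0. cub n y d \<subseteq> cub n x e" using d by blast
qed

lemma centre_in_cub: "(\<And>i. i \<ge> n ==> x i = 0) ==> e > 0 ==> x \<in> cub n x e"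
 by (auto simp: cub_def)

lemma cub_mono: "d \<le> e ==> cub n x d \<subseteq> cub n x e"
 by (force simp: cub_def)

lemma continuous_map_Euclidean_iff:
 "eopen n U ==> continuous_map (subtopology (Euclidean_space n) U) euclideanreal f \<longleftrightarrow> continuous_on U f"
proof -
 assume U: "eopen n U"
 have "subtopology (Euclidean_space n) U = top_of_set U"
  unfolding Euclidean_space_top_of_set subtopology_subtopology
  using openin_subset[OF U] by (simp add: topspace_Euclidean_space Int_absorb1)
 then show ?thesis by simp
qed

lemma continuous_on_eopen_iff:
 fixes f :: "pt => real"
 assumes "eopen n U"
 shows "continuous_on U f \<longleftrightarrow> continuous_on {h. cf n h \<in> U} (\<lambda>h. f (cf n h))"
proof
 assume f: "continuous_on U f"
 show "continuous_on {h. cf n h \<in> U} (\<lambda>h. f (cf n h))"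
  by (rule continuous_on_compose2[OF f continuous_on_cf[OF continuous_on_id]]) auto
next
 assume f: "continuous_on {h. cf n h \<in> U} (\<lambda>h. f (cf n h))"
 have "continuous_on U (\<lambda>x. f (cf n (hb n x)))"
  by (rule continuous_on_compose2[OF f])
   (use assms cf_hb_eopen in \<open>auto intro!: continuous_on_hb continuous_on_coord[OF continuous_on_id]\<close>)
 then show "continuous_on U f"
  by (rule continuous_on_eq) (use cf_hb_eopen[OF assms] in simp)
qed

lemma continuous_on_cubE:
 fixes f :: "pt => real"
 assumes "eopen n U" "continuous_on U f" "x \<in> U" "e > 0"
 obtains d where "d > 0" "cub n x d \<subseteq> U" "\<And>y. y \<in> cub n x d ==> \<bar>f y - f x\<bar> < e"
proof -
 have "openin (top_of_set U) (U \<inter> f -` ball (f x) e)"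
  using assms(2) by (rule continuous_openin_preimage_gen) simp
 moreover have "top_of_set U = subtopology (Euclidean_space n) U"
  unfolding Euclidean_space_top_of_set subtopology_subtopology
  using openin_subset[OF assms(1)] by (simp add: topspace_Euclidean_space Int_absorb1)
 ultimately have "eopen n (U \<inter> f -` ball (f x) e)"
  using assms(1) openin_trans_full by metis
 then obtain d where "d > 0" "cub n x d \<subseteq> U \<inter> f -` ball (f x) e"
  by (rule eopen_cubE[where x=x]) (use assms in auto)
 then show ?thesis
  by (intro that[of d]) (auto simp: dist_real_def)
qed

lemma eventually_upd:
 assumes "eopen n U" "x \<in> U" "i < n"
 shows "\<forall>\<^sub>F t in nhds (x i). x(i := t) \<in> U"
proof -
 obtain e where e: "e > 0" "cub n x e \<subseteq> U" using assms(1,2) by (rule eopen_cubE)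
 have "x(i := t) \<in> U" if "dist t (x i) < e" for t
  using e that assms(3) eopen_zero[OF assms(1,2)] by (auto simp: cub_def dist_real_def)
 then show ?thesis using e(1) eventually_nhds_metric by blast
qed

subsection \<open>Functions of class \<open>C\<^sup>k\<close>\<close>

lemma partialI:
 "((\<lambda>t. f (x(i := t))) has_real_derivative d) (at (x i)) ==> partial i f x = d"
 unfolding partial_def by (rule DERIV_imp_deriv)

lemma has_partialI:
 "((\<lambda>t. f (x(i := t))) has_real_derivative d) (at (x i)) ==> has_partial i f x"
 unfolding has_partial_def using real_differentiable_def by blast

lemma has_partialD:
 "has_partial i f x ==> ((\<lambda>t. f (x(i := t))) has_real_derivative partial i f x) (at (x i))"
 unfolding has_partial_def partial_def using DERIV_deriv_iff_real_differentiable by blast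

lemma partial_cong:
 assumes "eopen n U" "x \<in> U" "i < n" "\<And>y. y \<in> U ==> f y = g y"
 shows "partial i f x = partial i g x" "has_partial i f x = has_partial i g x"
proof -
 have ev: "\<forall>\<^sub>F t in nhds (x i). f (x(i := t)) = g (x(i := t))"
  using eventually_upd[OF assms(1-3)] by eventually_elim (use assms(4) in auto)
 show "partial i f x = partial i g x"
  unfolding partial_def by (rule deriv_cong_ev[OF ev refl])
 have "((\<lambda>t. f (x(i := t))) has_real_derivative d) (at (x i)) \<longleftrightarrow>
    ((\<lambda>t. g (x(i := t))) has_real_derivative d) (at (x i))" for d
  by (rule DERIV_cong_ev[OF refl ev refl])
 then show "has_partial i f x = has_partial i g x"
  unfolding has_partial_def real_differentiable_def by simp
qed

lemma Ck_on_cong: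
 assumes "eopen n U"
 shows "(\<And>y. y \<in> U ==> f y = g y) ==> Ck_on n k U f = Ck_on n k U g"
proof (induction k arbitrary: f g)
 case 0
 then show ?case
  using assms by (simp add: continuous_map_Euclidean_iff cong: continuous_on_cong)
next
 case (Suc k)
 have "continuous_on U f = continuous_on U g"
  using Suc.prems by (simp cong: continuous_on_cong)
 moreover have "Ck_on n k U (partial i f) = Ck_on n k U (partial i g)" if "i < n" for i
  by (rule Suc.IH) (rule partial_cong(1)[OF assms _ that Suc.prems])
 moreover have "has_partial i f x = has_partial i g x" if "i < n" "x \<in> U" for i x
  by (rule partial_cong(2)[OF assms that(2,1) Suc.prems])
 ultimately show ?case
  using assms by (auto simp: Ck_on.simps(2) continuous_map_Euclidean_iff)
qed

lemma Ck_on_continuous: "eopen n U ==> Ck_on n k U f ==> continuous_on U f"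
 by (cases k) (auto simp: Ck_on.simps(2) continuous_map_Euclidean_iff)

lemma Ck_on_SucD: "Ck_on n (Suc k) U f ==> Ck_on n k U f"
proof (induction k arbitrary: f)
 case (Suc k)
 then show ?case unfolding Ck_on.simps(2)[of n "Suc k"] by (subst Ck_on.simps(2)) blast
qed simp

declare Ck_on.simps(2) [simp del]

lemma Ck_on_le: "Ck_on n k U f ==> j \<le> k ==> Ck_on n j U f"
proof (induction k)
 case (Suc k)
 show ?case
 proof (cases "j = Suc k")
  case True
  then show ?thesis using Suc.prems(1) by simp
 next
  case False
  then show ?thesis using Suc.IH[OF Ck_on_SucD[OF Suc.prems(1)]] Suc.prems(2) by simp
 qed
qed simp

lemma Ck_on_subset: "Ck_on n k U f ==> V \<subseteq> U ==> Ck_on n k V f"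
proof (induction k arbitrary: f)
 case 0
 then show ?case by (auto intro: continuous_map_from_subtopology_mono)
next
 case (Suc k)
 then show ?case by (auto simp: Ck_on.simps(2) intro: continuous_map_from_subtopology_mono)
qed

lemma Ck_on_SucI:
 assumes "eopen n U" "continuous_on U f"
  and "\<And>i x. i < n ==> x \<in> U ==> ((\<lambda>t. f (x(i := t))) has_real_derivative g i x) (at (x i))"
  and "\<And>i. i < n ==> Ck_on n k U (g i)"
 shows "Ck_on n (Suc k) U f"
proof -
 have "Ck_on n k U (partial i f)" if "i < n" for i
 proof -
  have "Ck_on n k U (partial i f) = Ck_on n k U (g i)"
   by (rule Ck_on_cong[OF assms(1)]) (use assms(3) that partialI in blast)
  then show ?thesis using assms(4) that by simp
 qed
 then show ?thesis
  using assms by (auto simp: Ck_on.simps(2) continuous_map_Euclidean_iff intro: has_partialI)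
qed

lemma Ck_on_Suc_partial:
 assumes "Ck_on n (Suc k) U f" "i < n"
 shows "Ck_on n k U (partial i f)"
  and "x \<in> U ==> ((\<lambda>t. f (x(i := t))) has_real_derivative partial i f x) (at (x i))"
 using assms by (auto simp: Ck_on.simps(2) intro: has_partialD)

lemma Ck_on_const [simp]: "eopen n U ==> Ck_on n k U (\<lambda>x. c)"
proof (induction k arbitrary: c)
 case (Suc k)
 then show ?case by (intro Ck_on_SucI[where g="\<lambda>i x. 0"]) auto
qed (simp add: continuous_map_Euclidean_iff)

lemma Ck_on_coord: "eopen n U ==> Ck_on n k U (\<lambda>x. x i)"
proof (cases k)
 case (Suc k)
 assume U: "eopen n U"
 show ?thesis unfolding Suc
 proof (rule Ck_on_SucI[OF U, where g="\<lambda>j x. if i = j then 1 else 0"])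
  show "continuous_on U (\<lambda>x. x i)"
   by (rule continuous_on_coord[OF continuous_on_id])
  show "((\<lambda>t. (x(j := t)) i) has_real_derivative (if i = j then 1 else 0)) (at (x j))" for j x
   by (cases "i = j") auto
  show "Ck_on n k U (\<lambda>x. if i = j then 1 else 0)" for j
   using Ck_on_const[OF U] by simp
 qed
qed (simp add: continuous_map_Euclidean_iff continuous_on_coord[OF continuous_on_id])

lemma Ck_on_add:
 assumes "eopen n U"
 shows "Ck_on n k U f ==> Ck_on n k U g ==> Ck_on n k U (\<lambda>x. f x + g x)"
proof (induction k arbitrary: f g)
 case 0
 then show ?case using assms by (simp add: continuous_map_Euclidean_iff continuous_on_add)
next
 case (Suc k)
 show ?case
 proof (rule Ck_on_SucI[OF assms, where g="\<lambda>i x. partial i f x + partial i g x"])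
  show "continuous_on U (\<lambda>x. f x + g x)"
   using Suc.prems Ck_on_continuous[OF assms] by (intro continuous_on_add) blast+
  fix i assume i: "i < n"
  show "((\<lambda>t. f (x(i := t)) + g (x(i := t))) has_real_derivative
    partial i f x + partial i g x) (at (x i))" if "x \<in> U" for x
   by (rule DERIV_add[OF Ck_on_Suc_partial(2)[OF Suc.prems(1) i that] Ck_on_Suc_partial(2)[OF Suc.prems(2) i that]])
  show "Ck_on n k U (\<lambda>x. partial i f x + partial i g x)"
   using Suc.prems Ck_on_Suc_partial(1) i by (intro Suc.IH) blast+
 qed
qed

lemma Ck_on_mult:
 assumes "eopen n U"
 shows "Ck_on n k U f ==> Ck_on n k U g ==> Ck_on n k U (\<lambda>x. f x * g x)"
proof (induction k arbitrary: f g)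
 case 0
 then show ?case using assms by (simp add: continuous_map_Euclidean_iff continuous_on_mult)
next
 case (Suc k)
 show ?case
 proof (rule Ck_on_SucI[OF assms, where g="\<lambda>i x. partial i f x * g x + f x * partial i g x"])
  show "continuous_on U (\<lambda>x. f x * g x)"
   using Suc.prems Ck_on_continuous[OF assms] by (intro continuous_on_mult) blast+
  fix i assume i: "i < n"
  show "((\<lambda>t. f (x(i := t)) * g (x(i := t))) has_real_derivative
    partial i f x * g x + f x * partial i g x) (at (x i))" if "x \<in> U" for x
   using DERIV_mult[OF Ck_on_Suc_partial(2)[OF Suc.prems(1) i that] Ck_on_Suc_partial(2)[OF Suc.prems(2) i that]]
   by (simp add: mult.commute add.commute del: fun_upd_apply)
  show "Ck_on n k U (\<lambda>x. partial i f x * g x + f x * partial i g x)"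
   using Suc.prems Ck_on_Suc_partial(1) Ck_on_SucD i
   by (intro Ck_on_add[OF assms] Suc.IH) blast+
 qed
qed

lemma Ck_on_cmult: "eopen n U ==> Ck_on n k U f ==> Ck_on n k U (\<lambda>x. c * f x)"
 by (intro Ck_on_mult) auto

lemma Ck_on_uminus: "eopen n U ==> Ck_on n k U f ==> Ck_on n k U (\<lambda>x. - f x)"
 using Ck_on_cmult[of n U k f "-1"] by simp

lemma Ck_on_sum:
 "eopen n U ==> (\<And>j. j \<in> J ==> Ck_on n k U (f j)) ==> Ck_on n k U (\<lambda>x. \<Sum>j\<in>J. f j x)"
 by (induction J rule: infinite_finite_induct) (auto intro: Ck_on_add)

lemma Ck_on_inverse:
 assumes "eopen n U" "\<And>x. x \<in> U ==> f x \<noteq> 0"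
 shows "Ck_on n k U f ==> Ck_on n k U (\<lambda>x. inverse (f x))"
proof (induction k)
 case 0
 then show ?case using assms by (simp add: continuous_map_Euclidean_iff continuous_on_inverse)
next
 case (Suc k)
 show ?case
 proof (rule Ck_on_SucI[OF assms(1), where g="\<lambda>i x. - (inverse (f x) * partial i f x * inverse (f x))"])
  show "continuous_on U (\<lambda>x. inverse (f x))"
   using Suc.prems Ck_on_continuous[OF assms(1)] assms(2) by (intro continuous_on_inverse) blast+
  fix i assume i: "i < n"
  show "((\<lambda>t. inverse (f (x(i := t)))) has_real_derivative
    - (inverse (f x) * partial i f x * inverse (f x))) (at (x i))" if "x \<in> U" for x
   using DERIV_inverse'[OF Ck_on_Suc_partial(2)[OF Suc.prems i that]] assms(2)[OF that]
   by (simp del: fun_upd_apply)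
  show "Ck_on n k U (\<lambda>x. - (inverse (f x) * partial i f x * inverse (f x)))"
   using Suc Ck_on_SucD Ck_on_Suc_partial(1)[OF Suc.prems i]
   by (intro Ck_on_uminus Ck_on_mult assms(1)) blast+
 qed
qed

text \<open>One passes from the old point to the new one a coordinate at a time; each step is
  controlled by the mean value inequality and the continuity of one partial derivative. The result
  is a total derivative in the Banach space, from which the chain rules follow.\<close>

lemma C1_has_derivative:
 assumes U: "eopen n U" and f: "Ck_on n (Suc k) U f" and h: "cf n h \<in> U"
 shows "((\<lambda>h. f (cf n h)) has_derivative (\<lambda>v. \<Sum>i<n. partial i f (cf n h) * apply_bcontfun v i)) (at h)"
 unfolding has_derivative_at_alt
proof (intro conjI allI impI)
 show "bounded_linear (\<lambda>v::linf. \<Sum>i<n. partial i f (cf n h) * apply_bcontfun v i)"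
  by (intro bounded_linear_sum bounded_linear_const_mult bounded_linear_coord)
next
 define x where "x = cf n h"
 have x: "x \<in> U" using h by (simp add: x_def)
 let ?D = "\<lambda>v::linf. \<Sum>i<n. partial i f x * apply_bcontfun v i"
 have main: "\<exists>d>0. \<forall>k. norm (k - h) < d \<longrightarrow> norm (f (cf n k) - f x - ?D (k - h)) \<le> (real n * e) * norm (k - h)"
  if e: "e > 0" for e
 proof -
  have "\<exists>d>0. cub n x d \<subseteq> U \<and> (\<forall>y\<in>cub n x d. \<bar>partial i f y - partial i f x\<bar> < e)" if "i < n" for i
   using continuous_on_cubE[OF U _ x e, of "partial i f"] Ck_on_continuous[OF U Ck_on_Suc_partial(1)[OF f that]]
   by metis
  then obtain d where d: "\<And>i. i < n ==> d i > 0"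
    "\<And>i. i < n ==> cub n x (d i) \<subseteq> U \<and> (\<forall>y\<in>cub n x (d i). \<bar>partial i f y - partial i f x\<bar> < e)"
   by metis
  define \<delta> where "\<delta> = Min (insert 1 (d ` {..<n}))"
  have \<delta>: "\<delta> > 0" unfolding \<delta>_def using d(1) by (subst Min_gr_iff) auto
  have \<delta>d: "cub n x \<delta> \<subseteq> cub n x (d i)" if "i < n" for i
   by (rule cub_mono) (use that in \<open>auto simp: \<delta>_def\<close>)
  have "norm (f (cf n k) - f x - ?D (k - h)) \<le> (real n * e) * norm (k - h)" if k: "norm (k - h) < \<delta>" for k
  proof -
   define y where "y = cf n k"
   \<comment> \<open>\<open>z m\<close> has already moved in its first \<open>m\<close> coordinates,
     so consecutive points differ in coordinate \<open>m\<close> only.\<close>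
   define z where "z m = (\<lambda>j. if j < m then y j else x j)" for m
   have zn: "z n = y" and z0: "z 0 = x"
    by (auto simp: z_def y_def x_def fun_eq_iff)
   have yx: "y i - x i = apply_bcontfun (k - h) i" if "i < n" for i
    using that by (simp add: y_def x_def)
   have yxl: "\<bar>y i - x i\<bar> \<le> norm (k - h)" for i
    by (cases "i < n") (use yx coord_le_norm[of "k - h" i] in \<open>auto simp: y_def x_def\<close>)
   have step: "\<bar>(f (z (Suc m)) - f (z m)) - partial m f x * (y m - x m)\<bar> \<le> e * norm (k - h)"
    if m: "m < n" for m
   proof -
    have inc: "(z m)(m := t) \<in> cub n x \<delta>" if "t \<in> ball (x m) \<delta>" for t
    proof -
     have "\<bar>y i - x i\<bar> < \<delta>" for i using yxl[of i] k by linarith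
     moreover have "y i = 0" "x i = 0" if "i \<ge> n" for i using that by (auto simp: y_def x_def)
     ultimately show ?thesis
      using that m \<delta> by (auto simp: cub_def z_def dist_real_def abs_minus_commute)
    qed
    have "norm ((f ((z m)(m := y m)) - partial m f x * y m) - (f ((z m)(m := x m)) - partial m f x * x m))
      \<le> e * norm (y m - x m)"
    proof (rule field_differentiable_bound[where S="ball (x m) \<delta>"
       and f'="\<lambda>t. partial m f ((z m)(m := t)) - partial m f x"])
     fix t assume t: "t \<in> ball (x m) \<delta>"
     have c: "(z m)(m := t) \<in> cub n x (d m)" using inc[OF t] \<delta>d[OF m] by blast
     then have "(z m)(m := t) \<in> U" using d(2)[OF m] by blast
     from Ck_on_Suc_partial(2)[OF f m this]
     have "((\<lambda>s. f ((z m)(m := s))) has_real_derivative partial m f ((z m)(m := t))) (at t)" by simp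
     then have "((\<lambda>s. f ((z m)(m := s)) - partial m f x * s) has_real_derivative
       partial m f ((z m)(m := t)) - partial m f x) (at t)"
      by (auto intro!: derivative_eq_intros)
     then show "((\<lambda>s. f ((z m)(m := s)) - partial m f x * s) has_real_derivative
       partial m f ((z m)(m := t)) - partial m f x) (at t within ball (x m) \<delta>)"
      by (rule DERIV_subset) simp
     show "norm (partial m f ((z m)(m := t)) - partial m f x) \<le> e"
      using d(2)[OF m] c by fastforce
    next
     show "y m \<in> ball (x m) \<delta>"
      using yxl[of m] k by (auto simp: dist_real_def abs_minus_commute)
    qed (use \<delta> in auto)
    moreover have "(z m)(m := y m) = z (Suc m)" "(z m)(m := x m) = z m"
     by (auto simp: z_def fun_eq_iff)
    moreover have "e * norm (y m - x m) \<le> e * norm (k - h)"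
     using yxl[of m] e by simp
    ultimately show ?thesis by (simp add: algebra_simps)
   qed
   have "f y - f x = (\<Sum>m<n. f (z (Suc m)) - f (z m))"
    using zn z0 by (subst sum_lessThan_telescope) simp
   moreover have "?D (k - h) = (\<Sum>m<n. partial m f x * (y m - x m))"
    by (rule sum.cong) (use yx in auto)
   ultimately have "norm (f y - f x - ?D (k - h)) =
     \<bar>\<Sum>m<n. (f (z (Suc m)) - f (z m)) - partial m f x * (y m - x m)\<bar>"
    by (simp add: sum_subtractf)
   also have "\<dots> \<le> (\<Sum>m<n. e * norm (k - h))"
    by (rule order_trans[OF sum_abs]) (rule sum_mono, use step in auto)
   finally show ?thesis by (simp add: y_def)
  qed
  then show ?thesis using \<delta> by blast
 qed
 fix e :: real assume e: "e > 0"
 \<comment> \<open>Each of the \<open>n\<close> coordinate steps contributes one error; the added 1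
   covers \<open>n = 0\<close>.\<close>
 then have "e / (real n + 1) > 0" by simp
 from main[OF this] obtain d where d: "d > 0" and
  D: "\<And>k. norm (k - h) < d ==> norm (f (cf n k) - f x - ?D (k - h)) \<le> (real n * (e / (real n + 1))) * norm (k - h)"
  by blast
 have c: "real n * (e / (real n + 1)) \<le> e"
  using e by (simp add: field_simps)
 have "norm (f (cf n k) - f x - ?D (k - h)) \<le> e * norm (k - h)" if "norm (k - h) < d" for k
  using D[OF that] mult_right_mono[OF c norm_ge_zero[of "k - h"]] by linarith
 then show "\<exists>d>0. \<forall>k. norm (k - h) < d \<longrightarrow>
  norm (f (cf n k) - f (cf n h) - (\<Sum>i<n. partial i f (cf n h) * apply_bcontfun (k - h) i)) \<le> e * norm (k - h)"
  using d unfolding x_def by blast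
qed

text \<open>The curve is composed with \<open>hb m\<close> and \<open>f\<close> with
  \<open>cf m\<close>. The condition on the tail near \<open>s\<close> makes this the original
  composition in a neighbourhood of \<open>s\<close>, which is all that a derivative sees.\<close>

lemma C1_along_curve:
 assumes V: "eopen m V" and f: "Ck_on m (Suc k) V f" and s: "\<gamma> s \<in> V"
  and z: "\<forall>\<^sub>F t in nhds s. \<forall>i\<ge>m. \<gamma> t i = 0"
  and d: "\<And>i. i < m ==> ((\<lambda>t. \<gamma> t i) has_real_derivative d i) (at s)"
 shows "((\<lambda>t. f (\<gamma> t)) has_real_derivative (\<Sum>i<m. partial i f (\<gamma> s) * d i)) (at s)"
proof -
 have *: "((\<lambda>t. hb m (\<gamma> t)) has_derivative (\<lambda>u. \<Sum>i<m. (d i * u) *\<^sub>R ev i)) (at s)"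
  unfolding hb_def
  by (intro has_derivative_sum has_derivative_scaleR_left)
   (use d in \<open>auto simp: has_field_derivative_def\<close>)
 have "cf m (hb m (\<gamma> s)) \<in> V" using cf_hb_eopen[OF V s] s by simp
 from has_derivative_compose[OF * C1_has_derivative[OF V f this]]
 have "((\<lambda>t. f (cf m (hb m (\<gamma> t)))) has_derivative
   (\<lambda>u. \<Sum>i<m. partial i f (\<gamma> s) * apply_bcontfun (\<Sum>i<m. (d i * u) *\<^sub>R ev i) i)) (at s)"
  using cf_hb_eopen[OF V s] by simp
 moreover have "(\<lambda>u. \<Sum>i<m. partial i f (\<gamma> s) * apply_bcontfun (\<Sum>i<m. (d i * u) *\<^sub>R ev i) i)
   = (\<lambda>u. (\<Sum>i<m. partial i f (\<gamma> s) * d i) * u)"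
 proof
  fix u
  have "apply_bcontfun (\<Sum>i<m. (d i * u) *\<^sub>R ev i) i = d i * u" if "i < m" for i
   using that hb_apply[of m "\<lambda>i. d i * u" i] by (simp add: hb_def)
  then show "(\<Sum>i<m. partial i f (\<gamma> s) * apply_bcontfun (\<Sum>i<m. (d i * u) *\<^sub>R ev i) i)
    = (\<Sum>i<m. partial i f (\<gamma> s) * d i) * u"
   by (simp add: sum_distrib_right mult.assoc)
 qed
 ultimately have "((\<lambda>t. f (cf m (hb m (\<gamma> t)))) has_real_derivative (\<Sum>i<m. partial i f (\<gamma> s) * d i)) (at s)"
  by (simp add: has_field_derivative_def)
 moreover have e: "\<forall>\<^sub>F t in nhds s. f (cf m (hb m (\<gamma> t))) = f (\<gamma> t)"
  using z by eventually_elim (simp add: cf_hb_id del: cf_hb)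
 ultimately show ?thesis
  using iffD1[OF DERIV_cong_ev[OF refl e refl]] by blast
qed

lemma chain_partial:
 assumes U: "eopen n U" and V: "eopen m V" and G: "\<And>x. x \<in> U ==> G x \<in> V"
  and g: "\<And>j. j < m ==> Ck_on n (Suc k) U (\<lambda>x. G x j)" and f: "Ck_on m (Suc l) V f"
  and x: "x \<in> U" "i < n"
 shows "((\<lambda>t. f (G (x(i := t)))) has_real_derivative
     (\<Sum>j<m. partial j f (G x) * partial i (\<lambda>y. G y j) x)) (at (x i))"
proof -
 have "\<forall>\<^sub>F t in nhds (x i). \<forall>j\<ge>m. G (x(i := t)) j = 0"
  using eventually_upd[OF U x] by eventually_elim (use G eopen_zero[OF V] in blast)
 moreover have "((\<lambda>t. G (x(i := t)) j) has_real_derivative partial i (\<lambda>y. G y j) x) (at (x i))" if "j < m" for j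
  using Ck_on_Suc_partial(2)[OF g[OF that] x(2,1)] .
 ultimately show ?thesis
  using C1_along_curve[OF V f, of "\<lambda>t. G (x(i := t))" "x i" "\<lambda>j. partial i (\<lambda>y. G y j) x"] G x by simp
qed

text \<open>The induction is over arbitrary \<open>f\<close>, because its hypothesis is applied to
  the partial derivatives that the chain rule produces.\<close>

lemma Ck_on_compose:
 assumes U: "eopen n U" and V: "eopen m V" and G: "\<And>x. x \<in> U ==> G x \<in> V"
 shows "(\<And>j. j < m ==> Ck_on n k U (\<lambda>x. G x j)) ==> Ck_on m k V f ==> Ck_on n k U (\<lambda>x. f (G x))"
proof (induction k arbitrary: f)
 case 0
 have "continuous_on U G"
 proof (rule continuous_on_coordinatewise_then_product)
  fix j
  show "continuous_on U (\<lambda>x. G x j)"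
  proof (cases "j < m")
   case True
   then show ?thesis using Ck_on_continuous[OF U 0(1)] by blast
  next
   case False
   have "continuous_on U (\<lambda>x. G x j) = continuous_on U (\<lambda>x. 0::real)"
    by (rule continuous_on_cong[OF refl]) (use False G eopen_zero[OF V] in auto)
   then show ?thesis by simp
  qed
 qed
 moreover have "continuous_on V f" using Ck_on_continuous[OF V 0(2)] .
 ultimately have "continuous_on U (\<lambda>x. f (G x))"
  using G continuous_on_compose2 by blast
 then show ?case using U by (simp add: continuous_map_Euclidean_iff)
next
 case (Suc k)
 have low: "Ck_on n k U (\<lambda>x. G x j)" if "j < m" for j using Suc.prems(1)[OF that] by (rule Ck_on_SucD)
 show ?case
 proof (rule Ck_on_SucI[OF U, where g="\<lambda>i x. \<Sum>j<m. partial j f (G x) * partial i (\<lambda>y. G y j) x"])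
  show "continuous_on U (\<lambda>x. f (G x))"
   using Ck_on_continuous[OF U Suc.IH[OF low Ck_on_SucD[OF Suc.prems(2)]]] .
  fix i assume i: "i < n"
  show "((\<lambda>t. f (G (x(i := t)))) has_real_derivative
     (\<Sum>j<m. partial j f (G x) * partial i (\<lambda>y. G y j) x)) (at (x i))" if "x \<in> U" for x
   by (rule chain_partial[OF U V G Suc.prems that i])
  show "Ck_on n k U (\<lambda>x. \<Sum>j<m. partial j f (G x) * partial i (\<lambda>y. G y j) x)"
   using Suc.IH[OF low] Ck_on_Suc_partial(1)[OF Suc.prems(2)] Ck_on_Suc_partial(1)[OF Suc.prems(1) i]
   by (intro Ck_on_sum Ck_on_mult U) auto
 qed
qed

text \<open>The mean value theorem is used twice: in direction \<open>i\<close> for the difference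
  in direction \<open>j\<close>, then in direction \<open>j\<close> for the partial derivative just
  obtained.\<close>

lemma second_difference:
 assumes U: "eopen n U" and f: "Ck_on n 2 U f" and ij: "i < n" "j < n" "i \<noteq> j"
  and h: "h > 0" "cub n x (2 * h) \<subseteq> U" and x: "x \<in> U"
 shows "\<exists>\<xi>\<in>cub n x (2 * h).
  f (x(i := x i + h, j := x j + h)) - f (x(i := x i + h)) - f (x(j := x j + h)) + f x
  = h * h * partial j (partial i f) \<xi>"
proof -
 have f2: "Ck_on n (Suc (Suc 0)) U f" using f by (simp add: numeral_2_eq_2)
 have c: "x(i := s, j := t) \<in> cub n x (2 * h)" if "x i \<le> s" "s \<le> x i + h" "x j \<le> t" "t \<le> x j + h" for s t
  using that h ij eopen_zero[OF U x] by (auto simp: cub_def)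
 define \<phi> where "\<phi> s = f (x(i := s, j := x j + h)) - f (x(i := s, j := x j))" for s
 have "\<exists>z>x i. z < x i + h \<and> \<phi> (x i + h) - \<phi> (x i) = (x i + h - x i) *
  (partial i f (x(i := z, j := x j + h)) - partial i f (x(i := z, j := x j)))"
 proof (rule MVT2)
  fix s assume s: "x i \<le> s" "s \<le> x i + h"
  have "((\<lambda>s. f (x(i := s, j := t))) has_real_derivative partial i f (x(i := s, j := t))) (at s)"
   if "x j \<le> t" "t \<le> x j + h" for t
  proof -
   have "x(i := s, j := t) \<in> U" using c[OF s that] h by blast
   from Ck_on_Suc_partial(2)[OF f2 ij(1) this] show ?thesis
    using ij(3) by (simp add: fun_upd_twist)
  qed
  from DERIV_diff[OF this[of "x j + h"] this[of "x j"]]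
  show "(\<phi> has_real_derivative partial i f (x(i := s, j := x j + h)) - partial i f (x(i := s, j := x j))) (at s)"
   unfolding \<phi>_def using h by simp
 qed (use h in simp)
 then obtain s where s: "x i \<le> s" "s \<le> x i + h" and
  1: "\<phi> (x i + h) - \<phi> (x i) = h * (partial i f (x(i := s, j := x j + h)) - partial i f (x(i := s, j := x j)))"
  by (metis add_diff_cancel_left' less_imp_le)
 have "\<exists>z>x j. z < x j + h \<and> partial i f (x(i := s, j := x j + h)) - partial i f (x(i := s, j := x j))
   = (x j + h - x j) * partial j (partial i f) (x(i := s, j := z))"
 proof (rule MVT2)
  fix t assume t: "x j \<le> t" "t \<le> x j + h"
  have "x(i := s, j := t) \<in> U" using c[OF s t] h by blast
  from Ck_on_Suc_partial(2)[OF Ck_on_Suc_partial(1)[OF f2 ij(1)] ij(2) this]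
  show "((\<lambda>t. partial i f (x(i := s, j := t))) has_real_derivative partial j (partial i f) (x(i := s, j := t))) (at t)"
   by simp
 qed (use h in simp)
 then obtain t where t: "x j \<le> t" "t \<le> x j + h" and
  2: "partial i f (x(i := s, j := x j + h)) - partial i f (x(i := s, j := x j)) = h * partial j (partial i f) (x(i := s, j := t))"
  by (metis add_diff_cancel_left' less_imp_le)
 have "\<phi> (x i + h) - \<phi> (x i) = f (x(i := x i + h, j := x j + h)) - f (x(i := x i + h)) - f (x(j := x j + h)) + f x"
  unfolding \<phi>_def using ij(3) by (simp add: fun_upd_idem)
 then show ?thesis using 1 2 c[OF s t] by (intro bexI[of _ "x(i := s, j := t)"]) auto
qed

text \<open>The second difference does not depend on the order of the two directions, so it is
  expressed by either mixed derivative at a nearby point; continuity removes the displacement as the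
  step shrinks.\<close>

lemma partial_commute:
 assumes U: "eopen n U" and f: "Ck_on n 2 U f" and ij: "i < n" "j < n" and x: "x \<in> U"
 shows "partial i (partial j f) x = partial j (partial i f) x"
proof (cases "i = j")
 case False
 have f2: "Ck_on n (Suc (Suc 0)) U f" using f by (simp add: numeral_2_eq_2)
 have cont: "continuous_on U (partial a (partial b f))" if "a < n" "b < n" for a b
  using Ck_on_continuous[OF U] Ck_on_Suc_partial(1)[OF Ck_on_Suc_partial(1)[OF f2 that(2)] that(1)] by blast
 have "\<bar>partial i (partial j f) x - partial j (partial i f) x\<bar> \<le> e" if e: "e > 0" for e
 proof -
  obtain d1 where d1: "d1 > 0" "cub n x d1 \<subseteq> U"
   "\<And>y. y \<in> cub n x d1 ==> \<bar>partial i (partial j f) y - partial i (partial j f) x\<bar> < e / 2"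
   using continuous_on_cubE[OF U cont[OF ij] x, of "e/2"] e by (metis half_gt_zero)
  obtain d2 where d2: "d2 > 0" "cub n x d2 \<subseteq> U"
   "\<And>y. y \<in> cub n x d2 ==> \<bar>partial j (partial i f) y - partial j (partial i f) x\<bar> < e / 2"
   using continuous_on_cubE[OF U cont[OF ij(2,1)] x, of "e/2"] e by (metis half_gt_zero)
  define h where "h = min d1 d2 / 2"
  have h: "h > 0" "cub n x (2 * h) \<subseteq> cub n x d1" "cub n x (2 * h) \<subseteq> cub n x d2"
   using d1(1) d2(1) by (auto simp: h_def intro!: cub_mono)
  obtain \<xi> where \<xi>: "\<xi> \<in> cub n x (2 * h)"
   "f (x(i := x i + h, j := x j + h)) - f (x(i := x i + h)) - f (x(j := x j + h)) + f x
    = h * h * partial j (partial i f) \<xi>"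
   using second_difference[OF U f ij False h(1) _ x] h d1 by (meson order_trans)
  obtain \<eta> where \<eta>: "\<eta> \<in> cub n x (2 * h)"
   "f (x(j := x j + h, i := x i + h)) - f (x(j := x j + h)) - f (x(i := x i + h)) + f x
    = h * h * partial i (partial j f) \<eta>"
   using second_difference[OF U f ij(2,1) not_sym[OF False] h(1) _ x] h d1 by (meson order_trans)
  have "h * h * partial j (partial i f) \<xi> = h * h * partial i (partial j f) \<eta>"
   unfolding \<xi>(2)[symmetric] \<eta>(2)[symmetric] fun_upd_twist[OF False] by simp
  then have "partial j (partial i f) \<xi> = partial i (partial j f) \<eta>" using h(1) by simp
  then show ?thesis using d1(3)[of \<eta>] d2(3)[of \<xi>] \<xi>(1) \<eta>(1) h by (smt (verit) subsetD field_sum_of_halves)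
 qed
 then have "\<bar>partial i (partial j f) x - partial j (partial i f) x\<bar> \<le> 0"
  by (rule field_le_epsilon) simp
 then show ?thesis by simp
qed simp

section \<open>Analytic functions through derivative bounds\<close>

text \<open>Words instead of multi-indices: removing a letter is one differentiation, so estimates
  go by induction without multinomial coefficients. The leftmost letter differentiates first, unlike
  in \<open>lie_derivs\<close>.\<close>

primrec pw :: "nat list => (pt => real) => pt => real" where
 "pw [] f = f"
| "pw (i # w) f = pw w (partial i f)"

definition smooth :: "nat => pt set => (pt => real) => bool" where
 "smooth n U f \<longleftrightarrow> (\<forall>k. Ck_on n k U f)"

text \<open>\<open>b\<close> is the coefficient sequence of a majorant series: with the factorial
  split off, products of functions correspond to Cauchy products of such sequences. The cutoff
  \<open>k\<close> permits induction over the order of differentiation, on which reciprocals and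
  series rely.\<close>

definition dbound ::
  "nat => pt set => nat => pt => (pt => real) => bool" where
 "dbound n U k b f \<longleftrightarrow>
  (\<forall>w\<in>lists {..<n}. length w \<le> k \<longrightarrow> (\<forall>x\<in>U. \<bar>pw w f x\<bar> \<le> fact (length w) * b (length w)))"

text \<open>\<open>anorm n U \<rho> A f\<close> says that \<open>f\<close> has norm at most \<open>A\<close> in the algebra of functions normed by
  \<open>\<Sum>\<^sub>m \<rho>\<^sup>m/m! sup \<bar>\<partial>\<^sup>mf\<bar>\<close>, a submultiplicative norm.\<close>

definition anorm ::
  "nat => pt set => real => real => (pt => real) => bool" where
 "anorm n U \<rho> A f \<longleftrightarrow> smooth n U f \<and>
  (\<exists>b. (\<forall>m. 0 \<le> b m) \<and> (\<forall>k. dbound n U k b f) \<and> (\<forall>N. (\<Sum>m<N. \<rho> ^ m * b m) \<le> A))"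

text \<open>The constants serve all of \<open>U\<close>: this is the uniform analyticity of the
  spaces C^omega, stronger than analyticity near each point.\<close>

definition analytic :: "nat => pt set => (pt => real) => bool" where
 "analytic n U f \<longleftrightarrow> smooth n U f \<and> (\<exists>C\<ge>0. \<exists>R\<ge>0. \<forall>k. dbound n U k (\<lambda>m. C * R ^ m) f)"

lemma smooth_partial: "smooth n U f ==> i < n ==> smooth n U (partial i f)"
 unfolding smooth_def by (meson Ck_on_Suc_partial(1))

lemma smooth_Ck: "smooth n U f ==> Ck_on n k U f"
 by (simp add: smooth_def)

lemma smooth_cong: "eopen n U ==> (\<And>x. x \<in> U ==> f x = g x) ==> smooth n U f = smooth n U g"
 unfolding smooth_def using Ck_on_cong by blast

lemma smooth_subset: "smooth n U f ==> V \<subseteq> U ==> smooth n V f"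
 unfolding smooth_def using Ck_on_subset by blast

lemma smooth_add: "eopen n U ==> smooth n U f ==> smooth n U g ==> smooth n U (\<lambda>x. f x + g x)"
 unfolding smooth_def using Ck_on_add by blast

lemma smooth_mult: "eopen n U ==> smooth n U f ==> smooth n U g ==> smooth n U (\<lambda>x. f x * g x)"
 unfolding smooth_def using Ck_on_mult by blast

lemma pw_cong:
 "eopen n U ==> w \<in> lists {..<n} ==> (\<And>x. x \<in> U ==> f x = g x) ==> x \<in> U ==> pw w f x = pw w g x"
proof (induction w arbitrary: f g x)
 case (Cons i w)
 have "pw w (partial i f) x = pw w (partial i g) x"
  by (rule Cons.IH) (use Cons.prems partial_cong(1)[OF Cons.prems(1) _ _ Cons.prems(3)] in auto)
 then show ?case by simp
qed auto

lemma dbound_cong: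
 "eopen n U ==> (\<And>x. x \<in> U ==> f x = g x) ==> dbound n U k b f = dbound n U k b g"
 unfolding dbound_def using pw_cong[of n U _ f g] by simp

lemma dbound_0: "dbound n U 0 b f \<longleftrightarrow> (\<forall>x\<in>U. \<bar>f x\<bar> \<le> b 0)"
 by (auto simp: dbound_def)

text \<open>The shifted sequence \<open>(m + 1) * b (Suc m)\<close> belongs to the derivative of the
  majorant series.\<close>

lemma dbound_Suc:
 "dbound n U (Suc k) b f \<longleftrightarrow> (\<forall>x\<in>U. \<bar>f x\<bar> \<le> b 0) \<and>
  (\<forall>i<n. dbound n U k (\<lambda>m. (real m + 1) * b (Suc m)) (partial i f))"
proof safe
 assume D: "dbound n U (Suc k) b f"
 show "\<bar>f x\<bar> \<le> b 0" if "x \<in> U" for x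
  using D that unfolding dbound_def by (metis lists.Nil list.size(3) pw.simps(1) zero_le fact_0 mult_1)
 fix i assume i: "i < n"
 show "dbound n U k (\<lambda>m. (real m + 1) * b (Suc m)) (partial i f)"
  unfolding dbound_def
 proof (intro ballI impI)
  fix w x assume "w \<in> lists {..<n}" "length w \<le> k" "x \<in> U"
  then have "\<bar>pw (i # w) f x\<bar> \<le> fact (length (i # w)) * b (length (i # w))"
   using D i unfolding dbound_def by (metis lists.Cons lessThan_iff length_Cons Suc_le_mono)
  then show "\<bar>pw w (partial i f) x\<bar> \<le> fact (length w) * ((real (length w) + 1) * b (Suc (length w)))"
   by (simp add: algebra_simps)
 qed
next
 assume 0: "\<forall>x\<in>U. \<bar>f x\<bar> \<le> b 0"
  and S: "\<forall>i<n. dbound n U k (\<lambda>m. (real m + 1) * b (Suc m)) (partial i f)"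
 show "dbound n U (Suc k) b f"
  unfolding dbound_def
 proof (intro ballI impI)
  fix w x assume w: "w \<in> lists {..<n}" "length w \<le> Suc k" "x \<in> U"
  show "\<bar>pw w f x\<bar> \<le> fact (length w) * b (length w)"
  proof (cases w)
   case Nil
   then show ?thesis using 0 w by simp
  next
   case (Cons i v)
   then have "\<bar>pw v (partial i f) x\<bar> \<le> fact (length v) * ((real (length v) + 1) * b (Suc (length v)))"
    using S w unfolding dbound_def by auto
   then show ?thesis using Cons by (simp add: algebra_simps)
  qed
 qed
qed

lemma dbound_SucD:
 "dbound n U (Suc k) b f ==> i < n ==> dbound n U k (\<lambda>m. (real m + 1) * b (Suc m)) (partial i f)"
 by (simp add: dbound_Suc)

lemma dbound_mono:
 assumes "dbound n U k b f" "\<And>m. m \<le> k ==> b m \<le> c m"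
 shows "dbound n U k c f"
 unfolding dbound_def
proof (intro ballI impI)
 fix w x assume w: "w \<in> lists {..<n}" "length w \<le> k" "x \<in> U"
 have "\<bar>pw w f x\<bar> \<le> fact (length w) * b (length w)" using assms(1) w unfolding dbound_def by blast
 also have "\<dots> \<le> fact (length w) * c (length w)" using assms(2)[OF w(2)] by (intro mult_left_mono) auto
 finally show "\<bar>pw w f x\<bar> \<le> fact (length w) * c (length w)" .
qed

lemma dbound_le: "dbound n U k b f ==> j \<le> k ==> dbound n U j b f"
 unfolding dbound_def by auto

lemma dbound_subset: "dbound n U k b f ==> V \<subseteq> U ==> dbound n V k b f"
 unfolding dbound_def by auto

lemma partial_add_on:
 assumes "Ck_on n (Suc 0) U f" "Ck_on n (Suc 0) U g" "i < n" "x \<in> U"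
 shows "partial i (\<lambda>x. f x + g x) x = partial i f x + partial i g x"
 by (rule partialI) (rule DERIV_add[OF Ck_on_Suc_partial(2)[OF assms(1,3,4)] Ck_on_Suc_partial(2)[OF assms(2,3,4)]])

lemma partial_mult_on:
 assumes "Ck_on n (Suc 0) U f" "Ck_on n (Suc 0) U g" "i < n" "x \<in> U"
 shows "partial i (\<lambda>x. f x * g x) x = partial i f x * g x + f x * partial i g x"
 by (rule partialI)
  (use DERIV_mult[OF Ck_on_Suc_partial(2)[OF assms(1,3,4)] Ck_on_Suc_partial(2)[OF assms(2,3,4)]]
   in \<open>simp add: mult.commute add.commute del: fun_upd_apply\<close>)

lemma dbound_add:
 assumes U: "eopen n U"
 shows "smooth n U f ==> smooth n U g ==> dbound n U k b f ==> dbound n U k c g ==>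
  dbound n U k (\<lambda>m. b m + c m) (\<lambda>x. f x + g x)"
proof (induction k arbitrary: f g b c)
 case 0
 then show ?case unfolding dbound_0 by (meson abs_triangle_ineq add_mono order_trans)
next
 case (Suc k)
 have "dbound n U k (\<lambda>m. (real m + 1) * (b (Suc m) + c (Suc m))) (partial i (\<lambda>x. f x + g x))" if i: "i < n" for i
 proof -
  have "dbound n U k (\<lambda>m. (real m + 1) * b (Suc m) + (real m + 1) * c (Suc m)) (\<lambda>x. partial i f x + partial i g x)"
   by (rule Suc.IH) (use Suc.prems i dbound_Suc smooth_partial in auto)
  then show ?thesis
   using dbound_cong[OF U partial_add_on[OF smooth_Ck[OF Suc.prems(1)] smooth_Ck[OF Suc.prems(2)] i]]
   by (simp add: distrib_left)
 qed
 moreover have "\<bar>f x + g x\<bar> \<le> b 0 + c 0" if "x \<in> U" for x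
 proof -
  have "\<bar>f x\<bar> \<le> b 0" "\<bar>g x\<bar> \<le> c 0" using Suc.prems that dbound_Suc by blast+
  then show ?thesis by linarith
 qed
 ultimately show ?case by (subst dbound_Suc) blast
qed

text \<open>The Leibniz rule for majorant series, (bc)' = b'c + bc', compared coefficient by
  coefficient.\<close>

lemma conv_shift:
 fixes b c :: pt
 shows "(\<Sum>j\<le>m. (real j + 1) * b (Suc j) * c (m - j)) + (\<Sum>j\<le>m. b j * ((real (m - j) + 1) * c (Suc (m - j))))
  = (real m + 1) * (\<Sum>j\<le>Suc m. b j * c (Suc m - j))"
proof -
 have "(real m + 1) * (\<Sum>j\<le>Suc m. b j * c (Suc m - j))
   = (\<Sum>j\<le>Suc m. real j * (b j * c (Suc m - j)) + real (Suc m - j) * (b j * c (Suc m - j)))"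
  unfolding sum_distrib_left
 proof (rule sum.cong)
  fix j assume "j \<in> {..Suc m}"
  \<comment> \<open>The weight \<open>m + 1\<close> is divided between the two factors according to
    their indices.\<close>
  then have e: "real m + 1 = real j + real (Suc m - j)" by (simp add: of_nat_diff)
  show "(real m + 1) * (b j * c (Suc m - j))
   = real j * (b j * c (Suc m - j)) + real (Suc m - j) * (b j * c (Suc m - j))"
   unfolding e by (rule distrib_right)
 qed simp
 also have "\<dots> = (\<Sum>j\<le>Suc m. real j * (b j * c (Suc m - j))) + (\<Sum>j\<le>Suc m. real (Suc m - j) * (b j * c (Suc m - j)))"
  by (rule sum.distrib)
 also have "(\<Sum>j\<le>Suc m. real j * (b j * c (Suc m - j))) = (\<Sum>j\<le>m. (real j + 1) * b (Suc j) * c (m - j))"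
  by (subst sum.atMost_Suc_shift) (simp add: algebra_simps)
 also have "(\<Sum>j\<le>Suc m. real (Suc m - j) * (b j * c (Suc m - j)))
   = (\<Sum>j\<le>m. b j * ((real (m - j) + 1) * c (Suc (m - j))))"
  by (simp add: Suc_diff_le algebra_simps)
 finally show ?thesis by simp
qed

lemma dbound_mult:
 assumes U: "eopen n U"
 shows "smooth n U f ==> smooth n U g ==> dbound n U k b f ==> dbound n U k c g ==>
  dbound n U k (\<lambda>m. \<Sum>j\<le>m. b j * c (m - j)) (\<lambda>x. f x * g x)"
proof (induction k arbitrary: f g b c)
 case 0
 have "\<bar>f x * g x\<bar> \<le> b 0 * c 0" if "x \<in> U" for x
 proof -
  have "\<bar>f x\<bar> \<le> b 0" "\<bar>g x\<bar> \<le> c 0" using 0 that dbound_0 by blast+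
  then show ?thesis unfolding abs_mult by (intro mult_mono) auto
 qed
 then show ?case by (simp add: dbound_0)
next
 case (Suc k)
 have "dbound n U k (\<lambda>m. (real m + 1) * (\<Sum>j\<le>Suc m. b j * c (Suc m - j))) (partial i (\<lambda>x. f x * g x))" if i: "i < n" for i
 proof -
  have sf: "smooth n U (partial i f)" "smooth n U (partial i g)"
   using Suc.prems smooth_partial i by auto
  have d: "dbound n U k b f" "dbound n U k c g"
   using Suc.prems(3,4) by (auto intro: dbound_le)
  have d': "dbound n U k (\<lambda>m. (real m + 1) * b (Suc m)) (partial i f)"
   "dbound n U k (\<lambda>m. (real m + 1) * c (Suc m)) (partial i g)"
   by (rule dbound_SucD[OF Suc.prems(3) i], rule dbound_SucD[OF Suc.prems(4) i])
  have "dbound n U k (\<lambda>m. (\<Sum>j\<le>m. (real j + 1) * b (Suc j) * c (m - j)) + (\<Sum>j\<le>m. b j * ((real (m - j) + 1) * c (Suc (m - j)))))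
    (\<lambda>x. partial i f x * g x + f x * partial i g x)"
   by (rule dbound_add[OF U smooth_mult[OF U sf(1) Suc.prems(2)] smooth_mult[OF U Suc.prems(1) sf(2)]
      Suc.IH[OF sf(1) Suc.prems(2) d'(1) d(2)] Suc.IH[OF Suc.prems(1) sf(2) d(1) d'(2)]])
  then show ?thesis
   unfolding conv_shift
   using dbound_cong[OF U partial_mult_on[OF smooth_Ck[OF Suc.prems(1)] smooth_Ck[OF Suc.prems(2)] i]] by simp
 qed
 moreover have "\<bar>f x * g x\<bar> \<le> b 0 * c 0" if "x \<in> U" for x
 proof -
  have "\<bar>f x\<bar> \<le> b 0" "\<bar>g x\<bar> \<le> c 0" using Suc.prems that dbound_Suc by blast+
  then show ?thesis unfolding abs_mult by (intro mult_mono) auto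
 qed
 ultimately show ?case by (subst dbound_Suc) auto
qed

lemma partial_const [simp]: "partial i (\<lambda>x. c) = (\<lambda>x. 0)"
 by (simp add: partial_def fun_eq_iff)

lemma pw_const: "pw w (\<lambda>x. c) = (if w = [] then (\<lambda>x. c) else (\<lambda>x. 0))"
 by (induction w arbitrary: c) auto

lemma dbound_const: "dbound n U k (\<lambda>m::nat. if m = 0 then \<bar>c\<bar> else 0) (\<lambda>x. c)"
 unfolding dbound_def by (auto simp: pw_const)

lemma smooth_const: "eopen n U ==> smooth n U (\<lambda>x. c)"
 by (simp add: smooth_def)

lemma smooth_coord: "eopen n U ==> smooth n U (\<lambda>x. x i)"
 by (simp add: smooth_def Ck_on_coord)

lemma partial_coord: "partial j (\<lambda>x. x i) = (\<lambda>x. if i = j then 1 else 0)"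
proof
 fix x :: pt
 show "partial j (\<lambda>x. x i) x = (if i = j then 1 else 0)"
  by (rule partialI) (cases "i = j"; auto)
qed

lemma dbound_coord: "i < n ==> U \<subseteq> cub n (\<lambda>_. 0) e ==> dbound n U k (\<lambda>m. if m = 0 then e else if m = 1 then 1 else 0) (\<lambda>x. x i)"
 unfolding dbound_def
proof (intro ballI impI)
 fix w x assume i: "i < n" "U \<subseteq> cub n (\<lambda>_. 0) e" "w \<in> lists {..<n}" "x \<in> U"
 then have "\<bar>x i\<bar> < e" by (auto simp: cub_def)
 then show "\<bar>pw w (\<lambda>x. x i) x\<bar> \<le> fact (length w) * (if length w = 0 then e else if length w = 1 then 1 else 0)"
  by (cases w) (auto simp: partial_coord pw_const)
qed

section \<open>The normed algebra of analytic functions\<close>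

lemma anormD_smooth: "anorm n U \<rho> A f ==> smooth n U f"
 by (simp add: anorm_def)

lemma anorm_mono: "anorm n U \<rho> A f ==> A \<le> B ==> anorm n U \<rho> B f"
 unfolding anorm_def by (meson order_trans)

lemma anorm_nonneg: "anorm n U \<rho> A f ==> 0 \<le> A"
 unfolding anorm_def by (metis lessThan_0 sum.empty)

lemma anorm_bound:
 assumes "anorm n U \<rho> A f" "x \<in> U"
 shows "\<bar>f x\<bar> \<le> A"
proof -
 obtain b where b: "\<forall>k. dbound n U k b f" "\<forall>N. (\<Sum>m<N. \<rho> ^ m * b m) \<le> A"
  using assms unfolding anorm_def by blast
 have "\<bar>f x\<bar> \<le> b 0" using b(1) assms(2) dbound_0 by blast
 also have "\<dots> \<le> A" using b(2)[rule_format, of 1] by simp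
 finally show ?thesis .
qed

lemma anorm_const: "eopen n U ==> anorm n U \<rho> \<bar>c\<bar> (\<lambda>x. c)"
proof -
 assume U: "eopen n U"
 have "(\<Sum>m<N. \<rho> ^ m * (if m = 0 then \<bar>c\<bar> else 0)) \<le> \<bar>c\<bar>" for N
 proof -
  have "(\<Sum>m<N. \<rho> ^ m * (if m = 0 then \<bar>c\<bar> else 0)) = (\<Sum>m<N. if m = 0 then \<bar>c\<bar> else 0)"
   by (rule sum.cong) auto
  then show ?thesis by (simp add: sum.delta)
 qed
 then show ?thesis
  unfolding anorm_def using smooth_const[OF U] dbound_const[of n U _ c]
  by (intro conjI exI[of _ "\<lambda>m::nat. if m = 0 then \<bar>c\<bar> else 0"]) auto
qed

lemma anorm_coord:
 assumes "eopen n U" "i < n" "U \<subseteq> cub n (\<lambda>_. 0) e" "e \<ge> 0" "\<rho> \<ge> 0"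
 shows "anorm n U \<rho> (e + \<rho>) (\<lambda>x. x i)"
proof -
 let ?b = "\<lambda>m::nat. if m = 0 then e else if m = 1 then 1 else 0 :: real"
 have "(\<Sum>m<N. \<rho> ^ m * ?b m) \<le> e + \<rho>" for N
 proof -
  have "(\<Sum>m<N. \<rho> ^ m * ?b m) \<le> (\<Sum>m<Suc (Suc N). \<rho> ^ m * ?b m)"
   by (rule sum_mono2) (use assms in auto)
  also have "\<dots> = e + \<rho>"
   by (subst sum.lessThan_Suc_shift, subst sum.lessThan_Suc_shift) simp
  finally show ?thesis .
 qed
 then show ?thesis
  unfolding anorm_def using smooth_coord[OF assms(1)] dbound_coord[OF assms(2,3)] assms(4)
  by (intro conjI exI[of _ ?b]) auto
qed

lemma anorm_add:
 assumes U: "eopen n U" and f: "anorm n U \<rho> A f" and g: "anorm n U \<rho> B g"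
 shows "anorm n U \<rho> (A + B) (\<lambda>x. f x + g x)"
proof -
 obtain b where b: "\<forall>m. 0 \<le> b m" "\<forall>k. dbound n U k b f" "\<forall>N. (\<Sum>m<N. \<rho> ^ m * b m) \<le> A"
  using f unfolding anorm_def by blast
 obtain c where c: "\<forall>m. 0 \<le> c m" "\<forall>k. dbound n U k c g" "\<forall>N. (\<Sum>m<N. \<rho> ^ m * c m) \<le> B"
  using g unfolding anorm_def by blast
 have "(\<Sum>m<N. \<rho> ^ m * (b m + c m)) \<le> A + B" for N
  using b(3)[rule_format, of N] c(3)[rule_format, of N] by (simp add: distrib_left sum.distrib)
 then show ?thesis
  unfolding anorm_def using smooth_add[OF U anormD_smooth[OF f] anormD_smooth[OF g]]
   dbound_add[OF U anormD_smooth[OF f] anormD_smooth[OF g]] b c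
  by (intro conjI exI[of _ "\<lambda>m. b m + c m"]) auto
qed

lemma anorm_mult:
 assumes U: "eopen n U" and f: "anorm n U \<rho> A f" and g: "anorm n U \<rho> B g" and \<rho>: "\<rho> \<ge> 0"
 shows "anorm n U \<rho> (A * B) (\<lambda>x. f x * g x)"
proof -
 obtain b where b: "\<forall>m. 0 \<le> b m" "\<forall>k. dbound n U k b f" "\<forall>N. (\<Sum>m<N. \<rho> ^ m * b m) \<le> A"
  using f unfolding anorm_def by blast
 obtain c where c: "\<forall>m. 0 \<le> c m" "\<forall>k. dbound n U k c g" "\<forall>N. (\<Sum>m<N. \<rho> ^ m * c m) \<le> B"
  using g unfolding anorm_def by blast
 have "(\<Sum>m<N. \<rho> ^ m * (\<Sum>j\<le>m. b j * c (m - j))) \<le> A * B" for N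
 proof -
  have "(\<Sum>m<N. \<rho> ^ m * (\<Sum>j\<le>m. b j * c (m - j)))
    = (\<Sum>m<N. \<Sum>j\<le>m. (\<rho> ^ j * b j) * (\<rho> ^ (m - j) * c (m - j)))"
   unfolding sum_distrib_left
  proof (intro sum.cong refl)
   fix m j :: nat assume "j \<in> {..m}"
   then have "\<rho> ^ m = \<rho> ^ j * \<rho> ^ (m - j)" by (simp flip: power_add)
   then show "\<rho> ^ m * (b j * c (m - j)) = \<rho> ^ j * b j * (\<rho> ^ (m - j) * c (m - j))" by simp
  qed
  \<comment> \<open>The convolution sums run over a triangle, which is enlarged to a square because
    all terms are nonnegative.\<close>
  also have "\<dots> = (\<Sum>(i,j)\<in>{(i,j). i + j < N}. (\<rho> ^ i * b i) * (\<rho> ^ j * c j))"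
   by (rule sum.triangle_reindex[symmetric])
  also have "\<dots> \<le> (\<Sum>(i,j)\<in>{..<N} \<times> {..<N}. (\<rho> ^ i * b i) * (\<rho> ^ j * c j))"
   by (rule sum_mono2) (use b c \<rho> in auto)
  also have "\<dots> = (\<Sum>m<N. \<rho> ^ m * b m) * (\<Sum>m<N. \<rho> ^ m * c m)"
   by (simp add: sum_product sum.cartesian_product)
  also have "\<dots> \<le> A * B"
   using b c \<rho> anorm_nonneg[OF f] by (intro mult_mono) (auto intro!: sum_nonneg)
  finally show ?thesis .
 qed
 moreover have "0 \<le> (\<Sum>j\<le>m. b j * c (m - j))" for m
  using b c by (intro sum_nonneg) auto
 ultimately show ?thesis
  unfolding anorm_def using smooth_mult[OF U anormD_smooth[OF f] anormD_smooth[OF g]]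
   dbound_mult[OF U anormD_smooth[OF f] anormD_smooth[OF g]] b c
  by (intro conjI exI[of _ "\<lambda>m. \<Sum>j\<le>m. b j * c (m - j)"]) auto
qed

lemma anorm_cmult: "eopen n U ==> anorm n U \<rho> A f ==> \<rho> \<ge> 0 ==> anorm n U \<rho> (\<bar>c\<bar> * A) (\<lambda>x. c * f x)"
 by (intro anorm_mult anorm_const)

lemma anorm_sum:
 "eopen n U ==> (\<And>j. j \<in> J ==> anorm n U \<rho> (A j) (f j)) ==> anorm n U \<rho> (\<Sum>j\<in>J. A j) (\<lambda>x. \<Sum>j\<in>J. f j x)"
proof (induction J rule: infinite_finite_induct)
 case (infinite J)
 then show ?case using anorm_const[of n U \<rho> 0] by simp
next
 case empty
 then show ?case using anorm_const[of n U \<rho> 0] by simp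
next
 case (insert j J)
 then show ?case by (simp add: anorm_add)
qed

lemma anorm_dbound:
 assumes "anorm n U \<rho> A f" "\<rho> > 0"
 shows "dbound n U k (\<lambda>m. A * (1 / \<rho>) ^ m) f"
proof -
 obtain b where b: "\<forall>m. 0 \<le> b m" "\<forall>k. dbound n U k b f" "\<forall>N. (\<Sum>m<N. \<rho> ^ m * b m) \<le> A"
  using assms unfolding anorm_def by blast
 have "b m \<le> A * (1 / \<rho>) ^ m" for m
 proof -
  have "\<rho> ^ m * b m \<le> (\<Sum>m<Suc m. \<rho> ^ m * b m)"
   using b assms by (simp add: sum_nonneg)
  also have "\<dots> \<le> A" using b by blast
  finally show ?thesis using assms(2) by (simp add: power_one_over field_simps)
 qed
 then show ?thesis by (intro dbound_mono[OF b(2)[rule_format]])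
qed

lemma anorm_analytic: "anorm n U \<rho> A f ==> \<rho> > 0 ==> analytic n U f"
 unfolding analytic_def using anorm_dbound anormD_smooth anorm_nonneg
 by (metis less_imp_le zero_le_divide_1_iff)

text \<open>A radius of at most \<open>1 / (2 * R + 1)\<close> makes the ratio of the geometric
  series at most 1/2, so its sum is at most \<open>2 * C\<close> for every smaller radius as well.
  One bound for all small radii lets two functions be brought to a common radius.\<close>

lemma analytic_anorm:
 assumes "analytic n U f"
 shows "\<exists>\<rho>>0. \<exists>A. \<forall>\<sigma>. 0 < \<sigma> \<and> \<sigma> \<le> \<rho> \<longrightarrow> anorm n U \<sigma> A f"
proof -
 obtain C R where CR: "C \<ge> 0" "R \<ge> 0" "\<And>k. dbound n U k (\<lambda>m. C * R ^ m) f"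
  using assms unfolding analytic_def by blast
 have "anorm n U \<sigma> (2 * C) f" if \<sigma>: "0 < \<sigma>" "\<sigma> \<le> 1 / (2 * R + 1)" for \<sigma>
 proof -
  have r: "\<sigma> * R \<le> 1 / 2"
  proof -
   have "\<sigma> * R \<le> R / (2 * R + 1)" using mult_right_mono[OF \<sigma>(2) CR(2)] by simp
   also have "\<dots> \<le> 1 / 2" using CR(2) by (simp add: divide_simps)
   finally show ?thesis .
  qed
  have "(\<Sum>m<N. \<sigma> ^ m * (C * R ^ m)) \<le> 2 * C" for N
  proof -
   have "(\<Sum>m<N. \<sigma> ^ m * (C * R ^ m)) = C * (\<Sum>m<N. (\<sigma> * R) ^ m)"
    by (simp add: sum_distrib_left power_mult_distrib mult.left_commute)
   also have "\<dots> \<le> C * (\<Sum>m<N. (1/2) ^ m)"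
    using CR r \<sigma> by (intro mult_left_mono sum_mono power_mono) auto
   also have "\<dots> \<le> C * 2"
    by (intro mult_left_mono[OF _ CR(1)]) (subst geometric_sum, auto)
   finally show ?thesis by (simp add: mult.commute)
  qed
  then show ?thesis
   unfolding anorm_def using CR assms
   by (intro conjI exI[of _ "\<lambda>m. C * R ^ m"]) (auto simp: analytic_def)
 qed
 then show ?thesis using CR(2) by (intro exI[of _ "1 / (2 * R + 1)"]) auto
qed

lemma analytic_subset: "analytic n U f ==> V \<subseteq> U ==> analytic n V f"
 unfolding analytic_def by (meson smooth_subset dbound_subset)

lemma analytic_cong: "eopen n U ==> (\<And>x. x \<in> U ==> f x = g x) ==> analytic n U f = analytic n U g"
 unfolding analytic_def using smooth_cong[of n U f g] dbound_cong[of n U f g] by simp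

lemma analytic_smooth: "analytic n U f ==> smooth n U f"
 by (simp add: analytic_def)

lemma analytic_const: "eopen n U ==> analytic n U (\<lambda>x. c)"
 by (rule anorm_analytic[OF anorm_const[of n U 1]]) auto

lemma analytic_add:
 assumes U: "eopen n U" and f: "analytic n U f" and g: "analytic n U g"
 shows "analytic n U (\<lambda>x. f x + g x)"
proof -
 obtain \<rho> A where 1: "\<rho> > 0" "\<And>\<sigma>. 0 < \<sigma> ==> \<sigma> \<le> \<rho> ==> anorm n U \<sigma> A f" using analytic_anorm[OF f] by metis
 obtain \<tau> B where 2: "\<tau> > 0" "\<And>\<sigma>. 0 < \<sigma> ==> \<sigma> \<le> \<tau> ==> anorm n U \<sigma> B g" using analytic_anorm[OF g] by metis
 show ?thesis
  by (rule anorm_analytic[OF anorm_add[OF U 1(2) 2(2)], of "min \<rho> \<tau>"]) (use 1(1) 2(1) in auto)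
qed

lemma analytic_mult:
 assumes U: "eopen n U" and f: "analytic n U f" and g: "analytic n U g"
 shows "analytic n U (\<lambda>x. f x * g x)"
proof -
 obtain \<rho> A where 1: "\<rho> > 0" "\<And>\<sigma>. 0 < \<sigma> ==> \<sigma> \<le> \<rho> ==> anorm n U \<sigma> A f" using analytic_anorm[OF f] by metis
 obtain \<tau> B where 2: "\<tau> > 0" "\<And>\<sigma>. 0 < \<sigma> ==> \<sigma> \<le> \<tau> ==> anorm n U \<sigma> B g" using analytic_anorm[OF g] by metis
 show ?thesis
  by (rule anorm_analytic[OF anorm_mult[OF U 1(2) 2(2)], of "min \<rho> \<tau>"]) (use 1(1) 2(1) in auto)
qed

lemma analytic_sum:
 "eopen n U ==> (\<And>j. j \<in> J ==> analytic n U (f j)) ==> analytic n U (\<lambda>x. \<Sum>j\<in>J. f j x)"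
 by (induction J rule: infinite_finite_induct) (auto intro: analytic_add analytic_const)

text \<open>Convolving geometric sequences of equal ratio produces a factor \<open>m + 1\<close>;
  with ratios at least a factor 2 apart the cost is only the constant 2.\<close>

lemma conv_geometric_le:
 assumes "0 \<le> r" "r \<le> s / 2"
 shows "(\<Sum>j\<le>m. r ^ j * s ^ (m - j)) \<le> (2::real) * s ^ m"
proof -
 have s: "s \<ge> 0" using assms by simp
 have "(\<Sum>j\<le>m. r ^ j * s ^ (m - j)) \<le> (\<Sum>j\<le>m. (1/2) ^ j * s ^ m)"
 proof (rule sum_mono)
  fix j assume "j \<in> {..m}"
  then have "s ^ m = s ^ j * s ^ (m - j)" by (simp flip: power_add)
  moreover have "r ^ j \<le> (1/2) ^ j * s ^ j"
   using power_mono[OF assms(2,1), of j] by (simp add: power_divide)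
  ultimately show "r ^ j * s ^ (m - j) \<le> (1/2) ^ j * s ^ m"
   using mult_right_mono[of "r ^ j" "(1/2) ^ j * s ^ j" "s ^ (m - j)"] s by (simp add: mult.assoc)
 qed
 also have "\<dots> = (\<Sum>j<Suc m. (1/2) ^ j) * s ^ m"
  by (simp add: sum_distrib_right lessThan_Suc_atMost)
 also have "\<dots> \<le> 2 * s ^ m"
  using s by (intro mult_right_mono) (subst geometric_sum, auto)
 finally show ?thesis .
qed

text \<open>Induction over the order, through the derivative of the reciprocal, whose formula
  involves the reciprocal only to lower order. Of the two convolutions the first has ratios
  \<open>2 * R\<close> and \<open>S\<close> and costs a factor 2; the second has equal ratios and
  costs \<open>m + 1\<close>, exactly the factor that \<open>dbound_Suc\<close> allows.\<close>

lemma analytic_inverse: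
 assumes U: "eopen n U" and f: "analytic n U f" and \<kappa>: "\<kappa> > 0" "\<And>x. x \<in> U ==> \<bar>f x\<bar> \<ge> \<kappa>"
 shows "analytic n U (\<lambda>x. inverse (f x))"
proof -
 obtain C R where CR: "C \<ge> 0" "R \<ge> 0" "\<And>k. dbound n U k (\<lambda>m. C * R ^ m) f"
  using f unfolding analytic_def by blast
 have nz: "f x \<noteq> 0" if "x \<in> U" for x using \<kappa> that by force
 have sf: "smooth n U f" using f by (rule analytic_smooth)
 have sh: "smooth n U (\<lambda>x. inverse (f x))"
  using sf nz Ck_on_inverse[OF U] unfolding smooth_def by blast
 define K where "K = 1 / \<kappa>"
 \<comment> \<open>\<open>4 * R\<close> separates the ratios for the first convolution;
   \<open>2 * K * (C * R)\<close> absorbs the constants left over by the second.\<close>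
 define S where "S = 4 * R + 2 * K * (C * R)"
 have K: "K > 0" using \<kappa> by (simp add: K_def)
 have S: "2 * R \<le> S / 2 \<or> R = 0" "2 * K * (C * R) \<le> S" "S \<ge> 0" "2 * R \<le> S / 2"
  using CR K by (auto simp: S_def)
 have bnd: "\<bar>inverse (f x)\<bar> \<le> K" if "x \<in> U" for x
  using \<kappa> that le_imp_inverse_le[of \<kappa> "\<bar>f x\<bar>"] by (simp add: K_def inverse_eq_divide)
 have "dbound n U k (\<lambda>m. K * S ^ m) (\<lambda>x. inverse (f x))" for k
 proof (induction k)
  case 0
  then show ?case using bnd by (simp add: dbound_0)
 next
  case (Suc k)
  have "dbound n U k (\<lambda>m. (real m + 1) * (K * S ^ Suc m)) (partial i (\<lambda>x. inverse (f x)))" if i: "i < n" for i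
  proof -
   have "dbound n U k (\<lambda>m. (real m + 1) * (C * R ^ Suc m)) (partial i f)"
    by (rule dbound_SucD[OF CR(3) i])
   then have fi: "dbound n U k (\<lambda>m. C * R * (2 * R) ^ m) (partial i f)"
   proof (rule dbound_mono)
    fix m
    have "real m + 1 \<le> 2 ^ m"
     by (induction m) auto
    then have "(real m + 1) * (C * R * R ^ m) \<le> 2 ^ m * (C * R * R ^ m)"
     using CR by (intro mult_right_mono) auto
    then show "(real m + 1) * (C * R ^ Suc m) \<le> C * R * (2 * R) ^ m"
     by (simp add: power_mult_distrib mult_ac)
   qed
   have 1: "dbound n U k (\<lambda>m. 2 * C * R * K * S ^ m) (\<lambda>x. partial i f x * inverse (f x))"
   proof (rule dbound_mono[OF dbound_mult[OF U smooth_partial[OF sf i] sh fi Suc]])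
    fix m
    have "(\<Sum>j\<le>m. C * R * (2 * R) ^ j * (K * S ^ (m - j))) = C * R * K * (\<Sum>j\<le>m. (2 * R) ^ j * S ^ (m - j))"
     by (simp add: sum_distrib_left mult_ac)
    also have "\<dots> \<le> C * R * K * (2 * S ^ m)"
     using conv_geometric_le[of "2 * R" S m] CR K S by (intro mult_left_mono) auto
    finally show "(\<Sum>j\<le>m. C * R * (2 * R) ^ j * (K * S ^ (m - j))) \<le> 2 * C * R * K * S ^ m" by (simp add: mult_ac)
   qed
   have s1: "smooth n U (\<lambda>x. partial i f x * inverse (f x))"
    using smooth_mult[OF U smooth_partial[OF sf i] sh] .
   have 2: "dbound n U k (\<lambda>m. (real m + 1) * (K * S ^ Suc m)) (\<lambda>x. (partial i f x * inverse (f x)) * inverse (f x))"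
   proof (rule dbound_mono[OF dbound_mult[OF U s1 sh 1 Suc]])
    fix m
    have "(\<Sum>j\<le>m. 2 * C * R * K * S ^ j * (K * S ^ (m - j))) = (\<Sum>j\<le>m. 2 * C * R * K * K * S ^ m)"
     by (rule sum.cong) (auto simp: mult_ac simp flip: power_add)
    also have "\<dots> = (real m + 1) * (K * ((2 * K * (C * R)) * S ^ m))" by (simp add: mult_ac)
    also have "\<dots> \<le> (real m + 1) * (K * (S * S ^ m))"
     using K S by (intro mult_left_mono mult_right_mono) auto
    finally show "(\<Sum>j\<le>m. 2 * C * R * K * S ^ j * (K * S ^ (m - j))) \<le> (real m + 1) * (K * S ^ Suc m)" by simp
   qed
   have s2: "smooth n U (\<lambda>x. (partial i f x * inverse (f x)) * inverse (f x))"
    using smooth_mult[OF U s1 sh] .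
   have m1: "dbound n U k (\<lambda>m. if m = 0 then \<bar>-1\<bar> else 0) (\<lambda>x. - 1 :: real)" by (rule dbound_const)
   have 3: "dbound n U k (\<lambda>m. (real m + 1) * (K * S ^ Suc m)) (\<lambda>x. - 1 * ((partial i f x * inverse (f x)) * inverse (f x)))"
   proof (rule dbound_mono[OF dbound_mult[OF U smooth_const[OF U] s2 m1 2]])
    fix m
    have "(\<Sum>j\<le>m. (if j = 0 then \<bar>-1\<bar> else 0) * ((real (m - j) + 1) * (K * S ^ Suc (m - j))))
     = (\<Sum>j\<le>m. if j = 0 then (real m + 1) * (K * S ^ Suc m) else 0)"
     by (rule sum.cong) auto
    then show "(\<Sum>j\<le>m. (if j = 0 then \<bar>-1\<bar> else 0) * ((real (m - j) + 1) * (K * S ^ Suc (m - j))))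
     \<le> (real m + 1) * (K * S ^ Suc m)" by (simp add: sum.delta)
   qed
   have "partial i (\<lambda>x. inverse (f x)) x = - 1 * ((partial i f x * inverse (f x)) * inverse (f x))" if x: "x \<in> U" for x
    by (rule partialI)
     (use DERIV_inverse'[OF Ck_on_Suc_partial(2)[OF smooth_Ck[OF sf] i x]] nz[OF x] in
      \<open>simp add: mult_ac del: fun_upd_apply\<close>)
   then show ?thesis by (intro iffD2[OF dbound_cong[OF U] 3])
  qed
  then show ?case using bnd by (subst dbound_Suc) auto
 qed
 then show ?thesis
  unfolding analytic_def using sh K S by (meson less_imp_le)
qed

section \<open>Series of analytic functions\<close>

lemma summable_bound_series:
 fixes B :: pt
 assumes "summable B" "\<And>m. \<bar>f m\<bar> \<le> B m"
 shows "summable f" "\<bar>\<Sum>m. f m\<bar> \<le> (\<Sum>m. B m)"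
proof -
 have s: "summable (\<lambda>m. norm (f m))"
  by (rule summable_comparison_test'[OF assms(1), of 0]) (use assms(2) in auto)
 then show "summable f" by (rule summable_norm_cancel)
 have "\<bar>\<Sum>m. f m\<bar> \<le> (\<Sum>m. \<bar>f m\<bar>)" using summable_norm[OF s] by simp
 also have "\<dots> \<le> (\<Sum>m. B m)" by (rule suminf_le) (use assms s in auto)
 finally show "\<bar>\<Sum>m. f m\<bar> \<le> (\<Sum>m. B m)" .
qed

lemma suminf_continuous_bound:
 fixes f :: "nat => pt => real"
 assumes U: "eopen n U" and s: "\<And>m. smooth n U (f m)" and d: "\<And>m k. dbound n U k (b m) (f m)"
  and b: "\<And>j. summable (\<lambda>m. b m j)"
 shows "continuous_on U (\<lambda>x. \<Sum>m. f m x) \<and> (\<forall>x\<in>U. \<bar>\<Sum>m. f m x\<bar> \<le> (\<Sum>m. b m 0))"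
proof -
 have le: "\<bar>f m x\<bar> \<le> b m 0" if "x \<in> U" for m x
  using d[of 0 m] that by (simp add: dbound_0)
 have "continuous_on U (\<lambda>x. \<Sum>m. f m x)"
 proof (rule uniform_limit_theorem)
  show "uniform_limit U (\<lambda>N x. \<Sum>m<N. f m x) (\<lambda>x. \<Sum>m. f m x) sequentially"
   by (rule Weierstrass_m_test[OF _ b[of 0]]) (use le in auto)
  show "\<forall>\<^sub>F N in sequentially. continuous_on U (\<lambda>x. \<Sum>m<N. f m x)"
   using Ck_on_continuous[OF U smooth_Ck[OF s]] by (intro always_eventually allI continuous_on_sum) auto
 qed simp
 moreover have "\<bar>\<Sum>m. f m x\<bar> \<le> (\<Sum>m. b m 0)" if "x \<in> U" for x
  by (rule summable_bound_series(2)[OF b[of 0] le[OF that]])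
 ultimately show ?thesis by blast
qed

text \<open>Termwise differentiation, justified by uniform convergence of the derivatives on a ball
  in one coordinate. The majorants of the derivatives are again summable, so the induction over
  \<open>k\<close> applies to them.\<close>

lemma dbound_suminf:
 assumes U: "eopen n U"
 shows "(\<And>m. smooth n U (f m)) ==> (\<And>m k. dbound n U k (b m) (f m)) ==>
  (\<And>j. summable (\<lambda>m. b m j)) ==>
  Ck_on n k U (\<lambda>x. \<Sum>m. f m x) \<and> dbound n U k (\<lambda>j. \<Sum>m. b m j) (\<lambda>x. \<Sum>m. f m x)"
proof (induction k arbitrary: f b)
 case 0
 then show ?case using suminf_continuous_bound[of n U f b] U by (simp add: dbound_0 continuous_map_Euclidean_iff)
next
 case (Suc k)
 note B = suminf_continuous_bound[OF U Suc.prems(1) Suc.prems(2) Suc.prems(3)]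
 let ?b = "\<lambda>m j. (real j + 1) * b m (Suc j)"
 have s: "smooth n U (partial i (f m))" if "i < n" for i m
  using smooth_partial[OF Suc.prems(1) that] .
 have d: "dbound n U k (?b m) (partial i (f m))" if "i < n" for i m k
  by (rule dbound_SucD[OF Suc.prems(2) that])
 have sb: "summable (\<lambda>m. ?b m j)" for j
  using Suc.prems(3) by (rule summable_mult)
 note IH = Suc.IH[of "\<lambda>m. partial i (f m)" ?b for i, OF s d sb, THEN conjunct1]
  Suc.IH[of "\<lambda>m. partial i (f m)" ?b for i, OF s d sb, THEN conjunct2]
 have D: "((\<lambda>t. \<Sum>m. f m (x(i := t))) has_real_derivative (\<Sum>m. partial i (f m) x)) (at (x i))"
  if i: "i < n" and x: "x \<in> U" for i x
 proof -
  obtain e where e: "e > 0" "cub n x e \<subseteq> U" by (rule eopen_cubE[OF U x])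
  have inc: "x(i := t) \<in> U" if "t \<in> ball (x i) e" for t
   using e that i eopen_zero[OF U x] by (intro subsetD[OF e(2)]) (auto simp: cub_def dist_real_def abs_minus_commute)
  have d1: "((\<lambda>t. f m (x(i := t))) has_real_derivative partial i (f m) (x(i := t))) (at t within ball (x i) e)"
   if "t \<in> ball (x i) e" for m t
  proof -
   have "((\<lambda>s. f m ((x(i := t))(i := s))) has_real_derivative partial i (f m) (x(i := t))) (at ((x(i := t)) i))"
    by (rule Ck_on_Suc_partial(2)[OF smooth_Ck[OF Suc.prems(1)] i inc[OF that]])
   then have "((\<lambda>t. f m (x(i := t))) has_real_derivative partial i (f m) (x(i := t))) (at t)"
    by (simp only: fun_upd_upd fun_upd_same)
   then show ?thesis by (rule DERIV_subset) simp
  qed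
  have d2: "\<bar>partial i (f m) (x(i := t))\<bar> \<le> ?b m 0" if "t \<in> ball (x i) e" for m t
   using d[OF i, of 0 m] inc[OF that] by (simp add: dbound_0)
  have d3: "uniformly_convergent_on (ball (x i) e) (\<lambda>N t. \<Sum>m<N. partial i (f m) (x(i := t)))"
   unfolding uniformly_convergent_on_def
   by (rule exI, rule Weierstrass_m_test[OF _ sb[of 0]]) (use d2 in simp)
  have d4: "summable (\<lambda>m. f m (x(i := x i)))"
   using Suc.prems(2)[of 0] x by (intro summable_bound_series(1)[OF Suc.prems(3)[of 0]]) (simp add: dbound_0)
  have "((\<lambda>t. \<Sum>m. f m (x(i := t))) has_real_derivative (\<Sum>m. partial i (f m) (x(i := x i)))) (at (x i))"
   by (rule has_field_derivative_series'(2)[OF convex_ball d1 d3 _ d4]) (use e in auto)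
  then show ?thesis by simp
 qed
 have "Ck_on n (Suc k) U (\<lambda>x. \<Sum>m. f m x)"
  by (rule Ck_on_SucI[OF U _ D IH(1)]) (use B in auto)
 moreover have "dbound n U (Suc k) (\<lambda>j. \<Sum>m. b m j) (\<lambda>x. \<Sum>m. f m x)"
 proof (subst dbound_Suc, intro conjI allI impI)
  fix i assume i: "i < n"
  have "dbound n U k (\<lambda>j. (real j + 1) * (\<Sum>m. b m (Suc j))) (\<lambda>x. \<Sum>m. partial i (f m) x)"
   using IH(2)[of i] i suminf_mult[OF Suc.prems(3)] by simp
  then show "dbound n U k (\<lambda>j. (real j + 1) * (\<Sum>m. b m (Suc j))) (partial i (\<lambda>x. \<Sum>m. f m x))"
   by (rule iffD2[OF dbound_cong[OF U], rotated]) (rule partialI, rule D[OF i])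
 qed (use B in auto)
 ultimately show ?case by blast
qed

text \<open>Completeness of the normed algebra, for absolutely convergent series. Each coefficient
  satisfies \<open>b m j \<le> A m / \<rho> ^ j\<close>, hence is summable in \<open>m\<close>, and
  exchanging the two sums gives the norm of the total.\<close>

lemma anorm_suminf:
 assumes U: "eopen n U" and f: "\<And>m. anorm n U \<rho> (A m) (f m)" and A: "summable A" and \<rho>: "\<rho> > 0"
 shows "anorm n U \<rho> (\<Sum>m. A m) (\<lambda>x. \<Sum>m. f m x)"
proof -
 have "\<exists>b. (\<forall>j. 0 \<le> b j) \<and> (\<forall>k. dbound n U k b (f m)) \<and> (\<forall>N. (\<Sum>j<N. \<rho> ^ j * b j) \<le> A m)" for m
  using f[of m] unfolding anorm_def by blast
 then obtain b where b: "\<And>m j. 0 \<le> b m j" "\<And>m k. dbound n U k (b m) (f m)"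
   "\<And>m N. (\<Sum>j<N. \<rho> ^ j * b m j) \<le> A m" by metis
 have sb: "summable (\<lambda>m. b m j)" for j
 proof (rule summable_comparison_test'[OF summable_mult[OF A, of "1 / \<rho> ^ j"], of 0])
  fix m
  have "\<rho> ^ j * b m j \<le> (\<Sum>j<Suc j. \<rho> ^ j * b m j)"
   using b(1) \<rho> by (simp add: sum_nonneg)
  also have "\<dots> \<le> A m" using b(3) .
  finally show "norm (b m j) \<le> 1 / \<rho> ^ j * A m"
   using b(1) \<rho> by (simp add: field_simps)
 qed
 have s: "smooth n U (f m)" for m using f by (rule anormD_smooth)
 have "(\<Sum>j<N. \<rho> ^ j * (\<Sum>m. b m j)) \<le> (\<Sum>m. A m)" for N
 proof -
  have "(\<Sum>j<N. \<rho> ^ j * (\<Sum>m. b m j)) = (\<Sum>j<N. \<Sum>m. \<rho> ^ j * b m j)"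
   by (simp add: suminf_mult[OF sb])
  also have "\<dots> = (\<Sum>m. \<Sum>j<N. \<rho> ^ j * b m j)"
   by (rule suminf_sum[symmetric]) (rule summable_mult[OF sb])
  also have "\<dots> \<le> (\<Sum>m. A m)"
   by (rule suminf_le[OF b(3) summable_sum A]) (rule summable_mult[OF sb])
  finally show ?thesis .
 qed
 then show ?thesis
  unfolding anorm_def smooth_def using dbound_suminf[OF U s b(2) sb] suminf_nonneg[OF sb b(1)]
  by (intro conjI exI[of _ "\<lambda>j. \<Sum>m. b m j"]) auto
qed

subsection \<open>Relation to the Euclidean spaces \<open>C\<^sup>\<omega>\<close>\<close>

lemma smooth_partial_commute:
 "eopen n U ==> smooth n U f ==> i < n ==> j < n ==> x \<in> U ==>
  partial i (partial j f) x = partial j (partial i f) x"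
 using partial_commute smooth_Ck by blast

lemma smooth_funpow: "smooth n U f ==> m < n ==> smooth n U ((partial m ^^ a) f)"
 by (induction a) (auto intro: smooth_partial)

lemma funpow_partial_cong:
 "eopen n U ==> m < n ==> (\<And>x. x \<in> U ==> f x = g x) ==> x \<in> U ==>
  (partial m ^^ a) f x = (partial m ^^ a) g x"
proof (induction a arbitrary: x)
 case (Suc a)
 then show ?case using partial_cong(1)[of n U x m "(partial m ^^ a) f" "(partial m ^^ a) g"] by simp
qed auto

lemma mpartial_cong:
 "eopen n U ==> m \<le> n ==> (\<And>x. x \<in> U ==> f x = g x) ==> x \<in> U ==> mpartial ws m f x = mpartial ws m g x"
proof (induction m arbitrary: f g x)
 case (Suc m)
 have "mpartial ws m ((partial m ^^ ws m) f) x = mpartial ws m ((partial m ^^ ws m) g) x"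
  by (rule Suc.IH[OF Suc.prems(1) _ _ Suc.prems(4)])
   (use Suc.prems funpow_partial_cong[OF Suc.prems(1) _ Suc.prems(3)] in auto)
 then show ?case by simp
qed auto

lemma funpow_partial_commute:
 assumes U: "eopen n U" and f: "smooth n U f" and i: "i < n" and m: "m < n"
 shows "x \<in> U ==> (partial m ^^ a) (partial i f) x = partial i ((partial m ^^ a) f) x"
proof (induction a arbitrary: x)
 case (Suc a)
 have "(partial m ^^ Suc a) (partial i f) x = partial m (partial i ((partial m ^^ a) f)) x"
  using partial_cong(1)[OF U Suc.prems m Suc.IH] by simp
 also have "\<dots> = partial i (partial m ((partial m ^^ a) f)) x"
  by (rule smooth_partial_commute[OF U smooth_funpow[OF f m] m i Suc.prems])
 finally show ?case by simp
qed simp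

lemma mpartial_upd_above: "i \<ge> m ==> mpartial (ws(i := k)) m f = mpartial ws m f"
 by (induction m arbitrary: f) auto

lemma mpartial_partial:
 assumes U: "eopen n U"
 shows "m \<le> n ==> i < m ==> smooth n U f ==> x \<in> U ==>
  mpartial ws m (partial i f) x = mpartial (ws(i := Suc (ws i))) m f x"
proof (induction m arbitrary: f x)
 case (Suc m)
 show ?case
 proof (cases "i = m")
  case True
  then show ?thesis by (simp add: mpartial_upd_above funpow_swap1 fun_upd_same del: fun_upd_apply)
 next
  case False
  then have i: "i < m" using Suc.prems by simp
  have "mpartial ws (Suc m) (partial i f) x = mpartial ws m (partial i ((partial m ^^ ws m) f)) x"
   unfolding mpartial.simps
   by (rule mpartial_cong[OF U _ _ Suc.prems(4)])
    (use funpow_partial_commute[OF U Suc.prems(3)] Suc.prems i in auto)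
  also have "\<dots> = mpartial (ws(i := Suc (ws i))) m ((partial m ^^ ws m) f) x"
   by (rule Suc.IH) (use Suc.prems i smooth_funpow in auto)
  finally show ?thesis using i by (simp add: fun_upd_other del: fun_upd_apply)
 qed
qed simp

lemma funpow_pw: "(partial m ^^ a) f = pw (replicate a m) f"
proof (induction a arbitrary: f)
 case (Suc a)
 have "(partial m ^^ Suc a) f = (partial m ^^ a) (partial m f)" by (simp add: funpow_swap1)
 then show ?case unfolding Suc by simp
qed simp

lemma pw_append: "pw (v @ w) f = pw w (pw v f)"
 by (induction v arbitrary: f) auto

lemma mpartial_pw:
 "\<exists>w\<in>lists {..<m}. mpartial ws m f = pw w f \<and> length w = (\<Sum>i<m. ws i)"
proof (induction m arbitrary: f)
 case (Suc m)
 from Suc[of "(partial m ^^ ws m) f"] obtain w where w: "w \<in> lists {..<m}"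
  "mpartial ws m ((partial m ^^ ws m) f) = pw w ((partial m ^^ ws m) f)" "length w = (\<Sum>i<m. ws i)" by blast
 show ?case
  by (rule bexI[of _ "replicate (ws m) m @ w"])
   (use w in \<open>auto simp: funpow_pw pw_append less_Suc_eq\<close>)
qed simp

text \<open>Partial derivatives of smooth functions commute, so only the number of occurrences of
  each letter matters.\<close>

lemma pw_mpartial:
 assumes U: "eopen n U"
 shows "w \<in> lists {..<n} ==> smooth n U f ==>
  \<exists>ws. (\<forall>i\<ge>n. ws i = 0) \<and> length w = (\<Sum>i<n. ws i) \<and> (\<forall>x\<in>U. pw w f x = mpartial ws n f x)"
proof (induction w arbitrary: f)
 case Nil
 have "mpartial (\<lambda>_. 0) m f = f" for m by (induction m) auto
 then show ?case by (intro exI[of _ "\<lambda>_. 0"]) auto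
next
 case (Cons i w)
 have i: "i < n" using Cons.prems by auto
 obtain ws where ws: "\<forall>i\<ge>n. ws i = 0" "length w = (\<Sum>i<n. ws i)" "\<forall>x\<in>U. pw w (partial i f) x = mpartial ws n (partial i f) x"
  using Cons.IH[of "partial i f"] Cons.prems smooth_partial[OF Cons.prems(2) i] by auto
 have "(\<Sum>j<n. (ws(i := Suc (ws i))) j) = (\<Sum>j<n. ws j + (if j = i then 1 else 0))"
  by (rule sum.cong) auto
 also have "\<dots> = Suc (\<Sum>j<n. ws j)" using i by (simp add: sum.distrib sum.delta)
 finally have l: "(\<Sum>j<n. (ws(i := Suc (ws i))) j) = Suc (\<Sum>j<n. ws j)" .
 show ?case
 proof (intro exI conjI)
  show "\<forall>j\<ge>n. (ws(i := Suc (ws i))) j = 0" using ws(1) i by auto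
  show "length (i # w) = (\<Sum>j<n. (ws(i := Suc (ws i))) j)" using l ws(2) by simp
  show "\<forall>x\<in>U. pw (i # w) f x = mpartial (ws(i := Suc (ws i))) n f x"
   using ws(3) mpartial_partial[OF U order_refl i Cons.prems(2)] by (simp del: fun_upd_apply)
 qed
qed

text \<open>\<open>T\<close> is the value of the defining sum, hence a bound for each of its terms.
  Solving a term for the derivative leaves the product of the factorials of the entries, which is at
  most the factorial of their sum.\<close>

lemma C_omega_analytic:
 assumes U: "eopen n U" and F: "C_omega n m U F" and i: "i < m"
 shows "analytic n U (\<lambda>x. F x i)"
proof -
 obtain r where r: "r > 0" and ck: "\<And>k. Ck_on n k U (\<lambda>x. F x i)" and
  fin: "(\<Sum>\<^sub>\<infinity>ws\<in>{ws. \<forall>i\<ge>n. ws i = 0}.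
   ennreal (r ^ (\<Sum>i<n. ws i) / (\<Prod>i<n. fact (ws i))) *
   (SUP x\<in>U. ennreal (L2_set (\<lambda>i. mpartial ws n (\<lambda>y. F y i) x) {..<m}))) < \<infinity>"
  using F i unfolding C_omega_def C_omega_r_def by blast
 define T where "T = enn2real (\<Sum>\<^sub>\<infinity>ws\<in>{ws. \<forall>i\<ge>n. ws i = 0}.
   ennreal (r ^ (\<Sum>i<n. ws i) / (\<Prod>i<n. fact (ws i))) *
   (SUP x\<in>U. ennreal (L2_set (\<lambda>i. mpartial ws n (\<lambda>y. F y i) x) {..<m})))"
 have T: "\<bar>mpartial ws n (\<lambda>y. F y i) x\<bar> \<le> T * (1 / r) ^ (\<Sum>i<n. ws i) * fact (\<Sum>i<n. ws i)"
  if ws: "\<forall>i\<ge>n. ws i = 0" and x: "x \<in> U" for ws x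
 proof -
  let ?c = "r ^ (\<Sum>i<n. ws i) / (\<Prod>i<n. fact (ws i))"
  let ?l = "L2_set (\<lambda>i. mpartial ws n (\<lambda>y. F y i) x) {..<m}"
  have c: "?c > 0" using r by (simp add: prod_pos)
  have "ennreal (?c * ?l) = ennreal ?c * ennreal ?l"
   using c by (intro ennreal_mult) auto
  also have "\<dots> \<le> ennreal ?c * (SUP x\<in>U. ennreal (L2_set (\<lambda>i. mpartial ws n (\<lambda>y. F y i) x) {..<m}))"
   using x by (intro mult_left_mono SUP_upper) auto
  also have "\<dots> \<le> ennreal T"
  proof -
   have "infsum (\<lambda>ws. ennreal (r ^ (\<Sum>i<n. ws i) / (\<Prod>i<n. fact (ws i))) *
   (SUP x\<in>U. ennreal (L2_set (\<lambda>i. mpartial ws n (\<lambda>y. F y i) x) {..<m}))) {ws}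
    \<le> (\<Sum>\<^sub>\<infinity>ws\<in>{ws. \<forall>i\<ge>n. ws i = 0}. ennreal (r ^ (\<Sum>i<n. ws i) / (\<Prod>i<n. fact (ws i))) *
   (SUP x\<in>U. ennreal (L2_set (\<lambda>i. mpartial ws n (\<lambda>y. F y i) x) {..<m})))"
    by (rule infsum_mono_neutral) (use ws in \<open>auto intro!: nonneg_summable_on_complete\<close>)
   also have "\<dots> = ennreal T"
    unfolding T_def using fin by (subst ennreal_enn2real) auto
   finally show ?thesis by simp
  qed
  finally have "?c * ?l \<le> T" using c by (subst (asm) ennreal_le_iff) (auto simp: T_def)
  then have "?l * ?c \<le> T" by (simp only: mult.commute)
  then have "?l \<le> T / ?c" by (simp only: pos_le_divide_eq[OF c])
  moreover have "\<bar>mpartial ws n (\<lambda>y. F y i) x\<bar> \<le> ?l"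
   using member_le_L2_set[of "{..<m}" i "\<lambda>i. \<bar>mpartial ws n (\<lambda>y. F y i) x\<bar>"] i
   by (simp add: L2_set_def)
  moreover have "T / ?c = T * (1 / r) ^ (\<Sum>i<n. ws i) * (\<Prod>i<n. fact (ws i))"
   by (simp add: power_one_over field_simps)
  moreover have "(\<Prod>i<n. fact (ws i)) \<le> (fact (\<Sum>i<n. ws i) :: real)"
  proof (induction n)
   case (Suc n)
   have "(\<Prod>i<Suc n. fact (ws i)) \<le> (fact (\<Sum>i<n. ws i) * fact (ws n) :: real)"
    using Suc by (simp add: mult_right_mono)
   also have "\<dots> \<le> fact (\<Sum>i<Suc n. ws i)"
   proof -
    have "fact (\<Sum>i<n. ws i) * fact (ws n) \<le> (fact ((\<Sum>i<n. ws i) + ws n) :: nat)"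
     using fact_fact_dvd_fact by (intro dvd_imp_le) auto
    then have "real (fact (\<Sum>i<n. ws i) * fact (ws n)) \<le> real (fact ((\<Sum>i<n. ws i) + ws n))"
     by (rule of_nat_mono)
    then show ?thesis by simp
   qed
   finally show ?case .
  qed simp
  ultimately show ?thesis
   using r mult_left_mono[of "\<Prod>i<n. fact (ws i)" "fact (\<Sum>i<n. ws i)" "T * (1 / r) ^ (\<Sum>i<n. ws i)"]
   by (simp add: T_def)
 qed
 have s: "smooth n U (\<lambda>x. F x i)" using ck by (simp add: smooth_def)
 have "dbound n U k (\<lambda>m. T * (1 / r) ^ m) (\<lambda>x. F x i)" for k
  unfolding dbound_def
 proof (intro ballI impI)
  fix w x assume w: "w \<in> lists {..<n}" "length w \<le> k" "x \<in> U"
  obtain ws where "\<forall>i\<ge>n. ws i = 0" "length w = (\<Sum>i<n. ws i)" "\<forall>x\<in>U. pw w (\<lambda>x. F x i) x = mpartial ws n (\<lambda>x. F x i) x"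
   using pw_mpartial[OF U w(1) s] by blast
  then show "\<bar>pw w (\<lambda>x. F x i) x\<bar> \<le> fact (length w) * (T * (1 / r) ^ length w)"
   using T[of ws x] w(3) by (simp add: mult_ac)
 qed
 then show ?thesis
  unfolding analytic_def using s r T_def
  by (intro conjI exI[of _ T] exI[of _ "1/r"]) (auto simp only: enn2real_nonneg zero_le_divide_1_iff less_imp_le)
qed

text \<open>The multinomial coefficient is a product of binomial coefficients, each at most 2 to the
  order. This reverses the comparison of factorials in \<open>C_omega_analytic\<close>.\<close>

lemma fact_sum_le: "(fact (\<Sum>i<n. ws i) :: real) \<le> 2 ^ (n * (\<Sum>i<n. ws i)) * (\<Prod>i<n. fact (ws i))"
proof (induction n)
 case (Suc n)
 let ?s = "\<Sum>i<n. ws i"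
 have "(fact (?s + ws n) :: real) = fact ?s * fact (ws n) * real ((?s + ws n) choose ?s)"
  by (simp add: binomial_fact)
 also have "\<dots> \<le> fact ?s * fact (ws n) * 2 ^ (?s + ws n)"
 proof (rule mult_left_mono)
  show "real ((?s + ws n) choose ?s) \<le> 2 ^ (?s + ws n)"
   using binomial_le_pow2[of "?s + ws n" ?s] by (metis of_nat_le_iff of_nat_numeral of_nat_power)
 qed simp
 also have "\<dots> \<le> (2 ^ (n * ?s) * (\<Prod>i<n. fact (ws i))) * fact (ws n) * 2 ^ (?s + ws n)"
  using Suc by (intro mult_right_mono) auto
 also have "\<dots> = 2 ^ (n * ?s + (?s + ws n)) * (\<Prod>i<Suc n. fact (ws i))"
  by (simp add: power_add mult_ac)
 also have "\<dots> \<le> 2 ^ (Suc n * (?s + ws n)) * (\<Prod>i<Suc n. fact (ws i))"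
  by (intro mult_right_mono power_increasing) (auto intro!: prod_nonneg mult_nonneg_nonneg)
 finally show ?case by simp
qed simp

text \<open>The sum is dominated by a product of \<open>n\<close> geometric series, each with sum at
  most 2.\<close>

lemma multiindex_geometric:
 fixes z :: real
 assumes "0 \<le> z" "z \<le> 1/2" "finite S" "S \<subseteq> {ws. \<forall>i\<ge>n. ws i = 0}"
 shows "(\<Sum>ws\<in>S. z ^ (\<Sum>i<n. ws i)) \<le> 2 ^ n"
proof -
 \<comment> \<open>\<open>N\<close> exceeds every entry of every multi-index in \<open>S\<close>, so
   that \<open>S\<close> fits into a box. The restriction \<open>?r\<close> is needed because
   elements of \<open>PiE\<close> are undefined outside the index set, whereas multi-indices vanish
   there.\<close>
 define N where "N = Suc (\<Sum>ws\<in>S. \<Sum>i<n. ws i)"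
 let ?r = "\<lambda>ws::nat=>nat. restrict ws {..<n}"
 have inj: "inj_on ?r S"
 proof (rule inj_onI)
  fix ws \<beta> assume ab: "ws \<in> S" "\<beta> \<in> S" "?r ws = ?r \<beta>"
  show "ws = \<beta>"
  proof
   fix i
   show "ws i = \<beta> i"
    by (cases "i < n") (use subsetD[OF assms(4) ab(1)] subsetD[OF assms(4) ab(2)] fun_cong[OF ab(3), of i] in auto)
  qed
 qed
 have sub: "?r ` S \<subseteq> PiE {..<n} (\<lambda>_. {..<N})"
 proof (rule image_subsetI)
  fix ws assume ws: "ws \<in> S"
  have "ws i < N" if "i < n" for i
  proof -
  from ws that have "ws i \<le> (\<Sum>i<n. ws i)" "(\<Sum>i<n. ws i) \<le> (\<Sum>ws\<in>S. \<Sum>i<n. ws i)"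
   using assms(3) by (auto intro!: member_le_sum)
  then show ?thesis by (simp add: N_def)
  qed
  then show "?r ws \<in> PiE {..<n} (\<lambda>_. {..<N})" by (simp add: PiE_iff)
 qed
 have "(\<Sum>ws\<in>S. z ^ (\<Sum>i<n. ws i)) = (\<Sum>ws\<in>?r ` S. \<Prod>i<n. z ^ ws i)"
  by (subst sum.reindex[OF inj]) (simp add: power_sum)
 also have "\<dots> \<le> (\<Sum>ws\<in>PiE {..<n} (\<lambda>_. {..<N}). \<Prod>i<n. z ^ ws i)"
  by (rule sum_mono2[OF _ sub]) (use assms(1) in \<open>auto intro!: finite_PiE prod_nonneg zero_le_power\<close>)
 also have "\<dots> = (\<Prod>i<n. \<Sum>j<N. z ^ j)"
  by (rule prod_sum_PiE[symmetric]) auto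
 also have "\<dots> \<le> (\<Prod>i<n. 2)"
 proof (rule prod_mono)
  fix i
  have "(\<Sum>j<N. z ^ j) \<le> (\<Sum>j<N. (1/2) ^ j)" using assms by (intro sum_mono power_mono) auto
  also have "\<dots> \<le> 2" by (subst geometric_sum) auto
  finally show "0 \<le> (\<Sum>j<N. z ^ j) \<and> (\<Sum>j<N. z ^ j) \<le> 2" using assms by (auto intro: sum_nonneg)
 qed
 finally show ?thesis by simp
qed

lemma analytic_C_omega:
 assumes U: "eopen n U" and F: "\<And>i. i < m ==> analytic n U (\<lambda>x. F x i)"
 shows "C_omega n m U F"
proof -
 have "\<exists>C R. C \<ge> 0 \<and> R \<ge> 0 \<and> (\<forall>k. dbound n U k (\<lambda>l. C * R ^ l) (\<lambda>x. F x i))" if "i < m" for i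
  using F[OF that] unfolding analytic_def by blast
 then obtain C R where CR: "\<And>i. i < m ==> C i \<ge> 0 \<and> R i \<ge> 0 \<and> (\<forall>k. dbound n U k (\<lambda>l. C i * R i ^ l) (\<lambda>x. F x i))"
  by metis
 define R0 where "R0 = 1 + (\<Sum>i<m. R i)"
 define C0 where "C0 = (\<Sum>i<m. C i)"
 have R0: "R0 > 0" "R i \<le> R0" if "i < m" for i
  unfolding R0_def using CR that member_le_sum[of i "{..<m}" R] by (auto intro!: add_pos_nonneg sum_nonneg)
 have R0p: "R0 > 0" unfolding R0_def using CR by (auto intro!: add_pos_nonneg sum_nonneg)
 have C0: "C0 \<ge> 0" unfolding C0_def using CR by (auto intro!: sum_nonneg)
 \<comment> \<open>\<open>R0\<close> compensates the growth of the derivatives, \<open>2 ^ n\<close>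
   the factor from \<open>fact_sum_le\<close>, and the remaining 2 leaves a geometric series of
   ratio 1/2.\<close>
 define r where "r = 1 / (2 * 2 ^ n * R0)"
 have r: "r > 0" using R0p by (simp add: r_def)
 let ?t = "\<lambda>ws. ennreal (r ^ (\<Sum>i<n. ws i) / (\<Prod>i<n. fact (ws i))) *
   (SUP x\<in>U. ennreal (L2_set (\<lambda>i. mpartial ws n (\<lambda>y. F y i) x) {..<m}))"
 have t: "?t ws \<le> ennreal (C0 * (1/2) ^ (\<Sum>i<n. ws i))" for ws
 proof -
  let ?s = "\<Sum>i<n. ws i"
  let ?c = "r ^ ?s / (\<Prod>i<n. fact (ws i))"
  have c: "?c > 0" using r by (simp add: prod_pos)
  have "L2_set (\<lambda>i. mpartial ws n (\<lambda>y. F y i) x) {..<m} \<le> C0 * R0 ^ ?s * fact ?s" if x: "x \<in> U" for x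
  proof -
   have "L2_set (\<lambda>i. mpartial ws n (\<lambda>y. F y i) x) {..<m} \<le> (\<Sum>i<m. \<bar>mpartial ws n (\<lambda>y. F y i) x\<bar>)"
    by (rule L2_set_le_sum_abs)
   also have "\<dots> \<le> (\<Sum>i<m. C i * (R0 ^ ?s * fact ?s))"
   proof (rule sum_mono)
    fix i assume i: "i \<in> {..<m}"
    obtain w where w: "w \<in> lists {..<n}" "mpartial ws n (\<lambda>y. F y i) = pw w (\<lambda>y. F y i)" "length w = ?s"
     using mpartial_pw[of n ws "\<lambda>y. F y i"] by blast
    have "\<bar>pw w (\<lambda>y. F y i) x\<bar> \<le> fact ?s * (C i * R i ^ ?s)"
     using CR[of i] i w x unfolding dbound_def by (metis lessThan_iff order_refl)
    also have "\<dots> \<le> fact ?s * (C i * R0 ^ ?s)"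
     using CR[of i] i R0 by (intro mult_left_mono power_mono) auto
    finally show "\<bar>mpartial ws n (\<lambda>y. F y i) x\<bar> \<le> C i * (R0 ^ ?s * fact ?s)"
     using w(2) by (simp add: mult_ac)
   qed
   also have "\<dots> = C0 * R0 ^ ?s * fact ?s" by (simp add: C0_def sum_distrib_right mult.assoc)
   finally show ?thesis .
  qed
  then have "(SUP x\<in>U. ennreal (L2_set (\<lambda>i. mpartial ws n (\<lambda>y. F y i) x) {..<m})) \<le> ennreal (C0 * R0 ^ ?s * fact ?s)"
   by (intro SUP_least ennreal_leI)
  then have "?t ws \<le> ennreal ?c * ennreal (C0 * R0 ^ ?s * fact ?s)"
   by (rule mult_left_mono) simp
  also have "\<dots> = ennreal (?c * (C0 * R0 ^ ?s * fact ?s))"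
   using c C0 R0p by (intro ennreal_mult[symmetric]) auto
  also have "\<dots> \<le> ennreal (C0 * (1/2) ^ ?s)"
  proof (rule ennreal_leI)
   have "?c * (C0 * R0 ^ ?s * fact ?s) \<le> ?c * (C0 * R0 ^ ?s * (2 ^ (n * ?s) * (\<Prod>i<n. fact (ws i))))"
    using c C0 R0p fact_sum_le by (intro mult_left_mono) auto
   also have "\<dots> = C0 * (r ^ ?s * R0 ^ ?s * (2 ^ n) ^ ?s)"
    by (simp add: power_mult)
   also have "r ^ ?s * R0 ^ ?s * (2 ^ n) ^ ?s = (1/2) ^ ?s"
    using R0p by (simp add: r_def flip: power_mult_distrib)
   finally show "?c * (C0 * R0 ^ ?s * fact ?s) \<le> C0 * (1/2) ^ ?s" .
  qed
  finally show ?thesis .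
 qed
 have "(\<Sum>\<^sub>\<infinity>ws\<in>{ws. \<forall>i\<ge>n. ws i = 0}. ?t ws) \<le> ennreal (C0 * 2 ^ n)"
 proof (subst nonneg_infsum_complete, simp, rule SUP_least)
  fix S :: "(nat => nat) set" assume S: "S \<in> {S. finite S \<and> S \<subseteq> {ws. \<forall>i\<ge>n. ws i = 0}}"
  have "sum ?t S \<le> (\<Sum>ws\<in>S. ennreal (C0 * (1/2) ^ (\<Sum>i<n. ws i)))" by (rule sum_mono) (rule t)
  also have "\<dots> = ennreal (\<Sum>ws\<in>S. C0 * (1/2) ^ (\<Sum>i<n. ws i))" using C0 by (subst sum_ennreal) auto
  also have "(\<Sum>ws\<in>S. C0 * (1/2) ^ (\<Sum>i<n. ws i)) = C0 * (\<Sum>ws\<in>S. (1/2) ^ (\<Sum>i<n. ws i))"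
   by (simp add: sum_distrib_left)
  also have "ennreal \<dots> \<le> ennreal (C0 * 2 ^ n)"
   using S C0 multiindex_geometric[of "1/2" S n] by (intro ennreal_leI mult_left_mono) auto
  finally show "sum ?t S \<le> ennreal (C0 * 2 ^ n)" .
 qed
 then have "(\<Sum>\<^sub>\<infinity>ws\<in>{ws. \<forall>i\<ge>n. ws i = 0}. ?t ws) < \<infinity>"
  by (rule le_less_trans) simp
 moreover have "\<forall>i<m. \<forall>k. Ck_on n k U (\<lambda>x. F x i)"
  using F analytic_smooth smooth_Ck by blast
 ultimately show ?thesis unfolding C_omega_def C_omega_r_def using r by blast
qed

subsection \<open>Iterated derivatives along analytic fields\<close>

definition fderiv :: "nat => (nat => pt => real) => (pt => real) => pt => real" where
 "fderiv n a f x = (\<Sum>i<n. a i x * partial i f x)"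

lemma smooth_fderiv:
 "eopen n U ==> (\<And>i. i < n ==> smooth n U (a i)) ==> smooth n U f ==> smooth n U (fderiv n a f)"
 unfolding fderiv_def smooth_def
 by (intro allI Ck_on_sum Ck_on_mult) (use Ck_on_Suc_partial(1) in blast)+

text \<open>\<open>l\<close> counts the fields applied so far. The sequence
  \<open>B ^ m * (fact (l + m) / fact m)\<close> consists of the Taylor coefficients of
  \<open>fact l / (1 - B t) ^ (l + 1)\<close>: applying a field is majorized by a differentiation,
  which raises the exponent by one. Keeping all orders \<open>m\<close> is what lets the estimate be
  iterated.\<close>

lemma dbound_fderiv:
 assumes U: "eopen n U" and a: "\<And>i. i < n ==> smooth n U (a i)"
  and ab: "\<And>i k. i < n ==> dbound n U k (\<lambda>m. K * R ^ m) (a i)"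
  and f: "smooth n U f" and fb: "\<And>k. dbound n U k (\<lambda>m. C * B ^ m * (fact (l + m) / fact m)) f"
  and nn: "K \<ge> 0" "R \<ge> 0" "C \<ge> 0" "R \<le> B / 2"
 shows "dbound n U k (\<lambda>m. (C * (2 * real n * K * B)) * B ^ m * (fact (Suc l + m) / fact m)) (fderiv n a f)"
proof -
 have B: "B \<ge> 0" using nn by simp
 define D where "D = (\<lambda>m. 2 * K * C * B * B ^ m * (fact (Suc l + m) / fact m))"
 have 1: "dbound n U k D (\<lambda>x. a i x * partial i f x)" if i: "i < n" for i
 proof (rule dbound_mono[OF dbound_mult[OF U a[OF i] smooth_partial[OF f i] ab[OF i] dbound_SucD[OF fb i]]])
  fix m
  have "(\<Sum>j\<le>m. K * R ^ j * ((real (m - j) + 1) * (C * B ^ Suc (m - j) * (fact (l + Suc (m - j)) / fact (Suc (m - j))))))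
   \<le> (\<Sum>j\<le>m. K * C * B * (fact (Suc l + m) / fact m) * (R ^ j * B ^ (m - j)))"
  proof (rule sum_mono)
   fix j assume j: "j \<in> {..m}"
   \<comment> \<open>The quotient grows with \<open>p\<close>, so in the convolution it may be
     replaced by its value at \<open>m\<close>; a convolution of two geometric sequences
     remains.\<close>
   have mono: "(fact (Suc l + p) / fact p :: real) \<le> fact (Suc l + (p + d)) / fact (p + d)" for p d
   proof (induction d)
    case (Suc d)
    have "(fact (Suc l + (p + d)) / fact (p + d) :: real) * 1
     \<le> fact (Suc l + (p + d)) / fact (p + d) * (real (Suc l + Suc (p + d)) / real (Suc (p + d)))"
     by (rule mult_left_mono) auto
    also have "\<dots> = fact (Suc l + (p + Suc d)) / fact (p + Suc d)" by (simp add: field_simps)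
    finally show ?case using Suc by simp
   qed simp
   have eq: "(real p + 1) * (fact (l + Suc p) / fact (Suc p)) = (fact (Suc l + p) / fact p :: real)" for p
   proof -
    have "l + Suc p = Suc l + p" "(fact (Suc p) :: real) = (real p + 1) * fact p" by simp_all
    then show ?thesis by (simp only:) (simp del: fact_Suc add: divide_simps)
   qed
   have "(real (m - j) + 1) * (fact (l + Suc (m - j)) / fact (Suc (m - j))) = (fact (Suc l + (m - j)) / fact (m - j) :: real)"
    by (rule eq)
   also have "\<dots> \<le> fact (Suc l + m) / fact m" using mono[of "m - j" j] j by (simp only: le_add_diff_inverse2 atMost_iff)
   finally have "K * R ^ j * C * B ^ Suc (m - j) * ((real (m - j) + 1) * (fact (l + Suc (m - j)) / fact (Suc (m - j))))
    \<le> K * R ^ j * C * B ^ Suc (m - j) * (fact (Suc l + m) / fact m)"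
    using nn B by (intro mult_left_mono) auto
   then show "K * R ^ j * ((real (m - j) + 1) * (C * B ^ Suc (m - j) * (fact (l + Suc (m - j)) / fact (Suc (m - j)))))
    \<le> K * C * B * (fact (Suc l + m) / fact m) * (R ^ j * B ^ (m - j))"
    by (simp only: power_Suc mult_ac)
  qed
  also have "\<dots> = K * C * B * (fact (Suc l + m) / fact m) * (\<Sum>j\<le>m. R ^ j * B ^ (m - j))"
   by (rule sum_distrib_left[symmetric])
  also have "\<dots> \<le> K * C * B * (fact (Suc l + m) / fact m) * (2 * B ^ m)"
   using conv_geometric_le[of R B m] nn B by (intro mult_left_mono) auto
  also have "\<dots> = D m" by (simp add: D_def mult_ac)
  finally show "(\<Sum>j\<le>m. K * R ^ j * ((real (m - j) + 1) * (C * B ^ Suc (m - j) * (fact (l + Suc (m - j)) / fact (Suc (m - j)))))) \<le> D m" .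
 qed
 have s1: "smooth n U (\<lambda>x. a i x * partial i f x)" if "i < n" for i
  using smooth_mult[OF U a[OF that] smooth_partial[OF f that]] .
 have "p \<le> n ==> smooth n U (\<lambda>x. \<Sum>i<p. a i x * partial i f x) \<and>
   dbound n U k (\<lambda>m. real p * D m) (\<lambda>x. \<Sum>i<p. a i x * partial i f x)" for p
 proof (induction p)
  case 0
  show ?case using smooth_const[OF U, of 0] by (auto simp: dbound_def pw_const)
 next
  case (Suc p)
  then have IH: "smooth n U (\<lambda>x. \<Sum>i<p. a i x * partial i f x)"
   "dbound n U k (\<lambda>m. real p * D m) (\<lambda>x. \<Sum>i<p. a i x * partial i f x)" and p: "p < n" by auto
  have "(\<lambda>m. real (Suc p) * D m) = (\<lambda>m. real p * D m + D m)" by (simp add: algebra_simps)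
  then show ?case
   using smooth_add[OF U IH(1) s1[OF p]] dbound_add[OF U IH(1) s1[OF p] IH(2) 1[OF p]]
   by (simp only: sum.lessThan_Suc)
 qed
 from this[of n] have "dbound n U k (\<lambda>m. real n * D m) (fderiv n a f)"
  by (simp add: fderiv_def[abs_def])
 moreover have "real n * D m = (C * (2 * real n * K * B)) * B ^ m * (fact (Suc l + m) / fact m)" for m
  by (simp add: D_def mult_ac)
 ultimately show ?thesis by simp
qed

primrec fderivs ::
  "nat => (nat => nat => pt => real) => nat list => (pt => real) => pt => real" where
 "fderivs n a [] f = f"
| "fderivs n a (j # ws) f = fderiv n (a j) (fderivs n a ws f)"

lemma smooth_fderivs:
 "eopen n U ==> (\<And>j i. j < q ==> i < n ==> smooth n U (a j i)) ==> smooth n U f ==> ws \<in> lists {..<q} ==>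
  smooth n U (fderivs n a ws f)"
 by (induction ws) (auto intro: smooth_fderiv)

text \<open>The bound of \<open>dbound_fderiv\<close> is iterated along the word and then read at
  order \<open>m = 0\<close>, where the quotient of factorials is the factorial of the
  length.\<close>

lemma fderivs_bound:
 assumes U: "eopen n U" and a: "\<And>j i. j < q ==> i < n ==> analytic n U (a j i)" and f: "analytic n U f"
 shows "\<exists>C\<ge>0. \<exists>A\<ge>0. \<forall>ws\<in>lists {..<q}. \<forall>x\<in>U. \<bar>fderivs n a ws f x\<bar> \<le> C * A ^ length ws * fact (length ws)"
proof -
 have "\<forall>j i. \<exists>K R. j < q \<longrightarrow> i < n \<longrightarrow> K \<ge> 0 \<and> R \<ge> 0 \<and> (\<forall>k. dbound n U k (\<lambda>m. K * R ^ m) (a j i))"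
  using a unfolding analytic_def by blast
 then obtain K R where KR: "\<And>j i. j < q ==> i < n ==> K j i \<ge> 0 \<and> R j i \<ge> 0 \<and> (\<forall>k. dbound n U k (\<lambda>m. K j i * R j i ^ m) (a j i))"
  by metis
 obtain C Q where CQ: "C \<ge> 0" "Q \<ge> 0" "\<And>k. dbound n U k (\<lambda>m. C * Q ^ m) f"
  using f unfolding analytic_def by blast
 define K0 where "K0 = (\<Sum>j<q. \<Sum>i<n. K j i)"
 define R0 where "R0 = (\<Sum>j<q. \<Sum>i<n. R j i)"
 have le: "h j i \<le> (\<Sum>j<q. \<Sum>i<n. h j i)" if "j < q" "i < n" "\<And>j i. j < q ==> i < n ==> (0::real) \<le> h j i" for h j i
 proof -
  have "h j i \<le> (\<Sum>i<n. h j i)" using that by (intro member_le_sum) auto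
  also have "\<dots> \<le> (\<Sum>j<q. \<Sum>i<n. h j i)" using that by (intro member_le_sum) (auto intro: sum_nonneg)
  finally show ?thesis .
 qed
 have K0: "K0 \<ge> 0" "\<And>j i. j < q ==> i < n ==> K j i \<le> K0"
  unfolding K0_def using KR le[of _ _ K] by (auto intro!: sum_nonneg)
 have R0: "R0 \<ge> 0" "\<And>j i. j < q ==> i < n ==> R j i \<le> R0"
  unfolding R0_def using KR le[of _ _ R] by (auto intro!: sum_nonneg)
 have ab: "dbound n U k (\<lambda>m. K0 * R0 ^ m) (a j i)" if "j < q" "i < n" for j i k
  by (rule dbound_mono[of n U k "\<lambda>m. K j i * R j i ^ m"])
   (use KR[OF that] K0 R0 that in \<open>auto intro!: mult_mono power_mono\<close>)
 \<comment> \<open>\<open>B\<close> must majorize the ratio of the function, and that of the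
   coefficients with a gap of a factor 2.\<close>
 define B where "B = 2 * R0 + Q"
 have B: "B \<ge> 0" "R0 \<le> B / 2" "Q \<le> B" using R0 CQ by (auto simp: B_def)
 define A where "A = 2 * real n * K0 * B"
 have A: "A \<ge> 0" using K0 B by (simp add: A_def)
 have sa: "smooth n U (a j i)" if "j < q" "i < n" for j i using a[OF that] by (rule analytic_smooth)
 have main: "\<forall>k. dbound n U k (\<lambda>m. (C * A ^ length ws) * B ^ m * (fact (length ws + m) / fact m)) (fderivs n a ws f)"
  if "ws \<in> lists {..<q}" for ws
  using that
 proof (induction ws rule: list.induct)
  case Nil
  have "dbound n U k (\<lambda>m. C * B ^ m) f" for k
   by (rule dbound_mono[OF CQ(3)]) (use CQ B in \<open>auto intro!: mult_left_mono power_mono\<close>)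
  then show ?case by simp
 next
  case (Cons j ws)
  then have j: "j < q" "ws \<in> lists {..<q}" by auto
  have "dbound n U k (\<lambda>m. ((C * A ^ length ws) * (2 * real n * K0 * B)) * B ^ m * (fact (Suc (length ws) + m) / fact m)) (fderiv n (a j) (fderivs n a ws f))" for k
   by (rule dbound_fderiv[OF U sa[OF j(1)] ab[OF j(1)] smooth_fderivs[OF U sa analytic_smooth[OF f] j(2)]])
    (use Cons.IH[OF j(2)] K0 R0 CQ A B in auto)
  then show ?case by (simp add: A_def mult_ac)
 qed
 have "\<bar>fderivs n a ws f x\<bar> \<le> C * A ^ length ws * fact (length ws)" if "ws \<in> lists {..<q}" "x \<in> U" for ws x
  using main[OF that(1), rule_format, of 0] that(2) by (simp add: dbound_0)
 then show ?thesis using CQ A by blast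
qed

section \<open>Matrices of functions\<close>

definition mdet :: "nat => (nat => nat => 'x => real) => 'x => real" where
 "mdet n a x = Determinant.det (Matrix.mat n n (\<lambda>(i, j). a i j x))"

text \<open>The adjugate formula, hence the swapped indices of the cofactor. Division occurs only
  through the reciprocal of the determinant, so a class of functions closed under sums and products
  contains the inverse matrix once it contains the entries and that reciprocal.\<close>

definition minv :: "nat => (nat => nat => 'x => real) => nat => nat => 'x => real" where
 "minv n a i j x = cofactor (Matrix.mat n n (\<lambda>(i, j). a i j x)) j i * inverse (mdet n a x)"

lemma minv_inverse:
 assumes "mdet n a x \<noteq> 0" "i < n" "k < n"
 shows "(\<Sum>j<n. minv n a i j x * a j k x) = (if i = k then 1 else 0)"
  and "(\<Sum>j<n. a i j x * minv n a j k x) = (if i = k then 1 else 0)"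
proof -
 define A where "A = Matrix.mat n n (\<lambda>(i, j). a i j x)"
 have A: "A \<in> carrier_mat n n" by (simp add: A_def)
 have d: "mdet n a x = Determinant.det A" by (simp add: mdet_def A_def)
 have "(\<Sum>j<n. cofactor A j i * a j k x) = (adj_mat A * A) $$ (i, k)"
  using assms(2,3) by (auto simp: adj_mat_def A_def scalar_prod_def lessThan_atLeast0 intro!: sum.cong)
 also have "\<dots> = mdet n a x * (if i = k then 1 else 0)"
  unfolding adj_mat(3)[OF A] using assms(2,3) d by simp
 finally have e: "(\<Sum>j<n. cofactor A j i * a j k x) = mdet n a x * (if i = k then 1 else 0)" .
 have "(\<Sum>j<n. minv n a i j x * a j k x) = inverse (mdet n a x) * (\<Sum>j<n. cofactor A j i * a j k x)"
  by (simp add: minv_def A_def sum_distrib_left mult_ac)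
 then show "(\<Sum>j<n. minv n a i j x * a j k x) = (if i = k then 1 else 0)"
  using e assms(1) by simp
 have "(\<Sum>j<n. a i j x * cofactor A k j) = (A * adj_mat A) $$ (i, k)"
  using assms(2,3) by (auto simp: adj_mat_def A_def scalar_prod_def lessThan_atLeast0 intro!: sum.cong)
 also have "\<dots> = mdet n a x * (if i = k then 1 else 0)"
  unfolding adj_mat(2)[OF A] using assms(2,3) d by simp
 finally have e: "(\<Sum>j<n. a i j x * cofactor A k j) = mdet n a x * (if i = k then 1 else 0)" .
 have "(\<Sum>j<n. a i j x * minv n a j k x) = inverse (mdet n a x) * (\<Sum>j<n. a i j x * cofactor A k j)"
  by (simp add: minv_def A_def sum_distrib_left mult_ac)
 then show "(\<Sum>j<n. a i j x * minv n a j k x) = (if i = k then 1 else 0)"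
  using e assms(1) by simp
qed

lemma mdet_one: "(\<And>i j. i < n ==> j < n ==> a i j x = (if i = j then 1 else 0)) ==> mdet n a x = 1"
proof -
 assume "\<And>i j. i < n ==> j < n ==> a i j x = (if i = j then 1 else 0)"
 then have "Matrix.mat n n (\<lambda>(i, j). a i j x) = 1\<^sub>m n"
  by (intro eq_matI) auto
 then show ?thesis by (simp add: mdet_def)
qed

lemma mdet_nonzeroI:
 assumes "\<And>v. (\<And>i. i < n ==> (\<Sum>j<n. a i j x * v j) = 0) ==> \<forall>j<n. v j = 0"
 shows "mdet n a x \<noteq> 0"
proof
 let ?A = "Matrix.mat n n (\<lambda>(i, j). a i j x)"
 assume "mdet n a x = 0"
 then obtain v where v: "v \<in> carrier_vec n" "v \<noteq> 0\<^sub>v n" "?A *\<^sub>v v = 0\<^sub>v n"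
  using det_0_iff_vec_prod_zero_field[of ?A n] by (auto simp: mdet_def)
 have "(\<Sum>j<n. a i j x * v $ j) = 0" if "i < n" for i
 proof -
  have "(?A *\<^sub>v v) $ i = (\<Sum>j<n. a i j x * v $ j)"
   using that v(1) by (simp add: scalar_prod_def lessThan_atLeast0)
  then show ?thesis using v(3) that by simp
 qed
 then have "\<forall>j<n. v $ j = 0" by (rule assms)
 then have "v = 0\<^sub>v n" using v(1) by (intro eq_vecI) auto
 then show False using v(2) by simp
qed

text \<open>Applied both to functions of class C^k and to analytic functions.\<close>

locale function_algebra =
 fixes P :: "('x => real) => bool"
 assumes const: "P (\<lambda>x. c)"
  and add: "P f ==> P g ==> P (\<lambda>x. f x + g x)"
  and mult: "P f ==> P g ==> P (\<lambda>x. f x * g x)"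
begin

lemma sum: "(\<And>j. j \<in> J ==> P (f j)) ==> P (\<lambda>x. \<Sum>j\<in>J. f j x)"
 by (induction J rule: infinite_finite_induct) (auto intro: const add)

lemma prod: "(\<And>j. j \<in> J ==> P (f j)) ==> P (\<lambda>x. \<Prod>j\<in>J. f j x)"
 by (induction J rule: infinite_finite_induct) (auto intro: const mult)

lemma det:
 assumes "\<And>i j. i < n ==> j < n ==> P (a i j)"
 shows "P (\<lambda>x. Determinant.det (Matrix.mat n n (\<lambda>(i, j). a i j x)))"
proof -
 have e: "Determinant.det (Matrix.mat n n (\<lambda>(i, j). a i j x)) =
   (\<Sum>p\<in>{p. p permutes {0..<n}}. signof p * (\<Prod>i\<in>{0..<n}. a i (p i) x))" for x
  unfolding Determinant.det_def
  by (auto intro!: sum.cong prod.cong simp: permutes_in_image)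
 show ?thesis unfolding e
  by (intro sum mult const prod assms) (auto simp: permutes_in_image)
qed

lemma minv:
 assumes "\<And>i j. i < n ==> j < n ==> P (a i j)" "P (\<lambda>x. inverse (mdet n a x))" "i < n" "j < n"
 shows "P (minv n a i j)"
proof -
 \<comment> \<open>Deleting row or column \<open>i\<close> skips that index, so a minor is again a
   matrix of the given functions.\<close>
 let ?s = "\<lambda>i k. if k < i then k else Suc k"
 have "mat_delete (Matrix.mat n n (\<lambda>(i, j). a i j x)) j i
   = Matrix.mat (n - 1) (n - 1) (\<lambda>(k, l). a (?s j k) (?s i l) x)" for x
  unfolding mat_delete_def by (intro eq_matI) auto
 then have e: "minv n a i j = (\<lambda>x. ((-1) ^ (j + i) *
   Determinant.det (Matrix.mat (n - 1) (n - 1) (\<lambda>(k, l). a (?s j k) (?s i l) x))) * inverse (mdet n a x))"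
  by (simp add: minv_def cofactor_def fun_eq_iff)
 show ?thesis unfolding e
  by (intro mult const det assms) auto
qed

end

lemma function_algebra_Ck: "eopen n U ==> function_algebra (Ck_on n k U)"
 by unfold_locales (auto intro: Ck_on_add Ck_on_mult)

lemma function_algebra_analytic: "eopen n U ==> function_algebra (analytic n U)"
 by unfold_locales (auto intro: analytic_add analytic_mult analytic_const)

section \<open>Ordinary differential equations in Banach spaces\<close>

lemma vector_derivative_bound:
 fixes f :: "real => 'a::real_normed_vector"
 assumes "convex S" "\<And>r. r \<in> S ==> (f has_vector_derivative f' r) (at r within S)"
  and "\<And>r. r \<in> S ==> norm (f' r) \<le> B" "x \<in> S" "y \<in> S"
 shows "norm (f x - f y) \<le> B * \<bar>x - y\<bar>"
proof -
 have "norm (f x - f y) \<le> B * norm (x - y)"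
 proof (rule differentiable_bound[OF assms(1) _ _ assms(4,5)])
  show "(f has_derivative (\<lambda>h. h *\<^sub>R f' r)) (at r within S)" if "r \<in> S" for r
   using assms(2)[OF that] by (simp add: has_vector_derivative_def)
  show "onorm (\<lambda>h. h *\<^sub>R f' r) \<le> B" if "r \<in> S" for r
   using assms(3)[OF that] by (intro onorm_le) (auto simp: mult.commute[of B] intro: mult_left_mono)
 qed
 then show ?thesis by simp
qed

text \<open>A Gronwall estimate without exponentials: it suffices because all times occurring below are small
  compared to the Lipschitz constants.\<close>

lemma gronwall_half:
 fixes u :: "real => 'a::real_normed_vector"
 assumes "0 \<le> T" "0 \<le> K" "T * K \<le> 1/2" "0 \<le> \<eta>" "u 0 = 0"
  and d: "\<And>r. r \<in> {0..T} ==> (u has_vector_derivative u' r) (at r within {0..T})"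
  and b: "\<And>r. r \<in> {0..T} ==> norm (u' r) \<le> K * norm (u r) + \<eta>"
  and r: "r \<in> {0..T}"
 shows "norm (u r) \<le> 2 * T * \<eta>"
proof -
 have "continuous_on {0..T} u"
  using d has_vector_derivative_continuous continuous_on_eq_continuous_within by blast
 then have "continuous_on {0..T} (\<lambda>r. norm (u r))" by (rule continuous_on_norm)
 \<comment> \<open>At a maximum \<open>m\<close> of the norm, the mean value inequality bounds the
   maximum by half of itself plus \<open>T * \<eta>\<close>.\<close>
 then obtain m where m: "m \<in> {0..T}" "\<And>r. r \<in> {0..T} ==> norm (u r) \<le> norm (u m)"
  using continuous_attains_sup[of "{0..T}" "\<lambda>r. norm (u r)"] assms(1) by auto
 have "norm (u m - u 0) \<le> (K * norm (u m) + \<eta>) * \<bar>m - 0\<bar>"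
 proof (rule vector_derivative_bound[OF _ d _ m(1)])
  fix r assume "r \<in> {0..T}"
  then show "norm (u' r) \<le> K * norm (u m) + \<eta>"
   using b[of r] m(2)[of r] assms(2) mult_left_mono by fastforce
 qed (use assms(1) in auto)
 also have "\<dots> \<le> (K * norm (u m) + \<eta>) * T"
  using m(1) assms by (intro mult_left_mono) auto
 finally have "norm (u m) \<le> (T * K) * norm (u m) + T * \<eta>"
  using assms(5) by (simp add: algebra_simps)
 also have "\<dots> \<le> 1/2 * norm (u m) + T * \<eta>"
  using assms(3) by (intro add_right_mono mult_right_mono) auto
 finally have "norm (u m) \<le> 2 * T * \<eta>" by simp
 then show ?thesis using m(2)[OF r] by linarith
qed

text \<open>The Picard operator contracts with factor 1/2 because \<open>T * K \<le> 1/2\<close>,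
  and it keeps curves in the ball because \<open>T * B \<le> R\<close>.\<close>

lemma ode_exists:
 fixes F :: "'a::banach => 'a"
 assumes T: "0 \<le> T" and K: "0 \<le> K" and R: "0 \<le> R"
  and lip: "\<And>x y. x \<in> cball y0 R ==> y \<in> cball y0 R ==> norm (F x - F y) \<le> K * norm (x - y)"
  and bnd: "\<And>x. x \<in> cball y0 R ==> norm (F x) \<le> B"
  and TB: "T * B \<le> R" and TK: "T * K \<le> 1/2"
 shows "\<exists>u. u 0 = y0 \<and> (\<forall>s\<in>{-T..T}. u s \<in> cball y0 R \<and>
  (u has_vector_derivative F (u s)) (at s within {-T..T}))"
proof -
 have B: "B \<ge> 0" using bnd[of y0] R norm_ge_zero order_trans by (metis centre_in_cball)
 define S where "S = PiC (UNIV :: real set) (\<lambda>_. cball y0 R)"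
 have Smem: "u \<in> S \<longleftrightarrow> (\<forall>s. apply_bcontfun u s \<in> cball y0 R)" for u
  by (auto simp: S_def mem_PiC_iff Pi_def)
 have "complete S" unfolding complete_eq_closed S_def by (rule closed_PiC) simp
 have y0S: "const_bcontfun y0 \<in> S" unfolding Smem using R by (simp add: const_bcontfun.rep_eq)
 \<comment> \<open>Times are clamped to the interval, so that curves on it become bounded continuous
   functions on the whole line, which form a complete space.\<close>
 define c where "c s = max (-T) (min T s)" for s :: real
 have c: "c s \<in> {-T..T}" for s using T by (auto simp: c_def)
 have c_id: "c s = s" if "s \<in> {-T..T}" for s using that by (auto simp: c_def)
 have c_cont: "continuous_on UNIV c" unfolding c_def by (intro continuous_intros)
 \<comment> \<open>The integral starts at \<open>- T\<close>; the operator uses the difference to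
   \<open>G u 0\<close>, which covers times of both signs without cases.\<close>
 define G where "G u s = integral {-T..s} (\<lambda>r. F (apply_bcontfun u r))" for u :: "real \<Rightarrow>\<^sub>C 'a" and s
 have Fcont: "continuous_on (cball y0 R) F"
 proof (cases "K = 0")
  case True
  have "F x = F y0" if "x \<in> cball y0 R" for x using lip[OF that, of y0] True R by simp
  then show ?thesis by (metis continuous_on_const continuous_on_eq)
 next
  case False
  show ?thesis unfolding continuous_on_iff
  proof (intro ballI allI impI)
   fix x e assume x: "x \<in> cball y0 R" and e: "(0::real) < e"
   have "dist (F y) (F x) < e" if "y \<in> cball y0 R" "dist y x < e / K" for y
   proof -
    have "dist (F y) (F x) \<le> K * dist y x" using lip[OF that(1) x] by (simp add: dist_norm)
    also have "\<dots> < e" using that(2) False K by (simp add: field_simps)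
    finally show ?thesis .
   qed
   then show "\<exists>d>0. \<forall>x'\<in>cball y0 R. dist x' x < d \<longrightarrow> dist (F x') (F x) < e"
    using e False K by (intro exI[of _ "e / K"]) auto
  qed
 qed
 have Fu: "continuous_on {-T..T} (\<lambda>r. F (apply_bcontfun u r))" if "u \<in> S" for u
  by (rule continuous_on_compose2[OF Fcont continuous_on_apply_bcontfun]) (use that Smem in auto)
 have Gd: "(G u has_vector_derivative F (apply_bcontfun u s)) (at s within {-T..T})" if "u \<in> S" "s \<in> {-T..T}" for u s
  unfolding G_def by (rule integral_has_vector_derivative[OF Fu[OF that(1)] that(2)])
 define \<Gamma> where "\<Gamma> u = Bcontfun (\<lambda>s. y0 + (G u (c s) - G u 0))" for u
 have in_ball: "y0 + (G u (c s) - G u 0) \<in> cball y0 R" if "u \<in> S" for u s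
 proof -
  have "norm (G u (c s) - G u 0) \<le> B * \<bar>c s - 0\<bar>"
   by (rule vector_derivative_bound[of "{-T..T}"]) (use Gd[OF that] that Smem bnd c T in auto)
  also have "\<dots> \<le> B * T" using c[of s] B by (intro mult_left_mono) (auto simp: abs_le_iff)
  finally show ?thesis using TB by (simp add: dist_norm norm_minus_commute mult.commute)
 qed
 have \<Gamma>_app: "apply_bcontfun (\<Gamma> u) s = y0 + (G u (c s) - G u 0)" if "u \<in> S" for u s
 proof -
  have "continuous_on {-T..T} (G u)"
   using Gd[OF that] has_vector_derivative_continuous continuous_on_eq_continuous_within by blast
  then have "continuous_on UNIV (\<lambda>s. G u (c s))"
   by (rule continuous_on_compose2[OF _ c_cont]) (use c in auto)
  then have "continuous_on UNIV (\<lambda>s. y0 + (G u (c s) - G u 0))" by (intro continuous_intros)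
  moreover have "bounded (range (\<lambda>s. y0 + (G u (c s) - G u 0)))"
   by (rule bounded_subset[OF bounded_cball]) (use in_ball[OF that] in blast)
  ultimately show ?thesis unfolding \<Gamma>_def by (subst Bcontfun_inverse) (auto simp: bcontfun_def)
 qed
 have "\<exists>!u\<in>S. \<Gamma> u = u"
 proof (rule Banach_fix[OF \<open>complete S\<close>, of "1/2"])
  show "\<Gamma> ` S \<subseteq> S" using in_ball \<Gamma>_app Smem by auto
  fix u v assume uv: "u \<in> S" "v \<in> S"
  show "dist (\<Gamma> u) (\<Gamma> v) \<le> 1/2 * dist u v"
  proof (rule dist_bound)
   fix s
   let ?D = "\<lambda>s. G u s - G v s"
   have "norm (?D (c s) - ?D 0) \<le> (K * dist u v) * \<bar>c s - 0\<bar>"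
   proof (rule vector_derivative_bound[of "{-T..T}"])
    fix r assume r: "r \<in> {-T..T}"
    show "(?D has_vector_derivative F (apply_bcontfun u r) - F (apply_bcontfun v r)) (at r within {-T..T})"
     by (intro has_vector_derivative_diff Gd uv r)
    have "norm (F (apply_bcontfun u r) - F (apply_bcontfun v r)) \<le> K * dist (apply_bcontfun u r) (apply_bcontfun v r)"
     unfolding dist_norm using uv Smem by (intro lip) auto
    also have "\<dots> \<le> K * dist u v" using K by (intro mult_left_mono dist_bounded)
    finally show "norm (F (apply_bcontfun u r) - F (apply_bcontfun v r)) \<le> K * dist u v" .
   qed (use c T in auto)
   also have "\<dots> \<le> (K * dist u v) * T" using c[of s] K by (intro mult_left_mono) (auto simp: abs_le_iff)
   also have "\<dots> = (T * K) * dist u v" by simp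
   also have "\<dots> \<le> 1/2 * dist u v" using TK by (intro mult_right_mono) auto
   finally show "dist (apply_bcontfun (\<Gamma> u) s) (apply_bcontfun (\<Gamma> v) s) \<le> 1/2 * dist u v"
    unfolding dist_norm \<Gamma>_app[OF uv(1)] \<Gamma>_app[OF uv(2)] by (simp add: algebra_simps)
  qed
 qed (use y0S in auto)
 then obtain u where u: "u \<in> S" "\<Gamma> u = u" by blast
 have ue: "apply_bcontfun u s = y0 + (G u (c s) - G u 0)" for s using \<Gamma>_app[OF u(1)] u(2) by simp
 have "(apply_bcontfun u has_vector_derivative F (apply_bcontfun u s)) (at s within {-T..T})" if s: "s \<in> {-T..T}" for s
 proof (rule has_vector_derivative_transform[OF s])
  show "apply_bcontfun u r = y0 + (G u r - G u 0)" if "r \<in> {-T..T}" for r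
   using ue[of r] c_id[OF that] by simp
  show "((\<lambda>r. y0 + (G u r - G u 0)) has_vector_derivative F (apply_bcontfun u s)) (at s within {-T..T})"
   using has_vector_derivative_add[OF has_vector_derivative_const has_vector_derivative_diff[OF Gd[OF u(1) s] has_vector_derivative_const]]
   by simp
 qed
 moreover have "apply_bcontfun u 0 = y0" using ue[of 0] c_id[of 0] T by simp
 ultimately show ?thesis using u(1) Smem by blast
qed

section \<open>Functions differentiable along a frame\<close>

text \<open>The vectors fixed by \<open>P\<close> stand for the finite-dimensional space inside the
  Banach space, and only these are combinations of the first \<open>n\<close> fields.
  \<open>C\<close> bounds the coefficients of such combinations, and \<open>unif\<close> is the
  uniform continuity of the derivatives that a compact neighbourhood provides.\<close>

locale frame_fields =
 fixes X :: "nat => 'a::banach => 'a" and DX :: "nat => 'a => 'a => 'a"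
  and P :: "'a => 'a" and p n :: nat and x0 :: 'a and R B K C :: real
 assumes np: "n \<le> p" and R: "0 < R" and B: "0 \<le> B" and K: "0 \<le> K" and C: "0 \<le> C"
  and deriv: "j < p ==> x \<in> ball x0 R ==> (X j has_derivative DX j x) (at x)"
  and bnd: "j < p ==> x \<in> ball x0 R ==> norm (X j x) \<le> B"
  and dbnd: "j < p ==> x \<in> ball x0 R ==> norm (DX j x v) \<le> K * norm v"
  and unif: "e > 0 ==> \<exists>d>0. \<forall>j<p. \<forall>x\<in>ball x0 R. \<forall>y\<in>ball x0 R. dist x y < d \<longrightarrow>
   (\<forall>v. norm (DX j x v - DX j y v) \<le> e * norm v)"
  and P: "bounded_linear P" "\<And>j x. j < p ==> x \<in> ball x0 R ==> P (X j x) = X j x"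
  and frame: "x \<in> ball x0 R ==> P v = v ==> \<exists>s. v = (\<Sum>i<n. s i *\<^sub>R X i x) \<and> (\<Sum>i<n. \<bar>s i\<bar>) \<le> C * norm v"
begin

lemma lip: "j < p ==> x \<in> ball x0 R ==> y \<in> ball x0 R ==> norm (X j x - X j y) \<le> K * norm (x - y)"
proof (rule differentiable_bound[OF convex_ball, of x0 R "X j" "DX j"])
 fix z assume "j < p" "z \<in> ball x0 R"
 then show "(X j has_derivative DX j z) (at z within ball x0 R)"
  by (rule has_derivative_at_withinI[OF deriv])
next
 fix z assume jz: "j < p" "z \<in> ball x0 R"
 show "onorm (DX j z) \<le> K"
  by (rule onorm_bound[OF K]) (rule dbnd[OF jz])
qed auto

lemma cball_sub: "y \<in> cball x (R / 4) ==> x \<in> ball x0 (3 * R / 4) ==> y \<in> ball x0 R"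
 using dist_triangle[of x0 y x] by (simp add: dist_commute)

text \<open>A time during which a flow line started in the ball of radius \<open>3 * R / 4\<close>
  stays in that of radius \<open>R\<close> and Picard iteration contracts.\<close>

definition T0 :: real where "T0 = (if B = 0 \<and> K = 0 then 1 else min (R / (4 * (B + 1))) (1 / (2 * (K + 1))))"

lemma T0: "T0 > 0" "T0 * B \<le> R / 4" "T0 * K \<le> 1 / 2"
proof -
 have 1: "R / (4 * (B + 1)) > 0" "1 / (2 * (K + 1)) > 0" using R B K by auto
 then show "T0 > 0" by (simp add: T0_def)
 show "T0 * B \<le> R / 4"
 proof (cases "B = 0 \<and> K = 0")
  case False
  then have "T0 * B \<le> R / (4 * (B + 1)) * B" using B unfolding T0_def by (intro mult_right_mono) auto
  also have "\<dots> \<le> R / 4" using R B by (simp add: field_simps)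
  finally show ?thesis .
 qed (use R in auto)
 show "T0 * K \<le> 1 / 2"
 proof (cases "B = 0 \<and> K = 0")
  case False
  then have "T0 * K \<le> 1 / (2 * (K + 1)) * K" using K unfolding T0_def by (intro mult_right_mono) auto
  also have "\<dots> \<le> 1 / 2" using K by (simp add: field_simps)
  finally show ?thesis .
 qed auto
qed

lemma short_flow:
 assumes j: "j < p" and y: "y \<in> ball x0 (3 * R / 4)"
 shows "\<exists>u. u 0 = y \<and> (\<forall>s. \<bar>s\<bar> \<le> T0 \<longrightarrow> u s \<in> ball x0 R \<and> norm (u s - y) \<le> B * \<bar>s\<bar>) \<and>
  (\<forall>s. \<bar>s\<bar> < T0 \<longrightarrow> (u has_vector_derivative X j (u s)) (at s))"
proof -
 obtain u where u: "u 0 = y" "\<And>s. s \<in> {-T0..T0} ==> u s \<in> cball y (R / 4)"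
  "\<And>s. s \<in> {-T0..T0} ==> (u has_vector_derivative X j (u s)) (at s within {-T0..T0})"
  using ode_exists[of T0 K "R / 4" y "X j" B] T0 K R lip[OF j] bnd[OF j] cball_sub[OF _ y] by fastforce
 have "(u has_vector_derivative X j (u s)) (at s)" if "\<bar>s\<bar> < T0" for s
  using u(3)[of s] that at_within_interior[of s "{-T0..T0}"] by (auto simp: interior_atLeastAtMost_real abs_less_iff)
 moreover have "norm (u s - y) \<le> B * \<bar>s\<bar>" if "\<bar>s\<bar> \<le> T0" for s
 proof -
  have "norm (u s - u 0) \<le> B * \<bar>s - 0\<bar>"
   by (rule vector_derivative_bound[of "{-T0..T0}"]) (use u that T0 bnd[OF j] cball_sub[OF _ y] in auto)
  then show ?thesis using u(1) by simp
 qed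
 moreover have "u s \<in> ball x0 R" if "\<bar>s\<bar> \<le> T0" for s
  using cball_sub[OF u(2) y] that by (auto simp: abs_le_iff)
 ultimately show ?thesis using u(1) by blast
qed

text \<open>Only integral curves of a single frame field are tested, matching
  \<open>lie_deriv\<close>. Differentiability along other curves has to be derived, in
  \<open>derivative_along_combination\<close>.\<close>

definition along :: "('a => real) => (nat => 'a => real) => bool" where
 "along f g \<longleftrightarrow> (\<forall>j<n. \<forall>u a b. (\<forall>s\<in>{a<..<b}. u s \<in> ball x0 R \<and> (u has_vector_derivative X j (u s)) (at s)) \<longrightarrow>
  (\<forall>s\<in>{a<..<b}. ((\<lambda>s. f (u s)) has_real_derivative g j (u s)) (at s)))"

lemma alongD:
 assumes "along f g" "j < n" "\<And>s. s \<in> {a<..<b} ==> u s \<in> ball x0 R"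
  "\<And>s. s \<in> {a<..<b} ==> (u has_vector_derivative X j (u s)) (at s)" "s \<in> {a<..<b}"
 shows "((\<lambda>s. f (u s)) has_real_derivative g j (u s)) (at s)"
 using assms unfolding along_def by blast

text \<open>From \<open>y\<close> one follows the flow of each frame field in turn for the time
  \<open>s i\<close>. On the way the fields differ from their values at \<open>y\<close> by at most
  \<open>K * B\<close> times the total time, so the end point is that of the linear combination at
  \<open>y\<close> up to second order, and \<open>f\<close> changes by the matching combination of
  the \<open>g l y\<close> up to the oscillation \<open>e\<close>.\<close>

lemma chain_of_flows:
 assumes fg: "along f g" and y: "y \<in> ball x0 (R / 2)" and S: "(\<Sum>i<n. \<bar>s i\<bar>) < T0"
  and osc: "\<And>l \<xi>. l < n ==> \<xi> \<in> ball x0 R ==> norm (\<xi> - y) \<le> B * (\<Sum>i<n. \<bar>s i\<bar>) ==> \<bar>g l \<xi> - g l y\<bar> \<le> e"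
 shows "i \<le> n ==> \<exists>w. norm (w - y) \<le> B * (\<Sum>l<i. \<bar>s l\<bar>) \<and> P (w - y) = w - y \<and>
  norm (w - y - (\<Sum>l<i. s l *\<^sub>R X l y)) \<le> K * B * (\<Sum>l<n. \<bar>s l\<bar>) * (\<Sum>l<i. \<bar>s l\<bar>) \<and>
  \<bar>f w - f y - (\<Sum>l<i. s l * g l y)\<bar> \<le> e * (\<Sum>l<i. \<bar>s l\<bar>)"
proof (induction i)
 case 0
 show ?case using linear_simps(3)[OF P(1)] by (intro exI[of _ y]) auto
next
 case (Suc i)
 let ?S = "\<Sum>l<n. \<bar>s l\<bar>"
 obtain w where w: "norm (w - y) \<le> B * (\<Sum>l<i. \<bar>s l\<bar>)" "P (w - y) = w - y"
  "norm (w - y - (\<Sum>l<i. s l *\<^sub>R X l y)) \<le> K * B * ?S * (\<Sum>l<i. \<bar>s l\<bar>)"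
  "\<bar>f w - f y - (\<Sum>l<i. s l * g l y)\<bar> \<le> e * (\<Sum>l<i. \<bar>s l\<bar>)"
  using Suc by auto
 have i: "i < n" "i < p" using Suc.prems np by auto
 have Si: "(\<Sum>l<i. \<bar>s l\<bar>) + \<bar>s i\<bar> \<le> ?S"
  using sum_mono2[of "{..<n}" "{..<Suc i}" "\<lambda>l. \<bar>s l\<bar>"] Suc.prems by auto
 have BS: "B * ?S \<le> R / 4"
  using T0(2) mult_left_mono[of ?S T0 B] S B by (simp add: mult.commute)
 have nn: "(\<Sum>l<i. \<bar>s l\<bar>) \<ge> 0" by (simp add: sum_nonneg)
 have "norm (w - y) \<le> R / 4"
  using w(1) mult_left_mono[of "\<Sum>l<i. \<bar>s l\<bar>" ?S B] Si B BS by linarith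
 then have "w \<in> ball x0 (3 * R / 4)"
  using y dist_triangle[of x0 w y] by (simp add: dist_norm norm_minus_commute)
 from short_flow[OF i(2) this] obtain u where u: "u 0 = w"
  "\<And>r. \<bar>r\<bar> \<le> T0 ==> u r \<in> ball x0 R \<and> norm (u r - w) \<le> B * \<bar>r\<bar>"
  "\<And>r. \<bar>r\<bar> < T0 ==> (u has_vector_derivative X i (u r)) (at r)" by blast
 have si: "\<bar>s i\<bar> < T0" using Si S nn by linarith
 define J where "J = {-\<bar>s i\<bar>..\<bar>s i\<bar>}"
 have J: "convex J" "s i \<in> J" "0 \<in> J" "\<And>r. r \<in> J ==> \<bar>r\<bar> \<le> \<bar>s i\<bar> \<and> \<bar>r\<bar> < T0"
  using si by (auto simp: J_def)
 have ud: "(u has_vector_derivative X i (u r)) (at r within J)" if "r \<in> J" for r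
  using u(3) J(4)[OF that] has_vector_derivative_at_within by blast
 have uR: "u r \<in> ball x0 R" if "r \<in> J" for r using u(2) J(4)[OF that] by auto
 have uw: "norm (u r - w) \<le> B * \<bar>s i\<bar>" if "r \<in> J" for r
  using u(2)[of r] J(4)[OF that] B mult_left_mono[of "\<bar>r\<bar>" "\<bar>s i\<bar>" B] by fastforce
 have uy: "norm (u r - y) \<le> B * ((\<Sum>l<i. \<bar>s l\<bar>) + \<bar>s i\<bar>)" if "r \<in> J" for r
  using uw[OF that] w(1) norm_triangle_ineq[of "u r - w" "w - y"] by (simp add: distrib_left)
 have uyS: "norm (u r - y) \<le> B * ?S" if "r \<in> J" for r
  using uy[OF that] mult_left_mono[OF Si B] by linarith
 have yR: "y \<in> ball x0 R" using y R by simp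
 \<comment> \<open>\<open>u - P u\<close> has zero derivative, so the flow stays in the affine
   subspace through \<open>y\<close>.\<close>
 have 2: "P (u (s i) - y) = u (s i) - y"
 proof -
  have "norm ((\<lambda>r. u r - P (u r)) (s i) - (\<lambda>r. u r - P (u r)) 0) \<le> 0 * \<bar>s i - 0\<bar>"
  proof (rule vector_derivative_bound[OF J(1) _ _ J(2,3)])
   fix r assume r: "r \<in> J"
   show "((\<lambda>r. u r - P (u r)) has_vector_derivative (X i (u r) - P (X i (u r)))) (at r within J)"
    by (intro has_vector_derivative_diff bounded_linear.has_vector_derivative[OF P(1)] ud r)
   show "norm (X i (u r) - P (X i (u r))) \<le> 0" using P(2)[OF i(2) uR[OF r]] by simp
  qed
  then have "P (u (s i)) = u (s i) - (w - P w)" using u(1) by (simp add: algebra_simps)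
  moreover have "P w = w - y + P y"
   using w(2) unfolding linear_diff[OF bounded_linear.linear[OF P(1)]] by (simp add: algebra_simps)
  ultimately show ?thesis unfolding linear_diff[OF bounded_linear.linear[OF P(1)]] by simp
 qed
 have 3: "norm (u (s i) - w - s i *\<^sub>R X i y) \<le> K * B * ?S * \<bar>s i\<bar>"
 proof -
  have "norm ((\<lambda>r. u r - r *\<^sub>R X i y) (s i) - (\<lambda>r. u r - r *\<^sub>R X i y) 0) \<le> (K * (B * ?S)) * \<bar>s i - 0\<bar>"
  proof (rule vector_derivative_bound[OF J(1) _ _ J(2,3)])
   fix r assume r: "r \<in> J"
   show "((\<lambda>r. u r - r *\<^sub>R X i y) has_vector_derivative (X i (u r) - X i y)) (at r within J)"
    by (auto intro!: derivative_eq_intros ud r)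
   have "norm (X i (u r) - X i y) \<le> K * norm (u r - y)" by (rule lip[OF i(2) uR[OF r] yR])
   also have "\<dots> \<le> K * (B * ?S)" using uyS[OF r] K by (rule mult_left_mono)
   finally show "norm (X i (u r) - X i y) \<le> K * (B * ?S)" .
  qed
  then show ?thesis using u(1) by (simp add: algebra_simps)
 qed
 have 4: "\<bar>f (u (s i)) - f w - s i * g i y\<bar> \<le> e * \<bar>s i\<bar>"
 proof -
  have fd: "((\<lambda>r. f (u r)) has_real_derivative g i (u r)) (at r)" if "r \<in> J" for r
   by (rule alongD[OF fg i(1), of "-T0" T0]) (use u(2,3) J(4)[OF that] in \<open>auto simp: abs_less_iff abs_le_iff\<close>)
  have "norm ((\<lambda>r. f (u r) - r * g i y) (s i) - (\<lambda>r. f (u r) - r * g i y) 0) \<le> e * norm (s i - 0)"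
  proof (rule field_differentiable_bound[OF J(1) _ _ J(2,3)])
   fix r assume r: "r \<in> J"
   show "((\<lambda>r. f (u r) - r * g i y) has_real_derivative (g i (u r) - g i y)) (at r within J)"
    using DERIV_subset[OF fd[OF r] subset_UNIV] by (auto intro!: derivative_eq_intros)
   show "norm (g i (u r) - g i y) \<le> e" using osc[OF i(1) uR[OF r] uyS[OF r]] by simp
  qed
  then show ?thesis using u(1) by (simp add: algebra_simps)
 qed
 show ?case
 proof (intro exI[of _ "u (s i)"] conjI)
  show "norm (u (s i) - y) \<le> B * (\<Sum>l<Suc i. \<bar>s l\<bar>)" using uy[OF J(2)] by simp
  show "norm (u (s i) - y - (\<Sum>l<Suc i. s l *\<^sub>R X l y)) \<le> K * B * ?S * (\<Sum>l<Suc i. \<bar>s l\<bar>)"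
   using 3 w(3) norm_triangle_ineq[of "u (s i) - w - s i *\<^sub>R X i y" "w - y - (\<Sum>l<i. s l *\<^sub>R X l y)"]
   by (simp add: algebra_simps)
  show "\<bar>f (u (s i)) - f y - (\<Sum>l<Suc i. s l * g l y)\<bar> \<le> e * (\<Sum>l<Suc i. \<bar>s l\<bar>)"
   using 4 w(4) by (simp add: distrib_left)
 qed (rule 2)
qed

text \<open>The bounds serve \<open>lipschitz_along\<close>: the points met stay in the ball of
  radius \<open>R / 2\<close>, the flow times add up to less than \<open>T0\<close>, and the
  second-order error of \<open>chain_of_flows\<close> is at most half the distance to the
  target.\<close>

definition rho :: real where
 "rho = min (R / 6) (min (T0 / (4 * (C + 1))) (1 / (4 * (K * B * C * C + 1))))"

lemma rho: "0 < rho" "rho \<le> R / 6" "rho \<le> T0 / (4 * (C + 1))" "rho \<le> 1 / (4 * (K * B * C * C + 1))"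
proof -
 have "K * B * C * C \<ge> 0" using K B C by simp
 then show "0 < rho" using R T0(1) C by (simp add: rho_def)
 show "rho \<le> R / 6" by (simp only: rho_def min.cobounded1)
 show "rho \<le> T0 / (4 * (C + 1))" "rho \<le> 1 / (4 * (K * B * C * C + 1))"
  unfolding rho_def by (meson min.cobounded1 min.cobounded2 order_trans)+
qed

text \<open>Along the frame one moves from \<open>y\<close> to within half the distance of \<open>z\<close>; iterating this bounds
  \<open>f z - f y\<close>, because \<open>f\<close> is continuous.\<close>

lemma lipschitz_along:
 assumes fg: "along f g" and f: "continuous_on (ball x0 R) f"
  and G: "\<And>j x. j < n ==> x \<in> ball x0 R ==> \<bar>g j x\<bar> \<le> G" and G0: "0 \<le> G"
 shows "\<exists>L\<ge>0. \<forall>y\<in>ball x0 rho. \<forall>z\<in>ball x0 rho. P (z - y) = z - y \<longrightarrow> \<bar>f z - f y\<bar> \<le> L * norm (z - y)"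
proof -
 have KB: "K * B * C * C \<ge> 0" using K B C by simp
 \<comment> \<open>\<open>2 * G\<close> accounts for the oscillation of the derivatives and another
   \<open>G\<close> for the linear term; \<open>C\<close> turns distance into flow time.\<close>
 define L where "L = 3 * G * C"
 have L: "L \<ge> 0" using G0 C by (simp add: L_def)
 have step: "\<exists>w. norm (w - z) \<le> 1/2 * norm (y - z) \<and> P (z - w) = z - w \<and> \<bar>f w - f y\<bar> \<le> L * norm (y - z)"
  if y: "y \<in> ball x0 (3 * rho)" and z: "z \<in> ball x0 rho" and yz: "norm (y - z) \<le> 2 * rho" and Pz: "P (z - y) = z - y" for y z
 proof -
  have yR: "y \<in> ball x0 (R / 2)" using y rho(2) by simp
  then have "y \<in> ball x0 R" using R by simp
  from frame[OF this Pz] obtain s where s: "z - y = (\<Sum>i<n. s i *\<^sub>R X i y)" "(\<Sum>i<n. \<bar>s i\<bar>) \<le> C * norm (z - y)"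
   by blast
  let ?S = "\<Sum>i<n. \<bar>s i\<bar>"
  have S0: "?S \<ge> 0" by (simp add: sum_nonneg)
  have "?S \<le> C * (2 * rho)"
   using s(2) mult_left_mono[OF yz C] by (simp add: norm_minus_commute)
  also have "\<dots> \<le> (C + 1) * (2 * rho)" using rho(1) by (intro mult_right_mono) auto
  also have "\<dots> \<le> T0 / 2" using rho(3) C by (simp add: field_simps)
  also have "\<dots> < T0" using T0(1) by simp
  finally have ST: "?S < T0" .
  have osc: "\<bar>g l \<xi> - g l y\<bar> \<le> 2 * G" if "l < n" "\<xi> \<in> ball x0 R" for l \<xi>
   using G[OF that] G[OF that(1) \<open>y \<in> ball x0 R\<close>] by linarith
  obtain w where w: "P (w - y) = w - y"
   "norm (w - y - (\<Sum>l<n. s l *\<^sub>R X l y)) \<le> K * B * ?S * ?S"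
   "\<bar>f w - f y - (\<Sum>l<n. s l * g l y)\<bar> \<le> 2 * G * ?S"
   using chain_of_flows[OF fg yR ST osc order_refl] by blast
  have "norm (w - z) \<le> K * B * ?S * ?S" using w(2) unfolding s(1)[symmetric] by simp
  also have "\<dots> \<le> K * B * (C * norm (z - y)) * (C * norm (z - y))"
   using s(2) S0 K B C by (intro mult_mono mult_nonneg_nonneg) auto
  also have "\<dots> = (K * B * C * C * norm (y - z)) * norm (y - z)" by (simp add: norm_minus_commute mult_ac)
  also have "\<dots> \<le> 1/2 * norm (y - z)"
  proof (rule mult_right_mono)
   have "K * B * C * C * norm (y - z) \<le> (K * B * C * C + 1) * (2 * rho)"
    using yz KB by (intro mult_mono) auto
   also have "\<dots> \<le> 1/2" using rho(4) KB by (simp add: field_simps)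
   finally show "K * B * C * C * norm (y - z) \<le> 1/2" .
  qed simp
  finally have 1: "norm (w - z) \<le> 1/2 * norm (y - z)" .
  have "\<bar>\<Sum>l<n. s l * g l y\<bar> \<le> (\<Sum>l<n. \<bar>s l\<bar> * G)"
   by (rule order_trans[OF sum_abs]) (auto intro!: sum_mono mult_left_mono G simp: abs_mult \<open>y \<in> ball x0 R\<close>[simplified])
  moreover have "(\<Sum>l<n. \<bar>s l\<bar> * G) = G * ?S" by (simp add: sum_distrib_left mult.commute)
  ultimately have "\<bar>f w - f y\<bar> \<le> 3 * G * ?S" using w(3) by (simp add: algebra_simps abs_le_iff)
  also have "\<dots> \<le> L * norm (y - z)"
   using mult_left_mono[OF s(2), of "3 * G"] G0 by (simp add: L_def norm_minus_commute mult_ac)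
  finally have 2: "\<bar>f w - f y\<bar> \<le> L * norm (y - z)" .
  have "P (z - w) = P (z - y) - P (w - y)"
   by (simp flip: linear_diff[OF bounded_linear.linear[OF P(1)]])
  then show ?thesis using 1 2 w(1) Pz by (intro exI[of _ w]) simp
 qed
 have main: "\<bar>f z - f y\<bar> \<le> 2 * L * norm (z - y)"
  if y: "y \<in> ball x0 rho" and z: "z \<in> ball x0 rho" and Pz: "P (z - y) = z - y" for y z
 proof -
  have yz: "norm (y - z) \<le> 2 * rho"
   using y z dist_triangle2[of y z x0] by (simp add: dist_norm norm_minus_commute)
  have near: "w \<in> ball x0 (3 * rho)" if "norm (w - z) \<le> norm (y - z)" for w
   using that yz z dist_triangle[of x0 w z] by (simp add: dist_norm norm_minus_commute)
  \<comment> \<open>The increments of \<open>f\<close> shrink geometrically with the distances;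
    their partial sums are \<open>2 * L * (1 - (1/2) ^ k)\<close> times the first distance.\<close>
  have "\<exists>w. norm (w - z) \<le> (1/2) ^ k * norm (y - z) \<and> P (z - w) = z - w \<and>
    \<bar>f w - f y\<bar> \<le> 2 * L * (1 - (1/2) ^ k) * norm (y - z)" for k
  proof (induction k)
   case 0
   show ?case using Pz by (intro exI[of _ y]) simp
  next
   case (Suc k)
   then obtain w where w: "norm (w - z) \<le> (1/2) ^ k * norm (y - z)" "P (z - w) = z - w"
    "\<bar>f w - f y\<bar> \<le> 2 * L * (1 - (1/2) ^ k) * norm (y - z)" by blast
   have wz: "norm (w - z) \<le> norm (y - z)"
    using w(1) mult_right_mono[of "(1/2) ^ k" 1 "norm (y - z)"] by (simp add: power_le_one)
   obtain v where v: "norm (v - z) \<le> 1/2 * norm (w - z)" "P (z - v) = z - v" "\<bar>f v - f w\<bar> \<le> L * norm (w - z)"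
    using step[OF near[OF wz] z _ w(2)] wz yz by force
   have "L * norm (w - z) \<le> L * ((1/2) ^ k * norm (y - z))" using w(1) L by (rule mult_left_mono)
   then have "\<bar>f v - f y\<bar> \<le> 2 * L * (1 - (1/2) ^ Suc k) * norm (y - z)"
    using v(3) w(3) by (simp add: algebra_simps)
   then show ?case using v w(1) by (intro exI[of _ v]) auto
  qed
  then obtain w where w: "\<And>k. norm (w k - z) \<le> (1/2) ^ k * norm (y - z)"
   "\<And>k. \<bar>f (w k) - f y\<bar> \<le> 2 * L * (1 - (1/2) ^ k) * norm (y - z)" by metis
  have "(\<lambda>k. w k - z) \<longlonglongrightarrow> 0"
  proof (rule Lim_null_comparison)
   show "\<forall>\<^sub>F k in sequentially. norm (w k - z) \<le> (1/2) ^ k * norm (y - z)" using w(1) by simp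
   show "(\<lambda>k. (1/2) ^ k * norm (y - z)) \<longlonglongrightarrow> 0"
    by (intro tendsto_mult_left_zero LIMSEQ_power_zero) auto
  qed
  then have wl: "w \<longlonglongrightarrow> z" by (simp add: Lim_null[of w])
  have "z \<in> ball x0 R" using z rho(2) R by simp
  then have "isCont f z" using f continuous_on_eq_continuous_at[OF open_ball] by blast
  then have "(\<lambda>k. f (w k)) \<longlonglongrightarrow> f z" by (rule isCont_tendsto_compose[OF _ wl])
  then have "(\<lambda>k. \<bar>f (w k) - f y\<bar>) \<longlonglongrightarrow> \<bar>f z - f y\<bar>" by (intro tendsto_intros)
  moreover have "\<bar>f (w k) - f y\<bar> \<le> 2 * L * norm (z - y)" for k
  proof -
   have "2 * L * (1 - (1/2) ^ k) * norm (y - z) \<le> 2 * L * 1 * norm (y - z)"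
    using L by (intro mult_right_mono mult_left_mono) auto
   then show ?thesis using w(2)[of k] by (simp add: norm_minus_commute)
  qed
  ultimately show ?thesis by (intro LIMSEQ_le_const2) auto
 qed
 then show ?thesis using L by (intro exI[of _ "2 * L"]) auto
qed

text \<open>For small \<open>h\<close> the point \<open>u (r + h)\<close> differs from the end point
  of the flows with times \<open>h * t j\<close> by a small multiple of \<open>h\<close>. The
  Lipschitz bound transfers this closeness to \<open>f\<close>, and \<open>chain_of_flows\<close>
  gives the value of \<open>f\<close> at that end point.\<close>

lemma derivative_along_combination:
 assumes fg: "along f g" and f: "continuous_on (ball x0 R) f"
  and g: "\<And>j. j < n ==> continuous_on (ball x0 R) (g j)"
  and G: "\<And>j x. j < n ==> x \<in> ball x0 R ==> \<bar>g j x\<bar> \<le> G" "0 \<le> G"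
  and u: "\<And>s. s \<in> {a<..<b} ==> u s \<in> ball x0 rho"
   "\<And>s. s \<in> {a<..<b} ==> (u has_vector_derivative (\<Sum>j<n. t j *\<^sub>R X j (u s))) (at s)"
   "\<And>s. s \<in> {a<..<b} ==> P (u s - x0) = u s - x0"
  and r: "r \<in> {a<..<b}"
 shows "((\<lambda>s. f (u s)) has_real_derivative (\<Sum>j<n. t j * g j (u r))) (at r)"
proof -
 obtain L where lips: "0 \<le> L" "\<And>y z. y \<in> ball x0 rho ==> z \<in> ball x0 rho ==> P (z - y) = z - y ==> \<bar>f z - f y\<bar> \<le> L * norm (z - y)"
  using lipschitz_along[OF fg f G] by blast
 define y where "y = u r"
 have y\<rho>: "y \<in> ball x0 rho" using u(1)[OF r] by (simp add: y_def)
 have yR2: "y \<in> ball x0 (R / 2)" "y \<in> ball x0 R" using y\<rho> rho(2) R by auto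
 define S where "S = (\<Sum>i<n. \<bar>t i\<bar>)"
 have S: "S \<ge> 0" by (simp add: S_def sum_nonneg)
 have main: "\<exists>d>0. \<forall>h. \<bar>h\<bar> < d \<longrightarrow> \<bar>f (u (r + h)) - f y - h * (\<Sum>j<n. t j * g j y)\<bar> \<le> (S + 2 * L) * e * \<bar>h\<bar>"
  if e: "e > 0" for e
 proof -
  have "\<forall>j. \<exists>d>0. j < n \<longrightarrow> (\<forall>\<xi>\<in>ball x0 R. norm (\<xi> - y) < d \<longrightarrow> \<bar>g j \<xi> - g j y\<bar> < e)"
   using g yR2(2) e unfolding continuous_on_iff dist_norm by (metis real_norm_def zero_less_one)
  then obtain dj where dj: "\<And>j. dj j > 0" "\<And>j \<xi>. j < n ==> \<xi> \<in> ball x0 R ==> norm (\<xi> - y) < dj j ==> \<bar>g j \<xi> - g j y\<bar> < e"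
   by metis
  define d1 where "d1 = Min (insert 1 (dj ` {..<n}))"
  have d1: "d1 > 0" "\<And>j. j < n ==> d1 \<le> dj j" unfolding d1_def using dj(1) by (auto intro: Min_le)
  obtain d2 where d2: "d2 > 0" "\<And>s. norm (s - r) < d2 ==>
    norm (u s - u r - (s - r) *\<^sub>R (\<Sum>j<n. t j *\<^sub>R X j y)) \<le> e * norm (s - r)"
   using u(2)[OF r] e unfolding has_vector_derivative_def has_derivative_at_alt y_def by blast
  define M where "M = B * S + 1"
  have M: "M > 0" "B * S < M" using B S by (auto simp: M_def add_nonneg_pos)
  define d3 where "d3 = rho - dist x0 y"
  have d3: "d3 > 0" using y\<rho> by (simp add: d3_def)
  \<comment> \<open>In this order: differentiability of \<open>u\<close>, the two ends of the
    interval, flow time below \<open>T0\<close>, oscillation of the \<open>g j\<close> below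
    \<open>e\<close>, remaining in the ball of radius \<open>rho\<close>, second-order error below
    \<open>e\<close> times the increment.\<close>
  define d where "d = Min {d2, r - a, b - r, T0 / (S + 1), d1 / M, d3 / M, e / (K * B * S * S + 1)}"
  have KB: "K * B * S * S \<ge> 0" using K B S by simp
  have d0: "d > 0" using d2 d3 d1 M r T0(1) S e KB by (auto simp: d_def add_nonneg_pos)
  have "\<bar>f (u (r + h)) - f y - h * (\<Sum>j<n. t j * g j y)\<bar> \<le> (S + 2 * L) * e * \<bar>h\<bar>" if h: "\<bar>h\<bar> < d" for h
  proof -
   have hs: "\<bar>h\<bar> < d2" "\<bar>h\<bar> < r - a" "\<bar>h\<bar> < b - r" "\<bar>h\<bar> < T0 / (S + 1)" "\<bar>h\<bar> < d1 / M" "\<bar>h\<bar> < d3 / M"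
    "\<bar>h\<bar> < e / (K * B * S * S + 1)" using h unfolding d_def by (simp_all only: Min_gr_iff finite.intros insert_not_empty not_False_eq_True ball_simps simp_thms)
   let ?s = "\<lambda>i. h * t i"
   have Ss: "(\<Sum>i<n. \<bar>?s i\<bar>) = \<bar>h\<bar> * S" by (simp add: abs_mult sum_distrib_left S_def)
   have "\<bar>h\<bar> * S \<le> \<bar>h\<bar> * (S + 1)" by (simp add: mult_left_mono)
   also have "\<dots> < T0" using hs(4) S by (simp add: pos_less_divide_eq)
   finally have ST: "(\<Sum>i<n. \<bar>?s i\<bar>) < T0" using Ss by simp
   have BS: "B * (\<bar>h\<bar> * S) \<le> \<bar>h\<bar> * M" using M(2) mult_left_mono[of "B * S" M "\<bar>h\<bar>"] by (simp add: mult_ac)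
   have hM: "\<bar>h\<bar> * M < d1" "\<bar>h\<bar> * M < d3" using hs(5,6) M by (auto simp: pos_less_divide_eq)
   have osc: "\<bar>g l \<xi> - g l y\<bar> \<le> e" if "l < n" "\<xi> \<in> ball x0 R" "norm (\<xi> - y) \<le> B * (\<Sum>i<n. \<bar>?s i\<bar>)" for l \<xi>
    using dj(2)[OF that(1,2)] that(3) d1(2)[OF that(1)] BS hM Ss by fastforce
   obtain w where w: "norm (w - y) \<le> B * (\<bar>h\<bar> * S)" "P (w - y) = w - y"
    "norm (w - y - (\<Sum>l<n. ?s l *\<^sub>R X l y)) \<le> K * B * (\<bar>h\<bar> * S) * (\<bar>h\<bar> * S)"
    "\<bar>f w - f y - (\<Sum>l<n. ?s l * g l y)\<bar> \<le> e * (\<bar>h\<bar> * S)"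
    using chain_of_flows[OF fg yR2(1) ST osc order_refl] unfolding Ss by blast
   have "norm (w - y) < d3" using w(1) BS hM by linarith
   then have w\<rho>: "w \<in> ball x0 rho"
    using dist_triangle[of x0 w y] by (simp add: d3_def dist_norm norm_minus_commute)
   have rh: "r + h \<in> {a<..<b}" using hs(2,3) by (auto simp: abs_less_iff)
   have PP: "P (u (r + h) - w) = u (r + h) - w"
   proof -
    have lin: "linear P" using bounded_linear.linear[OF P(1)] .
    have "u (r + h) - w = (u (r + h) - x0) - (u r - x0) - (w - y)" by (simp add: y_def)
    then show ?thesis using u(3)[OF rh] u(3)[OF r] w(2) by (simp only: linear_diff[OF lin])
   qed
   have e1: "norm (u (r + h) - y - h *\<^sub>R (\<Sum>j<n. t j *\<^sub>R X j y)) \<le> e * \<bar>h\<bar>"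
    using d2(2)[of "r + h"] hs(1) by (simp add: y_def)
   have e2: "K * B * (\<bar>h\<bar> * S) * (\<bar>h\<bar> * S) \<le> e * \<bar>h\<bar>"
   proof -
    have "\<bar>h\<bar> * (K * B * S * S) \<le> \<bar>h\<bar> * (K * B * S * S + 1)" by (simp add: mult_left_mono)
    also have "\<dots> \<le> e" using hs(7) KB by (simp add: pos_less_divide_eq add_nonneg_pos)
    finally have "\<bar>h\<bar> * (K * B * S * S) * \<bar>h\<bar> \<le> e * \<bar>h\<bar>" by (rule mult_right_mono) simp
    then show ?thesis by (simp add: mult_ac)
   qed
   have hX: "(\<Sum>l<n. ?s l *\<^sub>R X l y) = h *\<^sub>R (\<Sum>j<n. t j *\<^sub>R X j y)" by (simp add: scaleR_sum_right)
   have "norm (u (r + h) - w) \<le> 2 * e * \<bar>h\<bar>"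
   proof -
    let ?A = "h *\<^sub>R (\<Sum>j<n. t j *\<^sub>R X j y)"
    have "norm (u (r + h) - w) = norm ((u (r + h) - y - ?A) - (w - y - ?A))" by simp
    also have "\<dots> \<le> norm (u (r + h) - y - ?A) + norm (w - y - ?A)" by (rule norm_triangle_ineq4)
    finally show ?thesis using e1 e2 w(3) unfolding hX by linarith
   qed
   then have "\<bar>f (u (r + h)) - f w\<bar> \<le> L * (2 * e * \<bar>h\<bar>)"
    using lips(2)[OF w\<rho> u(1)[OF rh] PP] mult_left_mono[OF _ lips(1)] by fastforce
   moreover have "h * (\<Sum>j<n. t j * g j y) = (\<Sum>l<n. ?s l * g l y)" by (simp add: sum_distrib_left mult.assoc)
   ultimately have "\<bar>f (u (r + h)) - f y - h * (\<Sum>j<n. t j * g j y)\<bar> \<le> L * (2 * e * \<bar>h\<bar>) + e * (\<bar>h\<bar> * S)"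
    using w(4) by linarith
   then show ?thesis by (simp add: algebra_simps)
  qed
  then show ?thesis using d0 by blast
 qed
 show ?thesis
  unfolding has_field_derivative_def has_derivative_at_alt
 proof (intro conjI allI impI)
  show "bounded_linear ((*) (\<Sum>j<n. t j * g j (u r)))" by (rule bounded_linear_mult_right)
  fix e :: real assume e: "e > 0"
  have pos: "S + 2 * L + 1 > 0" using S lips(1) by linarith
  then have "e / (S + 2 * L + 1) > 0" using e by simp
  from main[OF this] obtain d where d: "d > 0" "\<And>h. \<bar>h\<bar> < d ==>
   \<bar>f (u (r + h)) - f y - h * (\<Sum>j<n. t j * g j y)\<bar> \<le> (S + 2 * L) * (e / (S + 2 * L + 1)) * \<bar>h\<bar>" by blast
  have "(S + 2 * L) * (e / (S + 2 * L + 1)) \<le> e" using pos e by (simp add: field_simps)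
  then have "norm (f (u s) - f (u r) - (\<Sum>j<n. t j * g j (u r)) * (s - r)) \<le> e * norm (s - r)" if "norm (s - r) < d" for s
   using d(2)[of "s - r"] that mult_right_mono[of "(S + 2 * L) * (e / (S + 2 * L + 1))" e "\<bar>s - r\<bar>"]
   by (simp add: y_def mult.commute)
  then show "\<exists>d>0. \<forall>s. norm (s - r) < d \<longrightarrow>
   norm (f (u s) - f (u r) - (\<Sum>j<n. t j * g j (u r)) * (s - r)) \<le> e * norm (s - r)" using d(1) by blast
 qed
qed

end

section \<open>Power series over words and linear equations with analytic coefficients\<close>

text \<open>The m-th power of the noncommutative sum of the \<open>t j X j\<close>, with
  \<open>F ws\<close> in place of X^ws f at a point: a sum over all words of length
  \<open>m\<close>, weighted by the monomial of the word.\<close>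

primrec tw :: "nat => pt => nat => (nat list => real) => real" where
 "tw n t 0 F = F []"
| "tw n t (Suc m) F = (\<Sum>j<n. t j * tw n t m (\<lambda>ws. F (j # ws)))"

lemma tw_bound:
 "(\<And>ws. ws \<in> lists {..<n} ==> length ws = m ==> \<bar>F ws\<bar> \<le> c) ==> \<bar>tw n t m F\<bar> \<le> (\<Sum>j<n. \<bar>t j\<bar>) ^ m * c"
proof (induction m arbitrary: F)
 case (Suc m)
 have "\<bar>tw n t (Suc m) F\<bar> \<le> (\<Sum>j<n. \<bar>t j\<bar> * ((\<Sum>j<n. \<bar>t j\<bar>) ^ m * c))"
  unfolding tw.simps
  by (rule order_trans[OF sum_abs], rule sum_mono, subst abs_mult, rule mult_left_mono, rule Suc.IH)
   (use Suc.prems in auto)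
 also have "\<dots> = (\<Sum>j<n. \<bar>t j\<bar>) ^ Suc m * c" by (simp add: sum_distrib_right mult.assoc)
 finally show ?case .
qed simp

lemma tw_anorm:
 assumes U: "eopen n U" and \<rho>: "\<rho> \<ge> 0" and t: "\<And>j. j < n ==> anorm n U \<rho> \<theta> (\<lambda>t. t j)"
 shows "(\<And>ws. ws \<in> lists {..<n} ==> length ws = m ==> \<bar>F ws\<bar> \<le> c) ==>
  anorm n U \<rho> ((real n * \<theta>) ^ m * c) (\<lambda>t. tw n t m F)"
proof (induction m arbitrary: F)
 case 0
 have "\<bar>F []\<bar> \<le> c" by (rule 0) auto
 then show ?case using anorm_mono[OF anorm_const[OF U, of \<rho> "F []"]] by simp
next
 case (Suc m)
 have "anorm n U \<rho> (\<Sum>j<n. \<theta> * ((real n * \<theta>) ^ m * c)) (\<lambda>t. \<Sum>j<n. t j * tw n t m (\<lambda>ws. F (j # ws)))"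
  by (rule anorm_sum[OF U], rule anorm_mult[OF U t _ \<rho>], simp, rule Suc.IH) (use Suc.prems in auto)
 then show ?case by (simp add: mult.assoc)
qed

lemma tw_linear: "tw n t m (\<lambda>ws. \<Sum>j\<in>J. a j * G j ws) = (\<Sum>j\<in>J. a j * tw n t m (G j))"
proof (induction m arbitrary: G)
 case (Suc m)
 have "tw n t (Suc m) (\<lambda>ws. \<Sum>j\<in>J. a j * G j ws) = (\<Sum>i<n. \<Sum>j\<in>J. t i * (a j * tw n t m (\<lambda>ws. G j (i # ws))))"
  by (simp add: Suc sum_distrib_left)
 also have "\<dots> = (\<Sum>j\<in>J. \<Sum>i<n. t i * (a j * tw n t m (\<lambda>ws. G j (i # ws))))" by (rule sum.swap)
 finally show ?case by (simp add: sum_distrib_left mult.left_commute)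
qed simp

lemma tw_deriv:
 "(\<And>ws. ws \<in> lists {..<n} ==> ((\<lambda>r. F r ws) has_real_derivative F' ws) (at r)) ==>
  ((\<lambda>r. tw n t m (F r)) has_real_derivative tw n t m F') (at r)"
proof (induction m arbitrary: F F')
 case (Suc m)
 show ?case unfolding tw.simps
  by (intro DERIV_sum DERIV_cmult Suc.IH) (use Suc.prems in auto)
qed simp

text \<open>Each derivative in \<open>r\<close> puts one more letter in front, so the m-th
  derivative is a \<open>tw\<close> of order \<open>m\<close>. In the Lagrange remainder the
  factorial of the bound cancels that of the Taylor formula, and the rest decays like
  \<open>(1/2) ^ N\<close>.\<close>

lemma taylor_words:
 fixes F :: "real => nat list => real"
 assumes bnd: "\<And>ws r. ws \<in> lists {..<n} ==> r \<in> {0..1} ==> \<bar>F r ws\<bar> \<le> C * Q ^ length ws * fact (length ws)"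
  and der: "\<And>ws r. ws \<in> lists {..<n} ==> r \<in> {0..1} ==>
   ((\<lambda>r. F r ws) has_real_derivative (\<Sum>j<n. t j * F r (j # ws))) (at r)"
  and Q: "0 \<le> Q" "(\<Sum>j<n. \<bar>t j\<bar>) * Q \<le> 1/2" and r: "r \<in> {0..1}"
 shows "(\<lambda>m. tw n t m (F 0) / fact m * r ^ m) sums F r []"
proof (cases "r = 0")
 case True
 then show ?thesis using powser_sums_zero[of "\<lambda>m. tw n t m (F 0) / fact m"] by simp
next
 case False
 then have r0: "0 < r" using r by simp
 let ?d = "\<lambda>m s. tw n t m (F s)"
 have dd: "(?d m has_real_derivative ?d (Suc m) s) (at s)" if "0 \<le> s" "s \<le> r" for m s
 proof -
  have "((\<lambda>s. tw n t m (F s)) has_real_derivative tw n t m (\<lambda>ws. \<Sum>j<n. t j * F s (j # ws))) (at s)"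
   by (rule tw_deriv, rule der) (use that r in auto)
  then show ?thesis unfolding tw_linear by simp
 qed
 have C: "C \<ge> 0" using bnd[of "[]" 0] by (auto intro: order_trans[OF abs_ge_zero])
 have rem: "\<bar>F r [] - (\<Sum>m<N. tw n t m (F 0) / fact m * r ^ m)\<bar> \<le> C * (1/2) ^ N" for N
 proof -
  obtain s where s: "s > 0" "s \<le> r"
   "F r [] = (\<Sum>m<N. ?d m 0 / fact m * r ^ m) + ?d N s / fact N * r ^ N"
   using Maclaurin2[OF r0, of ?d "\<lambda>s. F s []" N] dd by auto
  have "\<bar>?d N s\<bar> \<le> (\<Sum>j<n. \<bar>t j\<bar>) ^ N * (C * Q ^ N * fact N)"
   by (rule tw_bound) (use bnd[of _ s] s r in auto)
  also have "\<dots> = C * ((\<Sum>j<n. \<bar>t j\<bar>) * Q) ^ N * fact N" by (simp add: power_mult_distrib mult_ac)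
  also have "\<dots> \<le> C * (1/2) ^ N * fact N"
   using C Q by (intro mult_right_mono mult_left_mono power_mono) (auto intro!: mult_nonneg_nonneg sum_nonneg)
  finally have "\<bar>?d N s / fact N\<bar> \<le> C * (1/2) ^ N" by (simp add: field_simps)
  moreover have "r ^ N \<le> 1" using r by (intro power_le_one) auto
  ultimately have "\<bar>?d N s / fact N\<bar> * r ^ N \<le> C * (1/2) ^ N * 1"
   using r0 C by (intro mult_mono) auto
  then show ?thesis using s(3) r0 by (simp add: abs_mult)
 qed
 have "(\<lambda>N. F r [] - (\<Sum>m<N. tw n t m (F 0) / fact m * r ^ m)) \<longlonglongrightarrow> 0"
 proof (rule Lim_null_comparison)
  show "\<forall>\<^sub>F N in sequentially. norm (F r [] - (\<Sum>m<N. tw n t m (F 0) / fact m * r ^ m)) \<le> C * (1/2) ^ N"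
   using rem by simp
  show "(\<lambda>N. C * (1/2) ^ N) \<longlonglongrightarrow> 0" by (intro tendsto_mult_right_zero LIMSEQ_power_zero) auto
 qed
 then have "(\<lambda>N. F r [] - (F r [] - (\<Sum>m<N. tw n t m (F 0) / fact m * r ^ m))) \<longlonglongrightarrow> F r [] - 0"
  by (intro tendsto_intros)
 then show ?thesis unfolding sums_def by simp
qed

text \<open>The coefficients of the power series in \<open>r\<close> solving \<open>v' = b - C v\<close>, \<open>v(0) = v0\<close>, where
  \<open>C(r) = \<Sum>\<^sub>j c\<^sub>j r\<^sup>j\<close>.\<close>

fun lin_coef :: "nat => (nat => nat => nat => 't => real) => pt => pt =>
  nat => nat => 't => real" where
 "lin_coef p c b v0 0 k t = v0 k"
| "lin_coef p c b v0 (Suc m) k t =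
  ((if m = 0 then b k else 0) - (\<Sum>j\<le>m. \<Sum>l<p. c j k l t * lin_coef p c b v0 (m - j) l t)) / (real m + 1)"

definition lin_sol :: "nat => (nat => nat => nat => 't => real) => pt => pt =>
  nat => 't => real => real" where
 "lin_sol p c b v0 k t r = (\<Sum>m. lin_coef p c b v0 m k t * r ^ m)"

text \<open>The matrix coefficients decay with ratio 1/4 and the solution is to decay with ratio
  1/2, so convolution costs a factor 2. By \<open>8 * real p * \<delta> \<le> 1\<close> it
  contributes at most \<open>V / 4\<close>, the source another \<open>V / 4\<close>: together half
  of \<open>V\<close>, as the next coefficient requires.\<close>

lemma lin_coef_anorm:
 assumes U: "eopen n U" and \<rho>: "\<rho> \<ge> 0"
  and c: "\<And>j k l. k < p ==> l < p ==> anorm n U \<rho> (\<delta> * (1/4) ^ j) (c j k l)"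
  and \<delta>: "\<delta> \<ge> 0" "8 * real p * \<delta> \<le> 1"
  and v0: "\<And>k. k < p ==> \<bar>v0 k\<bar> \<le> V" and b: "\<And>k. k < p ==> \<bar>b k\<bar> \<le> V / 4"
 shows "k < p ==> anorm n U \<rho> (V * (1/2) ^ m) (lin_coef p c b v0 m k)"
proof (induction m arbitrary: k rule: less_induct)
 case (less m)
 have V: "V \<ge> 0" using v0[OF less.prems] by linarith
 show ?case
 proof (cases m)
  case 0
  have "lin_coef p c b v0 0 k = (\<lambda>t. v0 k)" by (simp add: fun_eq_iff)
  then show ?thesis using 0 anorm_mono[OF anorm_const[OF U] v0[OF less.prems]] by simp
 next
  case (Suc i)
  let ?w = "\<lambda>t. \<Sum>j\<le>i. \<Sum>l<p. c j k l t * lin_coef p c b v0 (i - j) l t"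
  have "anorm n U \<rho> (\<Sum>j\<le>i. \<Sum>l<p. (\<delta> * (1/4) ^ j) * (V * (1/2) ^ (i - j))) ?w"
   by (intro anorm_sum[OF U] anorm_mult[OF U _ _ \<rho>] c less.IH) (use less.prems Suc in auto)
  moreover have "(\<Sum>j\<le>i. \<Sum>l<p. (\<delta> * (1/4) ^ j) * (V * (1/2) ^ (i - j))) \<le> V / 4 * (1/2) ^ i"
  proof -
   have "(\<Sum>j\<le>i. \<Sum>l<p. (\<delta> * (1/4) ^ j) * (V * (1/2) ^ (i - j)))
     = real p * \<delta> * V * (\<Sum>j\<le>i. (1/4) ^ j * (1/2) ^ (i - j))"
    by (simp add: sum_distrib_left mult_ac)
   also have "\<dots> \<le> real p * \<delta> * V * (2 * (1/2) ^ i)"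
    using \<delta> V conv_geometric_le[of "1/4" "1/2" i] by (intro mult_left_mono) auto
   also have "\<dots> = (8 * real p * \<delta>) * (V / 4 * (1/2) ^ i)" by simp
   also have "\<dots> \<le> 1 * (V / 4 * (1/2) ^ i)" using \<delta> V by (intro mult_right_mono) auto
   finally show ?thesis by simp
  qed
  ultimately have w: "anorm n U \<rho> (V / 4 * (1/2) ^ i) ?w" by (rule anorm_mono)
  let ?b = "if i = 0 then b k else 0"
  have "anorm n U \<rho> \<bar>?b\<bar> (\<lambda>t. ?b)" by (rule anorm_const[OF U])
  then have b': "anorm n U \<rho> (V / 4 * (1/2) ^ i) (\<lambda>t. ?b)"
   by (rule anorm_mono) (use b[OF less.prems] V in auto)
  have "anorm n U \<rho> (\<bar>1 / (real i + 1)\<bar> * (V / 4 * (1/2) ^ i + \<bar>-1\<bar> * (V / 4 * (1/2) ^ i)))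
    (\<lambda>t. 1 / (real i + 1) * (?b + (-1) * ?w t))"
   by (intro anorm_cmult[OF U _ \<rho>] anorm_add[OF U b'] w)
  moreover have "\<bar>1 / (real i + 1)\<bar> * (V / 4 * (1/2) ^ i + \<bar>-1\<bar> * (V / 4 * (1/2) ^ i)) \<le> V * (1/2) ^ m"
  proof -
   have "\<bar>1 / (real i + 1)\<bar> * (V * (1/2) ^ Suc i) \<le> 1 * (V * (1/2) ^ Suc i)"
    using V by (intro mult_right_mono) auto
   then show ?thesis using Suc by (simp add: field_simps)
  qed
  ultimately have "anorm n U \<rho> (V * (1/2) ^ m) (\<lambda>t. 1 / (real i + 1) * (?b + (-1) * ?w t))"
   by (rule anorm_mono)
  moreover have "lin_coef p c b v0 m k = (\<lambda>t. 1 / (real i + 1) * (?b + (-1) * ?w t))"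
   unfolding Suc by (simp add: fun_eq_iff)
  ultimately show ?thesis by simp
 qed
qed

lemma lin_sol_anorm:
 assumes U: "eopen n U" and \<rho>: "\<rho> > 0"
  and c: "\<And>j k l. k < p ==> l < p ==> anorm n U \<rho> (\<delta> * (1/4) ^ j) (c j k l)"
  and \<delta>: "\<delta> \<ge> 0" "8 * real p * \<delta> \<le> 1"
  and v0: "\<And>k. k < p ==> \<bar>v0 k\<bar> \<le> V" and b: "\<And>k. k < p ==> \<bar>b k\<bar> \<le> V / 4" and k: "k < p"
 shows "anorm n U \<rho> (\<Sum>m. V * (1/2) ^ m) (\<lambda>t. lin_sol p c b v0 k t 1)"
proof -
 have "anorm n U \<rho> (\<Sum>m. V * (1/2) ^ m) (\<lambda>t. \<Sum>m. lin_coef p c b v0 m k t)"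
  using \<rho> by (intro anorm_suminf[OF U] lin_coef_anorm[OF U _ c \<delta> v0 b k] summable_mult summable_geometric) auto
 then show ?thesis by (simp add: lin_sol_def)
qed

lemma lin_sol_0: "lin_sol p c b v0 k t 0 = v0 k"
 using powser_zero[of "\<lambda>m. lin_coef p c b v0 m k t"] by (simp add: lin_sol_def)

text \<open>The case of the centre \<open>t = 0\<close>, where the matrix vanishes and the solution
  is \<open>v0 + r b\<close>.\<close>

lemma lin_sol_trivial:
 assumes "\<And>j k l. k < p ==> l < p ==> c j k l t = 0" "k < p"
 shows "lin_sol p c b v0 k t 1 = v0 k + b k"
proof -
 have e: "lin_coef p c b v0 m k t = (if m = 0 then v0 k else if m = 1 then b k else 0)" for m
  using assms by (cases m) auto
 have "(\<Sum>m. lin_coef p c b v0 m k t) = (\<Sum>m\<in>{0, 1}. lin_coef p c b v0 m k t)"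
  by (rule suminf_finite) (auto simp: e)
 then show ?thesis by (simp add: lin_sol_def e)
qed

text \<open>Termwise differentiation and a Cauchy product. The series converge up to radius 2, which
  gives two-sided derivatives at both ends of the interval from 0 to 1.\<close>

lemma lin_sol_deriv:
 assumes v: "\<And>m k. k < p ==> \<bar>lin_coef p c b v0 m k t\<bar> \<le> V * (1/2) ^ m"
  and cb: "\<And>j k l. k < p ==> l < p ==> \<bar>c j k l t\<bar> \<le> \<delta> * (1/4) ^ j"
  and Cs: "\<And>l. l < p ==> (\<lambda>j. c j k l t * r ^ j) sums Cm l"
  and k: "k < p" and r: "\<bar>r\<bar> < 2"
 shows "((\<lambda>r. lin_sol p c b v0 k t r) has_real_derivative b k - (\<Sum>l<p. Cm l * lin_sol p c b v0 l t r)) (at r)"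
proof -
 let ?v = "\<lambda>l m. lin_coef p c b v0 m l t"
 have vsum: "summable (\<lambda>m. \<bar>?v l m * s ^ m\<bar>)" if "l < p" "\<bar>s\<bar> < 2" for l s
 proof (rule summable_comparison_test'[of "\<lambda>m. V * (\<bar>s\<bar> / 2) ^ m" 0])
  show "summable (\<lambda>m. V * (\<bar>s\<bar> / 2) ^ m)"
   using that by (intro summable_mult summable_geometric) auto
  fix m
  have "\<bar>?v l m\<bar> * \<bar>s\<bar> ^ m \<le> V * (1/2) ^ m * \<bar>s\<bar> ^ m" using v[OF that(1)] by (intro mult_right_mono) auto
  then show "norm \<bar>?v l m * s ^ m\<bar> \<le> V * (\<bar>s\<bar> / 2) ^ m"
   by (simp add: abs_mult power_abs power_divide)
 qed
 have csum: "summable (\<lambda>j. \<bar>c j k l t * r ^ j\<bar>)" if "l < p" for l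
 proof (rule summable_comparison_test'[of "\<lambda>m. \<delta> * (\<bar>r\<bar> / 4) ^ m" 0])
  show "summable (\<lambda>m. \<delta> * (\<bar>r\<bar> / 4) ^ m)"
   using r by (intro summable_mult summable_geometric) auto
  fix m
  have "\<bar>c m k l t\<bar> * \<bar>r\<bar> ^ m \<le> \<delta> * (1/4) ^ m * \<bar>r\<bar> ^ m" using cb[OF k that] by (intro mult_right_mono) auto
  then show "norm \<bar>c m k l t * r ^ m\<bar> \<le> \<delta> * (\<bar>r\<bar> / 4) ^ m"
   by (simp add: abs_mult power_abs power_divide)
 qed
 \<comment> \<open>A point strictly between \<open>\<bar>r\<bar>\<close> and 2, as termwise
   differentiation needs convergence beyond \<open>r\<close>.\<close>
 define s where "s = (\<bar>r\<bar> + 2) / 2"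
 have s: "\<bar>r\<bar> < \<bar>s\<bar>" "\<bar>s\<bar> < 2" using r by (auto simp: s_def)
 have D: "((\<lambda>r. \<Sum>m. ?v k m * r ^ m) has_real_derivative (\<Sum>m. diffs (?v k) m * r ^ m)) (at r)"
  by (rule termdiffs_strong[of _ s]) (use vsum[OF k s(2)] s(1) in \<open>auto intro: summable_rabs_cancel\<close>)
 have P: "(\<lambda>m. \<Sum>j\<le>m. (c j k l t * r ^ j) * (?v l (m - j) * r ^ (m - j))) sums (Cm l * lin_sol p c b v0 l t r)"
  if l: "l < p" for l
 proof -
  have "(\<Sum>j. c j k l t * r ^ j) = Cm l" using Cs[OF l] sums_unique by metis
  then show ?thesis
   using Cauchy_product_sums[of "\<lambda>j. c j k l t * r ^ j" "\<lambda>m. ?v l m * r ^ m"] csum[OF l] vsum[OF l r]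
   by (simp add: lin_sol_def)
 qed
 have "(\<lambda>m. (if m = 0 then b k else 0) - (\<Sum>l<p. \<Sum>j\<le>m. (c j k l t * r ^ j) * (?v l (m - j) * r ^ (m - j))))
   sums (b k - (\<Sum>l<p. Cm l * lin_sol p c b v0 l t r))"
 proof (rule sums_diff)
  show "(\<lambda>m. if m = 0 then b k else 0) sums b k" using sums_single[of 0 "\<lambda>_. b k"] by simp
  show "(\<lambda>m. \<Sum>l<p. \<Sum>j\<le>m. (c j k l t * r ^ j) * (?v l (m - j) * r ^ (m - j)))
    sums (\<Sum>l<p. Cm l * lin_sol p c b v0 l t r)"
   by (rule sums_sum) (use P in auto)
 qed
 moreover have "(if m = 0 then b k else 0) - (\<Sum>l<p. \<Sum>j\<le>m. (c j k l t * r ^ j) * (?v l (m - j) * r ^ (m - j)))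
   = diffs (?v k) m * r ^ m" for m
 proof -
  have 1: "(\<Sum>l<p. \<Sum>j\<le>m. (c j k l t * r ^ j) * (?v l (m - j) * r ^ (m - j)))
    = (\<Sum>j\<le>m. \<Sum>l<p. c j k l t * ?v l (m - j)) * r ^ m"
  proof -
   have "(\<Sum>l<p. \<Sum>j\<le>m. (c j k l t * r ^ j) * (?v l (m - j) * r ^ (m - j)))
    = (\<Sum>l<p. \<Sum>j\<le>m. c j k l t * ?v l (m - j) * r ^ m)"
   proof (intro sum.cong refl)
    fix l j assume "j \<in> {..m}"
    then have e: "r ^ m = r ^ j * r ^ (m - j)" by (simp flip: power_add)
    show "c j k l t * r ^ j * (?v l (m - j) * r ^ (m - j)) = c j k l t * ?v l (m - j) * r ^ m"
     unfolding e by simp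
   qed
   also have "\<dots> = (\<Sum>j\<le>m. \<Sum>l<p. c j k l t * ?v l (m - j) * r ^ m)" by (rule sum.swap)
   finally show ?thesis by (simp add: sum_distrib_right)
  qed
  have "diffs (?v k) m = (if m = 0 then b k else 0) - (\<Sum>j\<le>m. \<Sum>l<p. c j k l t * ?v l (m - j))"
   unfolding diffs_def lin_coef.simps by (simp add: add.commute)
  then show ?thesis unfolding 1 by (auto simp: left_diff_distrib)
 qed
 ultimately have "(\<lambda>m. diffs (?v k) m * r ^ m) sums (b k - (\<Sum>l<p. Cm l * lin_sol p c b v0 l t r))" by simp
 then have "(\<Sum>m. diffs (?v k) m * r ^ m) = b k - (\<Sum>l<p. Cm l * lin_sol p c b v0 l t r)"
  using sums_unique by metis
 then show ?thesis using D by (simp add: lin_sol_def)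
qed

section \<open>Canonical coordinates of an involutive frame\<close>

definition absum :: "nat => pt => real" where
 "absum n t = (\<Sum>j<n. \<bar>t j\<bar>)"

lemma absum_nonneg: "0 \<le> absum n t"
 by (simp add: absum_def sum_nonneg)

lemma absum_cub: "t \<in> cub n (\<lambda>_. 0) e ==> absum n t \<le> real n * e"
proof -
 assume "t \<in> cub n (\<lambda>_. 0) e"
 then have "absum n t \<le> (\<Sum>j<n. e)" unfolding absum_def by (intro sum_mono) (auto simp: cub_def less_imp_le)
 then show ?thesis by simp
qed

lemma norm_lincomb_le:
 assumes "\<And>j. j < n ==> norm (x j) \<le> M"
 shows "norm (\<Sum>j<n. t j *\<^sub>R x j) \<le> absum n t * M"
 unfolding absum_def sum_distrib_right
 by (rule order_trans[OF norm_sum], rule sum_mono) (use assms in \<open>auto intro: mult_left_mono\<close>)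

text \<open>The first field of each bracket is a frame field, since rays use combinations of the
  first \<open>n\<close> fields only. \<open>CC\<close> and \<open>QQ\<close> are common constants
  for all families of iterated derivatives.\<close>

locale involutive_frame = frame_fields +
 fixes c :: "nat => nat => nat => 'a => real" and CC QQ :: real
 assumes comm: "a < n ==> k < p ==> x \<in> ball x0 R ==>
   DX k x (X a x) - DX a x (X k x) = (\<Sum>l<p. c a k l x *\<^sub>R X l x)"
  and CQ: "0 \<le> CC" "0 \<le> QQ"
begin

text \<open>The counterpart of \<open>word_family\<close> in the Banach space.\<close>

definition good :: "(nat list => 'a => real) => bool" where
 "good fam \<longleftrightarrow> (\<forall>ws\<in>lists {..<n}. continuous_on (ball x0 R) (fam ws) \<and> along (fam ws) (\<lambda>j. fam (j # ws)) \<and>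
  (\<forall>x\<in>ball x0 R. \<bar>fam ws x\<bar> \<le> CC * QQ ^ length ws * fact (length ws)))"

text \<open>Adapted to solutions on the time interval from -2 to 2 that stay within
  \<open>rho / 2\<close> of the centre.\<close>

definition tau :: real where "tau = min (rho / (4 * (B + 1))) (1 / (4 * (K + 1)))"

lemma tau: "0 < tau" "2 * (tau * B) \<le> rho / 2" "2 * (tau * K) \<le> 1 / 2"
proof -
 show "0 < tau" using rho(1) B K by (simp add: tau_def)
 have "tau * B \<le> rho / (4 * (B + 1)) * B" using B unfolding tau_def by (intro mult_right_mono) auto
 also have "\<dots> \<le> rho / 4" using rho(1) B by (simp add: field_simps)
 finally show "2 * (tau * B) \<le> rho / 2" by simp
 have "tau * K \<le> 1 / (4 * (K + 1)) * K" using K unfolding tau_def by (intro mult_right_mono) auto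
 also have "\<dots> \<le> 1 / 4" using K by (simp add: field_simps)
 finally show "2 * (tau * K) \<le> 1 / 2" by simp
qed

section \<open>The canonical map and Taylor series along rays\<close>

definition Z :: "pt => 'a => 'a" where
 "Z t x = (\<Sum>j<n. t j *\<^sub>R X j x)"

lemma in_R: "x \<in> cball x0 (rho / 2) ==> x \<in> ball x0 rho" "x \<in> cball x0 (rho / 2) ==> x \<in> ball x0 R"
 using rho(1,2) R by auto

lemma Z_bound: "x \<in> ball x0 R ==> norm (Z t x) \<le> absum n t * B"
 unfolding Z_def using bnd np by (intro norm_lincomb_le) auto

lemma Z_lip: "x \<in> ball x0 R ==> y \<in> ball x0 R ==> norm (Z t x - Z t y) \<le> absum n t * (K * norm (x - y))"
 unfolding Z_def sum_subtractf[symmetric] scaleR_diff_right[symmetric]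
 using lip np by (intro norm_lincomb_le) auto

text \<open>The time interval extends beyond 0 and 1, so that derivatives at these times are
  two-sided.\<close>

definition is_sol :: "pt => (real => 'a) => bool" where
 "is_sol t u \<longleftrightarrow> u 0 = x0 \<and> (\<forall>s\<in>{-2..2}. u s \<in> cball x0 (rho / 2) \<and>
  (u has_vector_derivative Z t (u s)) (at s within {-2..2}))"

lemma sol_exists:
 assumes t: "absum n t \<le> tau"
 shows "\<exists>u. is_sol t u"
 unfolding is_sol_def
proof (rule ode_exists[where K="absum n t * K" and B="absum n t * B"])
 show "norm (Z t x - Z t y) \<le> absum n t * K * norm (x - y)"
  if "x \<in> cball x0 (rho / 2)" "y \<in> cball x0 (rho / 2)" for x y
  using Z_lip[OF in_R(2)[OF that(1)] in_R(2)[OF that(2)]] by (simp add: mult.assoc)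
 show "norm (Z t x) \<le> absum n t * B" if "x \<in> cball x0 (rho / 2)" for x
  by (rule Z_bound[OF in_R(2)[OF that]])
 show "2 * (absum n t * B) \<le> rho / 2" using tau(2) mult_right_mono[OF t B] by linarith
 show "2 * (absum n t * K) \<le> 1 / 2" using tau(3) mult_right_mono[OF t K] by linarith
qed (use rho(1) K absum_nonneg in auto)

text \<open>\<open>sol t 1\<close> is the canonical map, exp(t_1 X_1 + ... + t_n X_n) applied to
  \<open>x0\<close>.\<close>

definition sol :: "pt => real => 'a" where
 "sol t = (SOME u. is_sol t u)"

lemma sol:
 assumes t: "absum n t \<le> tau"
 shows "sol t 0 = x0" "s \<in> {-2..2} ==> sol t s \<in> cball x0 (rho / 2)"
  "s \<in> {-2<..<2} ==> (sol t has_vector_derivative Z t (sol t s)) (at s)"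
proof -
 have s: "is_sol t (sol t)" unfolding sol_def using sol_exists[OF t] by (rule someI_ex)
 then show "sol t 0 = x0" "s \<in> {-2..2} ==> sol t s \<in> cball x0 (rho / 2)" by (auto simp: is_sol_def)
 show "(sol t has_vector_derivative Z t (sol t s)) (at s)" if "s \<in> {-2<..<2}"
 proof -
  have "s \<in> {-2..2}" using that by auto
  then have "(sol t has_vector_derivative Z t (sol t s)) (at s within {-2..2})"
   using s unfolding is_sol_def by blast
  moreover have "at s within {-2..2} = at s"
   by (rule at_within_interior) (use that in \<open>auto simp: interior_atLeastAtMost_real\<close>)
  ultimately show ?thesis by simp
 qed
qed

lemma sol_R: "absum n t \<le> tau ==> s \<in> {-2..2} ==> sol t s \<in> ball x0 R"
 using in_R(2)[OF sol(2)] by blast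

lemma sol_rho: "absum n t \<le> tau ==> s \<in> {-2..2} ==> sol t s \<in> ball x0 rho"
 using in_R(1)[OF sol(2)] by blast

lemma sol_P:
 assumes t: "absum n t \<le> tau" and s: "s \<in> {-2<..<2}"
 shows "P (sol t s - x0) = sol t s - x0"
proof -
 have lin: "linear P" using bounded_linear.linear[OF P(1)] .
 have "norm ((\<lambda>r. sol t r - P (sol t r)) s - (\<lambda>r. sol t r - P (sol t r)) 0) \<le> 0 * \<bar>s - 0\<bar>"
 proof (rule vector_derivative_bound[of "{-2<..<2}"])
  fix r :: real assume r: "r \<in> {-2<..<2}"
  show "((\<lambda>r. sol t r - P (sol t r)) has_vector_derivative (Z t (sol t r) - P (Z t (sol t r)))) (at r within {-2<..<2})"
   by (intro has_vector_derivative_diff bounded_linear.has_vector_derivative[OF P(1)]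
     has_vector_derivative_at_within[OF sol(3)[OF t r]])
  have "P (Z t (sol t r)) = Z t (sol t r)"
   unfolding Z_def linear_sum[OF lin] linear_cmul[OF lin] using P(2) np sol_R[OF t, of r] r by (intro sum.cong) auto
  then show "norm (Z t (sol t r) - P (Z t (sol t r))) \<le> 0" by simp
 qed (use s in auto)
 then have "P (sol t s) = sol t s - (x0 - P x0)" using sol(1)[OF t] by (simp add: algebra_simps)
 then show ?thesis unfolding linear_diff[OF lin] by simp
qed

lemma good_deriv:
 assumes fam: "good fam" and ws: "ws \<in> lists {..<n}" and t: "absum n t \<le> tau" and s: "s \<in> {-2<..<2}"
 shows "((\<lambda>s. fam ws (sol t s)) has_real_derivative (\<Sum>j<n. t j * fam (j # ws) (sol t s))) (at s)"
proof (rule derivative_along_combination[where a="-2" and b=2 and G="CC * QQ ^ Suc (length ws) * fact (Suc (length ws))"])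
 have j: "j # ws \<in> lists {..<n}" if "j < n" for j using ws that by auto
 show "along (fam ws) (\<lambda>j. fam (j # ws))" "continuous_on (ball x0 R) (fam ws)" using fam ws unfolding good_def by blast+
 show "continuous_on (ball x0 R) (fam (j # ws))" if "j < n" for j using fam j[OF that] unfolding good_def by blast
 show "\<bar>fam (j # ws) x\<bar> \<le> CC * QQ ^ Suc (length ws) * fact (Suc (length ws))" if "j < n" "x \<in> ball x0 R" for j x
 proof -
  have "\<bar>fam (j # ws) x\<bar> \<le> CC * QQ ^ length (j # ws) * fact (length (j # ws))"
   using fam j[OF that(1)] that(2) unfolding good_def by blast
  then show ?thesis by (simp only: length_Cons)
 qed
 show "0 \<le> CC * QQ ^ Suc (length ws) * fact (Suc (length ws))" using CQ by simp
 show "sol t s \<in> ball x0 rho" if "s \<in> {-2<..<2}" for s using sol_rho[OF t, of s] that by auto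
 show "(sol t has_vector_derivative (\<Sum>j<n. t j *\<^sub>R X j (sol t s))) (at s)" if "s \<in> {-2<..<2}" for s
  using sol(3)[OF t that] by (simp add: Z_def)
 show "P (sol t s - x0) = sol t s - x0" if "s \<in> {-2<..<2}" for s by (rule sol_P[OF t that])
qed (rule s)

lemma good_taylor:
 assumes fam: "good fam" and t: "absum n t \<le> tau" "absum n t * QQ \<le> 1 / 2" and r: "r \<in> {0..1}"
 shows "(\<lambda>m. tw n t m (\<lambda>ws. fam ws x0) / fact m * r ^ m) sums fam [] (sol t r)"
proof -
 have "(\<lambda>m. tw n t m ((\<lambda>r ws. fam ws (sol t r)) 0) / fact m * r ^ m) sums (\<lambda>r ws. fam ws (sol t r)) r []"
 proof (rule taylor_words[OF _ _ CQ(2) _ r])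
  show "\<bar>fam ws (sol t r)\<bar> \<le> CC * QQ ^ length ws * fact (length ws)" if "ws \<in> lists {..<n}" "r \<in> {0..1}" for ws r
   using fam that sol_R[OF t(1), of r] unfolding good_def by auto
  show "((\<lambda>r. fam ws (sol t r)) has_real_derivative (\<Sum>j<n. t j * fam (j # ws) (sol t r))) (at r)"
   if "ws \<in> lists {..<n}" "r \<in> {0..1}" for ws r
   using good_deriv[OF fam that(1) t(1), of r] that(2) by auto
  show "(\<Sum>j<n. \<bar>t j\<bar>) * QQ \<le> 1 / 2" using t(2) by (simp add: absum_def)
 qed
 then show ?thesis using sol(1)[OF t(1)] by simp
qed

lemma tw_x0_bound:
 assumes fam: "good fam" and ws: "ws \<in> lists {..<n}" "length ws = m"
 shows "\<bar>fam ws x0\<bar> \<le> fact m * (CC * QQ ^ m)"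
 using fam ws R unfolding good_def by (fastforce simp: mult_ac)

lemma tw_fact_anorm:
 assumes fam: "good fam" and e: "0 < e"
 shows "anorm n (cub n (\<lambda>_. 0) e) e ((real n * (2 * e)) ^ m * (CC * QQ ^ m)) (\<lambda>t. tw n t m (\<lambda>ws. fam ws x0) / fact m)"
proof -
 have U: "eopen n (cub n (\<lambda>_. 0) e)" by (rule eopen_cub)
 \<comment> \<open>On the cube of size \<open>e\<close> and for the radius \<open>e\<close>, a
   coordinate function has norm at most \<open>2 * e\<close>: \<open>e\<close> from its values and
   \<open>e\<close> from its derivative.\<close>
 have th: "anorm n (cub n (\<lambda>_. 0) e) e (2 * e) (\<lambda>t. t j)" if "j < n" for j
  using anorm_coord[OF U that order_refl, of e] e by simp
 have "anorm n (cub n (\<lambda>_. 0) e) e ((real n * (2 * e)) ^ m * (fact m * (CC * QQ ^ m))) (\<lambda>t. tw n t m (\<lambda>ws. fam ws x0))"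
  by (rule tw_anorm[OF U _ th]) (use e tw_x0_bound[OF fam] in auto)
 from anorm_cmult[OF U this, of "1 / fact m"] e show ?thesis by (simp add: field_simps)
qed

text \<open>The first bound keeps \<open>absum n t\<close> below \<open>tau\<close>. The second
  makes the Taylor series in \<open>t\<close> converge with ratio 1/4, the decay that
  \<open>lin_coef_anorm\<close> asks of the matrix. The added 1s cover \<open>n = 0\<close> and
  \<open>QQ = 0\<close>.\<close>

definition eps1 :: real where "eps1 = min (tau / (real n + 1)) (1 / (8 * (real n + 1) * (QQ + 1)))"

lemma eps1: "0 < eps1" "0 < e ==> e \<le> eps1 ==> real n * e \<le> tau" "0 < e ==> e \<le> eps1 ==> real n * (2 * e) * QQ \<le> 1 / 4"
proof -
 show "0 < eps1" using tau(1) CQ by (simp add: eps1_def)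
 assume e: "0 < e" "e \<le> eps1"
 have "real n * e \<le> (real n + 1) * (tau / (real n + 1))"
  using e tau(1) unfolding eps1_def by (intro mult_mono) auto
 then show "real n * e \<le> tau" by simp
 have "real n * (2 * e) * QQ \<le> (real n + 1) * (2 * (1 / (8 * (real n + 1) * (QQ + 1)))) * (QQ + 1)"
  using e CQ unfolding eps1_def by (intro mult_mono) auto
 also have "\<dots> = 1 / 4" using CQ by (simp add: field_simps add_nonneg_eq_0_iff)
 finally show "real n * (2 * e) * QQ \<le> 1 / 4" .
qed

lemma small_t:
 assumes e: "0 < e" "e \<le> eps1" and t: "t \<in> cub n (\<lambda>_. 0) e"
 shows "absum n t \<le> tau" "absum n t * QQ \<le> 1 / 2"
proof -
 show "absum n t \<le> tau" using absum_cub[OF t] eps1(2)[OF e] by linarith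
 have "real n * e \<le> real n * (2 * e)" using e(1) by (intro mult_left_mono) auto
 then have le: "absum n t \<le> real n * (2 * e)"
  using absum_cub[OF t] by (rule order_trans[rotated])
 have "absum n t * QQ \<le> real n * (2 * e) * QQ"
  by (rule mult_right_mono[OF le CQ(2)])
 then show "absum n t * QQ \<le> 1 / 2" using eps1(3)[OF e] by linarith
qed

lemma good_analytic:
 assumes fam: "good fam" and e: "0 < e" "e \<le> eps1"
 shows "analytic n (cub n (\<lambda>_. 0) e) (\<lambda>t. fam [] (sol t 1))"
proof -
 let ?U = "cub n (\<lambda>_. 0) e"
 have U: "eopen n ?U" by (rule eopen_cub)
 have "anorm n ?U e (\<Sum>m. (real n * (2 * e)) ^ m * (CC * QQ ^ m)) (\<lambda>t. \<Sum>m. tw n t m (\<lambda>ws. fam ws x0) / fact m)"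
 proof (rule anorm_suminf[OF U tw_fact_anorm[OF fam e(1)] _ e(1)])
  have "summable (\<lambda>m. CC * (real n * (2 * e) * QQ) ^ m)"
   using eps1(3)[OF e] e CQ by (intro summable_mult summable_geometric) (auto simp: abs_of_nonneg)
  then show "summable (\<lambda>m. (real n * (2 * e)) ^ m * (CC * QQ ^ m))" by (simp add: power_mult_distrib mult_ac)
 qed
 then have "analytic n ?U (\<lambda>t. \<Sum>m. tw n t m (\<lambda>ws. fam ws x0) / fact m)" by (rule anorm_analytic[OF _ e(1)])
 moreover have eq: "fam [] (sol t 1) = (\<Sum>m. tw n t m (\<lambda>ws. fam ws x0) / fact m)" if "t \<in> ?U" for t
  using good_taylor[OF fam small_t[OF e that], of 1] by (simp add: sums_iff)
 ultimately show ?thesis by (simp only: analytic_cong[OF U eq])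
qed

end

section \<open>The matrix of structure functions along a ray and the variational equation\<close>

locale analytic_frame = involutive_frame +
 fixes cfam :: "nat => nat => nat => nat list => 'a => real"
 assumes cfam: "a < n ==> k < p ==> l < p ==> good (cfam a k l)"
  "a < n ==> k < p ==> l < p ==> x \<in> ball x0 R ==> cfam a k l [] x = c a k l x"
begin

text \<open>The coefficient of \<open>r ^ j\<close> in the entry \<open>(k, l)\<close> of
  \<open>Cmat\<close>. The last two indices of \<open>cfam\<close> are transposed: the column is the
  field inside the bracket, the row the component of the result.\<close>

definition cc :: "nat => nat => nat => pt => real" where
 "cc j k l t = (\<Sum>a<n. t a * (tw n t j (\<lambda>ws. cfam a l k ws x0) / fact j))"

definition Cmat :: "pt => real => nat => nat => real" where
 "Cmat t r k l = (\<Sum>a<n. t a * c a l k (sol t r))"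

text \<open>Ensures the smallness required in \<open>lin_coef_anorm\<close> for
  \<open>\<delta> = real n * (2 * e) * CC\<close>.\<close>

definition eps2 :: real where "eps2 = min eps1 (1 / (16 * (real n + 1) * (CC + 1) * (real p + 1)))"

lemma eps2: "0 < eps2" "e \<le> eps2 ==> e \<le> eps1" "0 < e ==> e \<le> eps2 ==> 8 * real p * (real n * (2 * e) * CC) \<le> 1"
proof -
 show "0 < eps2" using eps1(1) CQ by (simp add: eps2_def)
 show "e \<le> eps1" if "e \<le> eps2" using that by (simp add: eps2_def)
 assume e: "0 < e" "e \<le> eps2"
 have "8 * real p * (real n * (2 * e) * CC) \<le> 8 * (real p + 1) * ((real n + 1) * (2 * (1 / (16 * (real n + 1) * (CC + 1) * (real p + 1)))) * (CC + 1))"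
  using e CQ unfolding eps2_def by (intro mult_mono) auto
 also have "\<dots> = 1" using CQ by (simp add: divide_simps add_nonneg_eq_0_iff) (simp add: algebra_simps)
 finally show "8 * real p * (real n * (2 * e) * CC) \<le> 1" .
qed

text \<open>The factor \<open>t a\<close> supplies the small constant, the Taylor expansion of the
  structure functions the geometric decay.\<close>

lemma cc_anorm:
 assumes e: "0 < e" "e \<le> eps2" and k: "k < p" "l < p"
 shows "anorm n (cub n (\<lambda>_. 0) e) e ((real n * (2 * e) * CC) * (1/4) ^ j) (cc j k l)"
proof -
 let ?U = "cub n (\<lambda>_. 0) e"
 have U: "eopen n ?U" by (rule eopen_cub)
 have "anorm n ?U e (2 * e) (\<lambda>t. t a)" if "a < n" for a
  using anorm_coord[OF U that order_refl, of e] e by simp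
 then have "anorm n ?U e (\<Sum>a<n. (2 * e) * ((real n * (2 * e)) ^ j * (CC * QQ ^ j))) (cc j k l)"
  unfolding cc_def using e k
  by (intro anorm_sum[OF U] anorm_mult[OF U] tw_fact_anorm cfam(1)) auto
 moreover have "(\<Sum>a<n. (2 * e) * ((real n * (2 * e)) ^ j * (CC * QQ ^ j))) \<le> (real n * (2 * e) * CC) * (1/4) ^ j"
 proof -
  have "(\<Sum>a<n. (2 * e) * ((real n * (2 * e)) ^ j * (CC * QQ ^ j))) = (real n * (2 * e) * CC) * (real n * (2 * e) * QQ) ^ j"
   by (simp add: power_mult_distrib mult_ac)
  also have "\<dots> \<le> (real n * (2 * e) * CC) * (1/4) ^ j"
   using eps1(3)[OF e(1) eps2(2)[OF e(2)]] e CQ by (intro mult_left_mono power_mono) auto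
  finally show ?thesis .
 qed
 ultimately show ?thesis by (rule anorm_mono)
qed

lemma cc_sums:
 assumes e: "0 < e" "e \<le> eps2" and t: "t \<in> cub n (\<lambda>_. 0) e" and k: "k < p" "l < p" and r: "r \<in> {0..1}"
 shows "(\<lambda>j. cc j k l t * r ^ j) sums Cmat t r k l"
proof -
 note st = small_t[OF e(1) eps2(2)[OF e(2)] t]
 have "(\<lambda>j. \<Sum>a<n. t a * (tw n t j (\<lambda>ws. cfam a l k ws x0) / fact j * r ^ j)) sums (\<Sum>a<n. t a * cfam a l k [] (sol t r))"
  using k by (intro sums_sum sums_mult good_taylor[OF cfam(1) st r]) auto
 moreover have "(\<Sum>a<n. t a * cfam a l k [] (sol t r)) = Cmat t r k l"
  unfolding Cmat_def using k cfam(2) sol_R[OF st(1), of r] r by (intro sum.cong) auto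
 ultimately show ?thesis by (simp add: cc_def sum_distrib_right mult.assoc)
qed

abbreviation v :: "pt => pt => nat => pt => real => real" where
 "v b v0 \<equiv> lin_sol p cc b v0"

lemma v_bound_exists:
 fixes b v0 :: pt
 shows "\<exists>V. \<forall>k<p. \<bar>v0 k\<bar> \<le> V \<and> \<bar>b k\<bar> \<le> V / 4"
proof -
 define V where "V = (\<Sum>k<p. \<bar>v0 k\<bar> + 4 * \<bar>b k\<bar>)"
 have "\<bar>v0 k\<bar> + 4 * \<bar>b k\<bar> \<le> V" if "k < p" for k
  unfolding V_def using that by (intro member_le_sum) auto
 then have "\<bar>v0 k\<bar> \<le> V \<and> \<bar>b k\<bar> \<le> V / 4" if "k < p" for k
  using that[THEN \<open>\<And>k. k < p ==> \<bar>v0 k\<bar> + 4 * \<bar>b k\<bar> \<le> V\<close>] by linarith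
 then show ?thesis by blast
qed

lemma v_analytic:
 assumes e: "0 < e" "e \<le> eps2" and k: "k < p"
 shows "analytic n (cub n (\<lambda>_. 0) e) (\<lambda>t. v b v0 k t 1)"
proof -
 obtain V where V: "\<And>k. k < p ==> \<bar>v0 k\<bar> \<le> V" "\<And>k. k < p ==> \<bar>b k\<bar> \<le> V / 4"
  using v_bound_exists[of v0 b] by blast
 have nn: "0 \<le> real n * (2 * e) * CC" using e CQ by simp
 show ?thesis
  by (rule anorm_analytic[OF lin_sol_anorm[OF eopen_cub e(1) cc_anorm[OF e] nn eps2(3)[OF e] V k] e(1)])
qed

lemma v_deriv:
 assumes e: "0 < e" "e \<le> eps2" and t: "t \<in> cub n (\<lambda>_. 0) e" and k: "k < p" and r: "r \<in> {0..1}"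
 shows "((\<lambda>r. v b v0 k t r) has_real_derivative b k - (\<Sum>l<p. Cmat t r k l * v b v0 l t r)) (at r)"
proof -
 obtain V where V: "\<And>k. k < p ==> \<bar>v0 k\<bar> \<le> V" "\<And>k. k < p ==> \<bar>b k\<bar> \<le> V / 4"
  using v_bound_exists[of v0 b] by blast
 have nn: "0 \<le> real n * (2 * e) * CC" using e CQ by simp
 have 1: "\<bar>lin_coef p cc b v0 m k t\<bar> \<le> V * (1/2) ^ m" if "k < p" for m k
  by (rule anorm_bound[OF lin_coef_anorm[OF eopen_cub less_imp_le[OF e(1)] cc_anorm[OF e] nn eps2(3)[OF e] V that] t])
 show ?thesis
 proof (rule lin_sol_deriv[where V=V and \<delta>="real n * (2 * e) * CC"])
  show "\<bar>cc j k l t\<bar> \<le> real n * (2 * e) * CC * (1/4) ^ j" if "k < p" "l < p" for j k l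
   by (rule anorm_bound[OF cc_anorm[OF e that] t])
  show "(\<lambda>j. cc j k l t * r ^ j) sums Cmat t r k l" if "l < p" for l by (rule cc_sums[OF e t k that r])
 qed (use 1 k r in auto)
qed

text \<open>A combination \<open>w = \<Sum>\<^sub>k v\<^sub>k X\<^sub>k\<close> along a solution satisfies the variational equation, with
  source \<open>\<Sum>\<^sub>k b\<^sub>k X\<^sub>k\<close>, if the coefficients satisfy \<open>v' = b - C v\<close>.\<close>

lemma variational:
 assumes t: "absum n t \<le> tau" and r: "r \<in> {0..1}"
  and v: "\<And>k. k < p ==> (f k has_real_derivative b k - (\<Sum>l<p. Cmat t r k l * f l r)) (at r)"
 shows "((\<lambda>r. \<Sum>k<p. f k r *\<^sub>R X k (sol t r)) has_vector_derivative
  ((\<Sum>k<p. b k *\<^sub>R X k (sol t r)) + (\<Sum>a<n. t a *\<^sub>R DX a (sol t r) (\<Sum>k<p. f k r *\<^sub>R X k (sol t r))))) (at r)"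
proof -
 define y where "y = sol t r"
 have y: "y \<in> ball x0 R" using sol_R[OF t, of r] r by (auto simp: y_def)
 have lin: "linear (DX j y)" if "j < p" for j
  using has_derivative_linear[OF deriv[OF that y]] .
 have Xd: "((\<lambda>r. X k (sol t r)) has_vector_derivative DX k y (Z t y)) (at r)" if "k < p" for k
 proof -
  have "(sol t has_derivative (\<lambda>h. h *\<^sub>R Z t y)) (at r)"
   using sol(3)[OF t, of r] r by (auto simp: has_vector_derivative_def y_def)
  from has_derivative_compose[OF this, of "X k" "DX k y"] deriv[OF that y]
  show ?thesis by (simp add: has_vector_derivative_def y_def linear_cmul[OF lin[OF that, unfolded y_def]])
 qed
 \<comment> \<open>The bracket relation exchanges which field is differentiated. This produces the
   term with \<open>Cmat\<close>, which the equation for the coefficients \<open>f\<close> is made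
   to cancel.\<close>
 have DZ: "DX k y (Z t y) = (\<Sum>a<n. t a *\<^sub>R DX a y (X k y)) + (\<Sum>l<p. Cmat t r l k *\<^sub>R X l y)" if k: "k < p" for k
 proof -
  have "DX k y (Z t y) = (\<Sum>a<n. t a *\<^sub>R DX k y (X a y))"
   by (simp add: Z_def linear_sum[OF lin[OF k]] linear_cmul[OF lin[OF k]])
  also have "\<dots> = (\<Sum>a<n. t a *\<^sub>R DX a y (X k y) + (\<Sum>l<p. (t a * c a k l y) *\<^sub>R X l y))"
  proof (rule sum.cong)
   fix a assume "a \<in> {..<n}"
   then have "DX k y (X a y) = DX a y (X k y) + (\<Sum>l<p. c a k l y *\<^sub>R X l y)"
    using comm[OF _ k y, of a] by (simp add: algebra_simps)
   then show "t a *\<^sub>R DX k y (X a y) = t a *\<^sub>R DX a y (X k y) + (\<Sum>l<p. (t a * c a k l y) *\<^sub>R X l y)"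
    by (simp add: scaleR_right_distrib scaleR_sum_right)
  qed simp
  also have "\<dots> = (\<Sum>a<n. t a *\<^sub>R DX a y (X k y)) + (\<Sum>l<p. \<Sum>a<n. (t a * c a k l y) *\<^sub>R X l y)"
   unfolding sum.distrib by (subst sum.swap[of _ "{..<p}"]) simp
  finally show ?thesis by (simp add: Cmat_def y_def scaleR_sum_left)
 qed
 have "((\<lambda>r. \<Sum>k<p. f k r *\<^sub>R X k (sol t r)) has_vector_derivative
   (\<Sum>k<p. f k r *\<^sub>R DX k y (Z t y) + (b k - (\<Sum>l<p. Cmat t r k l * f l r)) *\<^sub>R X k y)) (at r)"
  unfolding y_def
  by (intro has_vector_derivative_sum has_vector_derivative_scaleR v Xd[unfolded y_def]) auto
 also have "(\<Sum>k<p. f k r *\<^sub>R DX k y (Z t y) + (b k - (\<Sum>l<p. Cmat t r k l * f l r)) *\<^sub>R X k y)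
   = (\<Sum>k<p. f k r *\<^sub>R (\<Sum>a<n. t a *\<^sub>R DX a y (X k y))) + (\<Sum>k<p. f k r *\<^sub>R (\<Sum>l<p. Cmat t r l k *\<^sub>R X l y))
    + (\<Sum>k<p. b k *\<^sub>R X k y) - (\<Sum>k<p. (\<Sum>l<p. Cmat t r k l * f l r) *\<^sub>R X k y)"
  using DZ by (simp add: sum.distrib scaleR_right_distrib scaleR_left_diff_distrib sum_subtractf)
 also have "(\<Sum>k<p. f k r *\<^sub>R (\<Sum>l<p. Cmat t r l k *\<^sub>R X l y)) = (\<Sum>k<p. (\<Sum>l<p. Cmat t r k l * f l r) *\<^sub>R X k y)"
  unfolding scaleR_sum_left scaleR_sum_right by (subst sum.swap) (simp add: mult.commute)
 also have "(\<Sum>k<p. f k r *\<^sub>R (\<Sum>a<n. t a *\<^sub>R DX a y (X k y))) = (\<Sum>a<n. t a *\<^sub>R DX a y (\<Sum>k<p. f k r *\<^sub>R X k y))"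
 proof -
  have "(\<Sum>k<p. f k r *\<^sub>R (\<Sum>a<n. t a *\<^sub>R DX a y (X k y))) = (\<Sum>a<n. \<Sum>k<p. t a *\<^sub>R f k r *\<^sub>R DX a y (X k y))"
   unfolding scaleR_sum_right by (subst sum.swap) (simp add: mult.commute)
  also have "\<dots> = (\<Sum>a<n. t a *\<^sub>R DX a y (\<Sum>k<p. f k r *\<^sub>R X k y))"
  proof (rule sum.cong)
   fix a assume "a \<in> {..<n}"
   then have l: "linear (DX a y)" using lin np by simp
   show "(\<Sum>k<p. t a *\<^sub>R f k r *\<^sub>R DX a y (X k y)) = t a *\<^sub>R DX a y (\<Sum>k<p. f k r *\<^sub>R X k y)"
    by (simp add: linear_sum[OF l] linear_cmul[OF l] scaleR_sum_right)
  qed simp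
  finally show ?thesis .
 qed
 finally show ?thesis by (simp add: y_def add.commute)
qed

lemma DZ_bound:
 assumes "x \<in> ball x0 R"
 shows "norm (\<Sum>a<n. t a *\<^sub>R DX a x w) \<le> absum n t * (K * norm w)"
 using dbnd[OF _ assms] np by (intro norm_lincomb_le) auto

lemma tK: "absum n t \<le> tau ==> absum n t * K \<le> 1 / 2"
 using mult_right_mono[of "absum n t" tau K] tau(3) K mult_nonneg_nonneg[OF less_imp_le[OF tau(1)] K] by linarith

text \<open>The combination itself solves a homogeneous linear equation, even when the fields are
  dependent and its coefficients are not unique; the Gronwall estimate keeps it at 0.\<close>

lemma combination_zero:
 assumes t: "absum n t \<le> tau" and r: "r \<in> {0..1}"
  and v: "\<And>k r. k < p ==> r \<in> {0..1} ==> (f k has_real_derivative - (\<Sum>l<p. Cmat t r k l * f l r)) (at r)"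
  and 0: "(\<Sum>k<p. f k 0 *\<^sub>R X k x0) = 0"
 shows "(\<Sum>k<p. f k r *\<^sub>R X k (sol t r)) = 0"
proof -
 let ?w = "\<lambda>r. \<Sum>k<p. f k r *\<^sub>R X k (sol t r)"
 have "norm (?w r) \<le> 2 * 1 * 0"
 proof (rule gronwall_half[of 1 "1/2" 0 ?w, OF _ _ _ _ _ _ _ r])
  show "?w 0 = 0" using 0 sol(1)[OF t] by simp
  fix s :: real assume s: "s \<in> {0..1}"
  have "(?w has_vector_derivative ((\<Sum>k<p. 0 *\<^sub>R X k (sol t s)) + (\<Sum>a<n. t a *\<^sub>R DX a (sol t s) (?w s)))) (at s)"
   by (rule variational[OF t s]) (use v[OF _ s] in simp)
  then have "(?w has_vector_derivative (\<Sum>a<n. t a *\<^sub>R DX a (sol t s) (?w s))) (at s)"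
   by simp
  then show "(?w has_vector_derivative (\<Sum>a<n. t a *\<^sub>R DX a (sol t s) (?w s))) (at s within {0..1})"
   by (rule has_vector_derivative_at_within)
  have "norm (\<Sum>a<n. t a *\<^sub>R DX a (sol t s) (?w s)) \<le> absum n t * (K * norm (?w s))"
   using sol_R[OF t, of s] s by (intro DZ_bound) auto
  also have "\<dots> \<le> 1/2 * norm (?w s)"
   using mult_right_mono[OF tK[OF t] norm_ge_zero[of "?w s"]] by (simp add: mult.assoc)
  finally show "norm (\<Sum>a<n. t a *\<^sub>R DX a (sol t s) (?w s)) \<le> 1/2 * norm (?w s) + 0" by simp
 qed auto
 then show ?thesis by simp
qed

definition mu :: "nat => nat => pt => real => real" where
 "mu i = v (\<lambda>k. if k = i then 1 else 0) (\<lambda>_. 0)"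

text \<open>The candidate for the derivative of \<open>sol t r\<close> in \<open>t i\<close>,
  written as a combination of the fields from the outset; \<open>sol_differentiable\<close>
  identifies it at \<open>r = 1\<close>.\<close>

definition J :: "nat => pt => real => 'a" where
 "J i t r = (\<Sum>k<p. mu i k t r *\<^sub>R X k (sol t r))"

lemma J_deriv:
 assumes e: "0 < e" "e \<le> eps2" and t: "t \<in> cub n (\<lambda>_. 0) e" and r: "r \<in> {0..1}" and i: "i < n"
 shows "(J i t has_vector_derivative (X i (sol t r) + (\<Sum>a<n. t a *\<^sub>R DX a (sol t r) (J i t r)))) (at r)"
proof -
 have "(J i t has_vector_derivative ((\<Sum>k<p. (if k = i then 1 else 0) *\<^sub>R X k (sol t r)) +
   (\<Sum>a<n. t a *\<^sub>R DX a (sol t r) (\<Sum>k<p. mu i k t r *\<^sub>R X k (sol t r))))) (at r)"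
  unfolding J_def[abs_def] mu_def
  by (rule variational[OF small_t(1)[OF e(1) eps2(2)[OF e(2)] t] r]) (rule v_deriv[OF e t _ r])
 moreover have "(\<Sum>k<p. (if k = i then 1 else 0) *\<^sub>R X k (sol t r)) = (\<Sum>k<p. if k = i then X k (sol t r) else 0)"
  by (rule sum.cong) auto
 moreover have "\<dots> = X i (sol t r)" using i np by (simp add: sum.delta)
 ultimately show ?thesis by (simp add: J_def)
qed

section \<open>Dependence of the canonical map on its parameters\<close>

lemma sol_lipschitz:
 assumes t: "absum n t \<le> tau" "absum n t' \<le> tau" and r: "r \<in> {0..1}"
 shows "norm (sol t' r - sol t r) \<le> 2 * (absum n (\<lambda>i. t' i - t i) * B)"
proof -
 let ?u = "\<lambda>r. sol t' r - sol t r"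
 let ?h = "\<lambda>i. t' i - t i"
 have "norm (?u r) \<le> 2 * 1 * (absum n ?h * B)"
 proof (rule gronwall_half[of 1 "1/2" _ ?u, OF _ _ _ _ _ _ _ r])
  show "?u 0 = 0" using sol(1) t by simp
  show "0 \<le> absum n ?h * B" using absum_nonneg B by simp
  fix s :: real assume s: "s \<in> {0..1}"
  have sR: "sol t s \<in> ball x0 R" "sol t' s \<in> ball x0 R" using sol_R t s by auto
  show "(?u has_vector_derivative Z t' (sol t' s) - Z t (sol t s)) (at s within {0..1})"
   by (rule has_vector_derivative_at_within, rule has_vector_derivative_diff) (use s t in \<open>auto intro!: sol(3)\<close>)
  \<comment> \<open>One part comes from the displacement of the point, the other from the change of
    the parameters.\<close>
  have eq: "Z t' (sol t' s) - Z t (sol t s) = (Z t' (sol t' s) - Z t' (sol t s)) + Z ?h (sol t s)"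
   by (simp add: Z_def scaleR_left_diff_distrib sum_subtractf)
  have "norm (Z t' (sol t' s) - Z t (sol t s)) \<le> absum n t' * (K * norm (?u s)) + absum n ?h * B"
   unfolding eq
   using Z_lip[OF sR(2,1), of t'] Z_bound[OF sR(1), of ?h] norm_triangle_ineq[of "Z t' (sol t' s) - Z t' (sol t s)" "Z ?h (sol t s)"]
   by linarith
  also have "\<dots> \<le> 1/2 * norm (?u s) + absum n ?h * B"
   using mult_right_mono[OF tK[OF t(2)] norm_ge_zero[of "?u s"]] by (simp add: mult.assoc)
  finally show "norm (Z t' (sol t' s) - Z t (sol t s)) \<le> 1/2 * norm (?u s) + absum n ?h * B" .
 qed auto
 then show ?thesis by simp
qed

text \<open>The mean value inequality for \<open>X j - DX j x\<close> on a small ball, uniform in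
  the point and in \<open>j\<close> through \<open>unif\<close>. For fields of class C^1 this takes
  the place of a quadratic error bound.\<close>

lemma linearization:
 assumes "e > 0"
 shows "\<exists>d>0. \<forall>j<p. \<forall>x\<in>ball x0 R. \<forall>y\<in>ball x0 R. dist x y < d \<longrightarrow>
  norm (X j y - X j x - DX j x (y - x)) \<le> e * norm (y - x)"
proof -
 obtain d where d: "d > 0" "\<And>j x y v. j < p ==> x \<in> ball x0 R ==> y \<in> ball x0 R ==> dist x y < d ==>
   norm (DX j x v - DX j y v) \<le> e * norm v"
  using unif[OF assms] by blast
 have "norm (X j y - X j x - DX j x (y - x)) \<le> e * norm (y - x)"
  if j: "j < p" and x: "x \<in> ball x0 R" and y: "y \<in> ball x0 R" and xy: "dist x y < d" for j x y
 proof -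
  let ?S = "ball x0 R \<inter> ball x d"
  let ?g = "\<lambda>z. X j z - DX j x z"
  have bl: "bounded_linear (DX j x)" using has_derivative_bounded_linear[OF deriv[OF j x]] .
  have "norm (?g y - ?g x) \<le> e * norm (y - x)"
  proof (rule differentiable_bound[of ?S ?g "\<lambda>z v. DX j z v - DX j x v"])
   show "convex ?S" by (intro convex_Int convex_ball)
   show "(?g has_derivative (\<lambda>v. DX j z v - DX j x v)) (at z within ?S)" if "z \<in> ?S" for z
    using that by (intro has_derivative_diff has_derivative_at_withinI[OF deriv[OF j]] bounded_linear_imp_has_derivative bl) auto
   show "onorm (\<lambda>v. DX j z v - DX j x v) \<le> e" if "z \<in> ?S" for z
    using d(2)[OF j _ x, of z] that assms by (intro onorm_bound) (auto simp: dist_commute)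
  qed (use x y xy d in auto)
  moreover have "?g y - ?g x = X j y - X j x - DX j x (y - x)"
   using linear_diff[OF bounded_linear.linear[OF bl]] by simp
  ultimately show ?thesis by simp
 qed
 then show ?thesis using d(1) by blast
qed

text \<open>The error of the linear approximation satisfies the variational equation with a source
  bounded by \<open>\<kappa>\<close>, which is small compared to the increment; the Gronwall
  estimate then bounds the error by \<open>2 * \<kappa>\<close>.\<close>

lemma sol_differentiable:
 assumes e: "0 < e" "e \<le> eps2" and t: "t \<in> cub n (\<lambda>_. 0) e" and \<eta>: "\<eta> > 0"
 shows "\<exists>d>0. \<forall>t'. absum n t' \<le> tau \<longrightarrow> absum n (\<lambda>i. t' i - t i) < d \<longrightarrow>
  norm (sol t' 1 - sol t 1 - (\<Sum>i<n. (t' i - t i) *\<^sub>R J i t 1)) \<le> \<eta> * absum n (\<lambda>i. t' i - t i)"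
proof -
 have t\<tau>: "absum n t \<le> tau" by (rule small_t(1)[OF e(1) eps2(2)[OF e(2)] t])
 \<comment> \<open>Chosen together with \<open>d\<close> so that each of the two parts of
   \<open>2 * \<kappa>\<close> is at most half of \<open>\<eta>\<close> times the increment.\<close>
 define \<zeta> where "\<zeta> = \<eta> / (8 * (tau + 1) * (B + 1))"
 have \<zeta>: "\<zeta> > 0" using \<eta> tau(1) B by (simp add: \<zeta>_def)
 obtain d0 where d0: "d0 > 0" "\<And>j x y. j < p ==> x \<in> ball x0 R ==> y \<in> ball x0 R ==> dist x y < d0 ==>
   norm (X j y - X j x - DX j x (y - x)) \<le> \<zeta> * norm (y - x)"
  using linearization[OF \<zeta>] by blast
 define d where "d = min (d0 / (2 * (B + 1))) (\<eta> / (8 * (K + 1) * (B + 1)))"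
 have d: "d > 0" using d0 \<eta> B K by (simp add: d_def)
 have "norm (sol t' 1 - sol t 1 - (\<Sum>i<n. (t' i - t i) *\<^sub>R J i t 1)) \<le> \<eta> * absum n (\<lambda>i. t' i - t i)"
  if t': "absum n t' \<le> tau" and hd: "absum n (\<lambda>i. t' i - t i) < d" for t'
 proof -
  define h where "h = (\<lambda>i. t' i - t i)"
  define A where "A = absum n h"
  have A: "A \<ge> 0" "A < d" using absum_nonneg hd by (auto simp: A_def h_def)
  let ?u = "\<lambda>r. sol t' r - sol t r - (\<Sum>i<n. h i *\<^sub>R J i t r)"
  let ?u' = "\<lambda>r. Z t' (sol t' r) - Z t (sol t r) - (\<Sum>i<n. h i *\<^sub>R (X i (sol t r) + (\<Sum>a<n. t a *\<^sub>R DX a (sol t r) (J i t r))))"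
  \<comment> \<open>\<open>2 * (A * B)\<close> is the distance of the two solutions according to
    \<open>sol_lipschitz\<close>.\<close>
  define \<kappa> where "\<kappa> = (absum n t * \<zeta> + A * K) * (2 * (A * B))"
  have \<kappa>: "\<kappa> \<ge> 0" unfolding \<kappa>_def using absum_nonneg[of n t] \<zeta> A K B by simp
  have "norm (?u 1) \<le> 2 * 1 * \<kappa>"
  proof (rule gronwall_half[of 1 "1/2" \<kappa> ?u ?u' 1])
   have "J i t 0 = 0" for i
    by (simp add: J_def mu_def lin_sol_0)
   then show "?u 0 = 0" using sol(1) t\<tau> t' by simp
   fix s :: real assume s: "s \<in> {0..1}"
   define y where "y = sol t s"
   define y' where "y' = sol t' s"
   have yR: "y \<in> ball x0 R" "y' \<in> ball x0 R" using sol_R t\<tau> t' s by (auto simp: y_def y'_def)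
   have lin: "linear (DX j y)" if "j < p" for j
    using has_derivative_linear[OF deriv[OF that yR(1)]] .
   show "(?u has_vector_derivative ?u' s) (at s within {0..1})"
    by (rule has_vector_derivative_at_within)
     (use s in \<open>intro has_vector_derivative_diff sol(3) t\<tau> t' has_vector_derivative_sum
      bounded_linear.has_vector_derivative[OF bounded_linear_scaleR_right] J_deriv[OF e t s]; auto\<close>)
   have yy: "norm (y' - y) \<le> 2 * (A * B)"
    using sol_lipschitz[OF t\<tau> t' s] by (simp add: y_def y'_def A_def h_def)
   have "2 * (A * B) \<le> A * (2 * (B + 1))" using A by (simp add: algebra_simps)
   also have "\<dots> < d0" using A(2) B by (simp add: d_def pos_less_divide_eq)
   finally have yd: "dist y y' < d0" using yy by (simp add: dist_norm norm_minus_commute)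
   let ?R = "\<lambda>a. X a y' - X a y - DX a y (y' - y)"
   \<comment> \<open>The equation of the error: linearization remainder, product of two increments,
     and the homogeneous part acting on the error itself.\<close>
   have "?u' s = (\<Sum>a<n. t a *\<^sub>R ?R a) + (\<Sum>a<n. h a *\<^sub>R (X a y' - X a y)) + (\<Sum>a<n. t a *\<^sub>R DX a y (?u s))"
   proof -
    have D: "DX a y (?u s) = DX a y (y' - y) - (\<Sum>i<n. h i *\<^sub>R DX a y (J i t s))" if "a < n" for a
    proof -
     have l: "linear (DX a y)" using lin that np by simp
     show ?thesis by (simp add: linear_diff[OF l] linear_sum[OF l] linear_cmul[OF l] flip: y_def y'_def)
    qed
    have "(\<Sum>a<n. t a *\<^sub>R DX a y (?u s)) = (\<Sum>a<n. t a *\<^sub>R DX a y (y' - y)) - (\<Sum>a<n. \<Sum>i<n. t a *\<^sub>R h i *\<^sub>R DX a y (J i t s))"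
     using D by (simp add: scaleR_right_diff_distrib sum_subtractf scaleR_sum_right)
    moreover have "(\<Sum>i<n. h i *\<^sub>R (\<Sum>a<n. t a *\<^sub>R DX a y (J i t s))) = (\<Sum>a<n. \<Sum>i<n. t a *\<^sub>R h i *\<^sub>R DX a y (J i t s))"
     unfolding scaleR_sum_right by (subst sum.swap) (simp add: mult.commute)
    moreover have "?u' s = (\<Sum>a<n. t' a *\<^sub>R X a y') - (\<Sum>a<n. t a *\<^sub>R X a y) - (\<Sum>a<n. h a *\<^sub>R X a y)
      - (\<Sum>i<n. h i *\<^sub>R (\<Sum>a<n. t a *\<^sub>R DX a y (J i t s)))"
     by (simp add: Z_def y_def y'_def scaleR_right_distrib sum.distrib)
    moreover have "(\<Sum>a<n. t' a *\<^sub>R X a y') = (\<Sum>a<n. t a *\<^sub>R X a y') + (\<Sum>a<n. h a *\<^sub>R X a y')"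
     by (simp add: h_def scaleR_left_diff_distrib sum_subtractf)
    ultimately show ?thesis
     by (simp add: scaleR_right_diff_distrib sum_subtractf)
   qed
   moreover have "norm (\<Sum>a<n. t a *\<^sub>R ?R a) \<le> absum n t * (\<zeta> * (2 * (A * B)))"
   proof (rule norm_lincomb_le)
    fix a assume "a < n"
    then have "norm (?R a) \<le> \<zeta> * norm (y' - y)" using d0(2)[OF _ yR yd] np by simp
    also have "\<dots> \<le> \<zeta> * (2 * (A * B))" using yy \<zeta> by (intro mult_left_mono) auto
    finally show "norm (?R a) \<le> \<zeta> * (2 * (A * B))" .
   qed
   moreover have "norm (\<Sum>a<n. h a *\<^sub>R (X a y' - X a y)) \<le> A * (K * (2 * (A * B)))"
    unfolding A_def
   proof (rule norm_lincomb_le)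
    fix a assume "a < n"
    then have "norm (X a y' - X a y) \<le> K * norm (y' - y)" using lip[OF _ yR(2,1)] np by simp
    also have "\<dots> \<le> K * (2 * (A * B))" using yy K by (intro mult_left_mono) auto
    finally show "norm (X a y' - X a y) \<le> K * (2 * (absum n h * B))" by (simp add: A_def)
   qed
   moreover have "norm (\<Sum>a<n. t a *\<^sub>R DX a y (?u s)) \<le> 1/2 * norm (?u s)"
    using DZ_bound[OF yR(1), of t "?u s"] mult_right_mono[OF tK[OF t\<tau>] norm_ge_zero[of "?u s"]]
    by (simp add: mult.assoc)
   ultimately show "norm (?u' s) \<le> 1/2 * norm (?u s) + \<kappa>"
    using norm_triangle_ineq[of "(\<Sum>a<n. t a *\<^sub>R ?R a) + (\<Sum>a<n. h a *\<^sub>R (X a y' - X a y))" "\<Sum>a<n. t a *\<^sub>R DX a y (?u s)"]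
     norm_triangle_ineq[of "\<Sum>a<n. t a *\<^sub>R ?R a" "\<Sum>a<n. h a *\<^sub>R (X a y' - X a y)"]
    by (simp add: \<kappa>_def algebra_simps)
  qed (use \<kappa> in auto)
  also have "2 * 1 * \<kappa> \<le> \<eta> * A"
  proof -
   have 1: "absum n t * \<zeta> * (4 * B) \<le> \<eta> / 2"
   proof -
    have "absum n t * \<zeta> * (4 * B) \<le> (tau + 1) * \<zeta> * (4 * (B + 1))"
     using t\<tau> \<zeta> B absum_nonneg[of n t] tau(1) by (intro mult_mono) auto
    also have "\<dots> = \<eta> / 2" using tau(1) B by (simp add: \<zeta>_def divide_simps) (simp add: algebra_simps)
    finally show ?thesis .
   qed
   have 2: "A * K * (4 * B) \<le> \<eta> / 2"
   proof -
    have "A * K * (4 * B) \<le> (\<eta> / (8 * (K + 1) * (B + 1))) * (K + 1) * (4 * (B + 1))"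
     using A K B \<eta> by (intro mult_mono) (auto simp: d_def intro!: divide_nonneg_nonneg mult_nonneg_nonneg)
    also have "\<dots> = \<eta> / 2" using K B by (simp add: divide_simps) (simp add: algebra_simps)
    finally show ?thesis .
   qed
   have "2 * 1 * \<kappa> = (absum n t * \<zeta> * (4 * B) + A * K * (4 * B)) * A" by (simp add: \<kappa>_def algebra_simps)
   also have "\<dots> \<le> \<eta> * A" using 1 2 A(1) by (intro mult_right_mono) auto
   finally show ?thesis .
  qed
  finally show ?thesis by (simp add: h_def A_def)
 qed
 then show ?thesis using d by blast
qed

end

text \<open>The determinant is 1 at the centre, hence at least 1/2 in absolute value on a smaller
  cube, where its reciprocal is analytic.\<close>

lemma minv_analytic_near_0:
 assumes e0: "0 < e0"
  and a: "\<And>i j. i < m ==> j < m ==> analytic n (cub n (\<lambda>_. 0) e0) (a i j)"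
  and 0: "\<And>i j. i < m ==> j < m ==> a i j (\<lambda>_. 0) = (if i = j then 1 else 0)"
 shows "\<exists>e1>0. e1 \<le> e0 \<and> (\<forall>t\<in>cub n (\<lambda>_. 0) e1. mdet m a t \<noteq> 0) \<and>
  (\<forall>i<m. \<forall>j<m. analytic n (cub n (\<lambda>_. 0) e1) (minv m a i j))"
proof -
 let ?U = "cub n (\<lambda>_. 0)"
 interpret A0: function_algebra "analytic n (?U e0)" by (rule function_algebra_analytic[OF eopen_cub])
 have det: "analytic n (?U e0) (mdet m a)"
  unfolding mdet_def[abs_def] by (rule A0.det) (rule a)
 have 1: "mdet m a (\<lambda>_. 0) = 1" by (rule mdet_one) (rule 0)
 have in0: "(\<lambda>_. 0) \<in> ?U e0" using e0 by (intro centre_in_cub) auto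
 have half: "(0::real) < 1/2" by simp
 have cont: "continuous_on (?U e0) (mdet m a)"
  by (rule Ck_on_continuous[OF eopen_cub smooth_Ck[OF analytic_smooth[OF det], of 0]])
 obtain e1 where e1': "e1 > 0" "?U e1 \<subseteq> ?U e0" "\<And>t. t \<in> ?U e1 ==> \<bar>mdet m a t - mdet m a (\<lambda>_. 0)\<bar> < 1/2"
  using continuous_on_cubE[OF eopen_cub cont in0 half] by metis
 note e1 = e1'(1,3)
 define e2 where "e2 = min e0 e1"
 have e2: "0 < e2" "e2 \<le> e0" "?U e2 \<subseteq> ?U e0" "?U e2 \<subseteq> ?U e1"
  using e0 e1 by (auto simp: e2_def intro!: cub_mono)
 have big: "\<bar>mdet m a t\<bar> \<ge> 1/2" if "t \<in> ?U e2" for t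
  using e1(2)[of t] e2(4) that 1 by (auto simp: abs_if split: if_splits)
 interpret A2: function_algebra "analytic n (?U e2)" by (rule function_algebra_analytic[OF eopen_cub])
 have "analytic n (?U e2) (minv m a i j)" if "i < m" "j < m" for i j
  by (rule A2.minv[OF analytic_subset[OF a e2(3)] analytic_inverse[OF eopen_cub analytic_subset[OF det e2(3)] _ big] that]) auto
 moreover have "mdet m a t \<noteq> 0" if "t \<in> ?U e2" for t using big[OF that] by auto
 ultimately show ?thesis using e2 by blast
qed

context analytic_frame
begin

lemma sol_zero:
 assumes "r \<in> {0..1}"
 shows "sol (\<lambda>_. 0) r = x0"
proof -
 have t: "absum n (\<lambda>_. 0) \<le> tau" using tau(1) by (simp add: absum_def)
 have "norm (sol (\<lambda>_. 0) r - sol (\<lambda>_. 0) 0) \<le> 0 * \<bar>r - 0\<bar>"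
 proof (rule vector_derivative_bound[of "{0..1}"])
  fix s :: real assume "s \<in> {0..1}"
  then show "(sol (\<lambda>_. 0) has_vector_derivative Z (\<lambda>_. 0) (sol (\<lambda>_. 0) s)) (at s within {0..1})"
   by (intro has_vector_derivative_at_within[OF sol(3)[OF t]]) auto
  show "norm (Z (\<lambda>_. 0) (sol (\<lambda>_. 0) s)) \<le> 0" by (simp add: Z_def)
 qed (use assms in auto)
 then show ?thesis using sol(1)[OF t] by simp
qed

lemma cc_zero: "cc j k l (\<lambda>_. 0) = 0"
 by (simp add: cc_def)

lemma J_zero: "i < n ==> J i (\<lambda>_. 0) 1 = X i x0"
proof -
 assume i: "i < n"
 have "J i (\<lambda>_. 0) 1 = (\<Sum>k<p. if k = i then X k x0 else 0)"
  unfolding J_def mu_def by (rule sum.cong) (auto simp: lin_sol_trivial cc_zero sol_zero)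
 then show ?thesis using i np by (simp add: sum.delta)
qed

text \<open>The fields along the ray and the solutions of the variational equation are related by a linear
  equation with analytic coefficients, although the fields themselves are only \<open>C\<^sup>1\<close>: with \<open>R' = -C R\<close>,
  every column of \<open>(X\<^sub>1 \<dots> X\<^sub>p) R\<close> solves the homogeneous variational equation, so that linear relations
  between the columns persist from \<open>x\<^sub>0\<close>.\<close>

theorem canonical_coordinates:
 "\<exists>e0 W. 0 < e0 \<and> e0 \<le> eps2 \<and> (\<forall>k<p. \<forall>i<n. analytic n (cub n (\<lambda>_. 0) e0) (W k i)) \<and>
  (\<forall>t\<in>cub n (\<lambda>_. 0) e0. \<forall>k<p. X k (sol t 1) = (\<Sum>i<n. W k i t *\<^sub>R J i t 1))"
proof -
 let ?U = "cub n (\<lambda>_. 0)"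
 have x0R: "x0 \<in> ball x0 R" using R by simp
 have "\<forall>k. \<exists>s. k < p \<longrightarrow> X k x0 = (\<Sum>i<n. s i *\<^sub>R X i x0)"
  using frame[OF x0R P(2)[OF _ x0R]] by blast
 then obtain s where s: "\<And>k. k < p ==> X k x0 = (\<Sum>i<n. s k i *\<^sub>R X i x0)" by metis
 \<comment> \<open>For the frame fields themselves the unit vectors are chosen, so that the matrix
   \<open>N\<close> below is the identity at 0.\<close>
 define \<beta> where "\<beta> k i = (if k < n then if i = k then 1 else 0 else s k i)" for k i
 have \<beta>: "X k x0 = (\<Sum>i<n. \<beta> k i *\<^sub>R X i x0)" if "k < p" for k
 proof (cases "k < n")
  case True
  then have "(\<Sum>i<n. \<beta> k i *\<^sub>R X i x0) = (\<Sum>i<n. if i = k then X i x0 else 0)"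
   by (intro sum.cong) (auto simp: \<beta>_def)
  then show ?thesis using True by (simp add: sum.delta)
 next
  case False
  then show ?thesis using s[OF that] by (simp add: \<beta>_def)
 qed
 \<comment> \<open>The fundamental matrix of R' = -C R, the identity at time 0, taken at time
   1.\<close>
 define Rm where "Rm l k t = v (\<lambda>_. 0) (\<lambda>l. if l = k then 1 else 0) l t 1" for l k t
 define E where "E k t = (\<Sum>l<p. Rm l k t *\<^sub>R X l (sol t 1))" for k t
 have E: "E k t = (\<Sum>i<n. \<beta> k i *\<^sub>R E i t)" if k: "k < p" and t: "t \<in> ?U eps2" for k t
 proof -
  \<comment> \<open>The coefficients of column \<open>k\<close> minus the corresponding combination
    of the first \<open>n\<close> columns.\<close>
  define f where "f l r = v (\<lambda>_. 0) (\<lambda>l. if l = k then 1 else 0) l t r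
   - (\<Sum>i<n. \<beta> k i * v (\<lambda>_. 0) (\<lambda>l. if l = i then 1 else 0) l t r)" for l r
  have "(\<Sum>l<p. f l 1 *\<^sub>R X l (sol t 1)) = 0"
  proof (rule combination_zero[OF small_t(1)[OF eps2(1) eps2(2)[OF order_refl] t]])
   fix l r assume l: "l < p" and r: "r \<in> {0..(1::real)}"
   note vd = v_deriv[OF eps2(1) order_refl t l r, of "\<lambda>_. 0"]
   have "(f l has_real_derivative (0 - (\<Sum>m<p. Cmat t r l m * v (\<lambda>_. 0) (\<lambda>l. if l = k then 1 else 0) m t r))
     - (\<Sum>i<n. \<beta> k i * (0 - (\<Sum>m<p. Cmat t r l m * v (\<lambda>_. 0) (\<lambda>l. if l = i then 1 else 0) m t r)))) (at r)"
    unfolding f_def[abs_def] by (intro DERIV_diff DERIV_sum DERIV_cmult vd)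
   moreover have "(\<Sum>m<p. Cmat t r l m * f m r) = (\<Sum>m<p. Cmat t r l m * v (\<lambda>_. 0) (\<lambda>l. if l = k then 1 else 0) m t r)
     - (\<Sum>i<n. \<beta> k i * (\<Sum>m<p. Cmat t r l m * v (\<lambda>_. 0) (\<lambda>l. if l = i then 1 else 0) m t r))"
   proof -
    have "(\<Sum>m<p. \<Sum>i<n. Cmat t r l m * (\<beta> k i * v (\<lambda>_. 0) (\<lambda>l. if l = i then 1 else 0) m t r))
     = (\<Sum>i<n. \<Sum>m<p. \<beta> k i * (Cmat t r l m * v (\<lambda>_. 0) (\<lambda>l. if l = i then 1 else 0) m t r))"
     by (subst sum.swap) (simp add: mult.left_commute)
    then show ?thesis by (simp add: f_def right_diff_distrib sum_subtractf sum_distrib_left)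
   qed
   ultimately show "(f l has_real_derivative - (\<Sum>m<p. Cmat t r l m * f m r)) (at r)"
    by (simp add: sum_negf)
  next
   have "(\<Sum>l<p. (if l = j then 1 else 0) *\<^sub>R X l x0) = X j x0" if "j < p" for j
   proof -
    have "(\<Sum>l<p. (if l = j then 1 else 0) *\<^sub>R X l x0) = (\<Sum>l<p. if l = j then X l x0 else 0)"
     by (rule sum.cong) auto
    then show ?thesis using that by (simp add: sum.delta)
   qed
   note d = this
   have "(\<Sum>l<p. f l 0 *\<^sub>R X l x0) = (\<Sum>l<p. (if l = k then 1 else 0) *\<^sub>R X l x0)
     - (\<Sum>l<p. \<Sum>i<n. \<beta> k i *\<^sub>R ((if l = i then 1 else 0) *\<^sub>R X l x0))"
    by (simp add: f_def lin_sol_0 scaleR_left_diff_distrib sum_subtractf scaleR_sum_left)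
   also have "(\<Sum>l<p. \<Sum>i<n. \<beta> k i *\<^sub>R ((if l = i then 1 else 0) *\<^sub>R X l x0))
     = (\<Sum>i<n. \<beta> k i *\<^sub>R (\<Sum>l<p. (if l = i then 1 else 0) *\<^sub>R X l x0))"
    unfolding scaleR_sum_right by (rule sum.swap)
   also have "\<dots> = (\<Sum>i<n. \<beta> k i *\<^sub>R X i x0)"
    using d np by (intro sum.cong) auto
   finally show "(\<Sum>l<p. f l 0 *\<^sub>R X l x0) = 0" using d[OF k] \<beta>[OF k] by simp
  qed auto
  moreover have "(\<Sum>l<p. f l 1 *\<^sub>R X l (sol t 1)) = E k t - (\<Sum>i<n. \<beta> k i *\<^sub>R E i t)"
  proof -
   have "(\<Sum>l<p. \<Sum>i<n. (\<beta> k i * Rm l i t) *\<^sub>R X l (sol t 1)) = (\<Sum>i<n. \<beta> k i *\<^sub>R E i t)"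
    unfolding E_def scaleR_sum_right by (subst sum.swap) simp
   then show ?thesis
    by (simp add: f_def E_def Rm_def[symmetric] scaleR_left_diff_distrib sum_subtractf scaleR_sum_left)
  qed
  ultimately show ?thesis by simp
 qed
 have Rm_an: "analytic n (?U eps2) (Rm l k)" if "l < p" for l k
  unfolding Rm_def by (rule v_analytic[OF eps2(1) order_refl that])
 have Rm0: "Rm l k (\<lambda>_. 0) = (if l = k then 1 else 0)" if "l < p" for l k
  unfolding Rm_def using that by (simp add: lin_sol_trivial cc_zero)
 obtain e1 where e1: "e1 > 0" "e1 \<le> eps2" "\<And>t. t \<in> ?U e1 ==> mdet p Rm t \<noteq> 0"
  "\<And>i j. i < p ==> j < p ==> analytic n (?U e1) (minv p Rm i j)"
  using minv_analytic_near_0[OF eps2(1) Rm_an Rm0] by metis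
 \<comment> \<open>Inverting \<open>Rm\<close> expresses the fields by all \<open>p\<close> columns,
   and \<open>\<beta>\<close> reduces these to the first \<open>n\<close> columns.\<close>
 define G where "G i m t = (\<Sum>k<p. minv p Rm k m t * \<beta> k i)" for i m t
 have XG: "X m (sol t 1) = (\<Sum>i<n. G i m t *\<^sub>R E i t)" if m: "m < p" and t: "t \<in> ?U e1" for m t
 proof -
  have t2: "t \<in> ?U eps2" using t cub_mono[OF e1(2)] by blast
  have "(\<Sum>i<n. G i m t *\<^sub>R E i t) = (\<Sum>k<p. minv p Rm k m t *\<^sub>R (\<Sum>i<n. \<beta> k i *\<^sub>R E i t))"
   unfolding G_def scaleR_sum_left scaleR_sum_right by (subst sum.swap) simp
  also have "\<dots> = (\<Sum>k<p. minv p Rm k m t *\<^sub>R E k t)"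
   using E[OF _ t2] by (intro sum.cong) auto
  also have "\<dots> = (\<Sum>l<p. (\<Sum>k<p. Rm l k t * minv p Rm k m t) *\<^sub>R X l (sol t 1))"
   unfolding E_def scaleR_sum_left scaleR_sum_right by (subst sum.swap) (simp add: mult.commute)
  also have "\<dots> = (\<Sum>l<p. if l = m then X l (sol t 1) else 0)"
   using minv_inverse(2)[OF e1(3)[OF t] _ m] by (intro sum.cong) auto
  finally show ?thesis using m by (simp add: sum.delta)
 qed
 have in0: "(\<lambda>_. 0) \<in> ?U e1" using e1(1) by (intro centre_in_cub) auto
 have minv0: "minv p Rm l m (\<lambda>_. 0) = (if l = m then 1 else 0)" if "l < p" "m < p" for l m
 proof -
  have "(\<Sum>k<p. Rm l k (\<lambda>_. 0) * minv p Rm k m (\<lambda>_. 0)) = (\<Sum>k<p. if k = l then minv p Rm k m (\<lambda>_. 0) else 0)"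
   by (rule sum.cong) (use Rm0[OF that(1)] in auto)
  then show ?thesis using minv_inverse(2)[OF e1(3)[OF in0] that] that by (simp add: sum.delta)
 qed
 have G0: "G i m (\<lambda>_. 0) = \<beta> m i" if "m < p" for i m
 proof -
  have "G i m (\<lambda>_. 0) = (\<Sum>k<p. if k = m then \<beta> k i else 0)"
   unfolding G_def by (rule sum.cong) (use minv0 that in auto)
  then show ?thesis using that by (simp add: sum.delta)
 qed
 interpret A1: function_algebra "analytic n (?U e1)" by (rule function_algebra_analytic[OF eopen_cub])
 have G_an: "analytic n (?U e1) (G i m)" if "m < p" for i m
  unfolding G_def using that by (intro A1.sum A1.mult e1(4) A1.const) auto
 \<comment> \<open>The derivatives \<open>J i\<close> in terms of the same \<open>n\<close> columns;
   inverting \<open>N\<close> near 0 eliminates the columns and leaves the fields in terms of the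
   \<open>J i\<close>.\<close>
 define N where "N i' i t = (\<Sum>k<p. G i' k t * mu i k t 1)" for i' i t
 have N_an: "analytic n (?U e1) (N i' i)" for i' i
  unfolding N_def mu_def
  by (intro A1.sum A1.mult G_an analytic_subset[OF v_analytic[OF eps2(1) order_refl] cub_mono[OF e1(2)]]) auto
 have N0: "N i' i (\<lambda>_. 0) = (if i' = i then 1 else 0)" if "i' < n" "i < n" for i' i
 proof -
  have "N i' i (\<lambda>_. 0) = (\<Sum>k<p. if k = i then \<beta> k i' else 0)"
   unfolding N_def mu_def by (rule sum.cong) (auto simp: G0 lin_sol_trivial cc_zero)
  then show ?thesis using that np by (simp add: sum.delta \<beta>_def)
 qed
 have JN: "J i t 1 = (\<Sum>i'<n. N i' i t *\<^sub>R E i' t)" if t: "t \<in> ?U e1" for i t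
 proof -
  have "J i t 1 = (\<Sum>k<p. mu i k t 1 *\<^sub>R (\<Sum>i'<n. G i' k t *\<^sub>R E i' t))"
   unfolding J_def using XG[OF _ t] by (intro sum.cong) auto
  also have "\<dots> = (\<Sum>i'<n. N i' i t *\<^sub>R E i' t)"
   unfolding N_def scaleR_sum_left scaleR_sum_right by (subst sum.swap) (simp add: mult.commute)
  finally show ?thesis .
 qed
 obtain e2 where e2: "e2 > 0" "e2 \<le> e1" "\<And>t. t \<in> ?U e2 ==> mdet n N t \<noteq> 0"
  "\<And>i j. i < n ==> j < n ==> analytic n (?U e2) (minv n N i j)"
  using minv_analytic_near_0[OF e1(1) N_an N0] by metis
 define W where "W m i t = (\<Sum>k<n. minv n N i k t * G k m t)" for m i t
 interpret A2: function_algebra "analytic n (?U e2)" by (rule function_algebra_analytic[OF eopen_cub])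
 have W_an: "analytic n (?U e2) (W m i)" if "m < p" "i < n" for m i
  unfolding W_def using that by (intro A2.sum A2.mult e2(4) analytic_subset[OF G_an cub_mono[OF e2(2)]]) auto
 have XW: "X m (sol t 1) = (\<Sum>i<n. W m i t *\<^sub>R J i t 1)" if m: "m < p" and t: "t \<in> ?U e2" for m t
 proof -
  have t1: "t \<in> ?U e1" using t cub_mono[OF e2(2)] by blast
  have "(\<Sum>i<n. W m i t *\<^sub>R J i t 1) = (\<Sum>i<n. \<Sum>i'<n. \<Sum>k<n. (N i' i t * minv n N i k t * G k m t) *\<^sub>R E i' t)"
   unfolding JN[OF t1] W_def scaleR_sum_left scaleR_sum_right
   by (intro sum.cong refl) (simp add: mult_ac)
  also have "\<dots> = (\<Sum>i'<n. \<Sum>i<n. \<Sum>k<n. (N i' i t * minv n N i k t * G k m t) *\<^sub>R E i' t)" by (rule sum.swap)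
  also have "\<dots> = (\<Sum>i'<n. \<Sum>k<n. ((\<Sum>i<n. N i' i t * minv n N i k t) * G k m t) *\<^sub>R E i' t)"
   unfolding scaleR_sum_left sum_distrib_right by (intro sum.cong refl sum.swap)
  also have "\<dots> = (\<Sum>i'<n. \<Sum>k<n. if k = i' then G k m t *\<^sub>R E i' t else 0)"
   using minv_inverse(2)[OF e2(3)[OF t]] by (intro sum.cong) auto
  also have "\<dots> = X m (sol t 1)" using XG[OF m t1] by (simp add: sum.delta)
  finally show ?thesis by simp
 qed
 show ?thesis using e1(2) e2(1,2) W_an XW by (intro exI[of _ e2] exI[of _ W]) auto
qed

end

text \<open>Bounded continuous functions are a complete space only over metric domains.\<close>

instantiation nat :: metric_space
begin

definition dist_nat :: "nat => nat => real" where
 "dist_nat m n = \<bar>real m - real n\<bar>"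

definition uniformity_nat :: "(nat \<times> nat) filter" where
 "uniformity_nat = (INF e\<in>{0<..}. principal {(x, y). dist x y < e})"

instance
proof
 fix U :: "nat set"
 have "\<forall>\<^sub>F (x', y) in uniformity. x' = x \<longrightarrow> y \<in> U" if "x \<in> U" for x
 proof -
  have "\<forall>\<^sub>F (x', y) in principal {(x, y). dist x y < (1::real)}. x' = x \<longrightarrow> y \<in> U"
  proof -
   have "a = b" if "\<bar>real a - real b\<bar> < 1" for a b using that by linarith
   then show ?thesis using that by (auto simp: eventually_principal dist_nat_def)
  qed
  moreover have "uniformity \<le> principal {(x, y :: nat). dist x y < (1::real)}"
   unfolding uniformity_nat_def by (rule INF_lower) simp
  ultimately show ?thesis by (rule filter_leD[rotated])
 qed
 then show "open U = (\<forall>x\<in>U. \<forall>\<^sub>F (x', y) in uniformity. x' = x \<longrightarrow> y \<in> U)"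
  by (simp add: open_discrete)
qed (auto simp: dist_nat_def uniformity_nat_def)

end

instance bcontfun :: (metric_space, banach) banach ..

section \<open>The inverse function theorem\<close>

lemma near_identity_inj:
 fixes F :: "'a::real_normed_vector => 'a"
 assumes d: "\<And>x. x \<in> ball a r ==> (F has_derivative F' x) (at x)"
  and b: "\<And>x v. x \<in> ball a r ==> norm (F' x v - v) \<le> 1/2 * norm v"
  and x: "x \<in> ball a r" and y: "y \<in> ball a r"
 shows "norm ((F x - x) - (F y - y)) \<le> 1/2 * norm (x - y)" "norm (x - y) \<le> 2 * norm (F x - F y)"
proof -
 show 1: "norm ((F x - x) - (F y - y)) \<le> 1/2 * norm (x - y)"
 proof (rule differentiable_bound[OF convex_ball _ _ x y])
  fix z assume z: "z \<in> ball a r"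
  show "((\<lambda>x. F x - x) has_derivative (\<lambda>v. F' z v - v)) (at z within ball a r)"
   by (intro has_derivative_diff has_derivative_at_withinI[OF d[OF z]] has_derivative_ident)
  show "onorm (\<lambda>v. F' z v - v) \<le> 1/2" by (rule onorm_bound) (use b[OF z] in auto)
 qed
 have "norm (x - y) = norm ((F x - F y) - ((F x - x) - (F y - y)))" by simp
 also have "\<dots> \<le> norm (F x - F y) + norm ((F x - x) - (F y - y))" by (rule norm_triangle_ineq4)
 finally show "norm (x - y) \<le> 2 * norm (F x - F y)" using 1 by simp
qed

text \<open>\<open>F h = y\<close> is the fixed point equation of
  \<open>h \<mapsto> y - (F h - h)\<close>, a contraction with factor 1/2. It preserves the closed
  ball of radius \<open>s\<close> around \<open>x\<close> when \<open>y\<close> is within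
  \<open>s / 2\<close> of \<open>F x\<close>.\<close>

lemma near_identity_open:
 fixes F :: "'a::banach => 'a"
 assumes d: "\<And>x. x \<in> ball a r ==> (F has_derivative F' x) (at x)"
  and b: "\<And>x v. x \<in> ball a r ==> norm (F' x v - v) \<le> 1/2 * norm v"
 shows "open (F ` ball a r)"
proof (subst open_contains_ball, safe)
 fix x assume x: "x \<in> ball a r"
 obtain s where s: "s > 0" "cball x s \<subseteq> ball a r" using open_ball[of a r] x unfolding open_contains_cball by blast
 have "y \<in> F ` ball a r" if y: "y \<in> ball (F x) (s / 2)" for y
 proof -
  let ?T = "\<lambda>h. y - (F h - h)"
  have lip: "norm ((F p - p) - (F q - q)) \<le> 1/2 * norm (p - q)" if "p \<in> ball a r" "q \<in> ball a r" for p q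
   by (rule near_identity_inj(1)[of a r F F', OF d b that])
  have "\<exists>!h\<in>cball x s. ?T h = h"
  proof (rule Banach_fix[of _ "1/2"])
   show "complete (cball x s)" by (simp add: complete_eq_closed)
   show "?T ` cball x s \<subseteq> cball x s"
   proof safe
    fix h assume h: "h \<in> cball x s"
    have "?T h - x = (y - F x) - ((F h - h) - (F x - x))" by simp
    then have "norm (?T h - x) \<le> norm (y - F x) + norm ((F h - h) - (F x - x))"
     by (metis norm_triangle_ineq4)
    also have "\<dots> \<le> s / 2 + 1/2 * norm (h - x)"
     using y lip[OF subsetD[OF s(2) h] x] h by (intro add_mono) (auto simp: dist_norm norm_minus_commute)
    also have "\<dots> \<le> s" using h by (simp add: dist_norm norm_minus_commute)
    finally show "?T h \<in> cball x s" by (simp add: dist_norm norm_minus_commute)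
   qed
   show "dist (?T h) (?T k) \<le> 1/2 * dist h k" if "h \<in> cball x s" "k \<in> cball x s" for h k
   proof -
    have "?T h - ?T k = (F k - k) - (F h - h)" by simp
    then show ?thesis
     using lip[OF subsetD[OF s(2) that(2)] subsetD[OF s(2) that(1)]]
     by (simp only: dist_norm norm_minus_commute[of h k])
   qed
  qed (use s in auto)
  then obtain h where h: "h \<in> cball x s" "?T h = h" by blast
  then have "y = F h" by (simp add: algebra_simps)
  then show ?thesis using h(1) s(2) by blast
 qed
 then show "\<exists>e>0. ball (F x) e \<subseteq> F ` ball a r" using s(1) by (intro exI[of _ "s / 2"]) auto
qed

text \<open>The values have zero tail, so the lift alone is not invertible on the Banach space;
  where invertibility matters, \<open>h - prj n h\<close> is added to act as the identity on the
  tail.\<close>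

definition lft :: "nat => (nat => pt => real) => linf => linf" where
 "lft n F h = hb n (\<lambda>i. F i (cf n h))"

definition dlft :: "nat => (nat => pt => real) => linf => linf => linf" where
 "dlft n F h v = hb n (\<lambda>i. \<Sum>k<n. partial k (F i) (cf n h) * apply_bcontfun v k)"

definition prj :: "nat => linf => linf" where
 "prj n h = hb n (cf n h)"

lemma bounded_linear_hb:
 assumes "\<And>i. i < n ==> bounded_linear (\<lambda>v. f v i)"
 shows "bounded_linear (\<lambda>v. hb n (f v))"
 unfolding hb_def
 by (intro bounded_linear_sum bounded_linear_compose[OF bounded_linear_scaleR_left] assms) auto

lemma prj_apply [simp]: "apply_bcontfun (prj n h) i = (if i < n then apply_bcontfun h i else 0)"
 by (simp add: prj_def)

lemma bounded_linear_prj: "bounded_linear (prj n)"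
 unfolding prj_def[abs_def] by (rule bounded_linear_hb) (simp add: bounded_linear_coord)

lemma norm_prj_le: "norm (prj n h) \<le> norm h"
 by (rule norm_bound) (auto intro: coord_le_norm[simplified])

lemma prj_hb [simp]: "prj n (hb n x) = hb n x"
 by (rule bcontfun_eqI) simp

lemma hb_inject: "(\<And>i. i \<ge> n ==> x i = 0) ==> (\<And>i. i \<ge> n ==> y i = 0) ==> hb n x = hb n y ==> x = y"
 by (metis cf_hb_id)

lemma lft_has_derivative:
 assumes U: "eopen n U" and F: "\<And>i. i < n ==> Ck_on n (Suc k) U (F i)" and h: "cf n h \<in> U"
 shows "(lft n F has_derivative dlft n F h) (at h)"
 unfolding lft_def[abs_def] dlft_def[abs_def] hb_def
 by (intro has_derivative_sum has_derivative_scaleR_left C1_has_derivative[OF U F h]) auto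

lemma continuous_on_cubI:
 fixes f :: "pt => real"
 assumes U: "eopen n U"
  and f: "\<And>x e. x \<in> U ==> 0 < e ==> \<exists>d>0. \<forall>y\<in>U. (\<forall>i<n. \<bar>y i - x i\<bar> < d) \<longrightarrow> \<bar>f y - f x\<bar> \<le> e"
 shows "continuous_on U f"
proof (subst continuous_on_eopen_iff[OF U], subst continuous_on_iff, intro ballI allI impI)
 fix h e assume h: "h \<in> {h. cf n h \<in> U}" and e: "(0::real) < e"
 obtain d where d: "d > 0" "\<And>y. y \<in> U ==> (\<forall>i<n. \<bar>y i - cf n h i\<bar> < d) ==> \<bar>f y - f (cf n h)\<bar> \<le> e / 2"
  using f[of "cf n h" "e / 2"] h e by auto
 have "dist (f (cf n k)) (f (cf n h)) < e" if "k \<in> {h. cf n h \<in> U}" "dist k h < d" for k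
 proof -
  have "\<bar>apply_bcontfun k i - apply_bcontfun h i\<bar> < d" for i
   using coord_le_norm[of "k - h" i] that(2) by (simp add: dist_norm)
  then have "\<bar>f (cf n k) - f (cf n h)\<bar> \<le> e / 2" using that(1) by (intro d(2)) auto
  then show ?thesis using e by (simp add: dist_real_def)
 qed
 then show "\<exists>d>0. \<forall>x'\<in>{h. cf n h \<in> U}. dist x' h < d \<longrightarrow> dist (f (cf n x')) (f (cf n h)) < e"
  using d(1) by blast
qed

lemma mdet_minv_Ck:
 assumes U: "eopen n U" and a: "\<And>i j. i < m ==> j < m ==> Ck_on n k U (a i j)"
 shows "Ck_on n k U (mdet m a)"
  and "(\<And>x. x \<in> U ==> mdet m a x \<noteq> 0) ==> i < m ==> j < m ==> Ck_on n k U (minv m a i j)"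
proof -
 interpret A: function_algebra "Ck_on n k U" by (rule function_algebra_Ck[OF U])
 show d: "Ck_on n k U (mdet m a)" unfolding mdet_def[abs_def] by (rule A.det) (rule a)
 show "Ck_on n k U (minv m a i j)" if "\<And>x. x \<in> U ==> mdet m a x \<noteq> 0" "i < m" "j < m"
  by (rule A.minv[OF a Ck_on_inverse[OF U that(1) d] that(2,3)])
qed

text \<open>Composition with the inverse \<open>Bm\<close> of the Jacobian at \<open>u0\<close>
  makes the derivative a small perturbation of the identity on a ball. The class of the inverse map
  is then read off from the formula for its derivative.\<close>

theorem inverse_function:
 assumes U: "eopen n U" and u0: "u0 \<in> U" and \<phi>: "\<And>i. i < n ==> Ck_on n (Suc k) U (\<lambda>u. \<phi> u i)"
  and z: "\<And>u i. u \<in> U ==> i \<ge> n ==> \<phi> u i = 0"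
  and det: "mdet n (\<lambda>i l. partial l (\<lambda>u. \<phi> u i)) u0 \<noteq> 0"
 shows "\<exists>U'. eopen n U' \<and> u0 \<in> U' \<and> U' \<subseteq> U \<and> inj_on \<phi> U' \<and> eopen n (\<phi> ` U') \<and>
  (\<forall>i<n. Ck_on n (Suc k) (\<phi> ` U') (\<lambda>z. inv_into U' \<phi> z i))"
proof -
 define Jac where "Jac = (\<lambda>i l. partial l (\<lambda>u. \<phi> u i))"
 have Jck: "Ck_on n k U (Jac i l)" if "i < n" "l < n" for i l
  unfolding Jac_def by (rule Ck_on_Suc_partial(1)[OF \<phi>[OF that(1)] that(2)])
 define Bm where "Bm i j = minv n Jac i j u0" for i j
 have BJ: "(\<Sum>i<n. Bm k i * Jac i l u0) = (if k = l then 1 else 0)" if "k < n" "l < n" for k l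
  using minv_inverse(1)[of n Jac u0] det that by (simp add: Bm_def Jac_def)
 have JB: "(\<Sum>k<n. Jac i k u0 * Bm k l) = (if i = l then 1 else 0)" if "i < n" "l < n" for i l
  using minv_inverse(2)[of n Jac u0] det that by (simp add: Bm_def Jac_def)
 define b\<phi> where "b\<phi> = (\<lambda>k u. \<Sum>i<n. Bm k i * \<phi> u i)"
 have b\<phi>ck: "Ck_on n (Suc k) U (b\<phi> l)" for l
  unfolding b\<phi>_def by (intro Ck_on_sum[OF U] Ck_on_cmult[OF U] \<phi>) auto
 have pb: "partial l (b\<phi> m) u = (\<Sum>i<n. Bm m i * Jac i l u)" if "l < n" "u \<in> U" for l m u
  unfolding b\<phi>_def Jac_def
  by (rule partialI, intro DERIV_sum DERIV_cmult Ck_on_Suc_partial(2)[OF \<phi> that]) auto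
 \<comment> \<open>The preconditioned map on the first \<open>n\<close> coordinates and the identity
   on the tail.\<close>
 define F where "F h = lft n b\<phi> h + (h - prj n h)" for h
 define F' where "F' h v = dlft n b\<phi> h v + (v - prj n v)" for h v
 have Fd: "(F has_derivative F' h) (at h)" if "cf n h \<in> U" for h
  unfolding F_def[abs_def] F'_def[abs_def]
  by (intro has_derivative_add has_derivative_diff lft_has_derivative[OF U b\<phi>ck that] has_derivative_ident
    bounded_linear_imp_has_derivative[OF bounded_linear_prj])
 \<comment> \<open>The entrywise deviation of the preconditioned Jacobian from the identity matrix,
   which bounds \<open>F' h v - v\<close> in terms of \<open>v\<close>.\<close>
 define S where "S u = (\<Sum>m<n. \<Sum>l<n. \<bar>(\<Sum>i<n. Bm m i * Jac i l u) - (if m = l then 1 else 0)\<bar>)" for u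
 have Sc: "continuous_on U S"
  unfolding S_def[abs_def]
  by (intro continuous_on_sum continuous_on_rabs continuous_on_diff continuous_on_mult continuous_on_const
    Ck_on_continuous[OF U Jck]) auto
 have S0: "S u0 = 0" using BJ by (simp add: S_def)
 have half: "(0::real) < 1/2" by simp
 obtain r where r': "r > 0" "cub n u0 r \<subseteq> U" "\<And>u. u \<in> cub n u0 r ==> \<bar>S u - S u0\<bar> < 1/2"
  using continuous_on_cubE[OF U Sc u0 half] by metis
 define a where "a = hb n u0"
 have cfa: "cf n h \<in> cub n u0 r" if "h \<in> ball a r" for h
 proof -
  have "\<bar>apply_bcontfun h i - u0 i\<bar> < r" if "i < n" for i
   using coord_le_norm[of "h - a" i] \<open>h \<in> ball a r\<close> that by (simp add: a_def dist_norm norm_minus_commute)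
  then show ?thesis by (auto simp: cub_def)
 qed
 have Fid: "norm (F' h v - v) \<le> 1/2 * norm v" if h: "h \<in> ball a r" for h v
 proof -
  have c: "cf n h \<in> cub n u0 r" by (rule cfa[OF h])
  have cU: "cf n h \<in> U" using c r'(2) by blast
  have "F' h v - v = hb n (\<lambda>m. \<Sum>l<n. ((\<Sum>i<n. Bm m i * Jac i l (cf n h)) - (if m = l then 1 else 0)) * apply_bcontfun v l)"
  proof (rule bcontfun_eqI)
   fix m
   have "(\<Sum>l<n. (if m = l then 1 else 0) * apply_bcontfun v l) = apply_bcontfun v m" if "m < n"
   proof -
    have "(\<Sum>l<n. (if m = l then 1 else 0) * apply_bcontfun v l) = (\<Sum>l<n. if l = m then apply_bcontfun v l else 0)"
     by (rule sum.cong) auto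
    then show ?thesis using that by (simp add: sum.delta)
   qed
   moreover have "(\<Sum>l<n. partial l (b\<phi> m) (cf n h) * apply_bcontfun v l)
     = (\<Sum>l<n. (\<Sum>i<n. Bm m i * Jac i l (cf n h)) * apply_bcontfun v l)"
    by (rule sum.cong) (use pb[OF _ cU] in auto)
   ultimately show "apply_bcontfun (F' h v - v) m = apply_bcontfun (hb n (\<lambda>m. \<Sum>l<n. ((\<Sum>i<n. Bm m i * Jac i l (cf n h)) - (if m = l then 1 else 0)) * apply_bcontfun v l)) m"
    by (simp add: F'_def dlft_def left_diff_distrib sum_subtractf)
  qed
  also have "norm \<dots> \<le> S (cf n h) * norm v"
  proof (rule norm_hb_bound)
   fix m assume m: "m < n"
   have "\<bar>\<Sum>l<n. ((\<Sum>i<n. Bm m i * Jac i l (cf n h)) - (if m = l then 1 else 0)) * apply_bcontfun v l\<bar>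
    \<le> (\<Sum>l<n. \<bar>(\<Sum>i<n. Bm m i * Jac i l (cf n h)) - (if m = l then 1 else 0)\<bar> * norm v)"
    by (rule order_trans[OF sum_abs], rule sum_mono) (auto simp: abs_mult intro!: mult_left_mono coord_le_norm)
   also have "\<dots> = (\<Sum>l<n. \<bar>(\<Sum>i<n. Bm m i * Jac i l (cf n h)) - (if m = l then 1 else 0)\<bar>) * norm v"
    by (simp add: sum_distrib_right)
   also have "\<dots> \<le> S (cf n h) * norm v"
    unfolding S_def using m by (intro mult_right_mono member_le_sum[of m "{..<n}"]) (auto intro: sum_nonneg)
   finally show "\<bar>\<Sum>l<n. ((\<Sum>i<n. Bm m i * Jac i l (cf n h)) - (if m = l then 1 else 0)) * apply_bcontfun v l\<bar> \<le> S (cf n h) * norm v" .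
  qed (auto simp: S_def intro!: mult_nonneg_nonneg sum_nonneg)
  also have "\<dots> \<le> 1/2 * norm v" using r'(3)[OF c] S0 by (intro mult_right_mono) auto
  finally show ?thesis .
 qed
 have FdU: "(F has_derivative F' h) (at h)" if "h \<in> ball a r" for h
  using Fd cfa[OF that] r'(2) by blast
 have lip: "norm (p - q) \<le> 2 * norm (F p - F q)" if "p \<in> ball a r" "q \<in> ball a r" for p q
  by (rule near_identity_inj(2)[of a r F F', OF FdU Fid that])
 define U' where "U' = {u. (\<forall>i\<ge>n. u i = 0) \<and> hb n u \<in> ball a r}"
 have U'U: "U' \<subseteq> cub n u0 r"
 proof
  fix u assume "u \<in> U'"
  then show "u \<in> cub n u0 r" using cfa[of "hb n u"] cf_hb_id[of n u] by (simp add: U'_def del: cf_hb)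
 qed
 have U'_U: "U' \<subseteq> U" using U'U r'(2) by blast
 have U'open: "eopen n U'"
 proof -
  have "{h. cf n h \<in> U'} = prj n -` ball a r" by (auto simp: U'_def prj_def)
  then show ?thesis
   unfolding eopen_lift_iff using linear_continuous_on[OF bounded_linear_prj]
   by (auto simp: U'_def intro!: open_vimage)
 qed
 have u0': "u0 \<in> U'" using r'(1) eopen_zero[OF U u0] by (auto simp: U'_def a_def)
 have FB: "F (hb n u) = hb n (\<lambda>m. b\<phi> m u)" if "u \<in> U'" for u
  using that cf_hb_id[of n u] by (simp add: F_def lft_def U'_def del: cf_hb)
 have B_inj: "x = y" if "\<forall>i\<ge>n. x i = 0" "\<forall>i\<ge>n. y i = 0" "\<And>m. m < n ==> (\<Sum>i<n. Bm m i * x i) = (\<Sum>i<n. Bm m i * y i)" for x y :: pt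
 proof
  fix i
  have *: "(\<Sum>k<n. Jac i k u0 * (\<Sum>l<n. Bm k l * x l)) = x i" if i: "i < n" for x :: pt
  proof -
   have "(\<Sum>k<n. Jac i k u0 * (\<Sum>l<n. Bm k l * x l)) = (\<Sum>l<n. (\<Sum>k<n. Jac i k u0 * Bm k l) * x l)"
    unfolding sum_distrib_left sum_distrib_right by (subst sum.swap) (simp add: mult.assoc)
   also have "\<dots> = (\<Sum>l<n. if l = i then x l else 0)" using JB[OF i] by (intro sum.cong) auto
   finally show ?thesis using i by (simp add: sum.delta)
  qed
  show "x i = y i"
   using *[of x] *[of y] that by (cases "i < n") auto
 qed
 have inj: "inj_on \<phi> U'"
 proof (rule inj_onI)
  fix u u' assume u: "u \<in> U'" "u' \<in> U'" "\<phi> u = \<phi> u'"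
  then have "F (hb n u) = F (hb n u')" by (simp add: FB b\<phi>_def)
  then have "hb n u = hb n u'" using lip[of "hb n u" "hb n u'"] u by (simp add: U'_def)
  then show "u = u'" using u by (intro hb_inject) (auto simp: U'_def)
 qed
 \<comment> \<open>As \<open>Bm\<close> is invertible, membership in the image of
   \<open>\<phi>\<close> can be tested on the preconditioned map; openness then follows from that of
   the image of \<open>F\<close>.\<close>
 have image: "\<phi> ` U' = {z. (\<forall>i\<ge>n. z i = 0) \<and> hb n (\<lambda>m. \<Sum>i<n. Bm m i * z i) \<in> F ` ball a r}"
 proof safe
  fix u i assume "u \<in> U'" "n \<le> i" then show "\<phi> u i = 0" using z U'_U by blast
 next
  fix u assume u: "u \<in> U'"
  then show "hb n (\<lambda>m. \<Sum>i<n. Bm m i * \<phi> u i) \<in> F ` ball a r"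
   using FB[OF u] by (force simp: b\<phi>_def U'_def)
 next
  fix x h assume x: "\<forall>i\<ge>n. x i = 0" and h: "hb n (\<lambda>m. \<Sum>i<n. Bm m i * x i) = F h" "h \<in> ball a r"
  have h0: "apply_bcontfun h i = 0" if "i \<ge> n" for i
   using arg_cong[OF h(1), of "\<lambda>h. apply_bcontfun h i"] that by (simp add: F_def lft_def)
  have hh: "hb n (cf n h) = h" by (rule bcontfun_eqI) (use h0 in auto)
  have hU: "cf n h \<in> U'" using hh h(2) by (auto simp: U'_def)
  have "\<phi> (cf n h) = x"
  proof (rule B_inj)
   show "\<forall>i\<ge>n. \<phi> (cf n h) i = 0" using z hU U'_U by blast
   fix m assume "m < n"
   then show "(\<Sum>i<n. Bm m i * \<phi> (cf n h) i) = (\<Sum>i<n. Bm m i * x i)"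
    using arg_cong[OF h(1), of "\<lambda>h. apply_bcontfun h m"] FB[OF hU] unfolding hh by (simp add: b\<phi>_def)
  qed (rule x)
  then show "x \<in> \<phi> ` U'" using hU by blast
 qed
 have V: "eopen n (\<phi> ` U')"
 proof -
  have "bounded_linear (\<lambda>h. hb n (\<lambda>m. \<Sum>i<n. Bm m i * cf n h i))"
   by (intro bounded_linear_hb bounded_linear_sum bounded_linear_const_mult) (simp add: bounded_linear_coord)
  then have "open ((\<lambda>h. hb n (\<lambda>m. \<Sum>i<n. Bm m i * cf n h i)) -` (F ` ball a r))"
   using near_identity_open[of a r F F', OF FdU Fid] by (intro open_vimage linear_continuous_on) auto
  moreover have "{h. cf n h \<in> \<phi> ` U'} = (\<lambda>h. hb n (\<lambda>m. \<Sum>i<n. Bm m i * cf n h i)) -` (F ` ball a r)"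
   unfolding image by auto
  ultimately show ?thesis unfolding eopen_lift_iff by (auto simp: image)
 qed
 define \<psi> where "\<psi> = inv_into U' \<phi>"
 have \<psi>: "\<psi> x \<in> U'" "\<phi> (\<psi> x) = x" if "x \<in> \<phi> ` U'" for x
  unfolding \<psi>_def by (rule inv_into_into[OF that], rule f_inv_into_f[OF that])
 have \<psi>c: "continuous_on (\<phi> ` U') (\<lambda>x. \<psi> x i)" if i: "i < n" for i
 proof (rule continuous_on_cubI[OF V])
  fix x and e :: real assume x: "x \<in> \<phi> ` U'" and e: "0 < e"
  define Bs where "Bs = (\<Sum>m<n. \<Sum>i<n. \<bar>Bm m i\<bar>)"
  have Bs: "Bs \<ge> 0" by (simp add: Bs_def sum_nonneg)
  have "\<bar>\<psi> y i - \<psi> x i\<bar> \<le> e" if y: "y \<in> \<phi> ` U'" "\<forall>i<n. \<bar>y i - x i\<bar> < e / (2 * (Bs + 1))" for y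
  proof -
   have "\<bar>\<psi> y i - \<psi> x i\<bar> \<le> norm (hb n (\<psi> y) - hb n (\<psi> x))"
    using coord_le_norm[of "hb n (\<psi> y) - hb n (\<psi> x)" i] i by simp
   also have "\<dots> \<le> 2 * norm (F (hb n (\<psi> y)) - F (hb n (\<psi> x)))"
    using \<psi>(1)[OF x] \<psi>(1)[OF y(1)] by (intro lip) (auto simp: U'_def)
   also have "F (hb n (\<psi> y)) - F (hb n (\<psi> x)) = hb n (\<lambda>m. \<Sum>i<n. Bm m i * (y i - x i))"
    unfolding FB[OF \<psi>(1)[OF x]] FB[OF \<psi>(1)[OF y(1)]] hb_diff b\<phi>_def \<psi>(2)[OF x] \<psi>(2)[OF y(1)]
    by (simp add: right_diff_distrib sum_subtractf)
   also have "norm \<dots> \<le> Bs * (e / (2 * (Bs + 1)))"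
   proof (rule norm_hb_bound)
    fix m assume m: "m < n"
    have "\<bar>\<Sum>i<n. Bm m i * (y i - x i)\<bar> \<le> (\<Sum>i<n. \<bar>Bm m i\<bar> * (e / (2 * (Bs + 1))))"
    proof (rule order_trans[OF sum_abs], rule sum_mono)
     fix i assume "i \<in> {..<n}"
     then have "\<bar>y i - x i\<bar> \<le> e / (2 * (Bs + 1))" using y(2) less_imp_le by blast
     then show "\<bar>Bm m i * (y i - x i)\<bar> \<le> \<bar>Bm m i\<bar> * (e / (2 * (Bs + 1)))"
      unfolding abs_mult by (rule mult_left_mono) simp
    qed
    also have "\<dots> = (\<Sum>i<n. \<bar>Bm m i\<bar>) * (e / (2 * (Bs + 1)))" by (rule sum_distrib_right[symmetric])
    also have "\<dots> \<le> Bs * (e / (2 * (Bs + 1)))"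
     unfolding Bs_def[symmetric] using m e Bs
     by (intro mult_right_mono) (auto simp: Bs_def intro!: member_le_sum[of m "{..<n}" "\<lambda>m. \<Sum>i<n. \<bar>Bm m i\<bar>"] sum_nonneg)
    finally show "\<bar>\<Sum>i<n. Bm m i * (y i - x i)\<bar> \<le> Bs * (e / (2 * (Bs + 1)))" .
   qed (use Bs e in auto)
   also have "2 * (Bs * (e / (2 * (Bs + 1)))) \<le> e" using Bs e by (simp add: field_simps)
   finally show ?thesis by simp
  qed
  then show "\<exists>d>0. \<forall>y\<in>\<phi> ` U'. (\<forall>i<n. \<bar>y i - x i\<bar> < d) \<longrightarrow> \<bar>\<psi> y i - \<psi> x i\<bar> \<le> e"
   using e Bs by (intro exI[of _ "e / (2 * (Bs + 1))"]) auto
 qed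
 \<comment> \<open>A derivative within 1/2 of the identity has trivial kernel, so the Jacobian is
   invertible on all of \<open>U'\<close>.\<close>
 have nz: "mdet n Jac u \<noteq> 0" if u: "u \<in> U'" for u
 proof (rule mdet_nonzeroI)
  fix v assume v: "\<And>i. i < n ==> (\<Sum>j<n. Jac i j u * v j) = 0"
  have hu: "hb n u \<in> ball a r" "cf n (hb n u) = u" "u \<in> U" using u U'_U cf_hb_id[of n u] by (auto simp: U'_def)
  have "F' (hb n u) (hb n v) = 0"
  proof (rule bcontfun_eqI)
   fix m
   have "(\<Sum>l<n. partial l (b\<phi> m) u * v l) = (\<Sum>i<n. Bm m i * (\<Sum>l<n. Jac i l u * v l))"
   proof -
    have "(\<Sum>l<n. partial l (b\<phi> m) u * v l) = (\<Sum>l<n. (\<Sum>i<n. Bm m i * Jac i l u) * v l)"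
     using pb hu(3) by (intro sum.cong) auto
    then show ?thesis unfolding sum_distrib_left sum_distrib_right by (subst (asm) sum.swap) (simp add: mult.assoc)
   qed
   moreover have "(\<Sum>l<n. partial l (b\<phi> m) u * (if l < n then v l else 0)) = (\<Sum>l<n. partial l (b\<phi> m) u * v l)"
    by (rule sum.cong) auto
   ultimately show "apply_bcontfun (F' (hb n u) (hb n v)) m = apply_bcontfun 0 m"
    using v hu(2) by (simp add: F'_def dlft_def del: cf_hb)
  qed
  then have "norm (hb n v) \<le> 1/2 * norm (hb n v)" using Fid[OF hu(1), of "hb n v"] by simp
  then have "hb n v = 0" by simp
  then show "\<forall>j<n. v j = 0" using hb_apply[of n v] by (metis zero_bcontfun.rep_eq)
 qed
 have D: "((\<lambda>s. \<psi> (x(l := s)) i) has_real_derivative minv n Jac i l (\<psi> x)) (at (x l))"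
  if x: "x \<in> \<phi> ` U'" and l: "l < n" and i: "i < n" for x l i
 proof -
  \<comment> \<open>Extended by the identity on the tail again, so that the rule for derivatives of
    inverse maps applies in the Banach space; one coordinate along one axis is read off
    afterwards.\<close>
  define f where "f h = lft n (\<lambda>i u. \<phi> u i) h + (h - prj n h)" for h
  define g where "g h = lft n (\<lambda>i x. \<psi> x i) h + (h - prj n h)" for h
  define g' where "g' v = hb n (\<lambda>i. \<Sum>l<n. minv n Jac i l (\<psi> x) * apply_bcontfun v l) + (v - prj n v)" for v
  have cx: "cf n (hb n x) = x" using cf_hb_eopen[OF V x] .
  have \<psi>U: "\<psi> x \<in> U'" "\<psi> x \<in> U" using \<psi>(1)[OF x] U'_U by auto
  have \<psi>0: "\<psi> y i = 0" if "y \<in> \<phi> ` U'" "i \<ge> n" for y i using \<psi>(1)[OF that(1)] that(2) by (auto simp: U'_def)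
  have cfg: "cf n (g h) = \<psi> (cf n h)" if "cf n h \<in> \<phi> ` U'" for h
   using \<psi>0[OF that] by (auto simp: g_def lft_def fun_eq_iff cf_def)
  have "(g has_derivative g') (at (hb n x))"
  proof (rule has_derivative_inverse_basic[where f=f and f'="\<lambda>v. dlft n (\<lambda>i u. \<phi> u i) (g (hb n x)) v + (v - prj n v)"
     and T="{h. cf n h \<in> \<phi> ` U'}"])
   show "(f has_derivative (\<lambda>v. dlft n (\<lambda>i u. \<phi> u i) (g (hb n x)) v + (v - prj n v))) (at (g (hb n x)))"
    unfolding f_def[abs_def]
    by (intro has_derivative_add has_derivative_diff lft_has_derivative[OF U \<phi>] has_derivative_ident
      bounded_linear_imp_has_derivative[OF bounded_linear_prj]) (use cfg[of "hb n x"] cx x \<psi>U in auto)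
   show "bounded_linear g'"
    unfolding g'_def[abs_def]
    by (intro bounded_linear_add bounded_linear_sub bounded_linear_ident bounded_linear_prj bounded_linear_hb
      bounded_linear_sum bounded_linear_const_mult bounded_linear_coord)
   show "g' \<circ> (\<lambda>v. dlft n (\<lambda>i u. \<phi> u i) (g (hb n x)) v + (v - prj n v)) = id"
   proof (rule ext, rule bcontfun_eqI)
    fix v m
    let ?w = "dlft n (\<lambda>i u. \<phi> u i) (g (hb n x)) v + (v - prj n v)"
    have w: "apply_bcontfun ?w l = (\<Sum>k<n. Jac l k (\<psi> x) * apply_bcontfun v k)" if "l < n" for l
     using that cfg[of "hb n x"] cx x by (simp add: dlft_def Jac_def)
    have "(\<Sum>l<n. minv n Jac m l (\<psi> x) * apply_bcontfun ?w l) = apply_bcontfun v m" if m: "m < n"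
    proof -
     have "(\<Sum>l<n. minv n Jac m l (\<psi> x) * apply_bcontfun ?w l)
      = (\<Sum>l<n. minv n Jac m l (\<psi> x) * (\<Sum>k<n. Jac l k (\<psi> x) * apply_bcontfun v k))"
      using w by (intro sum.cong) auto
     also have "\<dots> = (\<Sum>k<n. (\<Sum>l<n. minv n Jac m l (\<psi> x) * Jac l k (\<psi> x)) * apply_bcontfun v k)"
      unfolding sum_distrib_left sum_distrib_right by (subst sum.swap) (simp add: mult.assoc)
     also have "\<dots> = (\<Sum>k<n. if k = m then apply_bcontfun v k else 0)"
      using minv_inverse(1)[OF nz[OF \<psi>U(1)] m] by (intro sum.cong) auto
     finally show ?thesis using m by (simp add: sum.delta)
    qed
    then show "apply_bcontfun ((g' \<circ> (\<lambda>v. dlft n (\<lambda>i u. \<phi> u i) (g (hb n x)) v + (v - prj n v))) v) m = apply_bcontfun (id v) m"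
     by (simp add: g'_def) (simp add: dlft_def)
   qed
   have "continuous_on {h. cf n h \<in> \<phi> ` U'} g"
    unfolding g_def[abs_def] lft_def
    by (intro continuous_on_add continuous_on_diff continuous_on_hb continuous_on_id
      linear_continuous_on[OF bounded_linear_prj] iffD1[OF continuous_on_eopen_iff[OF V] \<psi>c])
   then show "continuous (at (hb n x)) g"
    using continuous_on_eq_continuous_at[OF open_lift[OF V], of g] x cx by (simp del: cf_hb)
   show "open {h. cf n h \<in> \<phi> ` U'}" by (rule open_lift[OF V])
   show "hb n x \<in> {h. cf n h \<in> \<phi> ` U'}" using x cx by simp
   show "f (g h) = h" if "h \<in> {h. cf n h \<in> \<phi> ` U'}" for h
   proof (rule bcontfun_eqI)
    fix m
    have "cf n (g h) = \<psi> (cf n h)" "\<phi> (\<psi> (cf n h)) = cf n h" using cfg \<psi>(2) that by auto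
    then show "apply_bcontfun (f (g h)) m = apply_bcontfun h m"
     by (simp add: f_def lft_def) (simp add: g_def lft_def)
   qed
  qed
  moreover have "((\<lambda>s. hb n (x(l := s))) has_derivative (\<lambda>u. u *\<^sub>R ev l)) (at (x l))"
  proof -
   have e: "hb n (x(l := s)) = hb n x + (s - x l) *\<^sub>R ev l" for s
    by (rule bcontfun_eqI) (use l in auto)
   have "((\<lambda>s. hb n x + (s - x l) *\<^sub>R ev l) has_derivative (\<lambda>u. u *\<^sub>R ev l)) (at (x l))"
    using has_derivative_add[OF has_derivative_const has_derivative_scaleR_left[OF has_derivative_diff[OF has_derivative_ident has_derivative_const]]]
    by simp
   then show ?thesis unfolding e .
  qed
  ultimately have "((\<lambda>s. g (hb n (x(l := s)))) has_derivative (\<lambda>u. g' (u *\<^sub>R ev l))) (at (x l))"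
   using has_derivative_compose[of "\<lambda>s. hb n (x(l := s))" "\<lambda>u. u *\<^sub>R ev l" "x l" UNIV g g']
   by (simp only: fun_upd_triv)
  from bounded_linear.has_derivative[OF bounded_linear_coord this, of i]
  have gd: "((\<lambda>s. apply_bcontfun (g (hb n (x(l := s)))) i) has_derivative (\<lambda>u. apply_bcontfun (g' (u *\<^sub>R ev l)) i)) (at (x l))" .
  have "((\<lambda>s. apply_bcontfun (g (hb n (x(l := s)))) i) has_real_derivative minv n Jac i l (\<psi> x)) (at (x l))"
  proof -
   have "apply_bcontfun (g' (u *\<^sub>R ev l)) i = minv n Jac i l (\<psi> x) * u" for u
   proof -
    have "(\<Sum>k<n. minv n Jac i k (\<psi> x) * (u * (if k = l then 1 else 0))) = (\<Sum>k<n. if k = l then minv n Jac i k (\<psi> x) * u else 0)"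
     by (rule sum.cong) auto
    then show ?thesis using i l by (simp add: g'_def sum.delta)
   qed
   then show ?thesis using gd by (simp add: has_field_derivative_def)
  qed
  moreover have ev: "\<forall>\<^sub>F s in nhds (x l). apply_bcontfun (g (hb n (x(l := s)))) i = \<psi> (x(l := s)) i"
   using eventually_upd[OF V x l]
  proof eventually_elim
   case (elim s)
   then show ?case using cfg[of "hb n (x(l := s))"] cf_hb_eopen[OF V elim] i by (metis cf_less)
  qed
  ultimately show ?thesis using iffD1[OF DERIV_cong_ev[OF refl ev refl]] by blast
 qed
 have \<psi>0: "Ck_on n 0 (\<phi> ` U') (\<lambda>x. \<psi> x i)" if "i < n" for i
  using \<psi>c[OF that] V by (simp add: continuous_map_Euclidean_iff)
 \<comment> \<open>Bootstrapping: the derivatives of the inverse map are entries of the inverse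
   Jacobian composed with the inverse map itself, so each class gives the next one as far as the
   Jacobian permits.\<close>
 have "j \<le> Suc k ==> \<forall>i<n. Ck_on n j (\<phi> ` U') (\<lambda>x. \<psi> x i)" for j
 proof (induction j)
  case (Suc j)
  have mi: "Ck_on n j U' (minv n Jac i l)" if "i < n" "l < n" for i l
   by (rule mdet_minv_Ck(2)[OF U'open _ nz that])
    (use Ck_on_le[OF Ck_on_subset[OF Jck U'_U]] Suc.prems in auto)
  show ?case
  proof (intro allI impI)
   fix i assume i: "i < n"
   show "Ck_on n (Suc j) (\<phi> ` U') (\<lambda>x. \<psi> x i)"
    by (rule Ck_on_SucI[OF V \<psi>c[OF i] D Ck_on_compose[OF V U'open \<psi>(1) _ mi[OF i]]])
     (use Suc i in auto)
  qed
 qed (use \<psi>0 in simp)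
 from this[of "Suc k"] show ?thesis
  using U'open u0' U'_U inj V unfolding \<psi>_def by (intro exI[of _ U']) auto
qed

section \<open>Analytic coordinates for fields given in a chart\<close>

text \<open>Closed cubes are compact as products of intervals and supply the uniform bounds that the
  locales require.\<close>

definition ccube :: "nat => pt => real => pt set" where
 "ccube n w r = {x. (\<forall>i\<ge>n. x i = 0) \<and> (\<forall>i<n. \<bar>x i - w i\<bar> \<le> r)}"

lemma compact_ccube: "compact (ccube n w r)"
proof -
 let ?S = "\<lambda>i. if i < n then {w i - r..w i + r} else {0}"
 have "compactin (product_topology (\<lambda>i::nat. euclideanreal) UNIV) (PiE UNIV ?S)"
  unfolding compactin_PiE by auto
 moreover have "PiE UNIV ?S = ccube n w r"
 proof (rule Set.set_eqI)
  fix x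
  have "x \<in> PiE UNIV ?S \<longleftrightarrow> (\<forall>i. x i \<in> ?S i)" by (simp add: PiE_iff)
  also have "\<dots> \<longleftrightarrow> x \<in> ccube n w r"
   by (auto simp: ccube_def abs_le_iff not_less split: if_splits)
  finally show "x \<in> PiE UNIV ?S \<longleftrightarrow> x \<in> ccube n w r" .
 qed
 ultimately show ?thesis by (simp add: euclidean_product_topology)
qed

lemma ccube_bounded:
 fixes g :: "'i => pt => real"
 assumes "finite I" "\<And>i. i \<in> I ==> continuous_on (ccube n w r) (g i)"
 shows "\<exists>b\<ge>0. \<forall>i\<in>I. \<forall>x\<in>ccube n w r. \<bar>g i x\<bar> \<le> b"
 using assms
proof (induction I)
 case (insert i I)
 then obtain b where b: "b \<ge> 0" "\<forall>i\<in>I. \<forall>x\<in>ccube n w r. \<bar>g i x\<bar> \<le> b" by auto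
 have "bounded (g i ` ccube n w r)"
  using insert.prems by (intro compact_imp_bounded compact_continuous_image compact_ccube) auto
 then obtain c where c: "c > 0" "\<forall>x\<in>ccube n w r. \<bar>g i x\<bar> \<le> c" by (auto simp: bounded_pos)
 show ?case using b c by (intro exI[of _ "max b c"]) (auto simp: le_max_iff_disj)
qed (intro exI[of _ 0], auto)

lemma ccube_uniform:
 fixes g :: "pt => real"
 assumes g: "continuous_on (ccube n w r) g" and e: "e > 0"
 shows "\<exists>d>0. \<forall>h h'. cf n h \<in> ccube n w r \<longrightarrow> cf n h' \<in> ccube n w r \<longrightarrow> dist h h' < d \<longrightarrow> \<bar>g (cf n h) - g (cf n h')\<bar> < e"
proof -
 let ?K = "hb n ` ccube n w r"
 have "compact ?K"
  by (rule compact_continuous_image[OF _ compact_ccube])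
   (auto intro!: continuous_on_hb continuous_on_coord[OF continuous_on_id])
 moreover have "continuous_on ?K (\<lambda>h. g (cf n h))"
  by (rule continuous_on_compose2[OF g continuous_on_cf[OF continuous_on_id]])
   (auto simp: ccube_def)
 ultimately have "uniformly_continuous_on ?K (\<lambda>h. g (cf n h))" by (rule compact_uniformly_continuous[rotated])
 then have "\<exists>d>0. \<forall>h\<in>?K. \<forall>h'\<in>?K. dist h' h < d \<longrightarrow> dist (g (cf n h')) (g (cf n h)) < e"
  using e unfolding uniformly_continuous_on_def by (elim allE[of _ e] impE)
 then obtain d where d: "d > 0" "\<forall>h\<in>?K. \<forall>h'\<in>?K. dist h' h < d \<longrightarrow> dist (g (cf n h')) (g (cf n h)) < e"
  by (elim exE conjE)
 have "\<bar>g (cf n h) - g (cf n h')\<bar> < e"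
  if "cf n h \<in> ccube n w r" "cf n h' \<in> ccube n w r" "dist h h' < d" for h h'
 proof -
  have c: "cf n (prj n k) = cf n k" for k by (auto simp: cf_def)
  have "dist (prj n h) (prj n h') \<le> dist h h'"
   using norm_prj_le[of n "h - h'"] by (simp add: dist_norm linear_diff[OF bounded_linear.linear[OF bounded_linear_prj]])
  then show ?thesis
   using d(2)[rule_format, of "prj n h'" "prj n h"] that c by (auto simp: prj_def dist_real_def simp del: cf_hb)
 qed
 then show ?thesis using d(1) by blast
qed

lemma ccube_uniform_finite:
 fixes g :: "'i => pt => real"
 assumes "finite I" "\<And>i. i \<in> I ==> continuous_on (ccube n w r) (g i)" "e > 0"
 shows "\<exists>d>0. \<forall>i\<in>I. \<forall>h h'. cf n h \<in> ccube n w r \<longrightarrow> cf n h' \<in> ccube n w r \<longrightarrow> dist h h' < d \<longrightarrow>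
  \<bar>g i (cf n h) - g i (cf n h')\<bar> < e"
 using assms
proof (induction I)
 case (insert i I)
 then obtain d where d: "d > 0" "\<forall>i\<in>I. \<forall>h h'. cf n h \<in> ccube n w r \<longrightarrow> cf n h' \<in> ccube n w r \<longrightarrow> dist h h' < d \<longrightarrow>
  \<bar>g i (cf n h) - g i (cf n h')\<bar> < e" by auto
 obtain d' where d': "d' > 0" "\<forall>h h'. cf n h \<in> ccube n w r \<longrightarrow> cf n h' \<in> ccube n w r \<longrightarrow> dist h h' < d' \<longrightarrow>
  \<bar>g i (cf n h) - g i (cf n h')\<bar> < e"
  using ccube_uniform[of n w r "g i" e] insert.prems by auto
 show ?case using d d' by (intro exI[of _ "min d d'"]) auto
qed (intro exI[of _ 1], auto)

text \<open>\<open>F ws\<close> plays the role of \<open>Z\<^sup>w\<^sup>sf\<close>: its derivative along integral curves of \<open>Z\<^sub>j\<close> is \<open>F (j # ws)\<close>.\<close>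

definition word_family :: "nat => pt set => (nat => nat => pt => real) => real => real =>
  (nat list => pt => real) => bool" where
 "word_family n W Z CC QQ F \<longleftrightarrow> (\<forall>ws\<in>lists {..<n}. continuous_on W (F ws) \<and>
  (\<forall>x\<in>W. \<bar>F ws x\<bar> \<le> CC * QQ ^ length ws * fact (length ws)) \<and>
  (\<forall>j<n. \<forall>\<eta> a b. (\<forall>s\<in>{a<..<b}. \<eta> s \<in> W \<and> (\<forall>i\<ge>n. \<eta> s i = 0) \<and>
     (\<forall>i<n. ((\<lambda>s. \<eta> s i) has_real_derivative Z j i (\<eta> s)) (at s))) \<longrightarrow>
    (\<forall>s\<in>{a<..<b}. ((\<lambda>s. F ws (\<eta> s)) has_real_derivative F (j # ws) (\<eta> s)) (at s))))"

lemma mdet_cong: "(\<And>i j. i < n ==> j < n ==> a i j x = b i j y) ==> mdet n a x = mdet n b y"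
 unfolding mdet_def by (intro arg_cong[of _ _ Determinant.det] eq_matI) auto

text \<open>The data in one chart are lifted to the Banach space, where the locales apply on a ball.
  \<open>cF\<close> holds the iterated derivatives of the structure functions; the
  \<open>w m i\<close> are the components of the fields in the new coordinates.\<close>

theorem analytic_coordinates:
 fixes Z :: "nat => nat => pt => real"
 assumes np: "n \<le> p" and W: "eopen n W" and w0: "w0 \<in> W"
  and Zck: "\<And>j i. j < p ==> i < n ==> Ck_on n (Suc 0) W (Z j i)"
  and det: "mdet n (\<lambda>i k. Z k i) w0 \<noteq> 0"
  and bracket: "\<And>j k i x. j < n ==> k < p ==> i < n ==> x \<in> W ==>
   (\<Sum>a<n. Z j a x * partial a (Z k i) x - Z k a x * partial a (Z j i) x) = (\<Sum>l<p. c j k l x * Z l i x)"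
  and CQ: "0 \<le> CC" "0 \<le> QQ"
  and cF: "\<And>j k l. j < n ==> k < p ==> l < p ==> word_family n W Z CC QQ (cF j k l)"
  and cF0: "\<And>j k l x. j < n ==> k < p ==> l < p ==> x \<in> W ==> cF j k l [] x = c j k l x"
 shows "\<exists>U \<phi> w. eopen n U \<and> inj_on \<phi> U \<and> \<phi> ` U \<subseteq> W \<and> eopen n (\<phi> ` U) \<and> w0 \<in> \<phi> ` U \<and>
  (\<forall>k<n. Ck_on n 2 U (\<lambda>u. \<phi> u k)) \<and> (\<forall>k<n. Ck_on n 2 (\<phi> ` U) (\<lambda>x. inv_into U \<phi> x k)) \<and>
  (\<forall>m<p. \<forall>i<n. analytic n U (w m i)) \<and>
  (\<forall>u\<in>U. \<forall>m<p. \<forall>k<n. Z m k (\<phi> u) = (\<Sum>i<n. partial i (\<lambda>u. \<phi> u k) u * w m i u)) \<and>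
  (\<forall>F. word_family n W Z CC QQ F \<longrightarrow> analytic n U (\<lambda>u. F [] (\<phi> u)))"
proof -
 define A where "A = (\<lambda>i k. Z k i)"
 have Ack: "Ck_on n (Suc 0) W (A i k)" if "i < n" "k < n" for i k
  using Zck[of k i] that np by (simp add: A_def)
 have pck: "continuous_on W (partial k (Z j i))" if "j < p" "i < n" "k < n" for j i k
  by (rule Ck_on_continuous[OF W Ck_on_Suc_partial(1)[OF Zck[OF that(1,2)] that(3)]])
 have det0: "\<bar>mdet n A w0\<bar> > 0" using det by (simp add: A_def)
 have dc: "continuous_on W (mdet n A)" by (rule Ck_on_continuous[OF W mdet_minv_Ck(1)[OF W Ack]])
 obtain d where d: "d > 0" "cub n w0 d \<subseteq> W" "\<And>y. y \<in> cub n w0 d ==> \<bar>mdet n A y - mdet n A w0\<bar> < \<bar>mdet n A w0\<bar>"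
  using continuous_on_cubE[OF W dc w0 det0] by metis
 \<comment> \<open>Half of \<open>d\<close>, so that the closed cube still lies where the
   determinant is nonzero.\<close>
 define R where "R = d / 2"
 have R: "R > 0" using d(1) by (simp add: R_def)
 define Q where "Q = ccube n w0 R"
 have QW: "Q \<subseteq> cub n w0 d" using R by (force simp: Q_def ccube_def cub_def R_def)
 have QW': "Q \<subseteq> W" using QW d(2) by blast
 have dnz: "mdet n A y \<noteq> 0" if "y \<in> cub n w0 d" for y using d(3)[OF that] by auto
 define x0 where "x0 = hb n w0"
 have w0z: "w0 i = 0" if "i \<ge> n" for i using eopen_zero[OF W w0 that] .
 have cx0: "cf n x0 = w0" unfolding x0_def by (rule cf_hb_id) (rule w0z)
 have inQ: "cf n h \<in> Q" if "h \<in> ball x0 R" for h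
 proof -
  have "\<bar>apply_bcontfun h i - w0 i\<bar> \<le> R" if "i < n" for i
   using coord_le_norm[of "h - x0" i] \<open>h \<in> ball x0 R\<close> that by (simp add: x0_def dist_norm norm_minus_commute)
  then show ?thesis by (auto simp: Q_def ccube_def)
 qed
 have inW: "cf n h \<in> W" if "h \<in> ball x0 R" for h using inQ[OF that] QW' by blast
 have cQ: "continuous_on (ccube n w0 R) f" if "continuous_on W f" for f :: "pt => real"
  by (rule continuous_on_subset[OF that QW'[unfolded Q_def]])
 have cQd: "continuous_on (ccube n w0 R) f" if "continuous_on (cub n w0 d) f" for f :: "pt => real"
  by (rule continuous_on_subset[OF that QW[unfolded Q_def]])
 obtain b1 where b1: "b1 \<ge> 0" "\<And>j i x. j < p ==> i < n ==> x \<in> Q ==> \<bar>Z j i x\<bar> \<le> b1"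
 proof -
  have "\<exists>b\<ge>0. \<forall>y\<in>{..<p} \<times> {..<n}. \<forall>x\<in>ccube n w0 R. \<bar>(case y of (j, i) => Z j i) x\<bar> \<le> b"
   by (rule ccube_bounded) (use cQ[OF Ck_on_continuous[OF W Zck]] in \<open>auto simp: split_def\<close>)
  then show ?thesis using that by (auto simp: Q_def)
 qed
 obtain b2 where b2: "b2 \<ge> 0" "\<And>j i k x. j < p ==> i < n ==> k < n ==> x \<in> Q ==> \<bar>partial k (Z j i) x\<bar> \<le> b2"
 proof -
  have "\<exists>b\<ge>0. \<forall>y\<in>{..<p} \<times> {..<n} \<times> {..<n}. \<forall>x\<in>ccube n w0 R. \<bar>(case y of (j, i, k) => partial k (Z j i)) x\<bar> \<le> b"
   by (rule ccube_bounded) (use cQ[OF pck] in \<open>auto simp: split_def\<close>)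
  then show ?thesis using that by (auto simp: Q_def)
 qed
 obtain b3 where b3: "b3 \<ge> 0" "\<And>i k x. i < n ==> k < n ==> x \<in> Q ==> \<bar>minv n A i k x\<bar> \<le> b3"
 proof -
  have "continuous_on (cub n w0 d) (minv n A i k)" if "i < n" "k < n" for i k
   by (rule Ck_on_continuous[OF eopen_cub mdet_minv_Ck(2)[OF eopen_cub Ck_on_subset[OF Ack d(2)] dnz that]])
  then have "\<exists>b\<ge>0. \<forall>y\<in>{..<n} \<times> {..<n}. \<forall>x\<in>ccube n w0 R. \<bar>(case y of (i, k) => minv n A i k) x\<bar> \<le> b"
   by (intro ccube_bounded) (use cQd in \<open>auto simp: split_def\<close>)
  then show ?thesis using that by (auto simp: Q_def)
 qed
 define X where "X j = lft n (Z j)" for j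
 define DX where "DX j = dlft n (Z j)" for j
 have Xc: "apply_bcontfun (X j h) i = (if i < n then Z j i (cf n h) else 0)" for j h i
  by (simp add: X_def lft_def)
 \<comment> \<open>Bounds on the first derivatives and on the inverse frame matrix over the compact
   cube; the factors \<open>real n\<close> come from sums over coordinates.\<close>
 define K where "K = real n * b2"
 define C where "C = real n * (real n * b3)"
 interpret frame_fields X DX "prj n" p n x0 R b1 K C
 proof (rule frame_fields.intro)
  show "n \<le> p" "0 < R" "0 \<le> b1" by fact+
  show "0 \<le> K" "0 \<le> C" using b2 b3 by (auto simp: K_def C_def)
  show "(X j has_derivative DX j x) (at x)" if "j < p" "x \<in> ball x0 R" for j x
   unfolding X_def DX_def by (rule lft_has_derivative[OF W Zck[OF that(1)] inW[OF that(2)]])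
  show "norm (X j x) \<le> b1" if "j < p" "x \<in> ball x0 R" for j x
   unfolding X_def lft_def by (rule norm_hb_bound) (use b1 inQ[OF that(2)] that(1) in auto)
  show "norm (DX j x v) \<le> K * norm v" if "j < p" "x \<in> ball x0 R" for j x v
   unfolding DX_def dlft_def
  proof (rule norm_hb_bound)
   fix i assume i: "i < n"
   have "\<bar>\<Sum>k<n. partial k (Z j i) (cf n x) * apply_bcontfun v k\<bar> \<le> (\<Sum>k<n. b2 * norm v)"
    by (rule order_trans[OF sum_abs], rule sum_mono)
     (use b2 inQ[OF that(2)] that(1) i coord_le_norm in \<open>auto simp: abs_mult intro!: mult_mono\<close>)
   then show "\<bar>\<Sum>k<n. partial k (Z j i) (cf n x) * apply_bcontfun v k\<bar> \<le> K * norm v" by (simp add: K_def)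
  qed (use b2 in \<open>auto simp: K_def\<close>)
  show "\<exists>d>0. \<forall>j<p. \<forall>x\<in>ball x0 R. \<forall>y\<in>ball x0 R. dist x y < d \<longrightarrow> (\<forall>v. norm (DX j x v - DX j y v) \<le> e * norm v)"
   if e: "e > 0" for e
  proof -
   define e' where "e' = e / (real n + 1)"
   have e': "e' > 0" using e by (simp add: e'_def)
   have "\<exists>d>0. \<forall>y\<in>{..<p} \<times> {..<n} \<times> {..<n}. \<forall>h h'. cf n h \<in> ccube n w0 R \<longrightarrow> cf n h' \<in> ccube n w0 R \<longrightarrow> dist h h' < d \<longrightarrow>
    \<bar>(case y of (j, i, k) => partial k (Z j i)) (cf n h) - (case y of (j, i, k) => partial k (Z j i)) (cf n h')\<bar> < e'"
    by (rule ccube_uniform_finite[OF _ _ e']) (use cQ[OF pck] in \<open>auto simp: split_def\<close>)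
   then obtain d where d: "d > 0" "\<And>j i k h h'. j < p ==> i < n ==> k < n ==> cf n h \<in> Q ==> cf n h' \<in> Q ==> dist h h' < d ==>
    \<bar>partial k (Z j i) (cf n h) - partial k (Z j i) (cf n h')\<bar> < e'"
    unfolding Q_def by fastforce
   have "norm (DX j x v - DX j y v) \<le> e * norm v" if "j < p" "x \<in> ball x0 R" "y \<in> ball x0 R" "dist x y < d" for j x y v
    unfolding DX_def dlft_def hb_diff
   proof (rule norm_hb_bound)
    fix i assume i: "i < n"
    have "\<bar>(\<Sum>k<n. partial k (Z j i) (cf n x) * apply_bcontfun v k) - (\<Sum>k<n. partial k (Z j i) (cf n y) * apply_bcontfun v k)\<bar>
     = \<bar>\<Sum>k<n. (partial k (Z j i) (cf n x) - partial k (Z j i) (cf n y)) * apply_bcontfun v k\<bar>"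
     by (simp add: sum_subtractf left_diff_distrib)
    also have "\<dots> \<le> (\<Sum>k<n. e' * norm v)"
    proof (rule order_trans[OF sum_abs], rule sum_mono)
     fix k assume "k \<in> {..<n}"
     then have "\<bar>partial k (Z j i) (cf n x) - partial k (Z j i) (cf n y)\<bar> \<le> e'"
      using d(2)[OF that(1) i _ inQ[OF that(2)] inQ[OF that(3)] that(4), of k] by simp
     then show "\<bar>(partial k (Z j i) (cf n x) - partial k (Z j i) (cf n y)) * apply_bcontfun v k\<bar> \<le> e' * norm v"
      unfolding abs_mult using e' by (intro mult_mono coord_le_norm) auto
    qed
    also have "\<dots> = (real n * e') * norm v" by simp
    also have "\<dots> \<le> e * norm v" using e by (intro mult_right_mono) (auto simp: e'_def field_simps)
    finally show "\<bar>(\<Sum>k<n. partial k (Z j i) (cf n x) * apply_bcontfun v k) - (\<Sum>k<n. partial k (Z j i) (cf n y) * apply_bcontfun v k)\<bar> \<le> e * norm v" .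
   qed (use e in auto)
   then show ?thesis using d(1) by blast
  qed
  show "bounded_linear (prj n)" by (rule bounded_linear_prj)
  show "prj n (X j x) = X j x" if "j < p" "x \<in> ball x0 R" for j x by (rule bcontfun_eqI) (simp add: Xc)
  show "\<exists>s. v = (\<Sum>i<n. s i *\<^sub>R X i x) \<and> (\<Sum>i<n. \<bar>s i\<bar>) \<le> C * norm v" if x: "x \<in> ball x0 R" and v: "prj n v = v" for x v
  proof (intro exI conjI)
   let ?s = "\<lambda>k. \<Sum>i<n. minv n A k i (cf n x) * apply_bcontfun v i"
   have nz: "mdet n A (cf n x) \<noteq> 0" using dnz inQ[OF x] QW by blast
   show "v = (\<Sum>i<n. ?s i *\<^sub>R X i x)"
   proof (rule bcontfun_eqI)
    fix m
    show "apply_bcontfun v m = apply_bcontfun (\<Sum>i<n. ?s i *\<^sub>R X i x) m"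
    proof (cases "m < n")
     case False
     then show ?thesis using arg_cong[OF v, of "\<lambda>h. apply_bcontfun h m"] by (simp add: sum_apply_bcontfun Xc)
    next
     case True
     have "apply_bcontfun (\<Sum>i<n. ?s i *\<^sub>R X i x) m = (\<Sum>k<n. ?s k * A m k (cf n x))"
      using True by (simp add: sum_apply_bcontfun Xc A_def)
     also have "\<dots> = (\<Sum>i<n. (\<Sum>k<n. A m k (cf n x) * minv n A k i (cf n x)) * apply_bcontfun v i)"
      unfolding sum_distrib_right by (subst sum.swap) (simp add: mult_ac)
     also have "\<dots> = (\<Sum>i<n. if i = m then apply_bcontfun v i else 0)"
      using minv_inverse(2)[OF nz True] by (intro sum.cong) auto
     finally show ?thesis using True by (simp add: sum.delta)
    qed
   qed
   have "(\<Sum>k<n. \<bar>?s k\<bar>) \<le> (\<Sum>k<n. \<Sum>i<n. b3 * norm v)"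
    by (rule sum_mono, rule order_trans[OF sum_abs], rule sum_mono)
     (use b3 inQ[OF x] coord_le_norm in \<open>auto simp: abs_mult intro!: mult_mono\<close>)
   then show "(\<Sum>k<n. \<bar>?s k\<bar>) \<le> C * norm v" by (simp add: C_def mult.assoc)
  qed
 qed
 have comm: "DX k x (X a x) - DX a x (X k x) = (\<Sum>l<p. c a k l (cf n x) *\<^sub>R X l x)"
  if "a < n" "k < p" "x \<in> ball x0 R" for a k x
 proof (rule bcontfun_eqI)
  fix i
  show "apply_bcontfun (DX k x (X a x) - DX a x (X k x)) i = apply_bcontfun (\<Sum>l<p. c a k l (cf n x) *\<^sub>R X l x) i"
   using bracket[OF that(1,2) _ inW[OF that(3)], of i]
   by (auto simp: DX_def dlft_def Xc sum_apply_bcontfun sum_subtractf mult.commute)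
 qed
 interpret involutive_frame X DX "prj n" p n x0 R b1 K C "\<lambda>a k l h. c a k l (cf n h)" CC QQ
  by unfold_locales (use comm CQ in auto)
 have goodF: "good (\<lambda>ws h. F ws (cf n h))" if F: "word_family n W Z CC QQ F" for F
  unfolding good_def
 proof (intro ballI conjI)
  fix ws assume ws: "ws \<in> lists {..<n}"
  show "continuous_on (ball x0 R) (\<lambda>h. F ws (cf n h))"
   by (rule continuous_on_compose2[OF _ continuous_on_cf[OF continuous_on_id]])
    (use F ws inW in \<open>auto simp: word_family_def\<close>)
  show "\<bar>F ws (cf n x)\<bar> \<le> CC * QQ ^ length ws * fact (length ws)" if "x \<in> ball x0 R" for x
   using F ws inW[OF that] unfolding word_family_def by blast
  show "along (\<lambda>h. F ws (cf n h)) (\<lambda>j h. F (j # ws) (cf n h))"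
   unfolding along_def
  proof (intro allI impI ballI)
   fix j u a b s
   assume j: "j < n" and u: "\<forall>s\<in>{a<..<b}. u s \<in> ball x0 R \<and> (u has_vector_derivative X j (u s)) (at s)"
    and s: "s \<in> {a<..<b}"
   have curve: "\<forall>s\<in>{a<..<b}. cf n (u s) \<in> W \<and> (\<forall>i\<ge>n. cf n (u s) i = 0) \<and>
     (\<forall>i<n. ((\<lambda>s. cf n (u s) i) has_real_derivative Z j i (cf n (u s))) (at s))"
   proof (intro ballI conjI allI impI)
    fix s i assume s: "s \<in> {a<..<b}" and i: "i < n"
    have "((\<lambda>s. apply_bcontfun (u s) i) has_vector_derivative apply_bcontfun (X j (u s)) i) (at s)"
     using u s by (intro bounded_linear.has_vector_derivative[OF bounded_linear_coord]) auto
    then show "((\<lambda>s. cf n (u s) i) has_real_derivative Z j i (cf n (u s))) (at s)"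
     using i by (simp add: has_real_derivative_iff_has_vector_derivative Xc)
   qed (use u inW in auto)
   have step: "\<And>\<eta> a b. (\<forall>s\<in>{a<..<b}. \<eta> s \<in> W \<and> (\<forall>i\<ge>n. \<eta> s i = 0) \<and>
     (\<forall>i<n. ((\<lambda>s. \<eta> s i) has_real_derivative Z j i (\<eta> s)) (at s))) ==>
    (\<forall>s\<in>{a<..<b}. ((\<lambda>s. F ws (\<eta> s)) has_real_derivative F (j # ws) (\<eta> s)) (at s))"
    using F ws j unfolding word_family_def by blast
   show "((\<lambda>s. F ws (cf n (u s))) has_real_derivative F (j # ws) (cf n (u s))) (at s)"
    by (rule bspec[OF step[of a b "\<lambda>s. cf n (u s)", OF curve] s])
  qed
 qed
 interpret analytic_frame X DX "prj n" p n x0 R b1 K C "\<lambda>a k l h. c a k l (cf n h)" CC QQ "\<lambda>a k l ws h. cF a k l ws (cf n h)"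
  by unfold_locales (use goodF cF cF0 inW in auto)
 obtain e0 w where e0: "0 < e0" "e0 \<le> eps2" and w: "\<And>k i. k < p ==> i < n ==> analytic n (cub n (\<lambda>_. 0) e0) (w k i)"
  "\<And>t k. t \<in> cub n (\<lambda>_. 0) e0 ==> k < p ==> X k (sol t 1) = (\<Sum>i<n. w k i t *\<^sub>R J i t 1)"
  using canonical_coordinates by blast
 define U where "U = cub n (\<lambda>_. 0) e0"
 have U: "eopen n U" unfolding U_def by (rule eopen_cub)
 have U2: "t \<in> cub n (\<lambda>_. 0) eps2" if "t \<in> U" for t using that cub_mono[OF e0(2)] by (auto simp: U_def)
 have U\<tau>: "absum n t \<le> tau" if "t \<in> U" for t using small_t(1)[OF eps2(1) eps2(2)[OF order_refl] U2[OF that]] .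
 define \<phi> where "\<phi> t = cf n (sol t 1)" for t
 have \<phi>W: "\<phi> t \<in> W" if "t \<in> U" for t unfolding \<phi>_def using sol_R[OF U\<tau>[OF that], of 1] by (intro inW) auto
 \<comment> \<open>The partial derivatives of \<open>\<phi>\<close>: analytic coefficients times the
   fields along \<open>\<phi>\<close>, which are only C^1 in the old chart.\<close>
 define g where "g i k t = (\<Sum>l<p. mu i l t 1 * Z l k (\<phi> t))" for i k t
 have Jg: "apply_bcontfun (J i t 1) k = g i k t" if "k < n" for i k t
  using that by (simp add: J_def g_def sum_apply_bcontfun Xc \<phi>_def)
 have D: "((\<lambda>s. \<phi> (t(i := s)) k) has_real_derivative g i k t) (at (t i))" if t: "t \<in> U" and i: "i < n" and k: "k < n" for t i k
  unfolding has_field_derivative_def has_derivative_at_alt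
 proof (intro conjI allI impI)
  show "bounded_linear ((*) (g i k t))" by (rule bounded_linear_mult_right)
  fix \<eta> :: real assume \<eta>: "\<eta> > 0"
  obtain d1 where d1: "d1 > 0" "\<And>t'. absum n t' \<le> tau ==> absum n (\<lambda>i. t' i - t i) < d1 ==>
   norm (sol t' 1 - sol t 1 - (\<Sum>i<n. (t' i - t i) *\<^sub>R J i t 1)) \<le> \<eta> * absum n (\<lambda>i. t' i - t i)"
   using sol_differentiable[OF eps2(1) order_refl U2[OF t] \<eta>] by blast
  obtain d2 where d2: "d2 > 0" "\<And>s. dist s (t i) < d2 ==> t(i := s) \<in> U"
   using eventually_upd[OF U t i] unfolding eventually_nhds_metric by blast
  have "norm (\<phi> (t(i := s)) k - \<phi> (t(i := t i)) k - g i k t * (s - t i)) \<le> \<eta> * norm (s - t i)"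
   if s: "norm (s - t i) < min d1 d2" for s
  proof -
   let ?t = "t(i := s)"
   have ab: "absum n (\<lambda>l. ?t l - t l) = \<bar>s - t i\<bar>"
   proof -
    have "absum n (\<lambda>l. ?t l - t l) = (\<Sum>j<n. if j = i then \<bar>s - t i\<bar> else 0)"
     unfolding absum_def by (rule sum.cong) auto
    then show ?thesis using i by (simp add: sum.delta)
   qed
   have sm: "(\<Sum>l<n. (?t l - t l) *\<^sub>R J l t 1) = (s - t i) *\<^sub>R J i t 1"
   proof -
    have "(\<Sum>l<n. (?t l - t l) *\<^sub>R J l t 1) = (\<Sum>l<n. if l = i then (s - t i) *\<^sub>R J l t 1 else 0)"
     by (rule sum.cong) auto
    then show ?thesis using i by (simp add: sum.delta)
   qed
   have tU: "?t \<in> U" using d2(2)[of s] s by (simp add: dist_norm)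
   have "norm (sol ?t 1 - sol t 1 - (s - t i) *\<^sub>R J i t 1) \<le> \<eta> * \<bar>s - t i\<bar>"
    using d1(2)[OF U\<tau>[OF tU]] s unfolding ab sm by simp
   moreover have "\<bar>apply_bcontfun (sol ?t 1 - sol t 1 - (s - t i) *\<^sub>R J i t 1) k\<bar> \<le> norm (sol ?t 1 - sol t 1 - (s - t i) *\<^sub>R J i t 1)"
    by (rule coord_le_norm)
   ultimately show ?thesis using k Jg[OF k, of i t] by (simp add: \<phi>_def mult.commute)
  qed
  then show "\<exists>d>0. \<forall>s. norm (s - t i) < d \<longrightarrow>
    norm (\<phi> (t(i := s)) k - \<phi> (t(i := t i)) k - g i k t * (s - t i)) \<le> \<eta> * norm (s - t i)"
   using d1(1) d2(1) by (intro exI[of _ "min d1 d2"]) auto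
 qed
 have \<phi>0: "Ck_on n 0 U (\<lambda>t. \<phi> t k)" if k: "k < n" for k
 proof -
  have "continuous_on U (\<lambda>t. \<phi> t k)"
  proof (rule continuous_on_cubI[OF U])
   fix t and e :: real assume t: "t \<in> U" and e: "0 < e"
   define d where "d = e / (2 * (real n + 1) * (b1 + 1))"
   have d: "d > 0" using e b1 by (simp add: d_def)
   have "\<bar>\<phi> t' k - \<phi> t k\<bar> \<le> e" if t': "t' \<in> U" "\<forall>i<n. \<bar>t' i - t i\<bar> < d" for t'
   proof -
    have "\<bar>\<phi> t' k - \<phi> t k\<bar> \<le> norm (sol t' 1 - sol t 1)"
     using coord_le_norm[of "sol t' 1 - sol t 1" k] k by (simp add: \<phi>_def)
    also have "\<dots> \<le> 2 * (absum n (\<lambda>i. t' i - t i) * b1)"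
     by (rule sol_lipschitz[OF U\<tau>[OF t] U\<tau>[OF t'(1)]]) simp
    also have "\<dots> \<le> 2 * (((real n + 1) * d) * (b1 + 1))"
    proof -
     have "absum n (\<lambda>i. t' i - t i) \<le> (\<Sum>i<n. d)" unfolding absum_def by (rule sum_mono) (use t'(2) in \<open>auto intro: less_imp_le\<close>)
     also have "\<dots> \<le> (real n + 1) * d" using d by simp
     finally show ?thesis using b1 d by (intro mult_left_mono mult_mono) auto
    qed
    also have "\<dots> = e" using b1 by (simp add: d_def field_simps add_nonneg_eq_0_iff)
    finally show ?thesis .
   qed
   then show "\<exists>d>0. \<forall>t'\<in>U. (\<forall>i<n. \<bar>t' i - t i\<bar> < d) \<longrightarrow> \<bar>\<phi> t' k - \<phi> t k\<bar> \<le> e" using d by blast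
  qed
  then show ?thesis using U by (simp add: continuous_map_Euclidean_iff)
 qed
 have mu_an: "analytic n U (\<lambda>t. mu i l t 1)" if "l < p" for i l
  unfolding mu_def U_def by (rule analytic_subset[OF v_analytic[OF eps2(1) order_refl that] cub_mono[OF e0(2)]])
 \<comment> \<open>Bootstrapping in two rounds: continuity of \<open>\<phi>\<close> makes
   \<open>g\<close> continuous and \<open>\<phi>\<close> of class C^1; then \<open>g\<close> is C^1
   and \<open>\<phi>\<close> of class C^2, where the regularity of the fields ends the
   process.\<close>
 have gk: "Ck_on n j U (g i k)" if "j \<le> Suc 0" "k < n" "\<And>k. k < n ==> Ck_on n j U (\<lambda>t. \<phi> t k)" for i k j
  unfolding g_def
 proof (rule Ck_on_sum[OF U], rule Ck_on_mult[OF U])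
  fix l assume "l \<in> {..<p}"
  then have l: "l < p" by simp
  show "Ck_on n j U (\<lambda>t. mu i l t 1)" by (rule smooth_Ck[OF analytic_smooth[OF mu_an[OF l]]])
  show "Ck_on n j U (\<lambda>t. Z l k (\<phi> t))"
   by (rule Ck_on_compose[OF U W \<phi>W that(3) Ck_on_le[OF Zck[OF l that(2)] that(1)]])
 qed
 have \<phi>1: "Ck_on n (Suc 0) U (\<lambda>t. \<phi> t k)" if k: "k < n" for k
  by (rule Ck_on_SucI[OF U _ D]) (use k \<phi>0 gk[of 0] Ck_on_continuous[OF U \<phi>0] in auto)
 have \<phi>2: "Ck_on n (Suc (Suc 0)) U (\<lambda>t. \<phi> t k)" if k: "k < n" for k
  by (rule Ck_on_SucI[OF U _ D]) (use k \<phi>1 gk[of "Suc 0"] Ck_on_continuous[OF U \<phi>0] in auto)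
 have part: "partial i (\<lambda>u. \<phi> u k) t = g i k t" if "t \<in> U" "i < n" "k < n" for t i k
  by (rule partialI[OF D[OF that]])
 have in0: "(\<lambda>_. 0) \<in> U" unfolding U_def using e0 by (intro centre_in_cub) auto
 have \<phi>at0: "\<phi> (\<lambda>_. 0) = w0" unfolding \<phi>_def using sol_zero[of 1] cx0 by simp
 \<comment> \<open>At 0 the partial derivatives of the canonical map are the frame fields at the
   base point.\<close>
 have "mdet n (\<lambda>i l. partial l (\<lambda>u. \<phi> u i)) (\<lambda>_. 0) = mdet n A w0"
 proof (rule mdet_cong)
  fix i l assume il: "i < n" "l < n"
  have "partial l (\<lambda>u. \<phi> u i) (\<lambda>_. 0) = apply_bcontfun (J l (\<lambda>_. 0) 1) i"
   using part[OF in0 il(2,1)] Jg[OF il(1)] by simp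
  also have "\<dots> = A i l w0" using J_zero[OF il(2)] il cx0 by (simp add: Xc A_def)
  finally show "partial l (\<lambda>u. \<phi> u i) (\<lambda>_. 0) = A i l w0" .
 qed
 then have jac0: "mdet n (\<lambda>i l. partial l (\<lambda>u. \<phi> u i)) (\<lambda>_. 0) \<noteq> 0" using det0 by simp
 obtain U' where U': "eopen n U'" "(\<lambda>_. 0) \<in> U'" "U' \<subseteq> U" "inj_on \<phi> U'" "eopen n (\<phi> ` U')"
  "\<And>i. i < n ==> Ck_on n (Suc (Suc 0)) (\<phi> ` U') (\<lambda>z. inv_into U' \<phi> z i)"
  proof -
  have "\<exists>U'. eopen n U' \<and> (\<lambda>_. 0) \<in> U' \<and> U' \<subseteq> U \<and> inj_on \<phi> U' \<and> eopen n (\<phi> ` U') \<and>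
    (\<forall>i<n. Ck_on n (Suc (Suc 0)) (\<phi> ` U') (\<lambda>z. inv_into U' \<phi> z i))"
   by (rule inverse_function[OF U in0 \<phi>2 _ jac0]) (simp_all add: \<phi>_def)
  then show ?thesis using that by (elim exE conjE) simp
 qed
 have Zw: "Z m k (\<phi> u) = (\<Sum>i<n. partial i (\<lambda>u. \<phi> u k) u * w m i u)" if "u \<in> U'" "m < p" "k < n" for u m k
 proof -
  have u: "u \<in> U" using that U'(3) by blast
  have "Z m k (\<phi> u) = apply_bcontfun (X m (sol u 1)) k" using that(3) by (simp add: Xc \<phi>_def)
  also have "\<dots> = (\<Sum>i<n. w m i u * apply_bcontfun (J i u 1) k)"
   using w(2)[of u m] u that(2) by (simp add: U_def sum_apply_bcontfun)
  also have "\<dots> = (\<Sum>i<n. partial i (\<lambda>u. \<phi> u k) u * w m i u)"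
   using part[OF u _ that(3)] Jg[OF that(3)] by (intro sum.cong) auto
  finally show ?thesis .
 qed
 have Fan: "analytic n U' (\<lambda>u. F [] (\<phi> u))" if "word_family n W Z CC QQ F" for F
  using analytic_subset[OF good_analytic[OF goodF[OF that] e0(1) eps2(2)[OF e0(2)]]] U'(3)
  unfolding \<phi>_def U_def by blast
 have "w0 \<in> \<phi> ` U'" using \<phi>at0 U'(2) by force
 moreover have "\<phi> ` U' \<subseteq> W" using \<phi>W U'(3) by blast
 moreover have "Ck_on n 2 U' (\<lambda>u. \<phi> u k)" if "k < n" for k
  using Ck_on_subset[OF \<phi>2[OF that] U'(3)] by (simp add: numeral_2_eq_2)
 moreover have "analytic n U' (w m i)" if "m < p" "i < n" for m i
  using analytic_subset[OF w(1)[OF that]] U'(3) by (simp add: U_def)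
 ultimately show ?thesis
  using U' Zw Fan by (intro exI[of _ U'] exI[of _ \<phi>] exI[of _ w]) (auto simp: numeral_2_eq_2)
qed

section \<open>Coordinate patches of a manifold\<close>

lemma jacobian_app_cong:
 assumes "eopen n U" "x \<in> U" "\<And>y. y \<in> U ==> F y i = G y i" "\<And>k. k < n ==> v k = w k"
 shows "jacobian_app n F x v i = jacobian_app n G x w i"
 unfolding jacobian_app_def
 by (rule sum.cong) (use partial_cong(1)[OF assms(1,2) _ assms(3)] assms(4) in auto)

lemma jacobian_app_id:
 assumes "eopen n U" "x \<in> U" "\<And>y. y \<in> U ==> F y i = y i" "i < n"
 shows "jacobian_app n F x v i = v i"
proof -
 have "jacobian_app n F x v i = (\<Sum>k<n. if i = k then v k else 0)"
  unfolding jacobian_app_def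
  by (rule sum.cong) (use partial_cong(1)[OF assms(1,2) _ assms(3)] in \<open>auto simp: partial_coord\<close>)
 then show ?thesis using assms(4) by (simp add: sum.delta)
qed

lemma jacobian_app_chain:
 assumes U: "eopen n U" and V: "eopen m V" and G: "\<And>x. x \<in> U ==> G x \<in> V"
  and g: "\<And>j. j < m ==> Ck_on n 2 U (\<lambda>x. G x j)" and f: "Ck_on m 2 V (\<lambda>x. F x i)"
  and x: "x \<in> U"
 shows "jacobian_app n (\<lambda>y. F (G y)) x w i = jacobian_app m F (G x) (jacobian_app n G x w) i"
proof -
 have "partial k (\<lambda>y. F (G y) i) x = (\<Sum>j<m. partial j (\<lambda>y. F y i) (G x) * partial k (\<lambda>y. G y j) x)"
  if "k < n" for k
  by (rule partialI) (rule chain_partial[OF U V G g[unfolded numeral_2_eq_2] f[unfolded numeral_2_eq_2] x that])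
 then have "jacobian_app n (\<lambda>y. F (G y)) x w i =
   (\<Sum>k<n. \<Sum>j<m. partial j (\<lambda>y. F y i) (G x) * partial k (\<lambda>y. G y j) x * w k)"
  unfolding jacobian_app_def by (intro sum.cong) (auto simp: sum_distrib_right)
 also have "\<dots> = jacobian_app m F (G x) (jacobian_app n G x w) i"
  unfolding jacobian_app_def sum_distrib_left by (subst sum.swap) (simp add: mult.assoc)
 finally show ?thesis .
qed

lemma homeomorphic_map_inv_into:
 assumes "homeomorphic_map X Y f"
 shows "continuous_map Y X (inv_into (topspace X) f)"
proof -
 obtain g where g: "homeomorphic_maps X Y f g" using assms unfolding homeomorphic_map_maps by blast
 have inj: "inj_on f (topspace X)" using assms by (rule homeomorphic_imp_injective_map)
 have "inv_into (topspace X) f y = g y" if y: "y \<in> topspace Y" for y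
 proof -
  have "g y \<in> topspace X" "f (g y) = y"
   using g y by (auto simp: homeomorphic_maps_def dest: continuous_map_image_subset_topspace)
  then show ?thesis using inv_into_f_f[OF inj, of "g y"] by simp
 qed
 moreover have "continuous_map Y X g" using g by (simp add: homeomorphic_maps_def)
 ultimately show ?thesis by (metis continuous_map_eq)
qed

locale C2_mfd =
 fixes L :: "'m manifold"
 assumes C2: "C2_manifold L"
begin

abbreviation n :: nat where "n \<equiv> mdim L"

lemma Hausdorff: "Hausdorff_space (mtop L)" using C2 by (simp add: C2_manifold_def)
lemma cover: "p \<in> points L \<longleftrightarrow> (\<exists>c\<in>atlas L. p \<in> fst c)" using C2 unfolding C2_manifold_def by blast

context
 fixes c assumes c: "c \<in> atlas L"
begin

lemma chart_open: "openin (mtop L) (fst c)" and chart_image: "eopen n (snd c ` fst c)"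
 and chart_homeo: "homeomorphic_map (subtopology (mtop L) (fst c)) (subtopology (Euclidean_space n) (snd c ` fst c)) (snd c)"
 using C2 c unfolding C2_manifold_def by blast+

lemma transition: "c' \<in> atlas L ==> i < n ==> Ck_on n 2 (snd c ` (fst c \<inter> fst c')) (\<lambda>x. snd c' (chart_inv c x) i)"
 using C2 c unfolding C2_manifold_def by blast

lemma chart_topspace: "topspace (subtopology (mtop L) (fst c)) = fst c"
 "topspace (subtopology (Euclidean_space n) (snd c ` fst c)) = snd c ` fst c"
 using openin_subset[OF chart_open] openin_subset[OF chart_image] by auto

lemma chart_inj: "inj_on (snd c) (fst c)"
 using homeomorphic_imp_injective_map[OF chart_homeo] unfolding chart_topspace .

lemma chart_inv [simp]: "p \<in> fst c ==> chart_inv c (snd c p) = p"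
 by (rule inv_into_f_f[OF chart_inj])

lemma chart_inv_in: "z \<in> snd c ` fst c ==> chart_inv c z \<in> fst c" "z \<in> snd c ` fst c ==> snd c (chart_inv c z) = z"
 by (rule inv_into_into, simp) (rule f_inv_into_f, simp)

lemma chart_open_image:
 assumes "openin (mtop L) V"
 shows "eopen n (snd c ` (fst c \<inter> V))"
proof -
 have "openin (subtopology (mtop L) (fst c)) (fst c \<inter> V)" by (rule openin_subtopology_Int2[OF assms])
 then have "openin (subtopology (Euclidean_space n) (snd c ` fst c)) (snd c ` (fst c \<inter> V))"
  using homeomorphic_imp_open_map[OF chart_homeo] unfolding open_map_def by blast
 then show ?thesis by (rule openin_trans_full[OF _ chart_image])
qed

lemma chart_continuous: "continuous_map (subtopology (mtop L) (fst c)) (Euclidean_space n) (snd c)"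
 using homeomorphic_imp_continuous_map[OF chart_homeo] by (rule continuous_map_into_fulltopology)

lemma chart_inv_continuous: "continuous_map (subtopology (Euclidean_space n) (snd c ` fst c)) (mtop L) (chart_inv c)"
proof -
 have "continuous_map (subtopology (Euclidean_space n) (snd c ` fst c)) (subtopology (mtop L) (fst c)) (chart_inv c)"
  using homeomorphic_map_inv_into[OF chart_homeo] by (simp only: chart_topspace(1))
 then show ?thesis unfolding continuous_map_in_subtopology by (rule conjunct1)
qed

end

text \<open>A local parametrization of class C^2 in both directions; by
  \<open>patch_iff_C2_diffeo\<close> the same as a diffeomorphism onto an open submanifold. As the
  image is not a separate parameter, composition and restriction stay simple.\<close>

definition patch :: "pt set => (pt => 'm) => bool" where
 "patch U \<Phi> \<longleftrightarrow> eopen n U \<and> inj_on \<Phi> U \<and> openin (mtop L) (\<Phi> ` U) \<and>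
  continuous_map (subtopology (Euclidean_space n) U) (mtop L) \<Phi> \<and>
  continuous_map (subtopology (mtop L) (\<Phi> ` U)) (Euclidean_space n) (inv_into U \<Phi>) \<and>
  (\<forall>c\<in>atlas L. \<forall>i<n. Ck_on n 2 {x \<in> U. \<Phi> x \<in> fst c} (\<lambda>x. snd c (\<Phi> x) i) \<and>
   Ck_on n 2 (snd c ` (fst c \<inter> \<Phi> ` U)) (\<lambda>z. inv_into U \<Phi> (chart_inv c z) i))"

lemma topspace_eopen: "eopen n U ==> topspace (subtopology (Euclidean_space n) U) = U"
 by (auto dest: openin_subset)

lemma patch_chart:
 assumes c: "c \<in> atlas L"
 shows "patch (snd c ` fst c) (chart_inv c)"
proof -
 have im: "chart_inv c ` snd c ` fst c = fst c" by (force simp: c)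
 have inj: "inj_on (chart_inv c) (snd c ` fst c)" by (auto simp: inj_on_def c)
 have iv: "inv_into (snd c ` fst c) (chart_inv c) p = snd c p" if "p \<in> fst c" for p
  using inv_into_f_f[OF inj, of "snd c p"] that by (simp add: c)
 have S1: "{x \<in> snd c ` fst c. chart_inv c x \<in> fst c'} = snd c ` (fst c \<inter> fst c')" for c' :: "'m chart"
  by (auto simp: c)
 show ?thesis
  unfolding patch_def im S1
 proof (intro conjI ballI allI impI)
  show "continuous_map (subtopology (mtop L) (fst c)) (Euclidean_space n) (inv_into (snd c ` fst c) (chart_inv c))"
   by (rule continuous_map_eq[OF chart_continuous[OF c]]) (simp add: iv)
  fix c' i assume c': "c' \<in> atlas L" and i: "i < n"
  show "Ck_on n 2 (snd c ` (fst c \<inter> fst c')) (\<lambda>x. snd c' (chart_inv c x) i)" by (rule transition[OF c c' i])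
  have O: "eopen n (snd c' ` (fst c' \<inter> fst c))" by (rule chart_open_image[OF c' chart_open[OF c]])
  show "Ck_on n 2 (snd c' ` (fst c' \<inter> fst c)) (\<lambda>z. inv_into (snd c ` fst c) (chart_inv c) (chart_inv c' z) i)"
   by (rule iffD2[OF Ck_on_cong[OF O] transition[OF c' c i]]) (auto simp: c' iv)
 qed (simp_all add: c inj chart_image chart_open chart_inv_continuous)
qed

context
 fixes U \<Phi> assumes P: "patch U \<Phi>"
begin

lemma patch_eopen: "eopen n U" and patch_inj: "inj_on \<Phi> U" and patch_image: "openin (mtop L) (\<Phi> ` U)"
 and patch_continuous: "continuous_map (subtopology (Euclidean_space n) U) (mtop L) \<Phi>"
 and patch_inv_continuous: "continuous_map (subtopology (mtop L) (\<Phi> ` U)) (Euclidean_space n) (inv_into U \<Phi>)"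
 using P unfolding patch_def by blast+

lemma patch_C2: "c \<in> atlas L ==> i < n ==> Ck_on n 2 {x \<in> U. \<Phi> x \<in> fst c} (\<lambda>x. snd c (\<Phi> x) i)"
 and patch_inv_C2: "c \<in> atlas L ==> i < n ==> Ck_on n 2 (snd c ` (fst c \<inter> \<Phi> ` U)) (\<lambda>z. inv_into U \<Phi> (chart_inv c z) i)"
 using P unfolding patch_def by blast+

lemma patch_inv [simp]: "x \<in> U ==> inv_into U \<Phi> (\<Phi> x) = x"
 by (rule inv_into_f_f[OF patch_inj])

lemma patch_preimage: "openin (mtop L) V ==> eopen n {x \<in> U. \<Phi> x \<in> V}"
 using openin_continuous_map_preimage[OF patch_continuous] openin_trans_full[OF _ patch_eopen]
 unfolding topspace_eopen[OF patch_eopen] by blast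

lemma patch_open_image: "eopen n U' ==> U' \<subseteq> U ==> openin (mtop L) (\<Phi> ` U')"
proof -
 assume U': "eopen n U'" "U' \<subseteq> U"
 have "topspace (subtopology (mtop L) (\<Phi> ` U)) = \<Phi> ` U" using openin_subset[OF patch_image] by auto
 then have "openin (subtopology (mtop L) (\<Phi> ` U)) {p \<in> \<Phi> ` U. inv_into U \<Phi> p \<in> U'}"
  using openin_continuous_map_preimage[OF patch_inv_continuous U'(1)] by simp
 moreover have "{p \<in> \<Phi> ` U. inv_into U \<Phi> p \<in> U'} = \<Phi> ` U'" using U'(2) by auto
 ultimately show ?thesis using openin_trans_full[OF _ patch_image] by metis
qed

lemma patch_coords_open: "c \<in> atlas L ==> eopen n (snd c ` (fst c \<inter> \<Phi> ` U))"
 by (rule chart_open_image[OF _ patch_image])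

lemma patch_points: "x \<in> U ==> \<Phi> x \<in> points L"
 using openin_subset[OF patch_image] by blast

end

lemma patch_compose:
 assumes P: "patch W \<Psi>" and U: "eopen n U" and inj: "inj_on \<phi> U" and sub: "\<phi> ` U \<subseteq> W"
  and V: "eopen n (\<phi> ` U)" and \<phi>: "\<And>k. k < n ==> Ck_on n 2 U (\<lambda>u. \<phi> u k)"
  and \<phi>i: "\<And>k. k < n ==> Ck_on n 2 (\<phi> ` U) (\<lambda>x. inv_into U \<phi> x k)"
 shows "patch U (\<lambda>u. \<Psi> (\<phi> u))"
proof -
 let ?\<Phi> = "\<lambda>u. \<Psi> (\<phi> u)"
 have W: "eopen n W" by (rule patch_eopen[OF P])
 have im: "?\<Phi> ` U = \<Psi> ` \<phi> ` U" by auto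
 have inj': "inj_on ?\<Phi> U"
  using comp_inj_on[OF inj inj_on_subset[OF patch_inj[OF P] sub]] by (simp add: comp_def)
 have iv: "inv_into U ?\<Phi> p = inv_into U \<phi> (inv_into W \<Psi> p)" if "p \<in> ?\<Phi> ` U" for p
  using that inv_into_f_f[OF inj'] inv_into_f_f[OF inj] patch_inv[OF P] sub by auto
 have op: "openin (mtop L) (?\<Phi> ` U)" unfolding im by (rule patch_open_image[OF P V sub])
 \<comment> \<open>The C^2 hypotheses concern the first \<open>n\<close> coordinates; the others
   vanish because the values lie in \<open>W\<close>.\<close>
 have z\<phi>: "\<phi> u = (\<lambda>i. if i < n then \<phi> u i else 0)" if "u \<in> U" for u
  using eopen_zero[OF W, of "\<phi> u"] that sub by (auto simp: fun_eq_iff not_less)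
 have zi: "inv_into U \<phi> x = (\<lambda>i. if i < n then inv_into U \<phi> x i else 0)" if "x \<in> \<phi> ` U" for x
  using eopen_zero[OF U, of "inv_into U \<phi> x"] that inv_into_into[of x \<phi> U] by (auto simp: fun_eq_iff not_less)
 have c\<phi>: "continuous_map (subtopology (Euclidean_space n) U) (Euclidean_space n) (\<lambda>u i. if i < n then \<phi> u i else 0)"
  unfolding continuous_map_componentwise_Euclidean_space
  using Ck_on_continuous[OF U \<phi>] continuous_map_Euclidean_iff[OF U] by blast
 have c\<phi>i: "continuous_map (subtopology (Euclidean_space n) (\<phi> ` U)) (Euclidean_space n) (\<lambda>x i. if i < n then inv_into U \<phi> x i else 0)"
  unfolding continuous_map_componentwise_Euclidean_space
  using Ck_on_continuous[OF V \<phi>i] continuous_map_Euclidean_iff[OF V] by blast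
 show ?thesis
  unfolding patch_def
 proof (intro conjI ballI allI impI)
  have "continuous_map (subtopology (Euclidean_space n) U) (subtopology (Euclidean_space n) W) \<phi>"
   unfolding continuous_map_in_subtopology
   using continuous_map_eq[OF c\<phi>, of \<phi>] z\<phi> sub by (auto simp: topspace_eopen[OF U])
  from continuous_map_compose[OF this patch_continuous[OF P]]
  show "continuous_map (subtopology (Euclidean_space n) U) (mtop L) ?\<Phi>" by (simp add: comp_def)
  have "continuous_map (subtopology (mtop L) (?\<Phi> ` U)) (Euclidean_space n) (inv_into W \<Psi>)"
   by (rule continuous_map_from_subtopology_mono[OF patch_inv_continuous[OF P]]) (use sub in auto)
  then have "continuous_map (subtopology (mtop L) (?\<Phi> ` U)) (subtopology (Euclidean_space n) (\<phi> ` U)) (inv_into W \<Psi>)"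
   unfolding continuous_map_in_subtopology using patch_inv[OF P] sub by auto
  from continuous_map_compose[OF this c\<phi>i]
  show "continuous_map (subtopology (mtop L) (?\<Phi> ` U)) (Euclidean_space n) (inv_into U ?\<Phi>)"
  proof (rule continuous_map_eq)
   fix p assume "p \<in> topspace (subtopology (mtop L) (?\<Phi> ` U))"
   then have p: "p \<in> ?\<Phi> ` U" by auto
   then have "inv_into W \<Psi> p \<in> \<phi> ` U" using patch_inv[OF P] sub by auto
   then show "((\<lambda>x i. if i < n then inv_into U \<phi> x i else 0) \<circ> inv_into W \<Psi>) p = inv_into U ?\<Phi> p"
    using zi iv[OF p] by simp
  qed
  fix c i assume c: "c \<in> atlas L" and i: "i < n"
  have O: "eopen n {x \<in> W. \<Psi> x \<in> fst c}" by (rule patch_preimage[OF P chart_open[OF c]])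
  have "\<And>k. k < n ==> continuous_on U (\<lambda>u. \<phi> u k)" by (rule Ck_on_continuous[OF U \<phi>])
  have O': "eopen n {x \<in> U. ?\<Phi> x \<in> fst c}"
   using openin_continuous_map_preimage[OF \<open>continuous_map (subtopology (Euclidean_space n) U) (mtop L) ?\<Phi>\<close> chart_open[OF c]]
    openin_trans_full[OF _ U] unfolding topspace_eopen[OF U] by blast
  show "Ck_on n 2 {x \<in> U. ?\<Phi> x \<in> fst c} (\<lambda>x. snd c (?\<Phi> x) i)"
   by (rule Ck_on_compose[OF O' O _ Ck_on_subset[OF \<phi>] patch_C2[OF P c i]]) (use sub in auto)
  have Q: "eopen n (snd c ` (fst c \<inter> ?\<Phi> ` U))" by (rule chart_open_image[OF c op])
  have Q': "snd c ` (fst c \<inter> ?\<Phi> ` U) \<subseteq> snd c ` (fst c \<inter> \<Psi> ` W)" using sub by auto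
  have "Ck_on n 2 (snd c ` (fst c \<inter> ?\<Phi> ` U)) (\<lambda>z. inv_into U \<phi> (inv_into W \<Psi> (chart_inv c z)) i)"
   by (rule Ck_on_compose[OF Q V _ Ck_on_subset[OF patch_inv_C2[OF P c] Q'] \<phi>i[OF i]])
    (use patch_inv[OF P] sub in \<open>auto simp: c\<close>)
  then show "Ck_on n 2 (snd c ` (fst c \<inter> ?\<Phi> ` U)) (\<lambda>z. inv_into U ?\<Phi> (chart_inv c z) i)"
   by (rule iffD2[OF Ck_on_cong[OF Q], rotated]) (auto simp: c iv)
 qed (use U inj' op in auto)
qed

lemma patch_subset:
 assumes P: "patch W \<Psi>" and U: "eopen n U" "U \<subseteq> W"
 shows "patch U \<Psi>"
proof -
 have "Ck_on n 2 U (\<lambda>x. inv_into U (\<lambda>x. x) x k)" if "k < n" for k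
  using Ck_on_cong[OF U(1), of "\<lambda>x. inv_into U (\<lambda>x. x) x k" "\<lambda>x. x k"] Ck_on_coord[OF U(1)]
  by (simp add: inv_into_f_f)
 then show ?thesis
  using patch_compose[OF P U(1), of "\<lambda>x. x"] U Ck_on_coord[OF U(1)] by simp
qed

lemma inv_into_open_sub:
 assumes c: "c \<in> atlas L" and z: "z \<in> snd c ` (fst c \<inter> V)"
 shows "inv_into (fst c \<inter> V) (snd c) z = chart_inv c z"
 using z inv_into_f_f[OF inj_on_subset[OF chart_inj[OF c]], of "fst c \<inter> V"] chart_inv[OF c] by auto

lemma eucl_sub:
 assumes U: "eopen n U"
 shows "topspace (mtop (eucl_manifold n U)) = U" "mtop (eucl_manifold n U) = subtopology (Euclidean_space n) U"
  "mdim (eucl_manifold n U) = n" "atlas (eucl_manifold n U) = {(U, \<lambda>x. x)}"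
 using topspace_eopen[OF U] by (simp_all add: eucl_manifold_def)

text \<open>The two notions differ in the carriers of \<open>inv_into\<close>: charts of the
  submanifold are inverted on restricted domains, and the identity chart of \<open>U\<close> is
  inverted too. On the relevant points the inverses agree.\<close>

lemma patch_iff_C2_diffeo:
 assumes U: "eopen n U" and V: "openin (mtop L) V"
 shows "C2_diffeo (eucl_manifold n U) (open_submanifold L V) \<Phi> \<longleftrightarrow> patch U \<Phi> \<and> \<Phi> ` U = V"
proof -
 have tV: "topspace (subtopology (mtop L) V) = V" using openin_subset[OF V] by auto
 have pV: "points (open_submanifold L V) = V" using tV by (simp add: open_submanifold_def)
 have bij: "bij_betw \<Phi> (points (eucl_manifold n U)) (points (open_submanifold L V)) \<longleftrightarrow> inj_on \<Phi> U \<and> \<Phi> ` U = V"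
  unfolding eucl_sub(1)[OF U] pV bij_betw_def ..
 have sub: "mtop (open_submanifold L V) = subtopology (mtop L) V" "mdim (open_submanifold L V) = n"
  "atlas (open_submanifold L V) = (\<lambda>c. (fst c \<inter> V, snd c)) ` atlas L"
  by (simp_all add: open_submanifold_def)
 have idU: "inv_into U (\<lambda>x. x) x = x" if "x \<in> U" for x using inv_into_f_f[of "\<lambda>x. x" U x] that by simp
 show ?thesis
 proof (cases "inj_on \<Phi> U \<and> \<Phi> ` U = V")
  case False
  then show ?thesis unfolding C2_diffeo_def bij patch_def by blast
 next
  case True
  then have inj: "inj_on \<Phi> U" and im: "\<Phi> ` U = V" by auto
  have cm: "continuous_map (subtopology (Euclidean_space n) U) (subtopology (mtop L) V) \<Phi> \<longleftrightarrow>
    continuous_map (subtopology (Euclidean_space n) U) (mtop L) \<Phi>"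
   using im by (auto simp: continuous_map_in_subtopology topspace_eopen[OF U])
  have cm': "continuous_map (subtopology (mtop L) V) (subtopology (Euclidean_space n) U) (inv_into U \<Phi>) \<longleftrightarrow>
    continuous_map (subtopology (mtop L) V) (Euclidean_space n) (inv_into U \<Phi>)"
   using im inv_into_into[of _ \<Phi> U] by (auto simp: continuous_map_in_subtopology tV)
  have A: "Ck_on n 2 ((\<lambda>x. x) ` {p \<in> U. \<Phi> p \<in> fst c \<inter> V}) (\<lambda>x. snd c (\<Phi> (inv_into U (\<lambda>x. x) x)) i) \<longleftrightarrow>
    Ck_on n 2 {x \<in> U. \<Phi> x \<in> fst c} (\<lambda>x. snd c (\<Phi> x) i)"
   if c: "c \<in> atlas L" and ct: "continuous_map (subtopology (Euclidean_space n) U) (mtop L) \<Phi>" for c i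
  proof -
   have eq: "(\<lambda>x. x) ` {p \<in> U. \<Phi> p \<in> fst c \<inter> V} = {x \<in> U. \<Phi> x \<in> fst c}" using im by auto
   have O': "eopen n {x \<in> U. \<Phi> x \<in> fst c}"
    using openin_continuous_map_preimage[OF ct chart_open[OF c]]
     openin_trans_full[OF _ U] unfolding topspace_eopen[OF U] by blast
   show ?thesis unfolding eq by (rule Ck_on_cong[OF O']) (simp add: idU)
  qed
  have B: "Ck_on n 2 (snd c ` {p \<in> fst c \<inter> V. inv_into U \<Phi> p \<in> U}) (\<lambda>z. inv_into U \<Phi> (inv_into (fst c \<inter> V) (snd c) z) i) \<longleftrightarrow>
    Ck_on n 2 (snd c ` (fst c \<inter> V)) (\<lambda>z. inv_into U \<Phi> (chart_inv c z) i)" if c: "c \<in> atlas L" for c i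
  proof -
   have eq: "{p \<in> fst c \<inter> V. inv_into U \<Phi> p \<in> U} = fst c \<inter> V" using im inv_into_into[of _ \<Phi> U] by auto
   show ?thesis unfolding eq
    by (rule Ck_on_cong[OF chart_open_image[OF c V]]) (simp add: inv_into_open_sub[OF c])
  qed
  have "C2_map (eucl_manifold n U) (open_submanifold L V) \<Phi> \<longleftrightarrow> continuous_map (subtopology (Euclidean_space n) U) (mtop L) \<Phi> \<and>
    (\<forall>c\<in>atlas L. \<forall>i<n. Ck_on n 2 {x \<in> U. \<Phi> x \<in> fst c} (\<lambda>x. snd c (\<Phi> x) i))"
   unfolding C2_map_def eucl_sub(2-)[OF U] sub cm using A by (intro conj_cong refl) simp
  moreover have "C2_map (open_submanifold L V) (eucl_manifold n U) (inv_into U \<Phi>) \<longleftrightarrow>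
    continuous_map (subtopology (mtop L) V) (Euclidean_space n) (inv_into U \<Phi>) \<and>
    (\<forall>c\<in>atlas L. \<forall>i<n. Ck_on n 2 (snd c ` (fst c \<inter> V)) (\<lambda>z. inv_into U \<Phi> (chart_inv c z) i))"
   unfolding C2_map_def eucl_sub(2-)[OF U] sub cm' using B by (intro conj_cong refl) simp
  ultimately show ?thesis
   unfolding C2_diffeo_def bij unfolding eucl_sub(1)[OF U] patch_def using U V inj im by auto
 qed
qed

text \<open>The tangent vector \<open>v\<close> at \<open>\<Phi> x\<close> is the image of \<open>w\<close> under the derivative of \<open>\<Phi>\<close>.\<close>

definition rep_at :: "(pt => 'm) => pt => 'm tvec => pt => bool" where
 "rep_at \<Phi> x v w \<longleftrightarrow> (\<forall>c\<in>atlas L. \<Phi> x \<in> fst c \<longrightarrow> (\<forall>i<n. v c i = jacobian_app n (\<lambda>y. snd c (\<Phi> y)) x w i))"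

text \<open>The derivative of the inverse parametrization recovers the representative, which is
  therefore unique.\<close>

lemma rep_at_inverse:
 assumes P: "patch U \<Phi>" and x: "x \<in> U" and r: "rep_at \<Phi> x v w" and c: "c \<in> atlas L" "\<Phi> x \<in> fst c" and i: "i < n"
 shows "w i = jacobian_app n (\<lambda>z. inv_into U \<Phi> (chart_inv c z)) (snd c (\<Phi> x)) (v c) i"
proof -
 let ?O = "{x \<in> U. \<Phi> x \<in> fst c}"
 have O: "eopen n ?O" by (rule patch_preimage[OF P chart_open[OF c(1)]])
 have "w i = jacobian_app n (\<lambda>y. inv_into U \<Phi> (chart_inv c (snd c (\<Phi> y)))) x w i"
  using x c patch_inv[OF P] by (intro jacobian_app_id[OF O _ _ i, symmetric]) auto
 also have "\<dots> = jacobian_app n (\<lambda>z. inv_into U \<Phi> (chart_inv c z)) (snd c (\<Phi> x)) (jacobian_app n (\<lambda>y. snd c (\<Phi> y)) x w) i"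
  by (rule jacobian_app_chain[where G = "\<lambda>y. snd c (\<Phi> y)" and F = "\<lambda>z. inv_into U \<Phi> (chart_inv c z)",
    OF O patch_coords_open[OF P c(1)] _ patch_C2[OF P c(1)] patch_inv_C2[OF P c(1) i]]) (use x c in auto)
 also have "\<dots> = jacobian_app n (\<lambda>z. inv_into U \<Phi> (chart_inv c z)) (snd c (\<Phi> x)) (v c) i"
  unfolding jacobian_app_def[of n "\<lambda>z. inv_into U \<Phi> (chart_inv c z)"]
  by (rule sum.cong) (use r c in \<open>auto simp: rep_at_def\<close>)
 finally show ?thesis .
qed

text \<open>The vector is pulled back through a single chart around the point; the transformation
  rule of \<open>tangent_space\<close> and the chain rule give the formula in all other
  charts.\<close>

lemma rep_at_exists:
 assumes P: "patch U \<Phi>" and x: "x \<in> U" and v: "v \<in> tangent_space L (\<Phi> x)"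
 shows "\<exists>w. rep_at \<Phi> x v w"
proof -
 obtain c0 where c0: "c0 \<in> atlas L" "\<Phi> x \<in> fst c0" using patch_points[OF P x] cover by blast
 let ?\<psi> = "\<lambda>z. inv_into U \<Phi> (chart_inv c0 z)"
 let ?z = "snd c0 (\<Phi> x)"
 let ?w = "jacobian_app n ?\<psi> ?z (v c0)"
 have "v c i = jacobian_app n (\<lambda>y. snd c (\<Phi> y)) x ?w i" if c: "c \<in> atlas L" "\<Phi> x \<in> fst c" and i: "i < n" for c i
 proof -
  let ?O = "snd c0 ` (fst c0 \<inter> (fst c \<inter> \<Phi> ` U))"
  have O: "eopen n ?O" by (rule chart_open_image[OF c0(1) openin_Int[OF chart_open[OF c(1)] patch_image[OF P]]])
  have zO: "?z \<in> ?O" using x c c0 by blast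
  have "v c i = jacobian_app n (\<lambda>z. snd c (chart_inv c0 z)) ?z (v c0) i"
   using v c c0 i unfolding tangent_space_def by blast
  also have "\<dots> = jacobian_app n (\<lambda>z. snd c (\<Phi> (?\<psi> z))) ?z (v c0) i"
   using patch_inv[OF P] c0 by (intro jacobian_app_cong[OF O zO]) auto
  also have "\<dots> = jacobian_app n (\<lambda>y. snd c (\<Phi> y)) (?\<psi> ?z) ?w i"
   by (rule jacobian_app_chain[where G = ?\<psi> and F = "\<lambda>y. snd c (\<Phi> y)", OF O patch_preimage[OF P chart_open[OF c(1)]] _
     Ck_on_subset[OF patch_inv_C2[OF P c0(1)]] patch_C2[OF P c(1) i] zO])
    (use c0 patch_inv[OF P] in auto)
  finally show ?thesis using c0 patch_inv[OF P x] by simp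
 qed
 then show ?thesis unfolding rep_at_def by blast
qed

lemma rep_at_chart:
 assumes c0: "c0 \<in> atlas L" and x: "x \<in> snd c0 ` fst c0" and v: "v \<in> tangent_space L (chart_inv c0 x)"
 shows "rep_at (chart_inv c0) x v (v c0)"
 unfolding rep_at_def
proof (intro ballI allI impI)
 fix c i assume c: "c \<in> atlas L" "chart_inv c0 x \<in> fst c" and i: "i < n"
 then have "v c i = jacobian_app n (\<lambda>z. snd c (chart_inv c0 z)) (snd c0 (chart_inv c0 x)) (v c0) i"
  using v c0 chart_inv_in[OF c0 x] unfolding tangent_space_def by blast
 then show "v c i = jacobian_app n (\<lambda>z. snd c (chart_inv c0 z)) x (v c0) i"
  using chart_inv_in[OF c0 x] by simp
qed

lemma rep_at_compose:
 assumes P: "patch W \<Psi>" and U: "eopen n U" and sub: "\<phi> ` U \<subseteq> W"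
  and \<phi>: "\<And>k. k < n ==> Ck_on n 2 U (\<lambda>u. \<phi> u k)" and u: "u \<in> U"
  and r: "rep_at \<Psi> (\<phi> u) v w'" and w': "\<And>k. k < n ==> w' k = jacobian_app n \<phi> u w k"
 shows "rep_at (\<lambda>u. \<Psi> (\<phi> u)) u v w"
 unfolding rep_at_def
proof (intro ballI allI impI)
 fix c i assume c: "c \<in> atlas L" "\<Psi> (\<phi> u) \<in> fst c" and i: "i < n"
 let ?O = "{x \<in> W. \<Psi> x \<in> fst c}"
 have O: "eopen n ?O" by (rule patch_preimage[OF P chart_open[OF c(1)]])
 obtain e where e: "e > 0" "cub n (\<phi> u) e \<subseteq> ?O"
  using eopen_cubE[OF O, of "\<phi> u"] u sub c by auto
 have "eopen n {x \<in> U. \<phi> x \<in> ?O}"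
 proof -
  have z\<phi>: "\<phi> u = (\<lambda>i. if i < n then \<phi> u i else 0)" if "u \<in> U" for u
   using eopen_zero[OF patch_eopen[OF P], of "\<phi> u"] that sub by (auto simp: fun_eq_iff not_less)
  have "continuous_map (subtopology (Euclidean_space n) U) (Euclidean_space n) (\<lambda>u i. if i < n then \<phi> u i else 0)"
   unfolding continuous_map_componentwise_Euclidean_space
   using Ck_on_continuous[OF U \<phi>] continuous_map_Euclidean_iff[OF U] by blast
  then have "continuous_map (subtopology (Euclidean_space n) U) (Euclidean_space n) \<phi>"
   by (rule continuous_map_eq) (use z\<phi> in \<open>auto simp: topspace_eopen[OF U]\<close>)
  from openin_continuous_map_preimage[OF this O] show ?thesis
   using openin_trans_full[OF _ U] unfolding topspace_eopen[OF U] by blast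
 qed
 then have "jacobian_app n (\<lambda>y. snd c (\<Psi> (\<phi> y))) u w i = jacobian_app n (\<lambda>y. snd c (\<Psi> y)) (\<phi> u) (jacobian_app n \<phi> u w) i"
  by (rule jacobian_app_chain[where G = \<phi> and F = "\<lambda>y. snd c (\<Psi> y)", OF _ O _ Ck_on_subset[OF \<phi>] patch_C2[OF P c(1) i]]) (use u sub c in auto)
 also have "\<dots> = jacobian_app n (\<lambda>y. snd c (\<Psi> y)) (\<phi> u) w' i"
  unfolding jacobian_app_def[of n "\<lambda>y. snd c (\<Psi> y)"] by (rule sum.cong) (auto simp: w')
 finally show "v c i = jacobian_app n (\<lambda>y. snd c (\<Psi> (\<phi> y))) u w i"
  using r c i by (simp add: rep_at_def)
qed

lemma tangent_zero: "v \<in> tangent_space L p ==> \<not> (c \<in> atlas L \<and> p \<in> fst c \<and> i < n) ==> v c i = 0"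
 unfolding tangent_space_def by blast

text \<open>Resolves the definite description in \<open>pullback\<close>: the representative padded
  with zeros gives existence, \<open>rep_at_inverse\<close> uniqueness.\<close>

lemma pullback_rep:
 assumes P: "patch U \<Phi>" and x: "x \<in> U" and v: "W (\<Phi> x) \<in> tangent_space L (\<Phi> x)"
  and r: "rep_at \<Phi> x (W (\<Phi> x)) w" and i: "i < n"
 shows "pullback (eucl_manifold n U) L \<Phi> W x (U, \<lambda>x. x) i = w i"
proof -
 let ?E = "eucl_manifold n U"
 have U: "eopen n U" by (rule patch_eopen[OF P])
 have idU: "inv_into U (\<lambda>x. x) x = x" if "x \<in> U" for x using inv_into_f_f[of "\<lambda>x. x" U x] that by simp
 define v0 :: "pt tvec" where "v0 = (\<lambda>c i. if c = (U, \<lambda>x. x) \<and> i < n then w i else 0)"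
 have t: "u \<in> tangent_space ?E x \<longleftrightarrow> (\<forall>c i. \<not> (c = (U, \<lambda>x. x) \<and> i < n) \<longrightarrow> u c i = 0)" for u
 proof -
  have "u (U, \<lambda>x. x) i = jacobian_app n (\<lambda>y. inv_into U (\<lambda>x. x) y) x (u (U, \<lambda>x. x)) i" if "i < n" for i
   using idU that by (intro jacobian_app_id[OF U x, symmetric]) auto
  then show ?thesis using x unfolding tangent_space_def eucl_sub[OF U] by simp blast
 qed
 have some: "(SOME c. c \<in> atlas ?E \<and> x \<in> fst c) = (U, \<lambda>x. x)"
  using x by (intro some_equality) (auto simp: eucl_sub[OF U])
 have d: "differential ?E L \<Phi> x u c i =
   (if c \<in> atlas L \<and> \<Phi> x \<in> fst c \<and> i < n then jacobian_app n (\<lambda>y. snd c (\<Phi> y)) x (u (U, \<lambda>x. x)) i else 0)" for u c i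
 proof -
  have "jacobian_app n (\<lambda>y. snd c (\<Phi> (inv_into U (\<lambda>x. x) y))) x (u (U, \<lambda>x. x)) i = jacobian_app n (\<lambda>y. snd c (\<Phi> y)) x (u (U, \<lambda>x. x)) i"
   using idU by (intro jacobian_app_cong[OF U x]) auto
  then show ?thesis unfolding differential_def some unfolding eucl_sub[OF U] Let_def by simp
 qed
 have "pullback ?E L \<Phi> W x = v0"
  unfolding pullback_def
 proof (rule the_equality)
  have "differential ?E L \<Phi> x v0 c i = W (\<Phi> x) c i" for c i
  proof -
   have "jacobian_app n (\<lambda>y. snd c (\<Phi> y)) x (v0 (U, \<lambda>x. x)) i = jacobian_app n (\<lambda>y. snd c (\<Phi> y)) x w i"
    by (rule jacobian_app_cong[OF U x]) (auto simp: v0_def)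
   then show ?thesis using r tangent_zero[OF v, of c i] unfolding d rep_at_def by auto
  qed
  then show "v0 \<in> tangent_space ?E x \<and> differential ?E L \<Phi> x v0 = W (\<Phi> x)"
   unfolding t by (intro conjI ext) (simp_all add: v0_def)
  fix u assume u: "u \<in> tangent_space ?E x \<and> differential ?E L \<Phi> x u = W (\<Phi> x)"
  have "rep_at \<Phi> x (W (\<Phi> x)) (u (U, \<lambda>x. x))"
   unfolding rep_at_def
  proof (intro ballI allI impI)
   fix c i assume "c \<in> atlas L" "\<Phi> x \<in> fst c" "i < n"
   then show "W (\<Phi> x) c i = jacobian_app n (\<lambda>y. snd c (\<Phi> y)) x (u (U, \<lambda>x. x)) i"
    using d[of u c i] u by simp
  qed
  moreover obtain c where c: "c \<in> atlas L" "\<Phi> x \<in> fst c" using patch_points[OF P x] cover by blast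
  ultimately have "u (U, \<lambda>x. x) i = w i" if "i < n" for i
   using rep_at_inverse[OF P x _ c that] r by metis
  moreover have "\<not> (c = (U, \<lambda>x. x) \<and> i < n) ==> u c i = 0" for c i using u t[of u] by blast
  ultimately have "u c i = v0 c i" for c i unfolding v0_def by metis
  then show "u = v0" by blast
 qed
 then show ?thesis using i by (simp add: v0_def)
qed

end

section \<open>Integral curves and Lie derivatives\<close>

text \<open>Compactness of a closed cube bounds the field and its partial derivatives, and the mean
  value inequality on the ball gives the Lipschitz constant.\<close>

lemma C1_locally_lipschitz:
 assumes O: "eopen n O'" and f: "\<And>i. i < n ==> Ck_on n (Suc 0) O' (f i)" and z: "z \<in> O'"
 shows "\<exists>r>0. \<exists>K\<ge>0. \<exists>B\<ge>0. \<forall>h\<in>ball (hb n z) r. cf n h \<in> O' \<and> norm (lft n f h) \<le> B \<and>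
  (\<forall>h'\<in>ball (hb n z) r. norm (lft n f h - lft n f h') \<le> K * norm (h - h'))"
proof -
 obtain e where e: "e > 0" "cub n z e \<subseteq> O'" using eopen_cubE[OF O z] .
 let ?r = "e / 2"
 have sub: "ccube n z ?r \<subseteq> O'" using e by (force simp: ccube_def cub_def)
 have c1: "continuous_on (ccube n z ?r) (f i)" if "i < n" for i
  by (rule continuous_on_subset[OF Ck_on_continuous[OF O f[OF that]] sub])
 have c2: "continuous_on (ccube n z ?r) (partial k (f i))" if "i < n" "k < n" for i k
  by (rule continuous_on_subset[OF Ck_on_continuous[OF O Ck_on_Suc_partial(1)[OF f[OF that(1)] that(2)]] sub])
 have "\<exists>b\<ge>0. \<forall>i\<in>{..<n}. \<forall>x\<in>ccube n z ?r. \<bar>f i x\<bar> \<le> b"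
  by (rule ccube_bounded) (use c1 in auto)
 then obtain B where B: "B \<ge> 0" "\<And>i x. i < n ==> x \<in> ccube n z ?r ==> \<bar>f i x\<bar> \<le> B" by auto
 have "\<exists>b\<ge>0. \<forall>y\<in>{..<n} \<times> {..<n}. \<forall>x\<in>ccube n z ?r. \<bar>(case y of (i, k) => partial k (f i)) x\<bar> \<le> b"
  by (rule ccube_bounded) (use c2 in auto)
 then obtain b where b: "b \<ge> 0" "\<And>i k x. i < n ==> k < n ==> x \<in> ccube n z ?r ==> \<bar>partial k (f i) x\<bar> \<le> b" by auto
 have cc: "cf n h \<in> ccube n z ?r" if h: "h \<in> ball (hb n z) ?r" for h
 proof -
  have "\<bar>apply_bcontfun h i - z i\<bar> \<le> ?r" if "i < n" for i
   using coord_le_norm[of "h - hb n z" i] h that by (simp add: dist_norm norm_minus_commute)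
  then show ?thesis by (auto simp: ccube_def)
 qed
 have loc: "\<forall>h\<in>ball (hb n z) ?r. cf n h \<in> O' \<and> norm (lft n f h) \<le> B \<and>
  (\<forall>h'\<in>ball (hb n z) ?r. norm (lft n f h - lft n f h') \<le> real n * b * norm (h - h'))"
 proof (intro conjI ballI)
  show "cf n h \<in> O'" if "h \<in> ball (hb n z) ?r" for h using cc[OF that] sub by blast
  show "norm (lft n f h) \<le> B" if "h \<in> ball (hb n z) ?r" for h
   unfolding lft_def by (rule norm_hb_bound) (use B cc[OF that] in auto)
  show "norm (lft n f h - lft n f h') \<le> real n * b * norm (h - h')"
   if h: "h \<in> ball (hb n z) ?r" and h': "h' \<in> ball (hb n z) ?r" for h h'
  proof (rule differentiable_bound[OF convex_ball _ _ h h', where f' = "dlft n f"])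
   fix k assume k: "k \<in> ball (hb n z) ?r"
   have "cf n k \<in> O'" using cc[OF k] sub by blast
   show "(lft n f has_derivative dlft n f k) (at k within ball (hb n z) ?r)"
    by (rule has_derivative_at_withinI, rule lft_has_derivative[where F = f, OF O _ \<open>cf n k \<in> O'\<close>], rule f)
   show "onorm (dlft n f k) \<le> real n * b"
   proof (rule onorm_bound)
    show "0 \<le> real n * b" using b by simp
    fix v
    show "norm (dlft n f k v) \<le> real n * b * norm v"
     unfolding dlft_def
    proof (rule norm_hb_bound)
     fix i assume i: "i < n"
     have "\<bar>\<Sum>j<n. partial j (f i) (cf n k) * apply_bcontfun v j\<bar> \<le> (\<Sum>j<n. b * norm v)"
      by (rule order_trans[OF sum_abs], rule sum_mono)
       (use b i cc[OF k] coord_le_norm in \<open>auto simp: abs_mult intro!: mult_mono\<close>)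
     then show "\<bar>\<Sum>j<n. partial j (f i) (cf n k) * apply_bcontfun v j\<bar> \<le> real n * b * norm v" by simp
    qed (use b in auto)
   qed
  qed
 qed
 have "?r > 0" "real n * b \<ge> 0" "B \<ge> 0" using e B b by auto
 show ?thesis
  by (rule exI[of _ ?r], rule conjI, fact, rule exI[of _ "real n * b"], rule conjI, fact,
    rule exI[of _ B], rule conjI, fact, rule loc)
qed

lemma hb_has_vector_derivative:
 assumes "\<And>i. i < n ==> ((\<lambda>t. \<gamma> t i) has_real_derivative d i) (at t)"
 shows "((\<lambda>t. hb n (\<gamma> t)) has_vector_derivative hb n d) (at t)"
 unfolding hb_def
proof (rule has_vector_derivative_sum)
 fix i assume "i \<in> {..<n}"
 then have "((\<lambda>t. \<gamma> t i) has_vector_derivative d i) (at t)"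
  using assms by (simp add: has_real_derivative_iff_has_vector_derivative)
 then show "((\<lambda>t. \<gamma> t i *\<^sub>R ev i) has_vector_derivative d i *\<^sub>R ev i) (at t)"
  by (rule bounded_linear.has_vector_derivative[OF bounded_linear_scaleR_left])
qed

definition solution :: "nat => pt set => (nat => pt => real) => real => real => (real => nat => real) => bool" where
 "solution n U f a b \<eta> \<longleftrightarrow> (\<forall>s\<in>{a<..<b}. \<eta> s \<in> U \<and> (\<forall>i<n. ((\<lambda>s. \<eta> s i) has_real_derivative f i (\<eta> s)) (at s)))"

lemma solution_unique_local:
 assumes O: "eopen n O'" and f: "\<And>i. i < n ==> Ck_on n (Suc 0) O' (f i)"
  and s: "solution n O' f a b \<gamma>" "solution n O' f a b \<gamma>'" and t0: "t0 \<in> {a<..<b}" "\<gamma> t0 = \<gamma>' t0"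
 shows "\<exists>e>0. \<forall>t. \<bar>t - t0\<bar> < e \<longrightarrow> \<gamma> t = \<gamma>' t"
proof -
 have z: "\<gamma> t0 \<in> O'" using s(1) t0(1) unfolding solution_def by blast
 have "\<exists>r>0. \<exists>K\<ge>0. \<exists>B\<ge>0. \<forall>h\<in>ball (hb n (\<gamma> t0)) r. cf n h \<in> O' \<and> norm (lft n f h) \<le> B \<and>
  (\<forall>h'\<in>ball (hb n (\<gamma> t0)) r. norm (lft n f h - lft n f h') \<le> K * norm (h - h'))"
  by (rule C1_locally_lipschitz[where f = f, OF O _ z], rule f)
 then obtain r K B where r: "r > 0" and K: "K \<ge> 0" and B: "B \<ge> 0"
  and loc: "\<forall>h\<in>ball (hb n (\<gamma> t0)) r. cf n h \<in> O' \<and> norm (lft n f h) \<le> B \<and>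
  (\<forall>h'\<in>ball (hb n (\<gamma> t0)) r. norm (lft n f h - lft n f h') \<le> K * norm (h - h'))"
  by (elim exE conjE) (rule that)
 have lip: "norm (lft n f h - lft n f h') \<le> K * norm (h - h')"
  if "h \<in> ball (hb n (\<gamma> t0)) r" "h' \<in> ball (hb n (\<gamma> t0)) r" for h h'
  by (rule bspec[OF conjunct2[OF conjunct2[OF bspec[OF loc that(1)]]] that(2)])
 have vd: "((\<lambda>t. hb n (\<beta> t)) has_vector_derivative lft n f (hb n (\<beta> t))) (at t)"
  if "solution n O' f a b \<beta>" "t \<in> {a<..<b}" for \<beta> t
 proof -
  have "cf n (hb n (\<beta> t)) = \<beta> t" using that by (intro cf_hb_eopen[OF O]) (simp add: solution_def)
  then have "lft n f (hb n (\<beta> t)) = hb n (\<lambda>i. f i (\<beta> t))" by (simp add: lft_def del: cf_hb)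
  then show ?thesis using that by (simp add: solution_def hb_has_vector_derivative)
 qed
 have ct: "\<forall>\<^sub>F t in at t0. hb n (\<beta> t) \<in> ball (hb n (\<gamma> t0)) r" if "solution n O' f a b \<beta>" "\<beta> t0 = \<gamma> t0" for \<beta>
 proof -
  have "isCont (\<lambda>t. hb n (\<beta> t)) t0" by (rule has_vector_derivative_continuous[OF vd[OF that(1) t0(1)]])
  then show ?thesis unfolding isCont_def
   by (rule topological_tendstoD) (use r that in auto)
 qed
 have "\<forall>\<^sub>F t in at t0. t \<in> {a<..<b} \<and> hb n (\<gamma> t) \<in> ball (hb n (\<gamma> t0)) r \<and> hb n (\<gamma>' t) \<in> ball (hb n (\<gamma> t0)) r"
  using ct[OF s(1)] ct[OF s(2)] t0 by (intro eventually_conj eventually_at_in_open') auto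
 then obtain d where d: "d > 0" "\<And>t. t \<noteq> t0 ==> \<bar>t - t0\<bar> < d ==>
   t \<in> {a<..<b} \<and> hb n (\<gamma> t) \<in> ball (hb n (\<gamma> t0)) r \<and> hb n (\<gamma>' t) \<in> ball (hb n (\<gamma> t0)) r"
  unfolding eventually_at by (auto simp: dist_real_def)
 have d': "t \<in> {a<..<b}" "hb n (\<gamma> t) \<in> ball (hb n (\<gamma> t0)) r" "hb n (\<gamma>' t) \<in> ball (hb n (\<gamma> t0)) r"
  if "\<bar>t - t0\<bar> < d" for t using d(2)[of t] that t0 r by (cases "t = t0"; auto)+
 define T where "T = min (d / 2) (1 / (2 * (K + 1)))"
 have T: "T > 0" "T < d" using d K by (auto simp: T_def)
 have TK: "T * K \<le> 1/2"
 proof -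
  have "T * K \<le> 1 / (2 * (K + 1)) * K" using K by (intro mult_right_mono) (auto simp: T_def)
  also have "\<dots> \<le> 1/2" using K by (simp add: field_simps)
  finally show ?thesis .
 qed
 \<comment> \<open>The sign \<open>\<sigma>\<close> selects the direction of time, as the Gronwall
   estimate runs forward only.\<close>
 have eq: "hb n (\<gamma> (t0 + \<sigma> * \<rho>)) - hb n (\<gamma>' (t0 + \<sigma> * \<rho>)) = 0" if \<sigma>: "\<bar>\<sigma>\<bar> = 1" and \<rho>: "\<rho> \<in> {0..T}" for \<sigma> \<rho>
 proof -
  let ?u = "\<lambda>\<rho>. hb n (\<gamma> (t0 + \<sigma> * \<rho>)) - hb n (\<gamma>' (t0 + \<sigma> * \<rho>))"
  let ?u' = "\<lambda>\<rho>. \<sigma> *\<^sub>R (lft n f (hb n (\<gamma> (t0 + \<sigma> * \<rho>))) - lft n f (hb n (\<gamma>' (t0 + \<sigma> * \<rho>))))"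
  have near: "\<bar>(t0 + \<sigma> * \<rho>) - t0\<bar> < d" if "\<rho> \<in> {0..T}" for \<rho> using that \<sigma> T by (simp add: abs_mult)
  have "norm (?u \<rho>) \<le> 2 * T * 0"
  proof (rule gronwall_half[where u = ?u and u' = ?u', OF _ K TK])
   fix \<rho> assume \<rho>: "\<rho> \<in> {0..T}"
   have lin: "((\<lambda>\<rho>. t0 + \<sigma> * \<rho>) has_vector_derivative \<sigma>) (at \<rho> within {0..T})"
    unfolding has_real_derivative_iff_has_vector_derivative[symmetric] by (auto intro!: derivative_eq_intros)
   have vc: "((\<lambda>\<rho>. hb n (\<beta> (t0 + \<sigma> * \<rho>))) has_vector_derivative \<sigma> *\<^sub>R lft n f (hb n (\<beta> (t0 + \<sigma> * \<rho>)))) (at \<rho> within {0..T})"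
    if "solution n O' f a b \<beta>" for \<beta>
    using vector_diff_chain_within[OF lin has_vector_derivative_at_within[OF vd[OF that d'(1)[OF near[OF \<rho>]]]]]
    by (simp add: comp_def)
   show "(?u has_vector_derivative ?u' \<rho>) (at \<rho> within {0..T})"
    unfolding scaleR_diff_right by (intro has_vector_derivative_diff vc s)
   show "norm (?u' \<rho>) \<le> K * norm (?u \<rho>) + 0"
    using lip[OF d'(2)[OF near[OF \<rho>]] d'(3)[OF near[OF \<rho>]]] \<sigma> by simp
  qed (use T \<rho> t0 in auto)
  then show ?thesis by simp
 qed
 show ?thesis
 proof (intro exI conjI allI impI)
  show "T > 0" by (rule T)
  fix t assume t: "\<bar>t - t0\<bar> < T"
  obtain \<sigma> :: real where \<sigma>: "\<bar>\<sigma>\<bar> = 1" "t = t0 + \<sigma> * \<bar>t - t0\<bar>"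
   using that[of 1] that[of "- 1"] by (cases "t \<ge> t0") auto
  have "hb n (\<gamma> t) = hb n (\<gamma>' t)"
   using eq[OF \<sigma>(1), of "\<bar>t - t0\<bar>"] t unfolding \<sigma>(2)[symmetric] by simp
  moreover have "\<gamma> t \<in> O'" "\<gamma>' t \<in> O'" using s d'(1)[of t] t T by (auto simp: solution_def)
  ultimately show "\<gamma> t = \<gamma>' t" using hb_inject[of n "\<gamma> t" "\<gamma>' t"] eopen_zero[OF O] by blast
 qed
qed

lemma solution_exists:
 assumes O: "eopen n O'" and f: "\<And>i. i < n ==> Ck_on n (Suc 0) O' (f i)" and z: "z \<in> O'"
 shows "\<exists>e>0. \<exists>\<eta>. \<eta> 0 = z \<and> solution n O' f (- e) e \<eta>"
proof -
 have "\<exists>r>0. \<exists>K\<ge>0. \<exists>B\<ge>0. \<forall>h\<in>ball (hb n z) r. cf n h \<in> O' \<and> norm (lft n f h) \<le> B \<and>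
  (\<forall>h'\<in>ball (hb n z) r. norm (lft n f h - lft n f h') \<le> K * norm (h - h'))"
  by (rule C1_locally_lipschitz[where f = f, OF O _ z], rule f)
 then obtain r K B where r: "r > 0" and K: "K \<ge> 0" and B: "B \<ge> 0"
  and loc: "\<forall>h\<in>ball (hb n z) r. cf n h \<in> O' \<and> norm (lft n f h) \<le> B \<and>
  (\<forall>h'\<in>ball (hb n z) r. norm (lft n f h - lft n f h') \<le> K * norm (h - h'))"
  by (elim exE conjE) (rule that)
 have inO: "cf n h \<in> O'" if "h \<in> ball (hb n z) r" for h by (rule conjunct1[OF bspec[OF loc that]])
 have bnd: "norm (lft n f h) \<le> B" if "h \<in> ball (hb n z) r" for h
  by (rule conjunct1[OF conjunct2[OF bspec[OF loc that]]])
 have lip: "norm (lft n f h - lft n f h') \<le> K * norm (h - h')"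
  if "h \<in> ball (hb n z) r" "h' \<in> ball (hb n z) r" for h h'
  by (rule bspec[OF conjunct2[OF conjunct2[OF bspec[OF loc that(1)]]] that(2)])
 have sub: "h \<in> ball (hb n z) r" if "h \<in> cball (hb n z) (r / 2)" for h using that r by simp
 define T where "T = min (r / 2 / (B + 1)) (1 / (2 * (K + 1)))"
 have T: "T > 0" using r B K by (auto simp: T_def)
 have TB: "T * B \<le> r / 2"
 proof -
  have "T * B \<le> r / 2 / (B + 1) * B" using B by (intro mult_right_mono) (auto simp: T_def)
  also have "\<dots> \<le> r / 2" using B r by (simp add: field_simps)
  finally show ?thesis .
 qed
 have TK: "T * K \<le> 1/2"
 proof -
  have "T * K \<le> 1 / (2 * (K + 1)) * K" using K by (intro mult_right_mono) (auto simp: T_def)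
  also have "\<dots> \<le> 1/2" using K by (simp add: field_simps)
  finally show ?thesis .
 qed
 have "\<exists>u. u 0 = hb n z \<and> (\<forall>s\<in>{-T..T}. u s \<in> cball (hb n z) (r / 2) \<and>
   (u has_vector_derivative lft n f (u s)) (at s within {-T..T}))"
  by (rule ode_exists[OF _ K _ _ _ TB TK]) (use T r lip bnd sub in auto)
 then obtain u where u: "u 0 = hb n z" "\<And>s. s \<in> {-T..T} ==> u s \<in> cball (hb n z) (r / 2)"
  "\<And>s. s \<in> {-T..T} ==> (u has_vector_derivative lft n f (u s)) (at s within {-T..T})" by blast
 have "solution n O' f (- T) T (\<lambda>s. cf n (u s))"
  unfolding solution_def
 proof (intro ballI conjI allI impI)
  fix s assume s: "s \<in> {- T<..<T}"
  then have s': "s \<in> {-T..T}" by simp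
  show "cf n (u s) \<in> O'" by (rule inO[OF sub[OF u(2)[OF s']]])
  fix i assume i: "i < n"
  have "at s within {-T..T} = at s" using s by (intro at_within_interior) (simp add: interior_atLeastAtMost_real)
  then have "(u has_vector_derivative lft n f (u s)) (at s)" using u(3)[OF s'] by simp
  from bounded_linear.has_vector_derivative[OF bounded_linear_coord this, of i]
  show "((\<lambda>s. cf n (u s) i) has_real_derivative f i (cf n (u s))) (at s)"
   using i by (simp add: has_real_derivative_iff_has_vector_derivative lft_def)
 qed
 moreover have "cf n (u 0) = z" using cf_hb_eopen[OF O z] u(1) by simp
 ultimately show ?thesis
  by (intro exI[of _ T] exI[of _ "\<lambda>s. cf n (u s)"] conjI T) simp_all
qed

context C2_mfd
begin

text \<open>The set of times at which the curves agree is closed by the Hausdorff property and open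
  by local uniqueness in a chart, and the common interval is connected.\<close>

lemma integral_curve_unique:
 assumes W: "C1_vector_field L W"
  and g1: "integral_curve L W {a1<..<b1} \<gamma>1" and g2: "integral_curve L W {a2<..<b2} \<gamma>2"
  and z: "0 \<in> {a1<..<b1}" "0 \<in> {a2<..<b2}" "\<gamma>1 0 = \<gamma>2 0"
  and t: "t \<in> {a1<..<b1}" "t \<in> {a2<..<b2}"
 shows "\<gamma>1 t = \<gamma>2 t"
proof -
 define I where "I = {max a1 a2<..<min b1 b2}"
 define S where "S = {t \<in> I. \<gamma>1 t = \<gamma>2 t}"
 have I: "open I" "connected I" "0 \<in> I" "t \<in> I" "I \<subseteq> {a1<..<b1}" "I \<subseteq> {a2<..<b2}"
  using z t by (auto simp: I_def)
 have c1: "continuous_map (top_of_set I) (mtop L) \<gamma>1"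
  using g1 I(5) unfolding integral_curve_def by (blast intro: continuous_map_from_subtopology_mono)
 have c2: "continuous_map (top_of_set I) (mtop L) \<gamma>2"
  using g2 I(6) unfolding integral_curve_def by (blast intro: continuous_map_from_subtopology_mono)
 have "closedin (top_of_set I) {t \<in> topspace (top_of_set I). \<gamma>1 t = \<gamma>2 t}"
  by (rule closedin_continuous_maps_eq[OF Hausdorff c1 c2])
 then have cl: "closedin (top_of_set I) S" by (simp add: S_def)
 have "open S"
  unfolding open_dist
 proof
  fix t0 assume "t0 \<in> S"
  then have t0: "t0 \<in> I" "\<gamma>1 t0 = \<gamma>2 t0" by (auto simp: S_def)
  have "\<gamma>1 t0 \<in> points L" using c1 t0(1) continuous_map_image_subset_topspace[OF c1] by auto
  then obtain c where c: "c \<in> atlas L" "\<gamma>1 t0 \<in> fst c" using cover by blast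
  have pre: "open {t \<in> I. \<beta> t \<in> fst c}" if "continuous_map (top_of_set I) (mtop L) \<beta>" for \<beta>
   using openin_continuous_map_preimage[OF that chart_open[OF c(1)]] I(1)
   by (simp add: openin_open_eq)
  have "open ({t \<in> I. \<gamma>1 t \<in> fst c} \<inter> {t \<in> I. \<gamma>2 t \<in> fst c})" by (intro open_Int pre c1 c2)
  moreover have "t0 \<in> {t \<in> I. \<gamma>1 t \<in> fst c} \<inter> {t \<in> I. \<gamma>2 t \<in> fst c}" using t0 c by auto
  ultimately have "\<exists>d>0. \<forall>t. dist t t0 < d \<longrightarrow> t \<in> {t \<in> I. \<gamma>1 t \<in> fst c} \<inter> {t \<in> I. \<gamma>2 t \<in> fst c}"
   unfolding open_dist by (rule bspec)
  then obtain d where d: "d > 0" "\<And>t. \<bar>t - t0\<bar> < d ==> t \<in> I \<and> \<gamma>1 t \<in> fst c \<and> \<gamma>2 t \<in> fst c"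
   by (auto simp: dist_real_def)
  let ?f = "\<lambda>i z. W (chart_inv c z) c i"
  have f: "Ck_on n (Suc 0) (snd c ` fst c) (?f i)" if "i < n" for i
   using W c(1) that unfolding C1_vector_field_def by simp
  have sol: "solution n (snd c ` fst c) ?f (t0 - d) (t0 + d) (\<lambda>t. snd c (\<beta> t))"
   if "integral_curve L W {a<..<b} \<beta>" "I \<subseteq> {a<..<b}" "\<And>t. \<bar>t - t0\<bar> < d ==> \<beta> t \<in> fst c" for \<beta> a b
   unfolding solution_def
  proof (intro ballI conjI allI impI)
   fix s assume "s \<in> {t0 - d<..<t0 + d}"
   then have s: "\<bar>s - t0\<bar> < d" by auto
   show "snd c (\<beta> s) \<in> snd c ` fst c" using that(3)[OF s] by simp
   fix i assume "i < n"
   then have "((\<lambda>s. snd c (\<beta> s) i) has_real_derivative W (\<beta> s) c i) (at s)"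
    using that(1,2) that(3)[OF s] d(2)[OF s] c(1) unfolding integral_curve_def by blast
   then show "((\<lambda>s. snd c (\<beta> s) i) has_real_derivative ?f i (snd c (\<beta> s))) (at s)"
    using that(3)[OF s] c(1) by simp
  qed
  have s1: "solution n (snd c ` fst c) ?f (t0 - d) (t0 + d) (\<lambda>t. snd c (\<gamma>1 t))"
   by (rule sol[OF g1 I(5)]) (use d in blast)
  have s2: "solution n (snd c ` fst c) ?f (t0 - d) (t0 + d) (\<lambda>t. snd c (\<gamma>2 t))"
   by (rule sol[OF g2 I(6)]) (use d in blast)
  obtain e where e: "e > 0" "\<And>t. \<bar>t - t0\<bar> < e ==> snd c (\<gamma>1 t) = snd c (\<gamma>2 t)"
   using solution_unique_local[OF chart_image[OF c(1)] f s1 s2, of t0] t0 d(1) by auto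
  show "\<exists>e>0. \<forall>y. dist y t0 < e \<longrightarrow> y \<in> S"
  proof (intro exI conjI allI impI)
   show "min d e > 0" using d e by simp
   fix y assume "dist y t0 < min d e"
   then have y: "\<bar>y - t0\<bar> < d" "\<bar>y - t0\<bar> < e" by (auto simp: dist_real_def)
   have "\<gamma>1 y = \<gamma>2 y" using inj_onD[OF chart_inj[OF c(1)] e(2)[OF y(2)]] d(2)[OF y(1)] by blast
   then show "y \<in> S" using d(2)[OF y(1)] by (simp add: S_def)
  qed
 qed
 then have op: "openin (top_of_set I) S" using I(1) by (simp add: openin_open_eq S_def)
 have "S = {} \<or> S = I" using I(2) cl op unfolding connected_clopen by blast
 then show ?thesis using I z by (auto simp: S_def)
qed

lemma flow_eq:
 assumes W: "C1_vector_field L W" and g: "integral_curve L W {a<..<b} \<gamma>" and "0 \<in> {a<..<b}" "t \<in> {a<..<b}"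
 shows "flow L W t (\<gamma> 0) = \<gamma> t"
 unfolding flow_def
proof (rule the_equality)
 show "\<exists>\<gamma>' a b. a < 0 \<and> 0 < b \<and> t \<in> {a<..<b} \<and> integral_curve L W {a<..<b} \<gamma>' \<and> \<gamma>' 0 = \<gamma> 0 \<and> \<gamma>' t = \<gamma> t"
  using assms by (intro exI[of _ \<gamma>] exI[of _ a] exI[of _ b]) auto
 fix y assume "\<exists>\<gamma>' a b. a < 0 \<and> 0 < b \<and> t \<in> {a<..<b} \<and> integral_curve L W {a<..<b} \<gamma>' \<and> \<gamma>' 0 = \<gamma> 0 \<and> \<gamma>' t = y"
 then obtain \<gamma>' a' b' where h: "a' < 0" "0 < b'" "t \<in> {a'<..<b'}" "integral_curve L W {a'<..<b'} \<gamma>'" "\<gamma>' 0 = \<gamma> 0" "\<gamma>' t = y"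
  by blast
 show "y = \<gamma> t" using integral_curve_unique[OF W h(4) g _ assms(3) h(5) h(3) assms(4)] h by auto
qed

lemma lie_deriv_along_0:
 assumes W: "C1_vector_field L W" and g: "integral_curve L W {a<..<b} \<gamma>" and z: "0 \<in> {a<..<b}"
 shows "has_lie_deriv L W f (\<gamma> 0) \<longleftrightarrow> (\<exists>D. ((\<lambda>t. f (\<gamma> t)) has_real_derivative D) (at 0))"
  and "((\<lambda>t. f (\<gamma> t)) has_real_derivative D) (at 0) ==> lie_deriv L W f (\<gamma> 0) = D"
proof -
 have "\<forall>\<^sub>F t in nhds 0. t \<in> {a<..<b}" using z by (intro eventually_nhds_in_open) auto
 then have ev: "\<forall>\<^sub>F t in nhds 0. f (flow L W t (\<gamma> 0)) = f (\<gamma> t)"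
  by (rule eventually_mono) (simp only: flow_eq[OF W g z])
 have "((\<lambda>t. f (flow L W t (\<gamma> 0))) has_real_derivative D) (at 0) = ((\<lambda>t. f (\<gamma> t)) has_real_derivative D) (at 0)" for D
  by (rule DERIV_cong_ev[OF refl ev refl])
 then show "has_lie_deriv L W f (\<gamma> 0) \<longleftrightarrow> (\<exists>D. ((\<lambda>t. f (\<gamma> t)) has_real_derivative D) (at 0))"
  and "((\<lambda>t. f (\<gamma> t)) has_real_derivative D) (at 0) ==> lie_deriv L W f (\<gamma> 0) = D"
  unfolding has_lie_deriv_def lie_deriv_def real_differentiable_def by (auto intro: DERIV_imp_deriv)
qed

text \<open>By uniqueness the flow started at \<open>\<gamma> s\<close> follows the shifted curve,
  so the derivative at time 0 in \<open>lie_deriv\<close> is the derivative along the curve at time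
  \<open>s\<close>.\<close>

lemma lie_deriv_along:
 assumes W: "C1_vector_field L W" and g: "integral_curve L W {a<..<b} \<gamma>" and s: "s \<in> {a<..<b}"
  and f: "has_lie_deriv L W f (\<gamma> s)"
 shows "((\<lambda>t. f (\<gamma> t)) has_real_derivative lie_deriv L W f (\<gamma> s)) (at s)"
proof -
 have "continuous_map (top_of_set {a - s<..<b - s}) (top_of_set {a<..<b}) (\<lambda>t. t + s)"
  by (auto intro!: continuous_on_add continuous_on_id continuous_on_const)
 from continuous_map_compose[OF this] have "continuous_map (top_of_set {a - s<..<b - s}) (mtop L) (\<lambda>t. \<gamma> (t + s))"
  using g unfolding integral_curve_def comp_def by blast
 moreover have "((\<lambda>t. snd c (\<gamma> (t + s)) i) has_real_derivative W (\<gamma> (t + s)) c i) (at t)"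
  if "t \<in> {a - s<..<b - s}" "c \<in> atlas L" "\<gamma> (t + s) \<in> fst c" "i < n" for t c i
 proof -
  have "t + s \<in> {a<..<b}" using that(1) by auto
  then have "((\<lambda>t. snd c (\<gamma> t) i) has_real_derivative W (\<gamma> (t + s)) c i) (at (t + s))"
   using g that unfolding integral_curve_def by blast
  then show ?thesis by (simp add: DERIV_shift)
 qed
 ultimately have g': "integral_curve L W {a - s<..<b - s} (\<lambda>t. \<gamma> (t + s))"
  unfolding integral_curve_def by blast
 have z: "0 \<in> {a - s<..<b - s}" using s by auto
 obtain D where D: "((\<lambda>t. f (\<gamma> (t + s))) has_real_derivative D) (at 0)"
  using lie_deriv_along_0(1)[OF W g' z, of f] f by auto
 then have "lie_deriv L W f (\<gamma> s) = D" using lie_deriv_along_0(2)[OF W g' z D] by simp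
 then show ?thesis using D DERIV_shift[of "\<lambda>t. f (\<gamma> t)" D 0 s] by simp
qed

lemma patch_integral_curve:
 assumes P: "patch U \<Phi>" and \<eta>: "solution n U w a b \<eta>"
  and r: "\<And>x. x \<in> U ==> rep_at \<Phi> x (W (\<Phi> x)) (\<lambda>i. w i x)"
 shows "integral_curve L W {a<..<b} (\<lambda>s. \<Phi> (\<eta> s))"
 unfolding integral_curve_def
proof (intro conjI ballI allI impI)
 have U: "eopen n U" by (rule patch_eopen[OF P])
 have inU: "\<eta> s \<in> U" if "s \<in> {a<..<b}" for s using \<eta> that by (simp add: solution_def)
 have zz: "\<eta> s = (\<lambda>i. if i < n then \<eta> s i else 0)" if "s \<in> {a<..<b}" for s
  using eopen_zero[OF U inU[OF that]] by (auto simp: fun_eq_iff not_less)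
 have "continuous_on {a<..<b} (\<lambda>s. \<eta> s i)" if "i < n" for i
  by (rule DERIV_continuous_on[where D = "\<lambda>s. w i (\<eta> s)", OF has_field_derivative_at_within])
   (use \<eta> that in \<open>simp add: solution_def\<close>)
 then have "continuous_map (top_of_set {a<..<b}) (Euclidean_space n) (\<lambda>s i. if i < n then \<eta> s i else 0)"
  unfolding continuous_map_componentwise_Euclidean_space by simp
 then have "continuous_map (top_of_set {a<..<b}) (Euclidean_space n) \<eta>"
  by (rule continuous_map_eq) (use zz in auto)
 then have "continuous_map (top_of_set {a<..<b}) (subtopology (Euclidean_space n) U) \<eta>"
  unfolding continuous_map_in_subtopology using inU by auto
 from continuous_map_compose[OF this patch_continuous[OF P]]
 show "continuous_map (top_of_set {a<..<b}) (mtop L) (\<lambda>s. \<Phi> (\<eta> s))" by (simp add: comp_def)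
 fix t c i assume t: "t \<in> {a<..<b}" and c: "c \<in> atlas L" "\<Phi> (\<eta> t) \<in> fst c" and i: "i < n"
 have ev: "\<forall>\<^sub>F s in nhds t. \<forall>i\<ge>n. \<eta> s i = 0"
 proof (rule eventually_mono)
  show "\<forall>\<^sub>F s in nhds t. s \<in> {a<..<b}" using t by (intro eventually_nhds_in_open) auto
 qed (use eopen_zero[OF U inU] in blast)
 have "((\<lambda>s. snd c (\<Phi> (\<eta> s)) i) has_real_derivative (\<Sum>k<n. partial k (\<lambda>x. snd c (\<Phi> x) i) (\<eta> t) * w k (\<eta> t))) (at t)"
  by (rule C1_along_curve[OF patch_preimage[OF P chart_open[OF c(1)]]
    patch_C2[OF P c(1) i, unfolded numeral_2_eq_2], where \<gamma> = \<eta>])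
   (use inU[OF t] c ev \<eta> t in \<open>auto simp: solution_def\<close>)
 then show "((\<lambda>s. snd c (\<Phi> (\<eta> s)) i) has_real_derivative W (\<Phi> (\<eta> t)) c i) (at t)"
  using r[OF inU[OF t]] c i by (simp add: rep_at_def jacobian_app_def)
qed

text \<open>The flow line through \<open>\<Phi> x\<close> is the image of a solution in coordinates,
  along which the chain rule yields the directional derivative.\<close>

lemma lie_deriv_patch:
 assumes P: "patch U \<Phi>" and W: "C1_vector_field L W" and w: "\<And>i. i < n ==> Ck_on n (Suc 0) U (w i)"
  and r: "\<And>x. x \<in> U ==> rep_at \<Phi> x (W (\<Phi> x)) (\<lambda>i. w i x)"
  and G: "Ck_on n (Suc 0) U G" and g: "\<And>x. x \<in> U ==> g (\<Phi> x) = G x" and x: "x \<in> U"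
 shows "has_lie_deriv L W g (\<Phi> x)" "lie_deriv L W g (\<Phi> x) = fderiv n w G x"
proof -
 have U: "eopen n U" by (rule patch_eopen[OF P])
 have "\<exists>e>0. \<exists>\<eta>. \<eta> 0 = x \<and> solution n U w (- e) e \<eta>"
  by (rule solution_exists[where f = w, OF U _ x], rule w)
 then obtain e \<eta> where e: "e > 0" "\<eta> 0 = x" and \<eta>: "solution n U w (- e) e \<eta>"
  by (elim exE conjE) (rule that)
 have inU: "\<eta> s \<in> U" if "s \<in> {-e<..<e}" for s using \<eta> that by (simp add: solution_def)
 have z: "0 \<in> {-e<..<e}" using e by simp
 have ev: "\<forall>\<^sub>F s in nhds 0. s \<in> {-e<..<e}" using z by (intro eventually_nhds_in_open) auto
 have "((\<lambda>s. G (\<eta> s)) has_real_derivative (\<Sum>i<n. partial i G (\<eta> 0) * w i (\<eta> 0))) (at 0)"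
 proof (rule C1_along_curve[OF U G])
  show "\<forall>\<^sub>F t in nhds 0. \<forall>i\<ge>n. \<eta> t i = 0"
   by (rule eventually_mono[OF ev]) (use eopen_zero[OF U inU] in blast)
 qed (use \<eta> z in \<open>auto simp: solution_def\<close>)
 also have "(\<Sum>i<n. partial i G (\<eta> 0) * w i (\<eta> 0)) = fderiv n w G x"
  using e by (simp add: fderiv_def mult.commute)
 finally have D: "((\<lambda>s. g (\<Phi> (\<eta> s))) has_real_derivative fderiv n w G x) (at 0)"
  by (rule iffD1[OF DERIV_cong_ev[OF refl _ refl], rotated])
   (rule eventually_mono[OF ev], simp add: g inU)
 note ic = patch_integral_curve[OF P \<eta> r]
 show "has_lie_deriv L W g (\<Phi> x)" "lie_deriv L W g (\<Phi> x) = fderiv n w G x"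
  using lie_deriv_along_0(1)[OF W ic z, of g] lie_deriv_along_0(2)[OF W ic z D] D e by auto
qed

lemma lie_derivs_patch:
 assumes P: "patch U \<Phi>" and Y: "\<And>j. j < q ==> C1_vector_field L (Y j)"
  and w: "\<And>j i. j < q ==> i < n ==> smooth n U (w j i)"
  and r: "\<And>j x. j < q ==> x \<in> U ==> rep_at \<Phi> x (Y j (\<Phi> x)) (\<lambda>i. w j i x)"
  and f: "smooth n U f" and g: "\<And>x. x \<in> U ==> g (\<Phi> x) = f x"
 shows "ws \<in> lists {..<q} ==> x \<in> U ==> lie_derivs L Y ws g (\<Phi> x) = fderivs n w ws f x"
proof (induction ws arbitrary: x)
 case (Cons j ws)
 then have j: "j < q" and ws: "ws \<in> lists {..<q}" by auto
 show ?case
  using lie_deriv_patch(2)[OF P Y[OF j] smooth_Ck[OF w[OF j]] r[OF j]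
    smooth_Ck[OF smooth_fderivs[OF patch_eopen[OF P] w f ws]] Cons.IH[OF ws] Cons.prems(2)] by simp
qed (use g in auto)

lemma card_words: "finite {ws. ws \<in> lists {..<q::nat} \<and> length ws = m}" "card {ws. ws \<in> lists {..<q} \<and> length ws = m} = q ^ m"
proof -
 have "{ws. ws \<in> lists {..<q} \<and> length ws = m} = {ws. set ws \<subseteq> {..<q} \<and> length ws = m}" by auto
 then show "finite {ws. ws \<in> lists {..<q::nat} \<and> length ws = m}" "card {ws. ws \<in> lists {..<q} \<and> length ws = m} = q ^ m"
  by (simp_all add: finite_lists_length_eq card_lists_length_eq)
qed

lemma patch_C_X_omega:
 assumes P: "patch U \<Phi>" and Y: "\<And>j. j < q ==> C1_vector_field L (Y j)"
  and w: "\<And>j i. j < q ==> i < n ==> analytic n U (w j i)"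
  and r: "\<And>j x. j < q ==> x \<in> U ==> rep_at \<Phi> x (Y j (\<Phi> x)) (\<lambda>i. w j i x)"
  and f: "analytic n U f" and g: "\<And>x. x \<in> U ==> g (\<Phi> x) = f x"
 shows "C_X_omega L q Y (\<Phi> ` U) g"
proof -
 have U: "eopen n U" by (rule patch_eopen[OF P])
 have ld: "lie_derivs L Y ws g (\<Phi> x) = fderivs n w ws f x" if "ws \<in> lists {..<q}" "x \<in> U" for ws x
  by (rule lie_derivs_patch[where w = w and Y = Y and q = q, OF P _ _ _ analytic_smooth[OF f] _ that])
   (simp_all add: Y r g analytic_smooth[OF w])
 have sm: "smooth n U (fderivs n w ws f)" if "ws \<in> lists {..<q}" for ws
  by (rule smooth_fderivs[OF U analytic_smooth[OF w] analytic_smooth[OF f] that])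
 have "\<exists>C\<ge>0. \<exists>A\<ge>0. \<forall>ws\<in>lists {..<q}. \<forall>x\<in>U. \<bar>fderivs n w ws f x\<bar> \<le> C * A ^ length ws * fact (length ws)"
  by (rule fderivs_bound[OF U w f])
 then obtain C A where CA: "C \<ge> 0" "A \<ge> 0"
  and b: "\<And>ws x. ws \<in> lists {..<q} ==> x \<in> U ==> \<bar>fderivs n w ws f x\<bar> \<le> C * A ^ length ws * fact (length ws)"
  by auto
 \<comment> \<open>There are \<open>q ^ m\<close> words of length \<open>m\<close>, each
   contributing at most \<open>C * A ^ m * fact m\<close>; this radius makes the terms decay with
   ratio 1/2.\<close>
 define r where "r = 1 / (2 * (A + 1) * (real q + 1))"
 have r: "r > 0" using CA by (simp add: r_def)
 have rqA: "r * real q * A \<le> 1/2"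
 proof -
  have "real q * A \<le> (A + 1) * (real q + 1)" using CA by (simp add: algebra_simps)
  moreover have "(A + 1) * (real q + 1) > 0" using CA by simp
  ultimately have h1: "real q * A / ((A + 1) * (real q + 1)) \<le> 1" by (simp only: divide_le_eq_1_pos)
  have h2: "r * real q * A = real q * A / ((A + 1) * (real q + 1)) / 2" by (simp add: r_def mult.assoc mult.commute)
  show ?thesis unfolding h2 by (rule divide_right_mono[OF h1]) simp
 qed
 have tV: "topspace (subtopology (mtop L) (\<Phi> ` U)) = \<Phi> ` U" using openin_subset[OF patch_image[OF P]] by auto
 have "C_X_omega_r L q Y r (\<Phi> ` U) g"
  unfolding C_X_omega_r_def
 proof (intro conjI ballI allI impI)
  have "\<bar>g p\<bar> \<le> C" if "p \<in> \<Phi> ` U" for p using that b[of "[]"] g by auto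
  then show "bounded (g ` \<Phi> ` U)" unfolding bounded_iff by (intro exI[of _ C]) auto
  fix ws assume ws: "ws \<in> lists {..<q}"
  have "continuous_map (subtopology (Euclidean_space n) U) euclideanreal (fderivs n w ws f)"
   using Ck_on_continuous[OF U smooth_Ck[OF sm[OF ws], of 0]] continuous_map_Euclidean_iff[OF U] by blast
  moreover have "continuous_map (subtopology (mtop L) (\<Phi> ` U)) (subtopology (Euclidean_space n) U) (inv_into U \<Phi>)"
   unfolding continuous_map_in_subtopology tV using patch_inv_continuous[OF P] by (auto intro: inv_into_into)
  ultimately have "continuous_map (subtopology (mtop L) (\<Phi> ` U)) euclideanreal (fderivs n w ws f \<circ> inv_into U \<Phi>)"
   by (rule continuous_map_compose[rotated])
  then show "continuous_map (subtopology (mtop L) (\<Phi> ` U)) euclideanreal (lie_derivs L Y ws g)"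
   by (rule continuous_map_eq) (use ld[OF ws] patch_inv[OF P] tV in auto)
  fix j p assume j: "j < q" and "p \<in> \<Phi> ` U"
  then obtain x where x: "x \<in> U" "p = \<Phi> x" by blast
  show "has_lie_deriv L (Y j) (lie_derivs L Y ws g) p"
   unfolding x(2)
   by (rule lie_deriv_patch(1)[OF P Y[OF j] smooth_Ck[OF analytic_smooth[OF w[OF j]]] assms(4)[OF j]
    smooth_Ck[OF sm[OF ws]] ld[OF ws] x(1)])
 next
  have "ennreal (r ^ m / fact m) * (\<Sum>ws | ws \<in> lists {..<q} \<and> length ws = m. SUP x\<in>\<Phi> ` U. ennreal \<bar>lie_derivs L Y ws g x\<bar>)
   \<le> ennreal (C * (1/2) ^ m)" for m
  proof -
   have "(\<Sum>ws | ws \<in> lists {..<q} \<and> length ws = m. SUP x\<in>\<Phi> ` U. ennreal \<bar>lie_derivs L Y ws g x\<bar>)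
    \<le> (\<Sum>ws | ws \<in> lists {..<q} \<and> length ws = m. ennreal (C * A ^ m * fact m))"
   proof (intro sum_mono SUP_least ennreal_leI)
    fix ws p assume "ws \<in> {ws. ws \<in> lists {..<q} \<and> length ws = m}" "p \<in> \<Phi> ` U"
    then show "\<bar>lie_derivs L Y ws g p\<bar> \<le> C * A ^ m * fact m" using ld b by fastforce
   qed
   also have "\<dots> = ennreal (real (q ^ m) * (C * A ^ m * fact m))"
    by (simp add: card_words ennreal_mult' ennreal_of_nat_eq_real_of_nat)
   finally have "ennreal (r ^ m / fact m) * (\<Sum>ws | ws \<in> lists {..<q} \<and> length ws = m. SUP x\<in>\<Phi> ` U. ennreal \<bar>lie_derivs L Y ws g x\<bar>)
    \<le> ennreal (r ^ m / fact m) * ennreal (real (q ^ m) * (C * A ^ m * fact m))" by (rule mult_left_mono) simp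
   also have "\<dots> = ennreal (r ^ m / fact m * (real (q ^ m) * (C * A ^ m * fact m)))"
    using r CA by (intro ennreal_mult[symmetric]) auto
   also have "r ^ m / fact m * (real (q ^ m) * (C * A ^ m * fact m)) = C * (r * real q * A) ^ m"
    by (simp add: power_mult_distrib)
   also have "ennreal \<dots> \<le> ennreal (C * (1/2) ^ m)"
    using CA r rqA by (intro ennreal_leI mult_left_mono power_mono) auto
   finally show ?thesis .
  qed
  then have "(\<Sum>m. ennreal (r ^ m / fact m) * (\<Sum>ws | ws \<in> lists {..<q} \<and> length ws = m. SUP x\<in>\<Phi> ` U. ennreal \<bar>lie_derivs L Y ws g x\<bar>))
   \<le> (\<Sum>m. ennreal (C * (1/2) ^ m))" by (intro suminf_le) auto
  also have "\<dots> = ennreal (\<Sum>m. C * (1/2) ^ m)"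
   using CA by (intro suminf_ennreal2) (auto intro!: summable_mult summable_geometric)
  also have "\<dots> < \<infinity>" by simp
  finally show "(\<Sum>m. ennreal (r ^ m / fact m) * (\<Sum>ws | ws \<in> lists {..<q} \<and> length ws = m. SUP x\<in>\<Phi> ` U. ennreal \<bar>lie_derivs L Y ws g x\<bar>)) < \<infinity>" .
 qed
 then show ?thesis using r unfolding C_X_omega_def by blast
qed

text \<open>The supremum for one word is a summand in a convergent sum of nonnegative terms, hence
  at most the total divided by its weight.\<close>

lemma C_X_omega_bound:
 assumes "C_X_omega L q Y V f"
 shows "\<exists>C\<ge>0. \<exists>Q\<ge>0. \<forall>ws\<in>lists {..<q}. \<forall>x\<in>V. \<bar>lie_derivs L Y ws f x\<bar> \<le> C * Q ^ length ws * fact (length ws)"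
proof -
 obtain r where r: "r > 0" and S: "(\<Sum>m. ennreal (r ^ m / fact m) *
   (\<Sum>ws | ws \<in> lists {..<q} \<and> length ws = m. SUP x\<in>V. ennreal \<bar>lie_derivs L Y ws f x\<bar>)) < \<infinity>" (is "?S < _")
  using assms unfolding C_X_omega_def C_X_omega_r_def by blast
 have "\<bar>lie_derivs L Y ws f x\<bar> \<le> enn2real ?S * (1 / r) ^ length ws * fact (length ws)"
  if ws: "ws \<in> lists {..<q}" and x: "x \<in> V" for ws x
 proof -
  let ?m = "length ws"
  let ?T = "\<lambda>m. ennreal (r ^ m / fact m) * (\<Sum>ws | ws \<in> lists {..<q} \<and> length ws = m. SUP x\<in>V. ennreal \<bar>lie_derivs L Y ws f x\<bar>)"
  have "ennreal \<bar>lie_derivs L Y ws f x\<bar> \<le> (SUP x\<in>V. ennreal \<bar>lie_derivs L Y ws f x\<bar>)" by (rule SUP_upper[OF x])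
  also have "\<dots> \<le> (\<Sum>ws | ws \<in> lists {..<q} \<and> length ws = ?m. SUP x\<in>V. ennreal \<bar>lie_derivs L Y ws f x\<bar>)"
   by (rule member_le_sum) (use ws card_words in auto)
  finally have "ennreal (r ^ ?m / fact ?m) * ennreal \<bar>lie_derivs L Y ws f x\<bar> \<le> ?T ?m" by (rule mult_left_mono) simp
  also have "?T ?m \<le> ?S" using sum_le_suminf[of ?T "{?m}"] by simp
  also have "?S = ennreal (enn2real ?S)" using S by (simp add: ennreal_enn2real_if less_top)
  also have "ennreal (r ^ ?m / fact ?m) * ennreal \<bar>lie_derivs L Y ws f x\<bar> = ennreal (r ^ ?m / fact ?m * \<bar>lie_derivs L Y ws f x\<bar>)"
   using r by (intro ennreal_mult[symmetric]) auto
  finally have "r ^ ?m / fact ?m * \<bar>lie_derivs L Y ws f x\<bar> \<le> enn2real ?S" by (simp add: ennreal_le_iff enn2real_nonneg)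
  then show ?thesis using r by (simp add: field_simps)
 qed
 then show ?thesis using r by (intro exI[of _ "enn2real ?S"] exI[of _ "1 / r"] conjI ballI) (auto simp: enn2real_nonneg)
qed

end

section \<open>Structure functions and analytic coordinates on a manifold\<close>

lemma tvec_sum_apply: "(\<Sum>k\<in>K. a k *\<^sub>R v k) c i = (\<Sum>k\<in>K. a k * v k c i)"
 for v :: "'k => 'm tvec"
 by (induction K rule: infinite_finite_induct) (auto simp: zero_fun_def plus_fun_def scaleR_fun_def)

lemma jacobian_app_sum:
 "jacobian_app n F x (\<lambda>i. \<Sum>k\<in>K. a k * w k i) l = (\<Sum>k\<in>K. a k * jacobian_app n F x (w k) l)"
 unfolding jacobian_app_def sum_distrib_left by (subst sum.swap) (simp add: mult_ac)

definition bracket :: "nat => (nat => pt => real) => (nat => pt => real) => nat => pt => real" where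
 "bracket n v w i x = (\<Sum>a<n. v a x * partial a (w i) x - w a x * partial a (v i) x)"

lemma analytic_partial:
 assumes U: "eopen n U" and f: "analytic n U f" and i: "i < n"
 shows "analytic n U (partial i f)"
proof -
 obtain C R where C: "C \<ge> 0" "R \<ge> 0" and d: "\<And>k. dbound n U k (\<lambda>m. C * R ^ m) f"
  using f unfolding analytic_def by blast
 have b: "(real m + 1) * (C * R ^ Suc m) \<le> (C * R) * (2 * R) ^ m" for m
 proof -
  have "real m + 1 \<le> 2 ^ m" by (induction m) auto
  then have "(real m + 1) * (C * R ^ Suc m) \<le> 2 ^ m * (C * R ^ Suc m)" using C by (intro mult_right_mono) auto
  then show ?thesis by (simp add: power_mult_distrib mult_ac)
 qed
 have "dbound n U k (\<lambda>m. (C * R) * (2 * R) ^ m) (partial i f)" for k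
  by (rule dbound_mono[OF dbound_SucD[OF d i] b])
 then show ?thesis
  unfolding analytic_def using C smooth_partial[OF analytic_smooth[OF f] i]
  by (intro conjI exI[of _ "C * R"] exI[of _ "2 * R"]) auto
qed

lemma has_partial_mult_on:
 assumes "Ck_on n (Suc 0) U f" "Ck_on n (Suc 0) U g" "i < n" "x \<in> U"
 shows "((\<lambda>t. f (x(i := t)) * g (x(i := t))) has_real_derivative
  (partial i f x * g x + f x * partial i g x)) (at (x i))"
 using DERIV_mult[OF Ck_on_Suc_partial(2)[OF assms(1,3,4)] Ck_on_Suc_partial(2)[OF assms(2,3,4)]]
 by (simp add: add.commute mult.commute)

context C2_mfd
begin

lemma rep_at_sum:
 assumes "\<And>k. k \<in> K ==> rep_at \<Phi> x (v k) (w k)"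
 shows "rep_at \<Phi> x (\<Sum>k\<in>K. a k *\<^sub>R v k) (\<lambda>i. \<Sum>k\<in>K. a k * w k i)"
 using assms unfolding rep_at_def tvec_sum_apply jacobian_app_sum by (auto intro!: sum.cong)

lemma rep_at_cong:
 assumes "\<And>i. i < n ==> w i = w' i"
 shows "rep_at \<Phi> x v w \<longleftrightarrow> rep_at \<Phi> x v w'"
proof -
 have "jacobian_app n F x w i = jacobian_app n F x w' i" for F i
  unfolding jacobian_app_def by (rule sum.cong) (use assms in auto)
 then show ?thesis unfolding rep_at_def by simp
qed

text \<open>One half of the bracket in a chart, rewritten in patch coordinates: the component of
  \<open>W\<close> is a combination of first derivatives of \<open>\<Phi>\<close>, to which chain
  rule and product rule apply. The second derivatives stay visible for the cancellation in
  \<open>rep_at_bracket\<close>.\<close>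

lemma derivative_of_component:
 assumes P: "patch U \<Phi>" and W: "C1_vector_field L W"
  and w: "\<And>i. i < n ==> Ck_on n (Suc 0) U (w i)"
  and rv: "rep_at \<Phi> x (V (\<Phi> x)) (\<lambda>i. v i x)"
  and rw: "\<And>x. x \<in> U ==> rep_at \<Phi> x (W (\<Phi> x)) (\<lambda>i. w i x)"
  and x: "x \<in> U" and c: "c \<in> atlas L" "\<Phi> x \<in> fst c" and l: "l < n"
 shows "(\<Sum>k<n. V (\<Phi> x) c k * partial k (\<lambda>z. W (chart_inv c z) c l) (snd c (\<Phi> x))) =
  (\<Sum>a<n. \<Sum>k<n. v a x * (partial a (partial k (\<lambda>y. snd c (\<Phi> y) l)) x * w k x +
    partial k (\<lambda>y. snd c (\<Phi> y) l) x * partial a (w k) x))"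
proof -
 let ?G = "\<lambda>y. snd c (\<Phi> y)"
 let ?O = "{y \<in> U. \<Phi> y \<in> fst c}"
 let ?W = "\<lambda>z. W (chart_inv c z) c l"
 have O: "eopen n ?O" by (rule patch_preimage[OF P chart_open[OF c(1)]])
 have xO: "x \<in> ?O" using x c by blast
 have G: "Ck_on n (Suc (Suc 0)) ?O (\<lambda>y. ?G y i)" if "i < n" for i
  using patch_C2[OF P c(1) that] by (simp add: numeral_2_eq_2)
 have Wc: "Ck_on n (Suc 0) (snd c ` fst c) ?W"
  using W c(1) l unfolding C1_vector_field_def by simp
 have eq: "?W (?G y) = (\<Sum>k<n. partial k (\<lambda>y. ?G y l) y * w k y)" if "y \<in> ?O" for y
  using rw[of y] that c l by (auto simp: rep_at_def jacobian_app_def)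
 have "(\<Sum>j<n. partial j ?W (?G x) * partial a (\<lambda>y. ?G y j) x) =
   (\<Sum>k<n. partial a (partial k (\<lambda>y. ?G y l)) x * w k x + partial k (\<lambda>y. ?G y l) x * partial a (w k) x)"
  if a: "a < n" for a
 proof -
  have "((\<lambda>t. ?W (?G (x(a := t)))) has_real_derivative
    (\<Sum>j<n. partial j ?W (?G x) * partial a (\<lambda>y. ?G y j) x)) (at (x a))"
   by (rule chain_partial[where G = ?G and k = "Suc 0", OF O chart_image[OF c(1)] _ G Wc xO a]) auto
  then have "partial a (\<lambda>y. ?W (?G y)) x = (\<Sum>j<n. partial j ?W (?G x) * partial a (\<lambda>y. ?G y j) x)"
   by (rule partialI)
  moreover have "((\<lambda>t. \<Sum>k<n. partial k (\<lambda>y. ?G y l) (x(a := t)) * w k (x(a := t))) has_real_derivative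
    (\<Sum>k<n. partial a (partial k (\<lambda>y. ?G y l)) x * w k x + partial k (\<lambda>y. ?G y l) x * partial a (w k) x)) (at (x a))"
  proof (rule DERIV_sum)
   fix k assume "k \<in> {..<n}"
   then have k: "k < n" by simp
   show "((\<lambda>t. partial k (\<lambda>y. ?G y l) (x(a := t)) * w k (x(a := t))) has_real_derivative
     partial a (partial k (\<lambda>y. ?G y l)) x * w k x + partial k (\<lambda>y. ?G y l) x * partial a (w k) x) (at (x a))"
    by (rule has_partial_mult_on[OF Ck_on_Suc_partial(1)[OF G[OF l] k] Ck_on_subset[OF w[OF k]] a xO]) auto
  qed
  then have "partial a (\<lambda>y. \<Sum>k<n. partial k (\<lambda>y. ?G y l) y * w k y) x =
    (\<Sum>k<n. partial a (partial k (\<lambda>y. ?G y l)) x * w k x + partial k (\<lambda>y. ?G y l) x * partial a (w k) x)"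
   by (rule partialI)
  moreover have "partial a (\<lambda>y. ?W (?G y)) x = partial a (\<lambda>y. \<Sum>k<n. partial k (\<lambda>y. ?G y l) y * w k y) x"
   by (rule partial_cong(1)[OF O xO a eq])
  ultimately show ?thesis by simp
 qed
 then have "(\<Sum>a<n. v a x * (\<Sum>j<n. partial j ?W (?G x) * partial a (\<lambda>y. ?G y j) x)) =
   (\<Sum>a<n. v a x * (\<Sum>k<n. partial a (partial k (\<lambda>y. ?G y l)) x * w k x + partial k (\<lambda>y. ?G y l) x * partial a (w k) x))"
  by (intro sum.cong) auto
 moreover have "(\<Sum>k<n. V (\<Phi> x) c k * partial k ?W (?G x)) =
   (\<Sum>a<n. v a x * (\<Sum>j<n. partial j ?W (?G x) * partial a (\<lambda>y. ?G y j) x))"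
 proof -
  have "(\<Sum>k<n. V (\<Phi> x) c k * partial k ?W (?G x)) =
    (\<Sum>k<n. (\<Sum>a<n. partial a (\<lambda>y. ?G y k) x * v a x) * partial k ?W (?G x))"
   by (rule sum.cong) (use rv c in \<open>auto simp: rep_at_def jacobian_app_def\<close>)
  also have "\<dots> = (\<Sum>a<n. v a x * (\<Sum>j<n. partial j ?W (?G x) * partial a (\<lambda>y. ?G y j) x))"
   unfolding sum_distrib_left sum_distrib_right by (subst sum.swap) (simp add: mult_ac)
  finally show ?thesis .
 qed
 ultimately show ?thesis by (simp add: sum_distrib_left)
qed

text \<open>The second derivatives of the coordinate change cancel by symmetry, so the bracket transforms
  like a tangent vector although the fields are only \<open>C\<^sup>1\<close>.\<close>

lemma rep_at_bracket:
 assumes P: "patch U \<Phi>" and V: "C1_vector_field L V" and W: "C1_vector_field L W"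
  and v: "\<And>i. i < n ==> Ck_on n (Suc 0) U (v i)" and w: "\<And>i. i < n ==> Ck_on n (Suc 0) U (w i)"
  and rv: "\<And>x. x \<in> U ==> rep_at \<Phi> x (V (\<Phi> x)) (\<lambda>i. v i x)"
  and rw: "\<And>x. x \<in> U ==> rep_at \<Phi> x (W (\<Phi> x)) (\<lambda>i. w i x)" and x: "x \<in> U"
 shows "rep_at \<Phi> x (lie_bracket L V W (\<Phi> x)) (\<lambda>i. bracket n v w i x)"
 unfolding rep_at_def
proof (intro ballI allI impI)
 fix c l assume c: "c \<in> atlas L" "\<Phi> x \<in> fst c" and l: "l < n"
 let ?g = "\<lambda>y. snd c (\<Phi> y) l"
 have O: "eopen n {y \<in> U. \<Phi> y \<in> fst c}" by (rule patch_preimage[OF P chart_open[OF c(1)]])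
 have sym: "(\<Sum>a<n. \<Sum>k<n. v a x * (partial a (partial k ?g) x * w k x)) =
   (\<Sum>a<n. \<Sum>k<n. w a x * (partial a (partial k ?g) x * v k x))"
 proof (subst sum.swap, intro sum.cong refl)
  fix k a assume "k \<in> {..<n}" "a \<in> {..<n}"
  then have "partial a (partial k ?g) x = partial k (partial a ?g) x"
   using x c by (intro partial_commute[OF O patch_C2[OF P c(1) l]]) auto
  then show "v a x * (partial a (partial k ?g) x * w k x) = w k x * (partial k (partial a ?g) x * v a x)"
   by (simp add: mult_ac)
 qed
 have d1: "(\<Sum>k<n. V (\<Phi> x) c k * partial k (\<lambda>z. W (chart_inv c z) c l) (snd c (\<Phi> x))) =
  (\<Sum>a<n. \<Sum>k<n. v a x * (partial a (partial k ?g) x * w k x + partial k ?g x * partial a (w k) x))"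
  by (rule derivative_of_component[where V = V and W = W and v = v and w = w, OF P W _ rv[OF x] _ x c l])
   (rule w rw; assumption)+
 have d2: "(\<Sum>k<n. W (\<Phi> x) c k * partial k (\<lambda>z. V (chart_inv c z) c l) (snd c (\<Phi> x))) =
  (\<Sum>a<n. \<Sum>k<n. w a x * (partial a (partial k ?g) x * v k x + partial k ?g x * partial a (v k) x))"
  by (rule derivative_of_component[where V = W and W = V and v = w and w = v, OF P V _ rw[OF x] _ x c l])
   (rule v rv; assumption)+
 have "lie_bracket L V W (\<Phi> x) c l =
   (\<Sum>k<n. V (\<Phi> x) c k * partial k (\<lambda>z. W (chart_inv c z) c l) (snd c (\<Phi> x))) -
   (\<Sum>k<n. W (\<Phi> x) c k * partial k (\<lambda>z. V (chart_inv c z) c l) (snd c (\<Phi> x)))"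
  using c l by (simp add: lie_bracket_def sum_subtractf)
 also have "\<dots> = (\<Sum>a<n. \<Sum>k<n. v a x * (partial k ?g x * partial a (w k) x)) -
   (\<Sum>a<n. \<Sum>k<n. w a x * (partial k ?g x * partial a (v k) x))"
  unfolding d1 d2 by (simp add: distrib_left sum.distrib sym)
 also have "\<dots> = (\<Sum>a<n. \<Sum>k<n. partial k ?g x * (v a x * partial a (w k) x - w a x * partial a (v k) x))"
  unfolding sum_subtractf[symmetric] by (intro sum.cong refl) (simp add: algebra_simps)
 also have "\<dots> = jacobian_app n (\<lambda>y. snd c (\<Phi> y)) x (\<lambda>i. bracket n v w i x) l"
  unfolding jacobian_app_def bracket_def sum_distrib_left by (rule sum.swap)
 finally show "lie_bracket L V W (\<Phi> x) c l = jacobian_app n (\<lambda>y. snd c (\<Phi> y)) x (\<lambda>i. bracket n v w i x) l" .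
qed

lemma rep_at_eq:
 assumes "rep_at \<Phi> x v w" "rep_at \<Phi> x v' w'" "\<And>i. i < n ==> w i = w' i"
  and "\<And>c i. \<not> (c \<in> atlas L \<and> \<Phi> x \<in> fst c \<and> i < n) ==> v c i = 0 \<and> v' c i = 0"
 shows "v = v'"
proof (intro ext)
 fix c i
 have "rep_at \<Phi> x v w'" using assms(1) rep_at_cong[OF assms(3)] by simp
 then show "v c i = v' c i"
  using assms(2) assms(4)[of c i] unfolding rep_at_def by (cases "c \<in> atlas L \<and> \<Phi> x \<in> fst c \<and> i < n") auto
qed

text \<open>A kernel vector of the matrix of components is a linear relation between the tangent
  vectors, because a tangent vector is determined by its representative.\<close>

lemma frame_det:
 assumes P: "patch U \<Phi>" and u: "u \<in> U"
  and y: "\<And>k. k < n ==> y k \<in> tangent_space L (\<Phi> u)" and r: "\<And>k. k < n ==> rep_at \<Phi> u (y k) (\<lambda>i. w k i u)"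
  and indep: "\<And>v. (\<Sum>k<n. v k *\<^sub>R y k) = 0 ==> \<forall>k<n. v k = (0::real)"
 shows "mdet n (\<lambda>i k. w k i) u \<noteq> 0"
proof (rule mdet_nonzeroI)
 fix v assume v: "\<And>i. i < n ==> (\<Sum>k<n. w k i u * v k) = 0"
 have "rep_at \<Phi> u (\<Sum>k<n. v k *\<^sub>R y k) (\<lambda>i. \<Sum>k<n. v k * w k i u)"
  by (rule rep_at_sum) (use r in auto)
 moreover have "rep_at \<Phi> u 0 (\<lambda>i. 0)" by (simp add: rep_at_def jacobian_app_def zero_fun_def)
 ultimately have "(\<Sum>k<n. v k *\<^sub>R y k) = 0"
 proof (rule rep_at_eq)
  show "(\<Sum>k<n. v k * w k i u) = 0" if "i < n" for i using v[OF that] by (simp add: mult.commute)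
  show "(\<Sum>k<n. v k *\<^sub>R y k) c i = 0 \<and> (0 :: 'm tvec) c i = 0"
   if "\<not> (c \<in> atlas L \<and> \<Phi> u \<in> fst c \<and> i < n)" for c i
   using tangent_zero[OF y that] by (simp add: tvec_sum_apply zero_fun_def)
 qed
 then show "\<forall>k<n. v k = 0" by (rule indep)
qed

lemma analytic_near:
 assumes U: "eopen n U" and u: "u0 \<in> U" and A: "\<And>i k. i < n ==> k < n ==> analytic n U (A i k)" and det: "mdet n A u0 \<noteq> 0"
 shows "\<exists>U'. eopen n U' \<and> u0 \<in> U' \<and> U' \<subseteq> U \<and> (\<forall>x\<in>U'. mdet n A x \<noteq> 0) \<and>
  (\<forall>i<n. \<forall>k<n. analytic n U' (minv n A i k))"
proof -
 interpret function_algebra "analytic n U" by (rule function_algebra_analytic[OF U])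
 have md: "analytic n U (mdet n A)"
  using det[OF A] by (simp add: mdet_def[abs_def])
 have "continuous_on U (mdet n A)" by (rule Ck_on_continuous[OF U smooth_Ck[OF analytic_smooth[OF md]]])
 moreover have "\<bar>mdet n A u0\<bar> / 2 > 0" using assms(4) by simp
 ultimately obtain d where d: "d > 0" "cub n u0 d \<subseteq> U" "\<And>y. y \<in> cub n u0 d ==> \<bar>mdet n A y - mdet n A u0\<bar> < \<bar>mdet n A u0\<bar> / 2"
  using continuous_on_cubE[OF U _ u] by metis
 let ?U = "cub n u0 d"
 have U': "eopen n ?U" by (rule eopen_cub)
 have lb: "\<bar>mdet n A x\<bar> \<ge> \<bar>mdet n A u0\<bar> / 2" if "x \<in> ?U" for x using d(3)[OF that] by linarith
 interpret U': function_algebra "analytic n ?U" by (rule function_algebra_analytic[OF U'])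
 have inv: "analytic n ?U (\<lambda>x. inverse (mdet n A x))"
  by (rule analytic_inverse[OF U' analytic_subset[OF md d(2)] \<open>\<bar>mdet n A u0\<bar> / 2 > 0\<close> lb])
 show ?thesis
 proof (intro exI[of _ ?U] conjI ballI allI impI)
  show "u0 \<in> ?U" by (rule centre_in_cub[OF _ d(1)]) (rule eopen_zero[OF U u])
  show "mdet n A x \<noteq> 0" if "x \<in> ?U" for x using lb[OF that] assms(4) by auto
  show "analytic n ?U (minv n A i k)" if "i < n" "k < n" for i k
   by (rule U'.minv[OF analytic_subset[OF A d(2)] inv that])
 qed (use U' d in auto)
qed

section \<open>Analytic components of the fields and analytic relations between them\<close>

lemma reps_of_coordinates:
 assumes Y: "\<And>j. j < q ==> C1_vector_field L (Y j)" and cc: "cond_coordinates L n q Y x0"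
 shows "\<exists>U \<Phi> w. patch U \<Phi> \<and> x0 \<in> \<Phi> ` U \<and> (\<forall>j<q. \<forall>i<n. analytic n U (w j i)) \<and>
  (\<forall>j<q. \<forall>x\<in>U. rep_at \<Phi> x (Y j (\<Phi> x)) (\<lambda>i. w j i x))"
proof -
 obtain V U \<Phi> where V: "openin (mtop L) V" "x0 \<in> V" and U: "eopen n U"
  and D: "C2_diffeo (eucl_manifold n U) (open_submanifold L V) \<Phi>"
  and an: "\<And>j. j < q ==> C_omega n n U (\<lambda>x. pullback (eucl_manifold n U) L \<Phi> (Y j) x (U, \<lambda>x. x))"
  using cc unfolding cond_coordinates_def by blast
 have P: "patch U \<Phi>" and im: "\<Phi> ` U = V" using D patch_iff_C2_diffeo[OF U V(1)] by auto
 define w where "w j i x = pullback (eucl_manifold n U) L \<Phi> (Y j) x (U, \<lambda>x. x) i" for j i x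
 have "rep_at \<Phi> x (Y j (\<Phi> x)) (\<lambda>i. w j i x)" if j: "j < q" and x: "x \<in> U" for j x
 proof -
  have t: "Y j (\<Phi> x) \<in> tangent_space L (\<Phi> x)"
   using Y[OF j] patch_points[OF P x] unfolding C1_vector_field_def by blast
  obtain v where v: "rep_at \<Phi> x (Y j (\<Phi> x)) v" using rep_at_exists[OF P x t] by blast
  have "w j i x = v i" if "i < n" for i unfolding w_def by (rule pullback_rep[where W = "Y j", OF P x t v that])
  then show ?thesis using v rep_at_cong[of "\<lambda>i. w j i x" v] by blast
 qed
 moreover have "analytic n U (w j i)" if "j < q" "i < n" for j i
  unfolding w_def[abs_def] by (rule C_omega_analytic[OF U an[OF that(1)] that(2)])
 ultimately show ?thesis using P im V(2) by blast
qed

lemma coordinates_of_reps: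
 assumes Y: "\<And>j. j < q ==> C1_vector_field L (Y j)" and P: "patch U \<Phi>" and x0: "x0 \<in> \<Phi> ` U"
  and w: "\<And>j i. j < q ==> i < n ==> analytic n U (w j i)"
  and r: "\<And>j x. j < q ==> x \<in> U ==> rep_at \<Phi> x (Y j (\<Phi> x)) (\<lambda>i. w j i x)"
 shows "cond_coordinates L n q Y x0"
 unfolding cond_coordinates_def
proof (intro exI conjI allI impI)
 have U: "eopen n U" by (rule patch_eopen[OF P])
 show "openin (mtop L) (\<Phi> ` U)" "x0 \<in> \<Phi> ` U" "eopen n U" using patch_image[OF P] x0 U by auto
 show "C2_diffeo (eucl_manifold n U) (open_submanifold L (\<Phi> ` U)) \<Phi>"
  using patch_iff_C2_diffeo[OF U patch_image[OF P]] P by simp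
 fix j assume j: "j < q"
 show "C_omega n n U (\<lambda>x. pullback (eucl_manifold n U) L \<Phi> (Y j) x (U, \<lambda>x. x))"
 proof (rule analytic_C_omega[OF U])
  fix i assume i: "i < n"
  show "analytic n U (\<lambda>x. pullback (eucl_manifold n U) L \<Phi> (Y j) x (U, \<lambda>x. x) i)"
  proof (rule iffD2[OF analytic_cong[OF U] w[OF j i]])
   fix x assume x: "x \<in> U"
   have "Y j (\<Phi> x) \<in> tangent_space L (\<Phi> x)"
    using Y[OF j] patch_points[OF P x] unfolding C1_vector_field_def by blast
   then show "pullback (eucl_manifold n U) L \<Phi> (Y j) x (U, \<lambda>x. x) i = w j i x"
    by (rule pullback_rep[where W = "Y j" and w = "\<lambda>i. w j i x", OF P x _ r[OF j x] i])
  qed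
 qed
qed

lemma lie_bracket_zero: "\<not> (c \<in> atlas L \<and> p \<in> fst c \<and> i < n) ==> lie_bracket L V W p c i = 0"
 by (auto simp: lie_bracket_def)

text \<open>In analytic coordinates every analytic field is an analytic combination of a frame, by Cramer's
  rule.\<close>

lemma analytic_relations:
 assumes Y: "\<And>j. j < q ==> C1_vector_field L (Y j)" and cc: "cond_coordinates L n q Y x0"
  and \<sigma>: "\<And>k. k < n ==> \<sigma> k < q"
  and indep: "\<And>v. (\<Sum>k<n. v k *\<^sub>R Y (\<sigma> k) x0) = 0 ==> \<forall>k<n. v k = (0::real)"
 shows "\<exists>V b c. openin (mtop L) V \<and> x0 \<in> V \<and>
  (\<forall>j<q. \<forall>p\<in>V. Y j p = (\<Sum>k<n. b j k p *\<^sub>R Y (\<sigma> k) p)) \<and>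
  (\<forall>i<q. \<forall>j<q. \<forall>p\<in>V. lie_bracket L (Y i) (Y j) p = (\<Sum>k<n. c i j k p *\<^sub>R Y (\<sigma> k) p)) \<and>
  (\<forall>\<tau>. (\<forall>j<q. \<tau> j < q) \<longrightarrow> C_X_omega L q (Y \<circ> \<tau>) V (\<lambda>p. 0) \<and> (\<forall>k<n. \<forall>j<q. C_X_omega L q (Y \<circ> \<tau>) V (b j k) \<and>
    (\<forall>i<q. C_X_omega L q (Y \<circ> \<tau>) V (c i j k))))"
proof -
 have "\<exists>U \<Phi> w. patch U \<Phi> \<and> x0 \<in> \<Phi> ` U \<and> (\<forall>j<q. \<forall>i<n. analytic n U (w j i)) \<and>
  (\<forall>j<q. \<forall>x\<in>U. rep_at \<Phi> x (Y j (\<Phi> x)) (\<lambda>i. w j i x))"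
  by (rule reps_of_coordinates[OF Y cc])
 then obtain U \<Phi> w where P: "patch U \<Phi>" and x0: "x0 \<in> \<Phi> ` U"
  and w0: "\<forall>j<q. \<forall>i<n. analytic n U (w j i)"
  and r0: "\<forall>j<q. \<forall>x\<in>U. rep_at \<Phi> x (Y j (\<Phi> x)) (\<lambda>i. w j i x)"
  by (elim exE conjE) (rule that)
 have w: "analytic n U (w j i)" if "j < q" "i < n" for j i using w0 that by blast
 have r: "rep_at \<Phi> x (Y j (\<Phi> x)) (\<lambda>i. w j i x)" if "j < q" "x \<in> U" for j x using r0 that by blast
 have U: "eopen n U" by (rule patch_eopen[OF P])
 obtain u0 where u0: "u0 \<in> U" "x0 = \<Phi> u0" using x0 by blast
 have tan: "Y j (\<Phi> x) \<in> tangent_space L (\<Phi> x)" if "j < q" "x \<in> U" for j x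
  using Y[OF that(1)] patch_points[OF P that(2)] unfolding C1_vector_field_def by blast
 define A where "A i k = w (\<sigma> k) i" for i k
 have A: "analytic n U (A i k)" if "i < n" "k < n" for i k using w[OF \<sigma>[OF that(2)] that(1)] by (simp add: A_def)
 have "mdet n (\<lambda>i k. (\<lambda>k. w (\<sigma> k)) k i) u0 \<noteq> 0"
  by (rule frame_det[OF P u0(1), where y = "\<lambda>k. Y (\<sigma> k) x0"])
   (use \<sigma> tan u0 r indep in auto)
 then have det: "mdet n A u0 \<noteq> 0" by (simp add: A_def[abs_def])
 obtain U' where U': "eopen n U'" "u0 \<in> U'" "U' \<subseteq> U" and nz: "\<And>x. x \<in> U' ==> mdet n A x \<noteq> 0"
  and mi: "\<And>i k. i < n ==> k < n ==> analytic n U' (minv n A i k)"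
  using analytic_near[where A = A, OF U u0(1) A det] by auto
 have P': "patch U' \<Phi>" by (rule patch_subset[OF P U'(1,3)])
 have r': "rep_at \<Phi> x (Y j (\<Phi> x)) (\<lambda>i. w j i x)" if "j < q" "x \<in> U'" for j x using r that U'(3) by blast
 have w': "analytic n U' (w j i)" if "j < q" "i < n" for j i by (rule analytic_subset[OF w[OF that] U'(3)])
 \<comment> \<open>The coefficients in the frame of a field with components \<open>f\<close>,
   through the inverse of the matrix of frame components.\<close>
 define co where "co f k x = (\<Sum>l<n. minv n A k l x * f l x)" for f :: "nat => pt => real" and k x
 have co: "(\<Sum>k<n. co f k x * w (\<sigma> k) i x) = f i x" if "x \<in> U'" "i < n" for f i x
 proof -
  have "(\<Sum>k<n. co f k x * w (\<sigma> k) i x) = (\<Sum>l<n. (\<Sum>k<n. A i k x * minv n A k l x) * f l x)"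
   unfolding co_def A_def sum_distrib_right by (subst sum.swap) (simp add: mult_ac)
  also have "\<dots> = (\<Sum>l<n. if i = l then f l x else 0)"
   by (rule sum.cong) (use minv_inverse(2)[OF nz[OF that(1)] that(2)] in auto)
  finally show ?thesis using that(2) by (simp add: sum.delta)
 qed
 have co_an: "analytic n U' (co f k)" if "k < n" "\<And>l. l < n ==> analytic n U' (f l)" for f k
  unfolding co_def[abs_def] using that
  by (intro analytic_sum[OF U'(1)] analytic_mult[OF U'(1)] mi) auto
 have br_an: "analytic n U' (bracket n (w i) (w j) l)" if "i < q" "j < q" "l < n" for i j l
 proof -
  have "analytic n U' (partial a (w m k))" if "m < q" "k < n" "a < n" for m k a
   by (rule analytic_partial[OF U'(1) w'[OF that(1,2)] that(3)])
  then have "analytic n U' (\<lambda>x. \<Sum>a<n. w i a x * partial a (w j l) x + (- 1) * (w j a x * partial a (w i l) x))"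
   using that w' by (intro analytic_sum[OF U'(1)] analytic_add[OF U'(1)] analytic_mult[OF U'(1)] analytic_const[OF U'(1)]) auto
  then show ?thesis by (simp add: bracket_def[abs_def])
 qed
 have combine: "v = (\<Sum>k<n. co f k x *\<^sub>R Y (\<sigma> k) (\<Phi> x))"
  if x: "x \<in> U'" and v: "rep_at \<Phi> x v (\<lambda>i. f i x)" and z: "\<And>c i. \<not> (c \<in> atlas L \<and> \<Phi> x \<in> fst c \<and> i < n) ==> v c i = 0"
  for v f x
 proof (rule rep_at_eq[OF v])
  show "rep_at \<Phi> x (\<Sum>k<n. co f k x *\<^sub>R Y (\<sigma> k) (\<Phi> x)) (\<lambda>i. \<Sum>k<n. co f k x * w (\<sigma> k) i x)"
   by (rule rep_at_sum) (use r'[OF \<sigma> x] in auto)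
  show "f i x = (\<Sum>k<n. co f k x * w (\<sigma> k) i x)" if "i < n" for i using co[OF x that] by simp
  show "v c i = 0 \<and> (\<Sum>k<n. co f k x *\<^sub>R Y (\<sigma> k) (\<Phi> x)) c i = 0"
   if "\<not> (c \<in> atlas L \<and> \<Phi> x \<in> fst c \<and> i < n)" for c i
   using z[OF that] tangent_zero[OF tan[OF \<sigma>] that] x U'(3) by (auto simp: tvec_sum_apply intro!: sum.neutral)
 qed
 let ?i = "inv_into U' \<Phi>"
 note inv = patch_inv[OF P']
 \<comment> \<open>\<open>\<tau>\<close> serves two orders of differentiation: the condition on the
   basis differentiates along the reordered fields, the one on commutators along the original
   ones.\<close>
 have CX: "C_X_omega L q (Y \<circ> \<tau>) (\<Phi> ` U') (\<lambda>p. f (?i p))"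
  if \<tau>: "\<forall>j<q. \<tau> j < q" and f: "analytic n U' f" for \<tau> f
  by (rule patch_C_X_omega[OF P', where w = "\<lambda>j. w (\<tau> j)" and f = f]) (use \<tau> f Y w' r' inv in auto)
 show ?thesis
 proof (intro exI[of _ "\<Phi> ` U'"] exI[of _ "\<lambda>j k p. co (w j) k (?i p)"]
   exI[of _ "\<lambda>i j k p. co (bracket n (w i) (w j)) k (?i p)"] conjI ballI allI impI)
  show "openin (mtop L) (\<Phi> ` U')" "x0 \<in> \<Phi> ` U'" using patch_image[OF P'] u0 U'(2) by auto
  show "Y j p = (\<Sum>k<n. co (w j) k (?i p) *\<^sub>R Y (\<sigma> k) p)" if j: "j < q" and p: "p \<in> \<Phi> ` U'" for j p
  proof -
   obtain x where x: "x \<in> U'" "p = \<Phi> x" using p by blast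
   show ?thesis unfolding x(2) inv[OF x(1)]
    by (rule combine[where f = "w j" and v = "Y j (\<Phi> x)", OF x(1) r'[OF j x(1)]]) (use tangent_zero[OF tan[OF j]] x U'(3) in blast)
  qed
  show "lie_bracket L (Y i) (Y j) p = (\<Sum>k<n. co (bracket n (w i) (w j)) k (?i p) *\<^sub>R Y (\<sigma> k) p)"
   if i: "i < q" and j: "j < q" and p: "p \<in> \<Phi> ` U'" for i j p
  proof -
   obtain x where x: "x \<in> U'" "p = \<Phi> x" using p by blast
   have C1: "Ck_on n (Suc 0) U' (w m l)" if "m < q" "l < n" for m l by (rule smooth_Ck[OF analytic_smooth[OF w'[OF that]]])
   have rb: "rep_at \<Phi> x (lie_bracket L (Y i) (Y j) (\<Phi> x)) (\<lambda>l. bracket n (w i) (w j) l x)"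
    by (rule rep_at_bracket[OF P' Y[OF i] Y[OF j] C1[OF i] C1[OF j] r'[OF i] r'[OF j] x(1)])
   show ?thesis unfolding x(2) inv[OF x(1)] by (rule combine[where f = "bracket n (w i) (w j)", OF x(1) rb]) (rule lie_bracket_zero)
  qed
  fix \<tau> assume \<tau>: "\<forall>j<q. \<tau> j < q"
  show "C_X_omega L q (Y \<circ> \<tau>) (\<Phi> ` U') (\<lambda>p. 0)" by (rule CX[OF \<tau> analytic_const[OF U'(1)]])
  fix k j assume k: "k < n" and j: "j < q"
  show "C_X_omega L q (Y \<circ> \<tau>) (\<Phi> ` U') (\<lambda>p. co (w j) k (?i p))" by (rule CX[OF \<tau> co_an[OF k w'[OF j]]])
  fix i assume i: "i < q"
  show "C_X_omega L q (Y \<circ> \<tau>) (\<Phi> ` U') (\<lambda>p. co (bracket n (w i) (w j)) k (?i p))"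
   by (rule CX[OF \<tau> co_an[OF k br_an[OF i j]]])
 qed
qed

text \<open>The locales ask for one pair of constants for all functions involved; maxima provide
  it.\<close>

lemma C_X_omega_bound_finite:
 assumes "finite FF" "\<And>f. f \<in> FF ==> C_X_omega L q Y V f"
 shows "\<exists>C\<ge>0. \<exists>Q\<ge>0. \<forall>f\<in>FF. \<forall>ws\<in>lists {..<q}. \<forall>x\<in>V. \<bar>lie_derivs L Y ws f x\<bar> \<le> C * Q ^ length ws * fact (length ws)"
 using assms
proof (induction FF)
 case (insert f FF)
 then obtain C Q where CQ: "C \<ge> 0" "Q \<ge> 0" and b: "\<forall>f\<in>FF. \<forall>ws\<in>lists {..<q}. \<forall>x\<in>V. \<bar>lie_derivs L Y ws f x\<bar> \<le> C * Q ^ length ws * fact (length ws)"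
  by auto
 obtain C' Q' where CQ': "C' \<ge> 0" "Q' \<ge> 0" and b': "\<forall>ws\<in>lists {..<q}. \<forall>x\<in>V. \<bar>lie_derivs L Y ws f x\<bar> \<le> C' * Q' ^ length ws * fact (length ws)"
  using C_X_omega_bound[of q Y V f] insert.prems by auto
 have m: "C * Q ^ m * fact m \<le> max C C' * max Q Q' ^ m * fact m" "C' * Q' ^ m * fact m \<le> max C C' * max Q Q' ^ m * fact m" for m
  using CQ CQ' by (auto intro!: mult_mono power_mono)
 have "\<forall>g\<in>insert f FF. \<forall>ws\<in>lists {..<q}. \<forall>x\<in>V. \<bar>lie_derivs L Y ws g x\<bar> \<le> max C C' * max Q Q' ^ length ws * fact (length ws)"
 proof (intro ballI)
  fix g ws x assume g: "g \<in> insert f FF" and ws: "ws \<in> lists {..<q}" and x: "x \<in> V"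
  show "\<bar>lie_derivs L Y ws g x\<bar> \<le> max C C' * max Q Q' ^ length ws * fact (length ws)"
  proof (cases "g = f")
   case True
   then show ?thesis using order_trans[OF bspec[OF bspec[OF b' ws] x] m(2)] by simp
  next
   case False
   then have "g \<in> FF" using g by simp
   show ?thesis by (rule order_trans[OF bspec[OF bspec[OF bspec[OF b \<open>g \<in> FF\<close>] ws] x] m(1)])
  qed
 qed
 moreover have "0 \<le> max C C'" "0 \<le> max Q Q'" using CQ by (auto simp: le_max_iff_disj)
 ultimately show ?case by blast
qed (intro exI[of _ 0], auto)

text \<open>Solutions in the chart are integral curves on the manifold, so iterated Lie derivatives
  form a word family. Letters below \<open>n\<close> number the frame and are translated to field
  indices by \<open>map \<sigma>\<close>.\<close>

lemma lie_derivs_word_family: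
 assumes Y: "\<And>j. j < q ==> C1_vector_field L (Y j)" and c0: "c0 \<in> atlas L" and V: "openin (mtop L) V"
  and \<sigma>: "\<And>k. k < n ==> \<sigma> k < q" and f: "C_X_omega L q Y V f"
  and b: "\<forall>ws\<in>lists {..<q}. \<forall>x\<in>V. \<bar>lie_derivs L Y ws f x\<bar> \<le> C * Q ^ length ws * fact (length ws)"
 shows "word_family n (snd c0 ` (fst c0 \<inter> V)) (\<lambda>j i x. Y (\<sigma> j) (chart_inv c0 x) c0 i) C Q
  (\<lambda>ws x. lie_derivs L Y (map \<sigma> ws) f (chart_inv c0 x))"
proof -
 let ?W = "snd c0 ` (fst c0 \<inter> V)"
 have W: "eopen n ?W" by (rule chart_open_image[OF c0 V])
 have WV: "chart_inv c0 x \<in> V" "chart_inv c0 x \<in> fst c0" "snd c0 (chart_inv c0 x) = x" if "x \<in> ?W" for x using that c0 by auto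
 have P: "patch ?W (chart_inv c0)" by (rule patch_subset[OF patch_chart[OF c0] W]) auto
 have cont: "continuous_map (subtopology (mtop L) V) euclideanreal (lie_derivs L Y ws f)"
  and has: "\<And>j p. j < q ==> p \<in> V ==> has_lie_deriv L (Y j) (lie_derivs L Y ws f) p" if "ws \<in> lists {..<q}" for ws
  using f that unfolding C_X_omega_def C_X_omega_r_def by blast+
 show ?thesis
  unfolding word_family_def
 proof (intro ballI conjI allI impI)
  fix ws assume "ws \<in> lists {..<n}"
  then have ws: "map \<sigma> ws \<in> lists {..<q}" using \<sigma> by auto
  have "continuous_map (subtopology (Euclidean_space n) ?W) (subtopology (mtop L) V) (chart_inv c0)"
   unfolding continuous_map_in_subtopology using patch_continuous[OF P] WV by (auto simp: topspace_eopen[OF W])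
  from continuous_map_compose[OF this cont[OF ws]]
  show "continuous_on ?W (\<lambda>x. lie_derivs L Y (map \<sigma> ws) f (chart_inv c0 x))"
   using continuous_map_Euclidean_iff[OF W] by (simp add: comp_def)
  show "\<bar>lie_derivs L Y (map \<sigma> ws) f (chart_inv c0 x)\<bar> \<le> C * Q ^ length ws * fact (length ws)" if "x \<in> ?W" for x
   using bspec[OF bspec[OF b ws] WV(1)[OF that]] by simp
  fix j \<eta> a b' s
  assume j: "j < n" and \<eta>: "\<forall>s\<in>{a<..<b'}. \<eta> s \<in> ?W \<and> (\<forall>i\<ge>n. \<eta> s i = 0) \<and>
   (\<forall>i<n. ((\<lambda>s. \<eta> s i) has_real_derivative Y (\<sigma> j) (chart_inv c0 (\<eta> s)) c0 i) (at s))"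
   and s: "s \<in> {a<..<b'}"
  have sol: "solution n ?W (\<lambda>i x. Y (\<sigma> j) (chart_inv c0 x) c0 i) a b' \<eta>"
   using \<eta> unfolding solution_def by blast
  have ic: "integral_curve L (Y (\<sigma> j)) {a<..<b'} (\<lambda>s. chart_inv c0 (\<eta> s))"
  proof (rule patch_integral_curve[OF P sol])
   fix x assume x: "x \<in> ?W"
   have "Y (\<sigma> j) (chart_inv c0 x) \<in> tangent_space L (chart_inv c0 x)"
    using Y[OF \<sigma>[OF j]] WV(1)[OF x] openin_subset[OF V] unfolding C1_vector_field_def by blast
   then show "rep_at (chart_inv c0) x (Y (\<sigma> j) (chart_inv c0 x)) (\<lambda>i. Y (\<sigma> j) (chart_inv c0 x) c0 i)"
    using x by (intro rep_at_chart[OF c0]) auto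
  qed
  have "chart_inv c0 (\<eta> s) \<in> V" using \<eta> s WV(1) by blast
  from lie_deriv_along[OF Y[OF \<sigma>[OF j]] ic s has[OF ws \<sigma>[OF j] this]]
  show "((\<lambda>s. lie_derivs L Y (map \<sigma> ws) f (chart_inv c0 (\<eta> s))) has_real_derivative
    lie_derivs L Y (map \<sigma> (j # ws)) f (chart_inv c0 (\<eta> s))) (at s)" by simp
 qed
qed

text \<open>The hard direction in the form common to (ii) and (iii). \<open>Fs\<close> collects
  further functions that must become analytic in the same coordinates, for (ii) the coefficients
  \<open>b\<close>.\<close>

lemma analytic_patch:
 assumes Y: "\<And>j. j < q ==> C1_vector_field L (Y j)" and V: "openin (mtop L) V" "x0 \<in> V"
  and np: "n \<le> p" and \<sigma>: "\<And>k. k < p ==> \<sigma> k < q"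
  and indep: "\<And>v. (\<Sum>k<n. v k *\<^sub>R Y (\<sigma> k) x0) = 0 ==> \<forall>k<n. v k = (0::real)"
  and c: "\<And>j k l. j < n ==> k < p ==> l < p ==> C_X_omega L q Y V (c j k l)"
  and br: "\<And>j k x. j < n ==> k < p ==> x \<in> V ==> lie_bracket L (Y (\<sigma> j)) (Y (\<sigma> k)) x = (\<Sum>l<p. c j k l x *\<^sub>R Y (\<sigma> l) x)"
  and Fs: "finite Fs" "\<And>f. f \<in> Fs ==> C_X_omega L q Y V f"
 shows "\<exists>U \<Phi> w. patch U \<Phi> \<and> \<Phi> ` U \<subseteq> V \<and> x0 \<in> \<Phi> ` U \<and> (\<forall>m<p. \<forall>i<n. analytic n U (w m i)) \<and>
  (\<forall>m<p. \<forall>u\<in>U. rep_at \<Phi> u (Y (\<sigma> m) (\<Phi> u)) (\<lambda>i. w m i u)) \<and> (\<forall>f\<in>Fs. analytic n U (\<lambda>u. f (\<Phi> u)))"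
proof -
 have \<sigma>n: "\<sigma> k < q" if "k < n" for k using \<sigma> np that by simp
 obtain c0 where c0: "c0 \<in> atlas L" "x0 \<in> fst c0" using V openin_subset[OF V(1)] cover by blast
 define W where "W = snd c0 ` (fst c0 \<inter> V)"
 have W: "eopen n W" unfolding W_def by (rule chart_open_image[OF c0(1) V(1)])
 define w0 where "w0 = snd c0 x0"
 have w0: "w0 \<in> W" "chart_inv c0 w0 = x0" unfolding w0_def W_def using V c0 by auto
 have WV: "chart_inv c0 x \<in> V" "chart_inv c0 x \<in> fst c0" "snd c0 (chart_inv c0 x) = x" if "x \<in> W" for x
  using that c0 unfolding W_def by auto
 have P: "patch W (chart_inv c0)" by (rule patch_subset[OF patch_chart[OF c0(1)] W]) (auto simp: W_def)
 define Z where "Z j i x = Y (\<sigma> j) (chart_inv c0 x) c0 i" for j i x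
 have tan: "Y (\<sigma> j) (chart_inv c0 x) \<in> tangent_space L (chart_inv c0 x)" if "j < p" "x \<in> W" for j x
  using Y[OF \<sigma>[OF that(1)]] WV(1)[OF that(2)] openin_subset[OF V(1)] unfolding C1_vector_field_def by blast
 have rep: "rep_at (chart_inv c0) x (Y (\<sigma> j) (chart_inv c0 x)) (\<lambda>i. Z j i x)" if "j < p" "x \<in> W" for j x
  unfolding Z_def using that(2) by (intro rep_at_chart[OF c0(1) _ tan[OF that]]) (auto simp: W_def)
 have Zck: "Ck_on n (Suc 0) W (Z j i)" if "j < p" "i < n" for j i
 proof -
  have "Ck_on n (Suc 0) (snd c0 ` fst c0) (Z j i)"
   using Y[OF \<sigma>[OF that(1)]] c0(1) that(2) unfolding C1_vector_field_def Z_def[abs_def] by simp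
  then show ?thesis by (rule Ck_on_subset) (auto simp: W_def)
 qed
 have det: "mdet n (\<lambda>i k. Z k i) w0 \<noteq> 0"
  by (rule frame_det[OF P w0(1), where y = "\<lambda>k. Y (\<sigma> k) x0"])
   (use np tan[OF _ w0(1)] rep[OF _ w0(1)] indep w0(2) in auto)
 have bracket: "(\<Sum>a<n. Z j a x * partial a (Z k i) x - Z k a x * partial a (Z j i) x) =
   (\<Sum>l<p. c j k l (chart_inv c0 x) * Z l i x)" if "j < n" "k < p" "i < n" "x \<in> W" for j k i x
 proof -
  have "(\<Sum>a<n. Z j a x * partial a (Z k i) x - Z k a x * partial a (Z j i) x) =
    lie_bracket L (Y (\<sigma> j)) (Y (\<sigma> k)) (chart_inv c0 x) c0 i"
   using WV[OF that(4)] c0(1) that(3) by (simp add: lie_bracket_def Z_def[abs_def])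
  then show ?thesis using br[OF that(1,2) WV(1)[OF that(4)]] by (simp add: tvec_sum_apply Z_def)
 qed
 \<comment> \<open>Structure functions and \<open>Fs\<close> together, to obtain common
   constants.\<close>
 let ?FF = "(\<lambda>(j, k, l). c j k l) ` ({..<n} \<times> {..<p} \<times> {..<p}) \<union> Fs"
 have FF: "C_X_omega L q Y V f" if "f \<in> ?FF" for f using that c Fs by auto
 have "\<exists>C\<ge>0. \<exists>Q\<ge>0. \<forall>f\<in>?FF. \<forall>ws\<in>lists {..<q}. \<forall>x\<in>V. \<bar>lie_derivs L Y ws f x\<bar> \<le> C * Q ^ length ws * fact (length ws)"
  by (rule C_X_omega_bound_finite) (use Fs FF in auto)
 then obtain C Q where CQ: "C \<ge> 0" "Q \<ge> 0" and b: "\<forall>f\<in>?FF. \<forall>ws\<in>lists {..<q}. \<forall>x\<in>V. \<bar>lie_derivs L Y ws f x\<bar> \<le> C * Q ^ length ws * fact (length ws)"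
  by (elim exE conjE) (rule that)
 define F where "F f = (\<lambda>ws x. lie_derivs L Y (map \<sigma> ws) f (chart_inv c0 x))" for f
 have wf: "word_family n W Z C Q (F f)" if "f \<in> ?FF" for f
  unfolding W_def Z_def[abs_def] F_def
  by (rule lie_derivs_word_family[where \<sigma> = \<sigma>, OF Y c0(1) V(1) \<sigma>n FF[OF that] bspec[OF b that]])
 have cF1: "word_family n W Z C Q (F (c j k l))" if "j < n" "k < p" "l < p" for j k l
  by (rule wf) (use that in force)
 have cF0: "F (c j k l) [] x = c j k l (chart_inv c0 x)" for j k l x by (simp add: F_def)
 have "\<exists>U \<phi> w. eopen n U \<and> inj_on \<phi> U \<and> \<phi> ` U \<subseteq> W \<and> eopen n (\<phi> ` U) \<and> w0 \<in> \<phi> ` U \<and>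
  (\<forall>k<n. Ck_on n 2 U (\<lambda>u. \<phi> u k)) \<and> (\<forall>k<n. Ck_on n 2 (\<phi> ` U) (\<lambda>x. inv_into U \<phi> x k)) \<and>
  (\<forall>m<p. \<forall>i<n. analytic n U (w m i)) \<and>
  (\<forall>u\<in>U. \<forall>m<p. \<forall>k<n. Z m k (\<phi> u) = (\<Sum>i<n. partial i (\<lambda>u. \<phi> u k) u * w m i u)) \<and>
  (\<forall>F. word_family n W Z C Q F \<longrightarrow> analytic n U (\<lambda>u. F [] (\<phi> u)))"
  by (rule analytic_coordinates[where c = "\<lambda>j k l x. c j k l (chart_inv c0 x)" and cF = "\<lambda>j k l. F (c j k l)",
    OF np W w0(1) _ det _ CQ]) (rule Zck bracket cF1 cF0; assumption)+
 then obtain U \<phi> w where U: "eopen n U" "inj_on \<phi> U" "\<phi> ` U \<subseteq> W" "eopen n (\<phi> ` U)" "w0 \<in> \<phi> ` U"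
  "\<forall>k<n. Ck_on n 2 U (\<lambda>u. \<phi> u k)" "\<forall>k<n. Ck_on n 2 (\<phi> ` U) (\<lambda>x. inv_into U \<phi> x k)"
  and w: "\<forall>m<p. \<forall>i<n. analytic n U (w m i)"
  and Zw: "\<forall>u\<in>U. \<forall>m<p. \<forall>k<n. Z m k (\<phi> u) = (\<Sum>i<n. partial i (\<lambda>u. \<phi> u k) u * w m i u)"
  and Fan: "\<forall>F. word_family n W Z C Q F \<longrightarrow> analytic n U (\<lambda>u. F [] (\<phi> u))"
  by (elim exE conjE) (rule that)
 have "patch U (\<lambda>u. chart_inv c0 (\<phi> u))"
  by (rule patch_compose[OF P U(1-4)]) (use U(6,7) in auto)
 moreover have "rep_at (\<lambda>u. chart_inv c0 (\<phi> u)) u (Y (\<sigma> m) (chart_inv c0 (\<phi> u))) (\<lambda>i. w m i u)"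
  if m: "m < p" and u: "u \<in> U" for m u
 proof (rule rep_at_compose[OF P U(1,3) _ u rep[OF m]])
  show "\<phi> u \<in> W" using u U(3) by blast
  show "Ck_on n 2 U (\<lambda>u. \<phi> u k)" if "k < n" for k using U(6) that by blast
  show "Z m k (\<phi> u) = jacobian_app n \<phi> u (\<lambda>i. w m i u) k" if "k < n" for k
   using Zw u m that by (simp add: jacobian_app_def)
 qed
 moreover have "analytic n U (\<lambda>u. f (chart_inv c0 (\<phi> u)))" if "f \<in> Fs" for f
  using Fan[rule_format, OF wf[of f]] that by (simp add: F_def)
 moreover have "(\<lambda>u. chart_inv c0 (\<phi> u)) ` U \<subseteq> V" using U(3) WV(1) by auto
 moreover have "x0 \<in> (\<lambda>u. chart_inv c0 (\<phi> u)) ` U" using U(5) w0(2) by force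
 ultimately show ?thesis using w by (intro exI[of _ U] exI[of _ "\<lambda>u. chart_inv c0 (\<phi> u)"] exI[of _ w]) blast
qed

end

section \<open>The tangent space and admissible reorderings\<close>

text \<open>Stated for families, so that a repeated vector counts as a dependence.\<close>

lemma independent_family_iff:
 fixes y :: "nat => 'v::real_vector"
 shows "inj_on y {..<n} \<and> independent (y ` {..<n}) \<longleftrightarrow> (\<forall>a. (\<Sum>k<n. a k *\<^sub>R y k) = 0 \<longrightarrow> (\<forall>k<n. a k = 0))"
proof (intro iffI conjI allI impI)
 fix a k assume h: "inj_on y {..<n} \<and> independent (y ` {..<n})" and s: "(\<Sum>k<n. a k *\<^sub>R y k) = 0" and k: "k < n"
 have "(\<Sum>v\<in>y ` {..<n}. a (inv_into {..<n} y v) *\<^sub>R v) = (\<Sum>k<n. a (inv_into {..<n} y (y k)) *\<^sub>R y k)"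
  using h by (simp add: sum.reindex)
 also have "\<dots> = 0" using s h by (simp add: inv_into_f_f)
 finally have "a (inv_into {..<n} y (y k)) = 0"
  by (rule independentD[of "y ` {..<n}", rotated 3]) (use h k in auto)
 then show "a k = 0" using h k by (simp add: inv_into_f_f)
next
 assume h: "\<forall>a. (\<Sum>k<n. a k *\<^sub>R y k) = 0 \<longrightarrow> (\<forall>k<n. a k = 0)"
 show inj: "inj_on y {..<n}"
 proof (rule inj_onI, rule ccontr)
  fix i j assume ij: "i \<in> {..<n}" "j \<in> {..<n}" "y i = y j" "i \<noteq> j"
  let ?a = "\<lambda>k. (if k = i then 1 else 0) - (if k = j then 1 else 0 :: real)"
  have "(\<Sum>k<n. ?a k *\<^sub>R y k) = (\<Sum>k<n. if k = i then y k else 0) - (\<Sum>k<n. if k = j then y k else 0)"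
   unfolding sum_subtractf[symmetric] by (rule sum.cong) auto
  also have "\<dots> = 0" using ij by (simp add: sum.delta)
  finally have z: "(\<Sum>k<n. ?a k *\<^sub>R y k) = 0" .
  have "?a i = 0" by (rule h[rule_format, OF z]) (use ij in simp)
  then show False using ij by simp
 qed
 show "independent (y ` {..<n})"
 proof (rule independent_if_scalars_zero)
  fix f x assume s: "(\<Sum>v\<in>y ` {..<n}. f v *\<^sub>R v) = 0" and x: "x \<in> y ` {..<n}"
  have "(\<Sum>k<n. f (y k) *\<^sub>R y k) = 0" using s inj by (simp add: sum.reindex)
  then show "f x = 0" using h[rule_format, of "\<lambda>k. f (y k)"] x by auto
 qed simp
qed

text \<open>A basis is selected among the values of the fields; its indices are moved to the front
  and the remaining ones follow in any order.\<close>

lemma admissible_reordering_exists: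
 fixes X :: "nat => 'm => 'm tvec"
 assumes n: "n = dim (span ((\<lambda>j. X j x) ` {..<q}))"
 shows "n \<le> q" "\<exists>\<sigma>. admissible_reordering n q X x \<sigma>"
proof -
 let ?y = "\<lambda>j. X j x"
 obtain B where B: "B \<subseteq> ?y ` {..<q}" "independent B" "?y ` {..<q} \<subseteq> span B" "card B = dim (?y ` {..<q})"
  by (rule basis_exists)
 have cB: "card B = n" using B(4) n by simp
 define J where "J = inv_into {..<q} ?y ` B"
 have J: "J \<subseteq> {..<q}"
 proof
  fix j assume "j \<in> J"
  then obtain b where b: "b \<in> B" "j = inv_into {..<q} ?y b" unfolding J_def by blast
  show "j \<in> {..<q}" unfolding b(2) by (rule inv_into_into[OF subsetD[OF B(1) b(1)]])
 qed
 have yi: "?y (inv_into {..<q} ?y b) = b" if "b \<in> B" for b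
  by (rule f_inv_into_f[where f = ?y and A = "{..<q}"]) (rule subsetD[OF B(1) that])
 have "inj_on (inv_into {..<q} ?y) B" by (rule inj_on_inverseI[of _ ?y]) (rule yi)
 then have cJ: "card J = n" using cB by (simp add: J_def card_image)
 show nq: "n \<le> q" using card_mono[OF _ J] cJ by simp
 have yJ: "?y ` J = B" using yi by (force simp: J_def image_image)
 have injJ: "inj_on ?y J" by (rule eq_card_imp_inj_on) (use finite_subset[OF J] yJ cJ cB in auto)
 obtain f where f: "bij_betw f {..<n} J"
  using finite_same_card_bij[of "{..<n}" J] cJ finite_subset[OF J] by auto
 obtain g where g: "bij_betw g {n..<q} ({..<q} - J)"
  using finite_same_card_bij[of "{n..<q}" "{..<q} - J"] card_Diff_subset[OF finite_subset[OF J] J] cJ by auto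
 define \<sigma> where "\<sigma> k = (if k < n then f k else if k < q then g k else k)" for k
 have 1: "bij_betw \<sigma> {..<n} J" using f by (rule iffD2[OF bij_betw_cong, rotated]) (simp add: \<sigma>_def)
 have 2: "bij_betw \<sigma> {n..<q} ({..<q} - J)" using g by (rule iffD2[OF bij_betw_cong, rotated]) (simp add: \<sigma>_def)
 have "bij_betw \<sigma> ({..<n} \<union> {n..<q}) (J \<union> ({..<q} - J))" by (rule bij_betw_combine[OF 1 2]) auto
 moreover have "{..<n} \<union> {n..<q} = {..<q}" "J \<union> ({..<q} - J) = {..<q}" using nq J by auto
 ultimately have "\<sigma> permutes {..<q}" using nq by (intro bij_imp_permutes) (auto simp: \<sigma>_def)
 moreover have \<sigma>J: "inj_on \<sigma> {..<n}" "\<sigma> ` {..<n} = J" using 1 by (auto simp: bij_betw_def)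
 moreover have "inj_on (\<lambda>j. X (\<sigma> j) x) {..<n}" using comp_inj_on[of \<sigma> "{..<n}" ?y] \<sigma>J injJ by (simp add: comp_def)
 moreover have "(\<lambda>j. X (\<sigma> j) x) ` {..<n} = B"
  unfolding yJ[symmetric] \<sigma>J(2)[symmetric] by (simp only: image_image)
 ultimately show "\<exists>\<sigma>. admissible_reordering n q X x \<sigma>"
  using B(2) unfolding admissible_reordering_def by auto
qed

lemma linear_differential: "linear (differential S S' f p)"
proof (rule linearI)
 have j: "jacobian_app m F x (\<lambda>i. a * v i + w i) i = a * jacobian_app m F x v i + jacobian_app m F x w i"
  for m F x v w i and a :: real
  unfolding jacobian_app_def sum_distrib_left sum.distrib[symmetric] by (rule sum.cong) (auto simp: algebra_simps)
 have j1: "jacobian_app m F x (\<lambda>i. v i + w i) i = jacobian_app m F x v i + jacobian_app m F x w i" for m F x v w i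
  using j[of m F x 1 v w i] by simp
 have j2: "jacobian_app m F x (\<lambda>i. a * v i) i = a * jacobian_app m F x v i" for m F x v i and a :: real
  using j[of m F x a v "\<lambda>i. 0" i] by (simp add: jacobian_app_def)
 show "differential S S' f p (v + w) = differential S S' f p v + differential S S' f p w" for v w
  by (auto simp: differential_def Let_def plus_fun_def fun_eq_iff j1)
 show "differential S S' f p (a *\<^sub>R v) = a *\<^sub>R differential S S' f p v" for a v
  by (auto simp: differential_def Let_def scaleR_fun_def fun_eq_iff j2)
qed

context C2_mfd
begin

text \<open>The coordinate vectors of one chart around the point, transported to the other charts by
  the Jacobians of the transitions.\<close>

lemma tangent_basis:
 assumes p: "p \<in> points L"
 shows "\<exists>e. (\<forall>k<n. e k \<in> tangent_space L p) \<and> (\<forall>v\<in>tangent_space L p. \<exists>a. v = (\<Sum>k<n. a k *\<^sub>R e k)) \<and>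
  (\<forall>a. (\<Sum>k<n. a k *\<^sub>R e k) = 0 \<longrightarrow> (\<forall>k<n. a k = (0::real)))"
proof -
 obtain c0 where c0: "c0 \<in> atlas L" "p \<in> fst c0" using p cover by blast
 let ?\<delta> = "\<lambda>k j. if j = k then 1 else 0 :: real"
 let ?z = "snd c0 p"
 define e :: "nat => 'm tvec" where "e k = (\<lambda>c i. if c \<in> atlas L \<and> p \<in> fst c \<and> i < n
  then jacobian_app n (\<lambda>x. snd c (chart_inv c0 x)) ?z (?\<delta> k) i else 0)" for k
 have O0: "eopen n (snd c0 ` fst c0)" by (rule chart_image[OF c0(1)])
 have e0: "e k c0 i = ?\<delta> k i" if "i < n" for k i
 proof -
  have "jacobian_app n (\<lambda>x. snd c0 (chart_inv c0 x)) ?z (?\<delta> k) i = ?\<delta> k i"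
   using c0 chart_inv_in(2)[OF c0(1)] that by (intro jacobian_app_id[OF O0]) auto
  then show ?thesis using c0 that by (simp add: e_def)
 qed
 have "e k \<in> tangent_space L p" for k
  unfolding tangent_space_def
 proof (intro CollectI conjI ballI allI impI)
  fix c c' i assume c: "c \<in> atlas L" and c': "c' \<in> atlas L" and pc: "p \<in> fst c \<inter> fst c'" and i: "i < n"
  let ?O = "snd c0 ` (fst c0 \<inter> (fst c \<inter> fst c'))"
  have O: "eopen n ?O" by (rule chart_open_image[OF c0(1) openin_Int[OF chart_open[OF c] chart_open[OF c']]])
  have O': "eopen n (snd c ` (fst c \<inter> fst c'))" by (rule chart_open_image[OF c chart_open[OF c']])
  have zO: "?z \<in> ?O" using c0 pc by blast
  have tr: "Ck_on n 2 ?O (\<lambda>x. snd c (chart_inv c0 x) j)" if "j < n" for j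
   by (rule Ck_on_subset[OF transition[OF c0(1) c that]]) auto
  have "e k c' i = jacobian_app n (\<lambda>x. snd c' (chart_inv c0 x)) ?z (?\<delta> k) i" using c' pc i by (simp add: e_def)
  also have "\<dots> = jacobian_app n (\<lambda>x. snd c' (chart_inv c (snd c (chart_inv c0 x)))) ?z (?\<delta> k) i"
   using c c0 by (intro jacobian_app_cong[OF O zO]) auto
  also have "\<dots> = jacobian_app n (\<lambda>x. snd c' (chart_inv c x)) (snd c (chart_inv c0 ?z))
    (jacobian_app n (\<lambda>x. snd c (chart_inv c0 x)) ?z (?\<delta> k)) i"
   by (rule jacobian_app_chain[where G = "\<lambda>x. snd c (chart_inv c0 x)" and F = "\<lambda>x. snd c' (chart_inv c x)",
     OF O O' _ tr transition[OF c c' i] zO]) (use c0 in auto)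
  also have "\<dots> = jacobian_app n (\<lambda>x. snd c' (chart_inv c x)) (snd c p) (e k c) i"
   unfolding jacobian_app_def[of n "\<lambda>x. snd c' (chart_inv c x)"]
   by (rule sum.cong) (use c0 c pc in \<open>auto simp: e_def\<close>)
  finally show "e k c' i = jacobian_app n (\<lambda>x. snd c' (chart_inv c x)) (snd c p) (e k c) i" .
 next
  fix c i assume "\<not> (c \<in> atlas L \<and> p \<in> fst c \<and> i < n)"
  then show "e k c i = 0" unfolding e_def by (rule if_not_P)
 qed
 moreover have "v = (\<Sum>k<n. v c0 k *\<^sub>R e k)" if v: "v \<in> tangent_space L p" for v
 proof (intro ext)
  fix c i
  show "v c i = (\<Sum>k<n. v c0 k *\<^sub>R e k) c i"
  proof (cases "c \<in> atlas L \<and> p \<in> fst c \<and> i < n")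
   case False
   then have "e k c i = 0" for k unfolding e_def by (rule if_not_P)
   then show ?thesis using tangent_zero[OF v False] by (simp add: tvec_sum_apply)
  next
   case True
   then have "v c i = jacobian_app n (\<lambda>x. snd c (chart_inv c0 x)) ?z (v c0) i"
    using v c0 unfolding tangent_space_def by blast
   also have "\<dots> = jacobian_app n (\<lambda>x. snd c (chart_inv c0 x)) ?z (\<lambda>i. \<Sum>k<n. v c0 k * ?\<delta> k i) i"
    unfolding jacobian_app_def by (rule sum.cong) (auto simp: if_distrib sum.delta cong: if_cong)
   also have "\<dots> = (\<Sum>k<n. v c0 k * e k c i)"
    unfolding jacobian_app_sum using True by (simp add: e_def)
   finally show ?thesis by (simp add: tvec_sum_apply)
  qed
 qed
 moreover have "a k = 0" if "(\<Sum>k<n. a k *\<^sub>R e k) = 0" "k < n" for a k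
 proof -
  have "0 = (\<Sum>j<n. a j *\<^sub>R e j) c0 k" using that(1) by (simp add: zero_fun_def)
  also have "\<dots> = (\<Sum>j<n. a j * ?\<delta> j k)" using e0[OF that(2)] by (simp add: tvec_sum_apply)
  also have "\<dots> = a k" using that(2) by (simp add: if_distrib sum.delta' cong: if_cong)
  finally show ?thesis by simp
 qed
 ultimately show ?thesis by blast
qed

text \<open>The number \<open>n\<close> of the theorem is read off in the ambient manifold,
  \<open>mdim L\<close> on the leaf; an injective linear map preserves dimension, so they
  agree.\<close>

lemma dim_differential_image:
 assumes p: "p \<in> points L" and D: "linear D" "inj_on D (tangent_space L p)"
  and y: "span (y ` {..<q}) = tangent_space L p"
 shows "dim (span ((\<lambda>j. D (y j)) ` {..<q})) = n"
proof -
 obtain e where e: "\<And>k. k < n ==> e k \<in> tangent_space L p"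
  and ex: "\<And>v. v \<in> tangent_space L p ==> \<exists>a. v = (\<Sum>k<n. a k *\<^sub>R e k)"
  and ind: "\<And>a. (\<Sum>k<n. a k *\<^sub>R e k) = 0 ==> \<forall>k<n. a k = (0::real)"
  using tangent_basis[OF p] by auto
 have sub: "subspace (tangent_space L p)" using subspace_span[of "y ` {..<q}"] y by simp
 have lin: "D (\<Sum>k<n. a k *\<^sub>R e k) = (\<Sum>k<n. a k *\<^sub>R D (e k))" for a
  by (simp add: linear_sum[OF D(1)] linear_scale[OF D(1)])
 have "\<forall>k<n. a k = 0" if "(\<Sum>k<n. a k *\<^sub>R D (e k)) = 0" for a
 proof (rule ind)
  have "(\<Sum>k<n. a k *\<^sub>R e k) \<in> tangent_space L p"
   using e by (intro subspace_sum[OF sub] subspace_scale[OF sub]) auto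
  then show "(\<Sum>k<n. a k *\<^sub>R e k) = 0"
   using inj_onD[OF D(2), of "\<Sum>k<n. a k *\<^sub>R e k" 0] that lin linear_0[OF D(1)] subspace_0[OF sub] by simp
 qed
 then have i: "inj_on (\<lambda>k. D (e k)) {..<n}" "independent ((\<lambda>k. D (e k)) ` {..<n})"
  using independent_family_iff[of "\<lambda>k. D (e k)" n] by auto
 have "span ((\<lambda>j. D (y j)) ` {..<q}) = D ` tangent_space L p"
  using linear_span_image[OF D(1), of "y ` {..<q}"] y by (simp add: image_image)
 also have "\<dots> = span ((\<lambda>k. D (e k)) ` {..<n})"
 proof
  show "D ` tangent_space L p \<subseteq> span ((\<lambda>k. D (e k)) ` {..<n})"
  proof
   fix w assume "w \<in> D ` tangent_space L p"
   then obtain v where v: "v \<in> tangent_space L p" "w = D v" by blast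
   then obtain a where "v = (\<Sum>k<n. a k *\<^sub>R e k)" using ex by blast
   then have "w = (\<Sum>k<n. a k *\<^sub>R D (e k))" using v lin by simp
   also have "\<dots> \<in> span ((\<lambda>k. D (e k)) ` {..<n})"
    by (intro span_sum span_scale span_base) auto
   finally show "w \<in> span ((\<lambda>k. D (e k)) ` {..<n})" .
  qed
  have "subspace (D ` tangent_space L p)" by (rule linear_subspace_image[OF D(1) sub])
  then show "span ((\<lambda>k. D (e k)) ` {..<n}) \<subseteq> D ` tangent_space L p"
   using e by (intro span_minimal) auto
 qed
 finally have eq: "span ((\<lambda>j. D (y j)) ` {..<q}) = span ((\<lambda>k. D (e k)) ` {..<n})" .
 show ?thesis unfolding eq dim_span_eq_card_independent[OF i(2)] card_image[OF i(1)] by simp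
qed

section \<open>The implications between the three conditions\<close>

lemma basis_of_coordinates:
 assumes Y: "\<And>j. j < q ==> C1_vector_field L (Y j)" and \<sigma>: "\<sigma> permutes {..<q}" and nq: "n \<le> q"
  and indep: "\<And>v. (\<Sum>k<n. v k *\<^sub>R Y (\<sigma> k) x0) = 0 ==> \<forall>k<n. v k = (0::real)"
  and cc: "cond_coordinates L n q Y x0"
 shows "cond_basis L n q (Y \<circ> \<sigma>) x0" "cond_commutators L q Y x0"
proof -
 have \<sigma>q: "\<sigma> k < q" if "k < q" for k using permutes_in_image[OF \<sigma>, of k] that by simp
 have \<sigma>n: "\<sigma> k < q" if "k < n" for k using \<sigma>q that nq by simp
 have "\<exists>V b c. openin (mtop L) V \<and> x0 \<in> V \<and>
  (\<forall>j<q. \<forall>p\<in>V. Y j p = (\<Sum>k<n. b j k p *\<^sub>R Y (\<sigma> k) p)) \<and>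
  (\<forall>i<q. \<forall>j<q. \<forall>p\<in>V. lie_bracket L (Y i) (Y j) p = (\<Sum>k<n. c i j k p *\<^sub>R Y (\<sigma> k) p)) \<and>
  (\<forall>\<tau>. (\<forall>j<q. \<tau> j < q) \<longrightarrow> C_X_omega L q (Y \<circ> \<tau>) V (\<lambda>p. 0) \<and> (\<forall>k<n. \<forall>j<q. C_X_omega L q (Y \<circ> \<tau>) V (b j k) \<and>
    (\<forall>i<q. C_X_omega L q (Y \<circ> \<tau>) V (c i j k))))"
  by (rule analytic_relations[where \<sigma> = \<sigma>, OF Y cc \<sigma>n indep])
 then obtain V b c where V: "openin (mtop L) V" "x0 \<in> V"
  and b: "\<forall>j<q. \<forall>p\<in>V. Y j p = (\<Sum>k<n. b j k p *\<^sub>R Y (\<sigma> k) p)"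
  and c: "\<forall>i<q. \<forall>j<q. \<forall>p\<in>V. lie_bracket L (Y i) (Y j) p = (\<Sum>k<n. c i j k p *\<^sub>R Y (\<sigma> k) p)"
  and an: "\<forall>\<tau>. (\<forall>j<q. \<tau> j < q) \<longrightarrow> C_X_omega L q (Y \<circ> \<tau>) V (\<lambda>p. 0) \<and> (\<forall>k<n. \<forall>j<q. C_X_omega L q (Y \<circ> \<tau>) V (b j k) \<and>
    (\<forall>i<q. C_X_omega L q (Y \<circ> \<tau>) V (c i j k)))"
  by (elim exE conjE) (rule that)
 have an\<sigma>: "C_X_omega L q (Y \<circ> \<sigma>) V (b j k)" "i < q ==> C_X_omega L q (Y \<circ> \<sigma>) V (c i j k)" if "k < n" "j < q" for i j k
  using an \<sigma>q that by blast+
 have anid: "C_X_omega L q Y V (\<lambda>p. 0)" "i < q ==> j < q ==> k < n ==> C_X_omega L q Y V (c i j k)" for i j k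
  using spec[OF an, of id] by auto
 show "cond_basis L n q (Y \<circ> \<sigma>) x0"
  unfolding cond_basis_def
 proof (intro exI[of _ V] conjI V)
  show "\<exists>c. \<forall>i<n. \<forall>j<n. (\<forall>k<n. C_X_omega L q (Y \<circ> \<sigma>) V (c i j k)) \<and>
    (\<forall>p\<in>V. lie_bracket L ((Y \<circ> \<sigma>) i) ((Y \<circ> \<sigma>) j) p = (\<Sum>k<n. c i j k p *\<^sub>R (Y \<circ> \<sigma>) k p))"
   by (rule exI[of _ "\<lambda>i j. c (\<sigma> i) (\<sigma> j)"]) (use an\<sigma>(2) c \<sigma>n in simp)
  show "\<exists>b. \<forall>j\<in>{n..<q}. (\<forall>k<n. C_X_omega L q (Y \<circ> \<sigma>) V (b j k)) \<and>
    (\<forall>p\<in>V. (Y \<circ> \<sigma>) j p = (\<Sum>k<n. b j k p *\<^sub>R (Y \<circ> \<sigma>) k p))"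
   by (rule exI[of _ "\<lambda>j. b (\<sigma> j)"]) (use an\<sigma>(1) b \<sigma>q in simp)
 qed
 \<comment> \<open>The relations involve the frame only, whereas the condition sums over all
   \<open>q\<close> fields; the other coefficients are set to 0.\<close>
 define c' where "c' i j m = (if inv_into UNIV \<sigma> m < n then c i j (inv_into UNIV \<sigma> m) else (\<lambda>p. 0))" for i j m
 show "cond_commutators L q Y x0"
  unfolding cond_commutators_def
 proof (intro exI[of _ V] conjI V exI[of _ c'] allI impI ballI)
  fix i j assume i: "i < q" and j: "j < q"
  show "C_X_omega L q Y V (c' i j m)" for m unfolding c'_def using anid i j by simp
  fix p assume p: "p \<in> V"
  have "(\<Sum>m<q. c' i j m p *\<^sub>R Y m p) = (\<Sum>k<q. c' i j (\<sigma> k) p *\<^sub>R Y (\<sigma> k) p)"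
   using sum.permute[OF \<sigma>, of "\<lambda>m. c' i j m p *\<^sub>R Y m p"] by (simp add: comp_def)
  also have "\<dots> = (\<Sum>k<q. if k < n then c i j k p *\<^sub>R Y (\<sigma> k) p else 0)"
   by (rule sum.cong) (auto simp: c'_def permutes_inverses[OF \<sigma>])
  also have "\<dots> = (\<Sum>k<n. c i j k p *\<^sub>R Y (\<sigma> k) p)"
   using nq by (intro sum.mono_neutral_cong_right) auto
  finally show "lie_bracket L (Y i) (Y j) p = (\<Sum>m<q. c' i j m p *\<^sub>R Y m p)" using c i j p by simp
 qed
qed

text \<open>All \<open>q\<close> fields enter \<open>analytic_patch\<close>, reordered so that the
  first \<open>n\<close> are independent at the base point.\<close>

lemma coordinates_of_commutators:
 assumes Y: "\<And>j. j < q ==> C1_vector_field L (Y j)" and \<sigma>: "\<sigma> permutes {..<q}" and nq: "n \<le> q"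
  and indep: "\<And>v. (\<Sum>k<n. v k *\<^sub>R Y (\<sigma> k) x0) = 0 ==> \<forall>k<n. v k = (0::real)"
  and cc: "cond_commutators L q Y x0"
 shows "cond_coordinates L n q Y x0"
proof -
 have \<sigma>q: "\<sigma> k < q" if "k < q" for k using permutes_in_image[OF \<sigma>, of k] that by simp
 have i\<sigma>: "inv_into UNIV \<sigma> k < q" if "k < q" for k using permutes_in_image[OF permutes_inv[OF \<sigma>], of k] that by simp
 obtain V c where V: "openin (mtop L) V" "x0 \<in> V"
  and c0: "\<forall>i<q. \<forall>j<q. (\<forall>k<q. C_X_omega L q Y V (c i j k)) \<and>
   (\<forall>p\<in>V. lie_bracket L (Y i) (Y j) p = (\<Sum>k<q. c i j k p *\<^sub>R Y k p))"
  using cc unfolding cond_commutators_def by (elim exE conjE) (rule that)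
 have c: "C_X_omega L q Y V (c i j k)" if "i < q" "j < q" "k < q" for i j k using c0 that by blast
 have br: "lie_bracket L (Y i) (Y j) p = (\<Sum>k<q. c i j k p *\<^sub>R Y k p)" if "i < q" "j < q" "p \<in> V" for i j p
  using c0 that by blast
 have "\<exists>U \<Phi> w. patch U \<Phi> \<and> \<Phi> ` U \<subseteq> V \<and> x0 \<in> \<Phi> ` U \<and> (\<forall>m<q. \<forall>i<n. analytic n U (w m i)) \<and>
  (\<forall>m<q. \<forall>u\<in>U. rep_at \<Phi> u (Y (\<sigma> m) (\<Phi> u)) (\<lambda>i. w m i u)) \<and> (\<forall>f\<in>({} :: ('m => real) set). analytic n U (\<lambda>u. f (\<Phi> u)))"
 proof (rule analytic_patch[where \<sigma> = \<sigma> and c = "\<lambda>j k l. c (\<sigma> j) (\<sigma> k) (\<sigma> l)", OF Y V nq \<sigma>q indep])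
  show "lie_bracket L (Y (\<sigma> j)) (Y (\<sigma> k)) x = (\<Sum>l<q. c (\<sigma> j) (\<sigma> k) (\<sigma> l) x *\<^sub>R Y (\<sigma> l) x)"
   if "j < n" "k < q" "x \<in> V" for j k x
   using br[OF \<sigma>q \<sigma>q that(3), of j k] that nq sum.permute[OF \<sigma>, of "\<lambda>l. c (\<sigma> j) (\<sigma> k) l x *\<^sub>R Y l x"]
   by (simp add: comp_def)
 qed (use c \<sigma>q nq in auto)
 then obtain U \<Phi> w where P: "patch U \<Phi>" "x0 \<in> \<Phi> ` U" and w: "\<forall>m<q. \<forall>i<n. analytic n U (w m i)"
  and r: "\<forall>m<q. \<forall>u\<in>U. rep_at \<Phi> u (Y (\<sigma> m) (\<Phi> u)) (\<lambda>i. w m i u)" by (elim exE conjE) (rule that)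
 show ?thesis
 proof (rule coordinates_of_reps[where w = "\<lambda>j. w (inv_into UNIV \<sigma> j)", OF Y P])
  fix j x assume j: "j < q" and x: "x \<in> U"
  show "rep_at \<Phi> x (Y j (\<Phi> x)) (\<lambda>i. w (inv_into UNIV \<sigma> j) i x)"
   using r i\<sigma>[OF j] x permutes_inverses(1)[OF \<sigma>, of j] by metis
 qed (use w i\<sigma> in auto)
qed

lemma coordinates_of_basis:
 assumes Y: "\<And>j. j < q ==> C1_vector_field L (Y j)" and \<sigma>: "\<sigma> permutes {..<q}" and nq: "n \<le> q"
  and indep: "\<And>v. (\<Sum>k<n. v k *\<^sub>R Y (\<sigma> k) x0) = 0 ==> \<forall>k<n. v k = (0::real)"
  and cc: "cond_basis L n q (Y \<circ> \<sigma>) x0"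
 shows "cond_coordinates L n q Y x0"
proof -
 have \<sigma>q: "\<sigma> k < q" if "k < q" for k using permutes_in_image[OF \<sigma>, of k] that by simp
 have i\<sigma>: "inv_into UNIV \<sigma> k < q" if "k < q" for k using permutes_in_image[OF permutes_inv[OF \<sigma>], of k] that by simp
 obtain V c b where V: "openin (mtop L) V" "x0 \<in> V"
  and c0: "\<forall>i<n. \<forall>j<n. (\<forall>k<n. C_X_omega L q (Y \<circ> \<sigma>) V (c i j k)) \<and>
   (\<forall>p\<in>V. lie_bracket L ((Y \<circ> \<sigma>) i) ((Y \<circ> \<sigma>) j) p = (\<Sum>k<n. c i j k p *\<^sub>R (Y \<circ> \<sigma>) k p))"
  and b0: "\<forall>j\<in>{n..<q}. (\<forall>k<n. C_X_omega L q (Y \<circ> \<sigma>) V (b j k)) \<and>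
   (\<forall>p\<in>V. (Y \<circ> \<sigma>) j p = (\<Sum>k<n. b j k p *\<^sub>R (Y \<circ> \<sigma>) k p))"
  using cc unfolding cond_basis_def by (elim exE conjE) (rule that)
 have c: "C_X_omega L q (Y \<circ> \<sigma>) V (c i j k)" if "i < n" "j < n" "k < n" for i j k using c0 that by blast
 have br: "lie_bracket L ((Y \<circ> \<sigma>) i) ((Y \<circ> \<sigma>) j) p = (\<Sum>k<n. c i j k p *\<^sub>R (Y \<circ> \<sigma>) k p)"
  if "i < n" "j < n" "p \<in> V" for i j p using c0 that by blast
 have b: "C_X_omega L q (Y \<circ> \<sigma>) V (b j k)" if "j \<in> {n..<q}" "k < n" for j k using b0 that by blast
 have bY: "Y (\<sigma> j) p = (\<Sum>k<n. b j k p *\<^sub>R Y (\<sigma> k) p)" if "j \<in> {n..<q}" "p \<in> V" for j p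
  using b0 that by simp
 let ?Fs = "(\<lambda>(j, k). b j k) ` ({n..<q} \<times> {..<n})"
 \<comment> \<open>Brackets are given for the frame only, so \<open>p = n\<close>; the coefficients
   \<open>b\<close> are passed along as extra functions.\<close>
 have "\<exists>U \<Phi> w. patch U \<Phi> \<and> \<Phi> ` U \<subseteq> V \<and> x0 \<in> \<Phi> ` U \<and> (\<forall>m<n. \<forall>i<n. analytic n U (w m i)) \<and>
  (\<forall>m<n. \<forall>u\<in>U. rep_at \<Phi> u ((Y \<circ> \<sigma>) (id m) (\<Phi> u)) (\<lambda>i. w m i u)) \<and> (\<forall>f\<in>?Fs. analytic n U (\<lambda>u. f (\<Phi> u)))"
  by (rule analytic_patch[where q = q and \<sigma> = id and c = c and Y = "Y \<circ> \<sigma>", OF _ V order_refl])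
   (use Y \<sigma>q nq indep c br b in auto)
 then obtain U \<Phi> w where P: "patch U \<Phi>" and sub: "\<Phi> ` U \<subseteq> V" and x0: "x0 \<in> \<Phi> ` U" and w: "\<forall>m<n. \<forall>i<n. analytic n U (w m i)"
  and r: "\<forall>m<n. \<forall>u\<in>U. rep_at \<Phi> u ((Y \<circ> \<sigma>) (id m) (\<Phi> u)) (\<lambda>i. w m i u)"
  and ban: "\<forall>f\<in>?Fs. analytic n U (\<lambda>u. f (\<Phi> u))" by (elim exE conjE) (rule that)
 have U: "eopen n U" by (rule patch_eopen[OF P])
 \<comment> \<open>The remaining fields obtain their components from the frame through the
   coefficients \<open>b\<close>, now analytic in the coordinates.\<close>
 define w' where "w' j = (if j < n then w j else (\<lambda>i u. \<Sum>k<n. b j k (\<Phi> u) * w k i u))" for j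
 have w'an: "analytic n U (w' j i)" if "j < q" "i < n" for j i
 proof (cases "j < n")
  case True
  then show ?thesis using w that by (simp add: w'_def)
 next
  case False
  have "analytic n U (\<lambda>u. b j k (\<Phi> u))" if "k < n" for k
   by (rule bspec[OF ban]) (use False \<open>j < q\<close> that in force)
  then have "analytic n U (\<lambda>u. \<Sum>k<n. b j k (\<Phi> u) * w k i u)"
   using w that(2) by (intro analytic_sum[OF U] analytic_mult[OF U]) auto
  then show ?thesis using False by (simp add: w'_def)
 qed
 have r': "rep_at \<Phi> u (Y (\<sigma> j) (\<Phi> u)) (\<lambda>i. w' j i u)" if j: "j < q" and u: "u \<in> U" for j u
 proof (cases "j < n")
  case True
  then show ?thesis using r u by (simp add: w'_def)
 next
  case False
  then have "Y (\<sigma> j) (\<Phi> u) = (\<Sum>k<n. b j k (\<Phi> u) *\<^sub>R Y (\<sigma> k) (\<Phi> u))"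
   using j u sub by (intro bY) auto
  moreover have "rep_at \<Phi> u (\<Sum>k<n. b j k (\<Phi> u) *\<^sub>R Y (\<sigma> k) (\<Phi> u)) (\<lambda>i. \<Sum>k<n. b j k (\<Phi> u) * w k i u)"
   by (rule rep_at_sum) (use r u in auto)
  ultimately show ?thesis using False by (simp add: w'_def)
 qed
 show ?thesis
 proof (rule coordinates_of_reps[where w = "\<lambda>j. w' (inv_into UNIV \<sigma> j)", OF Y P x0])
  fix j x assume j: "j < q" and x: "x \<in> U"
  show "rep_at \<Phi> x (Y j (\<Phi> x)) (\<lambda>i. w' (inv_into UNIV \<sigma> j) i x)"
   using r'[OF i\<sigma>[OF j] x] by (simp add: permutes_inverses(1)[OF \<sigma>])
 qed (use w'an i\<sigma> in auto)
qed

end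

theorem theorem3p3:
  fixes S L :: "'m manifold" and M :: "'m set"
    and X Y :: "nat \<Rightarrow> 'm \<Rightarrow> 'm tvec"
    and q n :: nat and x\<^sub>0 :: 'm
  assumes "C2_manifold S"
    and "\<forall>j<q. C1_vector_field S (X j)"
    and "x\<^sub>0 \<in> points S"
    and "openin (orbit_topology S q X x\<^sub>0) M"
    and "connectedin (orbit_topology S q X x\<^sub>0) M"
    and "x\<^sub>0 \<in> M"
    and "\<exists>a :: nat \<Rightarrow> nat \<Rightarrow> nat \<Rightarrow> 'm \<Rightarrow> real. \<forall>i<q. \<forall>j<q.
           (\<forall>k<q. locally_bounded (subtopology (orbit_topology S q X x\<^sub>0) M) (a i j k)) \<and>
           (\<forall>p\<in>M. lie_bracket S (X i) (X j) p = (\<Sum>k<q. a i j k p *\<^sub>R X k p))"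
    and "canonical_structure S q X x\<^sub>0 M L"
    and "\<forall>j. Y j = pullback L S (\<lambda>p. p) (X j)"
    and "n = dim (span ((\<lambda>j. X j x\<^sub>0) ` {..<q}))"
  shows "(cond_coordinates L n q Y x\<^sub>0 \<longleftrightarrow> cond_commutators L q Y x\<^sub>0) \<and>
    (\<exists>\<sigma>. admissible_reordering n q X x\<^sub>0 \<sigma>) \<and>
    (\<forall>\<sigma>. admissible_reordering n q X x\<^sub>0 \<sigma> \<longrightarrow>
       (cond_coordinates L n q Y x\<^sub>0 \<longleftrightarrow> cond_basis L n q (Y \<circ> \<sigma>) x\<^sub>0))"
proof -
 note cs = assms(8)[unfolded canonical_structure_def]
 interpret C2_mfd L by unfold_locales (use cs in blast)
 let ?D = "differential L S (\<lambda>p. p) x\<^sub>0"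
 let ?T = "tangent_space L x\<^sub>0"
 have pts: "points L = M" using cs openin_subset[OF assms(4)] by auto
 have inj: "inj_on ?D ?T" using cs pts assms(6) unfolding immersion_def by blast
 have Y: "C1_vector_field L (Y j)" if "j < q" for j using cs assms(9) that by simp
 \<comment> \<open>Injectivity of the differential makes the definite description in
   \<open>pullback\<close> meaningful.\<close>
 have DY: "?D (Y j x\<^sub>0) = X j x\<^sub>0" if j: "j < q" for j
 proof -
  obtain v where v: "v \<in> ?T" "?D v = X j x\<^sub>0" using cs j assms(6) by force
  have "Y j x\<^sub>0 = v"
   unfolding assms(9)[rule_format] pullback_def
   by (rule the_equality) (use v inj_onD[OF inj] in auto)
  then show ?thesis using v by simp
 qed
 have sp: "span ((\<lambda>j. Y j x\<^sub>0) ` {..<q}) = ?T" using cs assms(6,9) by simp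
 have "dim (span ((\<lambda>j. ?D (Y j x\<^sub>0)) ` {..<q})) = mdim L"
  by (rule dim_differential_image[OF _ linear_differential inj sp]) (use pts assms(6) in simp)
 moreover have "(\<lambda>j. ?D (Y j x\<^sub>0)) ` {..<q} = (\<lambda>j. X j x\<^sub>0) ` {..<q}" using DY by auto
 ultimately have n: "n = mdim L" using assms(10) by simp
 have nq: "mdim L \<le> q" using admissible_reordering_exists(1)[of n X x\<^sub>0 q, OF assms(10)] n by simp
 have indep: "\<forall>k<mdim L. v k = 0"
  if \<sigma>: "admissible_reordering n q X x\<^sub>0 \<sigma>" and v: "(\<Sum>k<mdim L. v k *\<^sub>R Y (\<sigma> k) x\<^sub>0) = 0" for \<sigma> v
 proof -
  have \<sigma>q: "\<sigma> k < q" if "k < mdim L" for k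
   using permutes_in_image[of \<sigma> "{..<q}" k] \<sigma> that nq by (simp add: admissible_reordering_def)
  have "(\<Sum>k<mdim L. v k *\<^sub>R X (\<sigma> k) x\<^sub>0) = (\<Sum>k<mdim L. v k *\<^sub>R ?D (Y (\<sigma> k) x\<^sub>0))"
   by (rule sum.cong) (use DY \<sigma>q in auto)
  also have "\<dots> = ?D (\<Sum>k<mdim L. v k *\<^sub>R Y (\<sigma> k) x\<^sub>0)"
   by (simp add: linear_sum[OF linear_differential] linear_scale[OF linear_differential])
  also have "\<dots> = 0" unfolding v by (rule linear_0[OF linear_differential])
  finally show ?thesis
   using \<sigma> independent_family_iff[of "\<lambda>k. X (\<sigma> k) x\<^sub>0" n] unfolding admissible_reordering_def n by blast
 qed
 have perm: "\<sigma> permutes {..<q}" if "admissible_reordering n q X x\<^sub>0 \<sigma>" for \<sigma>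
  using that by (simp add: admissible_reordering_def)
 obtain \<sigma> where \<sigma>: "admissible_reordering n q X x\<^sub>0 \<sigma>" using admissible_reordering_exists(2)[of n X x\<^sub>0 q, OF assms(10)] by blast
 have "cond_coordinates L n q Y x\<^sub>0 \<longleftrightarrow> cond_commutators L q Y x\<^sub>0"
  unfolding n
 proof
  assume h: "cond_coordinates L (mdim L) q Y x\<^sub>0"
  show "cond_commutators L q Y x\<^sub>0"
   by (rule basis_of_coordinates(2)[where Y = Y, OF _ perm[OF \<sigma>] nq _ h]) (rule Y indep[OF \<sigma>]; assumption)+
 next
  assume h: "cond_commutators L q Y x\<^sub>0"
  show "cond_coordinates L (mdim L) q Y x\<^sub>0"
   by (rule coordinates_of_commutators[where Y = Y, OF _ perm[OF \<sigma>] nq _ h]) (rule Y indep[OF \<sigma>]; assumption)+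
 qed
 moreover have "cond_coordinates L n q Y x\<^sub>0 \<longleftrightarrow> cond_basis L n q (Y \<circ> \<tau>) x\<^sub>0"
  if \<tau>: "admissible_reordering n q X x\<^sub>0 \<tau>" for \<tau>
  unfolding n
 proof
  assume h: "cond_coordinates L (mdim L) q Y x\<^sub>0"
  show "cond_basis L (mdim L) q (Y \<circ> \<tau>) x\<^sub>0"
   by (rule basis_of_coordinates(1)[where Y = Y, OF _ perm[OF \<tau>] nq _ h]) (rule Y indep[OF \<tau>]; assumption)+
 next
  assume h: "cond_basis L (mdim L) q (Y \<circ> \<tau>) x\<^sub>0"
  show "cond_coordinates L (mdim L) q Y x\<^sub>0"
   by (rule coordinates_of_basis[where Y = Y, OF _ perm[OF \<tau>] nq _ h]) (rule Y indep[OF \<tau>]; assumption)+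
 qed
 ultimately show ?thesis using \<sigma> by blast
qed

end
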